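(* Let $k$ be an algebraically closed field, $G$ a finite group with $\mathrm{char}(k)\nmid |G|$, $X$ an integral scheme over $k$, and $V_0,\dots,V_r$ the irreducible representations of $G$ over $k$ (up to isomorphism). Let $\mathcal{E}$ be a torsion-free coherent $\mathcal{O}_X[G]$-module of type $V_0^{n_0}\oplus\cdots\oplus V_r^{n_r}$. Then the isotypical decomposition of $\mathcal{E}$ is given by $$\mathcal{E}\simeq (\mathcal{O}(V_0)\otimes\mathcal{F}_0)\oplus\cdots\oplus(\mathcal{O}(V_r)\otimes\mathcal{F}_r),$$ where each $\mathcal{F}_i$ is an $\mathcal{O}_X$-module (with trivial $G$-action) of rank $n_i$.
   Context: An $\mathcal{O}_X[G]$-module is an $\mathcal{O}_X$-module $\mathcal{E}$ together with a $k$-algebra homomorphism $k[G]\to \mathrm{End}(\mathcal{E})$ (equivalently, an $\mathcal{O}_X$-linear $G$-action). It is coherent or torsion-free if it is so as an $\mathcal{O}_X$-module. The isotypical decomposition of $\mathcal{E}$ is $\mathcal{E}=e_0\mathcal{E}\oplus\cdots\oplus e_r\mathcal{E}$, where $e_i\in k[G]$ is the central idempotent corresponding to $V_i$; thus the assertion is $e_i\mathcal{E}\simeq\mathcal{O}(V_i)\otimes\mathcal{F}_i$ as $\mathcal{O}_X[G]$-modules. For a representation $V$ of $G$ over $k$, $\mathcal{O}(V):=\mathcal{O}_X\otimes_k V$ with the induced $G$-action. If $K$ is the function field and $\epsilon$ the generic point of $X$, the type of $\mathcal{E}$ is the representation $W$ of $G$ over $k$ (unique up to isomorphism) with $\mathcal{E}_\epsilon\simeq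 W\otimes_k K$ as representations of $G$ over $K$. The rank is the dimension over $K$ of the stalk at $\epsilon$. *)

theory Defs
  imports
    "HOL-Analysis.Abstract_Topology"
    "HOL-Algebra.Algebraic_Closure"
    "HOL-Algebra.Free_Abelian_Groups"
begin

section \<open>Rings and modules\<close>

definition ring_char :: "('a, 'm) ring_scheme \<Rightarrow> nat" where
  "ring_char R =
     (if \<exists>n::nat. 0 < n \<and> [n] \<cdot>\<^bsub>R\<^esub> \<one>\<^bsub>R\<^esub> = \<zero>\<^bsub>R\<^esub>
      then LEAST n::nat. 0 < n \<and> [n] \<cdot>\<^bsub>R\<^esub> \<one>\<^bsub>R\<^esub> = \<zero>\<^bsub>R\<^esub> else 0)"

definition local_ring :: "('a, 'm) ring_scheme \<Rightarrow> bool" where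
  "local_ring R \<longleftrightarrow> cring R \<and> (\<exists>!I. maximalideal I R)"

text \<open>The fraction \<open>a/f\<close> in the localization of \<open>A\<close> at the multiplicative set \<open>S\<close>, as an
  equivalence class of pairs.\<close>

definition fraction :: "('a, 'm) ring_scheme \<Rightarrow> 'a set \<Rightarrow> 'a \<Rightarrow> 'a \<Rightarrow> ('a \<times> 'a) set" where
  "fraction A S a f = {(b, g). b \<in> carrier A \<and> g \<in> S \<and>
     (\<exists>h\<in>S. h \<otimes>\<^bsub>A\<^esub> (a \<otimes>\<^bsub>A\<^esub> g \<ominus>\<^bsub>A\<^esub> b \<otimes>\<^bsub>A\<^esub> f) = \<zero>\<^bsub>A\<^esub>)}"

text \<open>From here on, an operation on equivalence classes is written as the union, over all
  representatives, of the class of the result; these classes all coincide.\<close>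

definition localization :: "('a, 'm) ring_scheme \<Rightarrow> 'a set \<Rightarrow> ('a \<times> 'a) set ring" where
  "localization A S =
     \<lparr>carrier = {fraction A S a f | a f. a \<in> carrier A \<and> f \<in> S},
      monoid.mult = (\<lambda>C D. \<Union>(a, f)\<in>C. \<Union>(b, g)\<in>D. fraction A S (a \<otimes>\<^bsub>A\<^esub> b) (f \<otimes>\<^bsub>A\<^esub> g)),
      monoid.one = fraction A S \<one>\<^bsub>A\<^esub> \<one>\<^bsub>A\<^esub>,
      ring.zero = fraction A S \<zero>\<^bsub>A\<^esub> \<one>\<^bsub>A\<^esub>,
      ring.add = (\<lambda>C D. \<Union>(a, f)\<in>C. \<Union>(b, g)\<in>D.
               fraction A S (a \<otimes>\<^bsub>A\<^esub> g \<oplus>\<^bsub>A\<^esub> b \<otimes>\<^bsub>A\<^esub> f) (f \<otimes>\<^bsub>A\<^esub> g))\<rparr>"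

text \<open>The ring fields \<open>mult\<close> and \<open>one\<close> of a module record carry no information; they are left
  \<open>undefined\<close> in all modules constructed here, except in \<open>ring_module\<close>.\<close>

definition ring_module :: "'a ring \<Rightarrow> ('a, 'a) module" where
  "ring_module R = ring.extend R (module.fields (monoid.mult R))"

definition module_homs ::
  "('a, 'm) ring_scheme \<Rightarrow> ('a, 'b, 'n) module_scheme \<Rightarrow> ('a, 'c, 'o) module_scheme \<Rightarrow> ('b \<Rightarrow> 'c) set"
  where
  "module_homs R M N = {h \<in> carrier M \<rightarrow> carrier N.
     (\<forall>x\<in>carrier M. \<forall>y\<in>carrier M. h (x \<oplus>\<^bsub>M\<^esub> y) = h x \<oplus>\<^bsub>N\<^esub> h y) \<and>
     (\<forall>a\<in>carrier R. \<forall>x\<in>carrier M. h (a \<odot>\<^bsub>M\<^esub> x) = a \<odot>\<^bsub>N\<^esub> h x)}"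

definition has_dim :: "('a, 'm) ring_scheme \<Rightarrow> ('a, 'b, 'n) module_scheme \<Rightarrow> nat \<Rightarrow> bool" where
  "has_dim R M n \<longleftrightarrow>
     (\<exists>B. B \<subseteq> carrier M \<and> finite B \<and> card B = n \<and>
        (\<forall>x\<in>carrier M. \<exists>!c. c \<in> B \<rightarrow>\<^sub>E carrier R \<and> x = (\<Oplus>\<^bsub>M\<^esub>b\<in>B. c b \<odot>\<^bsub>M\<^esub> b)))"

text \<open>For a finite index set, the direct sum is the product.\<close>

definition dsum_module :: "'i set \<Rightarrow> ('i \<Rightarrow> ('a, 'b, 'n) module_scheme) \<Rightarrow> ('a, 'i \<Rightarrow> 'b) module" where
  "dsum_module I M =
     \<lparr>carrier = (\<Pi>\<^sub>E i\<in>I. carrier (M i)), monoid.mult = undefined, monoid.one = undefined,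
      ring.zero = (\<lambda>i\<in>I. \<zero>\<^bsub>M i\<^esub>),
      ring.add = (\<lambda>x y. \<lambda>i\<in>I. x i \<oplus>\<^bsub>M i\<^esub> y i),
      module.smult = (\<lambda>a x. \<lambda>i\<in>I. a \<odot>\<^bsub>M i\<^esub> x i)\<rparr>"


subsection \<open>Tensor products\<close>

text \<open>The tensor product over \<open>R\<close> of \<open>M\<close> and \<open>N\<close>: the free abelian group on pairs modulo the
  bilinearity relations. \<open>R\<close> acts on \<open>M\<close> through \<open>act\<close>, whereas the scalar multiplication of
  the record \<open>M\<close>, possibly over another ring, is the one inherited by the tensor product. This
  covers both \<open>M \<otimes>\<^sub>R N\<close> as an \<open>R\<close>-module and the base change \<open>B \<otimes>\<^sub>R N\<close> as a \<open>B\<close>-module.\<close>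

definition tensor_rel ::
  "('r, 'm) ring_scheme \<Rightarrow> ('r \<Rightarrow> 'b \<Rightarrow> 'b) \<Rightarrow> ('s, 'b, 'n) module_scheme \<Rightarrow>
   ('r, 'c, 'o) module_scheme \<Rightarrow> ('b \<times> 'c \<Rightarrow>\<^sub>0 int) set" where
  "tensor_rel R act M N = generate (free_Abelian_group (carrier M \<times> carrier N))
     ({frag_of (x \<oplus>\<^bsub>M\<^esub> x', y) - frag_of (x, y) - frag_of (x', y) | x x' y.
         x \<in> carrier M \<and> x' \<in> carrier M \<and> y \<in> carrier N} \<union>
      {frag_of (x, y \<oplus>\<^bsub>N\<^esub> y') - frag_of (x, y) - frag_of (x, y') | x y y'.
         x \<in> carrier M \<and> y \<in> carrier N \<and> y' \<in> carrier N} \<union>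
      {frag_of (act r x, y) - frag_of (x, r \<odot>\<^bsub>N\<^esub> y) | r x y.
         r \<in> carrier R \<and> x \<in> carrier M \<and> y \<in> carrier N})"

definition tensor_class ::
  "('r, 'm) ring_scheme \<Rightarrow> ('r \<Rightarrow> 'b \<Rightarrow> 'b) \<Rightarrow> ('s, 'b, 'n) module_scheme \<Rightarrow>
   ('r, 'c, 'o) module_scheme \<Rightarrow> ('b \<times> 'c \<Rightarrow>\<^sub>0 int) \<Rightarrow> ('b \<times> 'c \<Rightarrow>\<^sub>0 int) set" where
  "tensor_class R act M N z =
     tensor_rel R act M N #>\<^bsub>free_Abelian_group (carrier M \<times> carrier N)\<^esub> z"

text \<open>The map \<open>f \<otimes> g\<close> into the tensor product of \<open>M\<close> and \<open>N\<close>.\<close>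

definition tensor_map ::
  "('r, 'm) ring_scheme \<Rightarrow> ('r \<Rightarrow> 'b \<Rightarrow> 'b) \<Rightarrow> ('s, 'b, 'n) module_scheme \<Rightarrow>
   ('r, 'c, 'o) module_scheme \<Rightarrow> ('d \<Rightarrow> 'b) \<Rightarrow> ('e \<Rightarrow> 'c) \<Rightarrow>
   ('d \<times> 'e \<Rightarrow>\<^sub>0 int) set \<Rightarrow> ('b \<times> 'c \<Rightarrow>\<^sub>0 int) set" where
  "tensor_map R act M N f g C =
     (\<Union>z\<in>C. tensor_class R act M N (frag_extend (\<lambda>(x, y). frag_of (f x, g y)) z))"

definition tensor ::
  "('r, 'm) ring_scheme \<Rightarrow> ('r \<Rightarrow> 'b \<Rightarrow> 'b) \<Rightarrow> ('s, 'b, 'n) module_scheme \<Rightarrow>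
   ('r, 'c, 'o) module_scheme \<Rightarrow> ('s, ('b \<times> 'c \<Rightarrow>\<^sub>0 int) set) module" where
  "tensor R act M N =
     (let Q = free_Abelian_group (carrier M \<times> carrier N) Mod tensor_rel R act M N in
      \<lparr>carrier = carrier Q, monoid.mult = undefined, monoid.one = undefined,
       ring.zero = \<one>\<^bsub>Q\<^esub>, ring.add = (\<otimes>\<^bsub>Q\<^esub>),
       module.smult = (\<lambda>s. tensor_map R act M N (\<lambda>x. s \<odot>\<^bsub>M\<^esub> x) id)\<rparr>)"


section \<open>Representations of a group\<close>

record ('a, 'v, 'g) rep = "('a, 'v) module" +
  ract :: "'g \<Rightarrow> 'v \<Rightarrow> 'v"

definition representation ::
  "('a, 'm) ring_scheme \<Rightarrow> ('g, 'n) monoid_scheme \<Rightarrow> ('a, 'v, 'g) rep \<Rightarrow> bool" where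
  "representation R G V \<longleftrightarrow>
     module R V \<and>
     (\<forall>g\<in>carrier G. ract V g \<in> module_homs R V V) \<and>
     (\<forall>v\<in>carrier V. ract V \<one>\<^bsub>G\<^esub> v = v) \<and>
     (\<forall>g\<in>carrier G. \<forall>h\<in>carrier G. \<forall>v\<in>carrier V.
        ract V (g \<otimes>\<^bsub>G\<^esub> h) v = ract V g (ract V h v))"

definition irreducible_rep ::
  "('a, 'm) ring_scheme \<Rightarrow> ('g, 'n) monoid_scheme \<Rightarrow> ('a, 'v, 'g) rep \<Rightarrow> bool" where
  "irreducible_rep R G V \<longleftrightarrow>
     representation R G V \<and> carrier V \<noteq> {\<zero>\<^bsub>V\<^esub>} \<and>
     (\<forall>W. submodule W R V \<and> (\<forall>g\<in>carrier G. ract V g ` W \<subseteq> W) \<longrightarrow>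
        W = {\<zero>\<^bsub>V\<^esub>} \<or> W = carrier V)"

definition rep_isomorphic ::
  "('a, 'm) ring_scheme \<Rightarrow> ('g, 'n) monoid_scheme \<Rightarrow> ('a, 'v, 'g) rep \<Rightarrow> ('a, 'w, 'g) rep \<Rightarrow> bool"
  where
  "rep_isomorphic R G V W \<longleftrightarrow>
     (\<exists>f\<in>module_homs R V W. bij_betw f (carrier V) (carrier W) \<and>
        (\<forall>g\<in>carrier G. \<forall>v\<in>carrier V. f (ract V g v) = ract W g (f v)))"

text \<open>\<open>V 0, \<dots>, V r\<close> is a complete irredundant list of irreducible representations. Every
  irreducible representation of a finite group embeds into the regular one, whose vectors are
  functions from the group to the field; hence completeness only needs to be tested on
  representations with vectors of type \<open>'g \<Rightarrow> 'k\<close>.\<close>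

definition irreducibles ::
  "('k, 'm) ring_scheme \<Rightarrow> ('g, 'n) monoid_scheme \<Rightarrow> nat \<Rightarrow> (nat \<Rightarrow> ('k, 'v, 'g) rep) \<Rightarrow> bool" where
  "irreducibles k G r V \<longleftrightarrow>
     (\<forall>i\<le>r. irreducible_rep k G (V i)) \<and>
     (\<forall>i\<le>r. \<forall>j\<le>r. i \<noteq> j \<longrightarrow> \<not> rep_isomorphic k G (V i) (V j)) \<and>
     (\<forall>W :: ('k, 'g \<Rightarrow> 'k, 'g) rep. irreducible_rep k G W \<longrightarrow> (\<exists>i\<le>r. rep_isomorphic k G W (V i)))"

definition dsum_rep :: "'i set \<Rightarrow> ('i \<Rightarrow> ('a, 'v, 'g) rep) \<Rightarrow> ('a, 'i \<Rightarrow> 'v, 'g) rep" where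
  "dsum_rep I V = module.extend (dsum_module I V)
     (rep.fields (\<lambda>g x. \<lambda>i\<in>I. ract (V i) g (x i)))"

text \<open>\<open>V 0 ^ n 0 \<oplus> \<dots> \<oplus> V r ^ n r\<close>\<close>

definition multiplicity_rep ::
  "nat \<Rightarrow> (nat \<Rightarrow> ('a, 'v, 'g) rep) \<Rightarrow> (nat \<Rightarrow> nat) \<Rightarrow> ('a, nat \<times> nat \<Rightarrow> 'v, 'g) rep" where
  "multiplicity_rep r V n = dsum_rep (SIGMA i:{..r}. {..<n i}) (\<lambda>(i, j). V i)"

definition group_algebra :: "('k, 'm) ring_scheme \<Rightarrow> ('g, 'n) monoid_scheme \<Rightarrow> ('g \<Rightarrow> 'k) ring" where
  "group_algebra k G =
     \<lparr>carrier = carrier G \<rightarrow>\<^sub>E carrier k,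
      monoid.mult = (\<lambda>a b. \<lambda>g\<in>carrier G. \<Oplus>\<^bsub>k\<^esub>h\<in>carrier G. a h \<otimes>\<^bsub>k\<^esub> b (inv\<^bsub>G\<^esub> h \<otimes>\<^bsub>G\<^esub> g)),
      monoid.one = (\<lambda>g\<in>carrier G. if g = \<one>\<^bsub>G\<^esub> then \<one>\<^bsub>k\<^esub> else \<zero>\<^bsub>k\<^esub>),
      ring.zero = (\<lambda>g\<in>carrier G. \<zero>\<^bsub>k\<^esub>),
      ring.add = (\<lambda>a b. \<lambda>g\<in>carrier G. a g \<oplus>\<^bsub>k\<^esub> b g)\<rparr>"

definition alg_act :: "('g, 'n) monoid_scheme \<Rightarrow> ('k, 'v, 'g) rep \<Rightarrow> ('g \<Rightarrow> 'k) \<Rightarrow> 'v \<Rightarrow> 'v" where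
  "alg_act G V a v = (\<Oplus>\<^bsub>V\<^esub>g\<in>carrier G. a g \<odot>\<^bsub>V\<^esub> ract V g v)"

definition isotypical_idempotent ::
  "('k, 'm) ring_scheme \<Rightarrow> ('g, 'n) monoid_scheme \<Rightarrow> nat \<Rightarrow> (nat \<Rightarrow> ('k, 'v, 'g) rep) \<Rightarrow> nat \<Rightarrow> 'g \<Rightarrow> 'k"
  where
  "isotypical_idempotent k G r V i = (THE e.
     e \<in> carrier (group_algebra k G) \<and>
     e \<otimes>\<^bsub>group_algebra k G\<^esub> e = e \<and>
     (\<forall>a\<in>carrier (group_algebra k G). e \<otimes>\<^bsub>group_algebra k G\<^esub> a = a \<otimes>\<^bsub>group_algebra k G\<^esub> e) \<and>
     (\<forall>v\<in>carrier (V i). alg_act G (V i) e v = v) \<and>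
     (\<forall>j\<le>r. j \<noteq> i \<longrightarrow> (\<forall>v\<in>carrier (V j). alg_act G (V j) e v = \<zero>\<^bsub>V j\<^esub>)))"


section \<open>Sheaves and germs\<close>

text \<open>A sheaf of sets on \<open>T\<close>. Covers may be empty, so there is exactly one section over the empty
  set.\<close>

locale set_sheaf =
  fixes T :: "'p topology" and F :: "'p set \<Rightarrow> 'c set" and \<rho> :: "'p set \<Rightarrow> 'p set \<Rightarrow> 'c \<Rightarrow> 'c"
  assumes res_closed:
      "\<lbrakk>openin T U; openin T V; V \<subseteq> U; s \<in> F U\<rbrakk> \<Longrightarrow> \<rho> U V s \<in> F V"
    and res_id: "\<lbrakk>openin T U; s \<in> F U\<rbrakk> \<Longrightarrow> \<rho> U U s = s"
    and res_res:
      "\<lbrakk>openin T U; openin T V; openin T W; W \<subseteq> V; V \<subseteq> U; s \<in> F U\<rbrakk> \<Longrightarrow> \<rho> V W (\<rho> U V s) = \<rho> U W s"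
    and locality:
      "\<lbrakk>\<And>V. V \<in> \<U> \<Longrightarrow> openin T V; s \<in> F (\<Union>\<U>); t \<in> F (\<Union>\<U>);
        \<And>V. V \<in> \<U> \<Longrightarrow> \<rho> (\<Union>\<U>) V s = \<rho> (\<Union>\<U>) V t\<rbrakk> \<Longrightarrow> s = t"
    and gluing:
      "\<lbrakk>\<And>V. V \<in> \<U> \<Longrightarrow> openin T V; \<And>V. V \<in> \<U> \<Longrightarrow> \<sigma> V \<in> F V;
        \<And>V W. \<lbrakk>V \<in> \<U>; W \<in> \<U>\<rbrakk> \<Longrightarrow> \<rho> V (V \<inter> W) (\<sigma> V) = \<rho> W (V \<inter> W) (\<sigma> W)\<rbrakk> \<Longrightarrow>
       \<exists>t\<in>F (\<Union>\<U>). \<forall>V\<in>\<U>. \<rho> (\<Union>\<U>) V t = \<sigma> V"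

definition germ ::
  "'p topology \<Rightarrow> ('p set \<Rightarrow> 'c set) \<Rightarrow> ('p set \<Rightarrow> 'p set \<Rightarrow> 'c \<Rightarrow> 'c) \<Rightarrow> 'p \<Rightarrow> 'p set \<Rightarrow> 'c \<Rightarrow> ('p set \<times> 'c) set"
  where
  "germ T F \<rho> x U s = {(V, t). openin T V \<and> x \<in> V \<and> t \<in> F V \<and>
     (\<exists>W. openin T W \<and> x \<in> W \<and> W \<subseteq> U \<inter> V \<and> \<rho> V W t = \<rho> U W s)}"


section \<open>Schemes\<close>

record ('p, 'a) rspace =
  topo :: "'p topology"
  sec :: "'p set \<Rightarrow> 'a ring"
  res :: "'p set \<Rightarrow> 'p set \<Rightarrow> 'a \<Rightarrow> 'a"

abbreviation points :: "('p, 'a) rspace \<Rightarrow> 'p set" where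
  "points \<X> \<equiv> topspace (topo \<X>)"

definition ringed_space :: "('p, 'a) rspace \<Rightarrow> bool" where
  "ringed_space \<X> \<longleftrightarrow>
     set_sheaf (topo \<X>) (\<lambda>U. carrier (sec \<X> U)) (res \<X>) \<and>
     (\<forall>U. openin (topo \<X>) U \<longrightarrow> cring (sec \<X> U)) \<and>
     (\<forall>U V. openin (topo \<X>) U \<and> openin (topo \<X>) V \<and> V \<subseteq> U \<longrightarrow> res \<X> U V \<in> ring_hom (sec \<X> U) (sec \<X> V))"

definition restrict_rspace :: "('p, 'a) rspace \<Rightarrow> 'p set \<Rightarrow> ('p, 'a) rspace" where
  "restrict_rspace \<X> U = \<X>\<lparr>topo := subtopology (topo \<X>) U\<rparr>"

abbreviation rgerm :: "('p, 'a) rspace \<Rightarrow> 'p \<Rightarrow> 'p set \<Rightarrow> 'a \<Rightarrow> ('p set \<times> 'a) set" where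
  "rgerm \<X> \<equiv> germ (topo \<X>) (\<lambda>U. carrier (sec \<X> U)) (res \<X>)"

definition stalk_ring :: "('p, 'a) rspace \<Rightarrow> 'p \<Rightarrow> ('p set \<times> 'a) set ring" where
  "stalk_ring \<X> x =
     \<lparr>carrier = {rgerm \<X> x U s | U s. openin (topo \<X>) U \<and> x \<in> U \<and> s \<in> carrier (sec \<X> U)},
      monoid.mult = (\<lambda>C D. \<Union>(U, s)\<in>C. \<Union>(V, t)\<in>D.
                rgerm \<X> x (U \<inter> V) (res \<X> U (U \<inter> V) s \<otimes>\<^bsub>sec \<X> (U \<inter> V)\<^esub> res \<X> V (U \<inter> V) t)),
      monoid.one = rgerm \<X> x (points \<X>) \<one>\<^bsub>sec \<X> (points \<X>)\<^esub>,
      ring.zero = rgerm \<X> x (points \<X>) \<zero>\<^bsub>sec \<X> (points \<X>)\<^esub>,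
      ring.add = (\<lambda>C D. \<Union>(U, s)\<in>C. \<Union>(V, t)\<in>D.
                rgerm \<X> x (U \<inter> V) (res \<X> U (U \<inter> V) s \<oplus>\<^bsub>sec \<X> (U \<inter> V)\<^esub> res \<X> V (U \<inter> V) t))\<rparr>"

definition locally_ringed_space :: "('p, 'a) rspace \<Rightarrow> bool" where
  "locally_ringed_space \<X> \<longleftrightarrow> ringed_space \<X> \<and> (\<forall>x\<in>points \<X>. local_ring (stalk_ring \<X> x))"

text \<open>Isomorphic as ringed spaces; for locally ringed spaces an isomorphism is automatically
  local on stalks.\<close>

definition rspace_isomorphic :: "('p, 'a) rspace \<Rightarrow> ('q, 'b) rspace \<Rightarrow> bool" where
  "rspace_isomorphic \<X> Y \<longleftrightarrow>
     (\<exists>f \<phi>. homeomorphic_map (topo \<X>) (topo Y) f \<and>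
        (\<forall>V. openin (topo Y) V \<longrightarrow>
           \<phi> V \<in> ring_iso (sec Y V) (sec \<X> {x \<in> points \<X>. f x \<in> V})) \<and>
        (\<forall>V W. openin (topo Y) V \<and> openin (topo Y) W \<and> W \<subseteq> V \<longrightarrow>
           (\<forall>s\<in>carrier (sec Y V).
              \<phi> W (res Y V W s) = res \<X> {x \<in> points \<X>. f x \<in> V} {x \<in> points \<X>. f x \<in> W} (\<phi> V s))))"

definition spec_top :: "'a ring \<Rightarrow> 'a set topology" where
  "spec_top A = topology (\<lambda>U. \<exists>S\<subseteq>carrier A. U = {\<pp>. primeideal \<pp> A \<and> \<not> S \<subseteq> \<pp>})"

text \<open>Sections over \<open>U\<close> are the functions assigning to each prime \<open>\<pp>\<close> in \<open>U\<close> an element of the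
  localization at \<open>\<pp>\<close> that are locally given by a single fraction.\<close>

definition Spec :: "'a ring \<Rightarrow> ('a set, 'a set \<Rightarrow> ('a \<times> 'a) set) rspace" where
  "Spec A =
     \<lparr>topo = spec_top A,
      sec = (\<lambda>U.
        \<lparr>carrier = {s \<in> (\<Pi>\<^sub>E \<pp>\<in>U. carrier (localization A (carrier A - \<pp>))).
           \<forall>\<pp>\<in>U. \<exists>V a f. openin (spec_top A) V \<and> \<pp> \<in> V \<and> V \<subseteq> U \<and> a \<in> carrier A \<and> f \<in> carrier A \<and>
             (\<forall>\<qq>\<in>V. f \<notin> \<qq> \<and> s \<qq> = fraction A (carrier A - \<qq>) a f)},
         monoid.mult = (\<lambda>s t. \<lambda>\<pp>\<in>U. s \<pp> \<otimes>\<^bsub>localization A (carrier A - \<pp>)\<^esub> t \<pp>),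
         monoid.one = (\<lambda>\<pp>\<in>U. \<one>\<^bsub>localization A (carrier A - \<pp>)\<^esub>),
         ring.zero = (\<lambda>\<pp>\<in>U. \<zero>\<^bsub>localization A (carrier A - \<pp>)\<^esub>),
         ring.add = (\<lambda>s t. \<lambda>\<pp>\<in>U. s \<pp> \<oplus>\<^bsub>localization A (carrier A - \<pp>)\<^esub> t \<pp>)\<rparr>),
      res = (\<lambda>U V s. restrict s V)\<rparr>"

text \<open>If \<open>U\<close> is isomorphic to \<open>Spec A\<close>, then \<open>A\<close> is isomorphic to the ring of sections over \<open>U\<close>, so
  restricting to rings \<open>A\<close> with elements of type \<open>'a\<close> is no loss.\<close>

definition scheme :: "('p, 'a) rspace \<Rightarrow> bool" where
  "scheme \<X> \<longleftrightarrow>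
     locally_ringed_space \<X> \<and>
     (\<forall>x\<in>points \<X>. \<exists>U. openin (topo \<X>) U \<and> x \<in> U \<and>
        (\<exists>A::'a ring. cring A \<and> rspace_isomorphic (restrict_rspace \<X> U) (Spec A)))"

definition integral_scheme :: "('p, 'a) rspace \<Rightarrow> bool" where
  "integral_scheme \<X> \<longleftrightarrow>
     scheme \<X> \<and> points \<X> \<noteq> {} \<and> (\<forall>U. openin (topo \<X>) U \<and> U \<noteq> {} \<longrightarrow> domain (sec \<X> U))"

text \<open>A scheme over \<open>k\<close> is a scheme whose structure sheaf is a sheaf of \<open>k\<close>-algebras; this amounts
  to a ring homomorphism \<open>\<kappa>\<close> from \<open>k\<close> to the global sections, followed by restriction.\<close>

definition scheme_over :: "'k ring \<Rightarrow> ('p, 'a) rspace \<Rightarrow> ('k \<Rightarrow> 'a) \<Rightarrow> bool" where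
  "scheme_over k \<X> \<kappa> \<longleftrightarrow> scheme \<X> \<and> \<kappa> \<in> ring_hom k (sec \<X> (points \<X>))"

definition const_sec :: "('p, 'a) rspace \<Rightarrow> ('k \<Rightarrow> 'a) \<Rightarrow> 'p set \<Rightarrow> 'k \<Rightarrow> 'a" where
  "const_sec \<X> \<kappa> U c = res \<X> (points \<X>) U (\<kappa> c)"

definition generic_point :: "('p, 'a) rspace \<Rightarrow> 'p \<Rightarrow> bool" where
  "generic_point \<X> x \<longleftrightarrow> x \<in> points \<X> \<and> topo \<X> closure_of {x} = points \<X>"


section \<open>Sheaves of modules\<close>

record ('p, 'a, 'b) omod =
  msec :: "'p set \<Rightarrow> ('a, 'b) module"
  mres :: "'p set \<Rightarrow> 'p set \<Rightarrow> 'b \<Rightarrow> 'b"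

definition omodule :: "('p, 'a) rspace \<Rightarrow> ('p, 'a, 'b, 'z) omod_scheme \<Rightarrow> bool" where
  "omodule \<X> M \<longleftrightarrow>
     set_sheaf (topo \<X>) (\<lambda>U. carrier (msec M U)) (mres M) \<and>
     (\<forall>U. openin (topo \<X>) U \<longrightarrow> module (sec \<X> U) (msec M U)) \<and>
     (\<forall>U V. openin (topo \<X>) U \<and> openin (topo \<X>) V \<and> V \<subseteq> U \<longrightarrow>
        (\<forall>x\<in>carrier (msec M U). \<forall>y\<in>carrier (msec M U).
           mres M U V (x \<oplus>\<^bsub>msec M U\<^esub> y) = mres M U V x \<oplus>\<^bsub>msec M V\<^esub> mres M U V y) \<and>
        (\<forall>a\<in>carrier (sec \<X> U). \<forall>x\<in>carrier (msec M U).
           mres M U V (a \<odot>\<^bsub>msec M U\<^esub> x) = res \<X> U V a \<odot>\<^bsub>msec M V\<^esub> mres M U V x))"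

abbreviation mgerm ::
  "('p, 'a) rspace \<Rightarrow> ('p, 'a, 'b, 'z) omod_scheme \<Rightarrow> 'p \<Rightarrow> 'p set \<Rightarrow> 'b \<Rightarrow> ('p set \<times> 'b) set" where
  "mgerm \<X> M \<equiv> germ (topo \<X>) (\<lambda>U. carrier (msec M U)) (mres M)"

definition stalk ::
  "('p, 'a) rspace \<Rightarrow> ('p, 'a, 'b, 'z) omod_scheme \<Rightarrow> 'p \<Rightarrow> (('p set \<times> 'a) set, ('p set \<times> 'b) set) module"
  where
  "stalk \<X> M x =
     \<lparr>carrier = {mgerm \<X> M x U s | U s. openin (topo \<X>) U \<and> x \<in> U \<and> s \<in> carrier (msec M U)},
      monoid.mult = undefined, monoid.one = undefined,
      ring.zero = mgerm \<X> M x (points \<X>) \<zero>\<^bsub>msec M (points \<X>)\<^esub>,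
      ring.add = (\<lambda>C D. \<Union>(U, s)\<in>C. \<Union>(V, t)\<in>D.
               mgerm \<X> M x (U \<inter> V) (mres M U (U \<inter> V) s \<oplus>\<^bsub>msec M (U \<inter> V)\<^esub> mres M V (U \<inter> V) t)),
      module.smult = (\<lambda>C D. \<Union>(U, a)\<in>C. \<Union>(V, t)\<in>D.
               mgerm \<X> M x (U \<inter> V) (res \<X> U (U \<inter> V) a \<odot>\<^bsub>msec M (U \<inter> V)\<^esub> mres M V (U \<inter> V) t))\<rparr>"

definition has_rank :: "('p, 'a) rspace \<Rightarrow> 'p \<Rightarrow> ('p, 'a, 'b, 'z) omod_scheme \<Rightarrow> nat \<Rightarrow> bool" where
  "has_rank \<X> \<epsilon> M n \<longleftrightarrow> has_dim (stalk_ring \<X> \<epsilon>) (stalk \<X> M \<epsilon>) n"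

definition torsion_free :: "('p, 'a) rspace \<Rightarrow> ('p, 'a, 'b, 'z) omod_scheme \<Rightarrow> bool" where
  "torsion_free \<X> M \<longleftrightarrow>
     (\<forall>x\<in>points \<X>. \<forall>a\<in>carrier (stalk_ring \<X> x). \<forall>m\<in>carrier (stalk \<X> M x).
        a \<odot>\<^bsub>stalk \<X> M x\<^esub> m = \<zero>\<^bsub>stalk \<X> M x\<^esub> \<longrightarrow> a = \<zero>\<^bsub>stalk_ring \<X> x\<^esub> \<or> m = \<zero>\<^bsub>stalk \<X> M x\<^esub>)"

text \<open>Locally there is an epimorphism from a finite free module, given by sections
  \<open>s 0, \<dots>, s (n - 1)\<close>.\<close>

definition finite_type :: "('p, 'a) rspace \<Rightarrow> ('p, 'a, 'b, 'z) omod_scheme \<Rightarrow> bool" where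
  "finite_type \<X> M \<longleftrightarrow>
     (\<forall>x\<in>points \<X>. \<exists>U (n::nat) s. openin (topo \<X>) U \<and> x \<in> U \<and> s \<in> {..<n} \<rightarrow> carrier (msec M U) \<and>
        (\<forall>V t y. openin (topo \<X>) V \<and> V \<subseteq> U \<and> t \<in> carrier (msec M V) \<and> y \<in> V \<longrightarrow>
           (\<exists>W a. openin (topo \<X>) W \<and> y \<in> W \<and> W \<subseteq> V \<and> a \<in> {..<n} \<rightarrow> carrier (sec \<X> W) \<and>
              mres M V W t = (\<Oplus>\<^bsub>msec M W\<^esub>i\<in>{..<n}. a i \<odot>\<^bsub>msec M W\<^esub> mres M U W (s i)))))"

text \<open>The kernel of the morphism from the free module of rank \<open>n\<close> on \<open>U\<close> to \<open>M\<close> given by sections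
  \<open>s 0, \<dots>, s (n - 1)\<close> over \<open>U\<close>.\<close>

definition relation_sheaf ::
  "('p, 'a) rspace \<Rightarrow> ('p, 'a, 'b, 'z) omod_scheme \<Rightarrow> 'p set \<Rightarrow> nat \<Rightarrow> (nat \<Rightarrow> 'b) \<Rightarrow> ('p, 'a, nat \<Rightarrow> 'a) omod"
  where
  "relation_sheaf \<X> M U n s =
     \<lparr>msec = (\<lambda>V. let D = dsum_module {..<n} (\<lambda>_. ring_module (sec \<X> V)) in
        D\<lparr>carrier := {a \<in> carrier D.
          (\<Oplus>\<^bsub>msec M V\<^esub>i\<in>{..<n}. a i \<odot>\<^bsub>msec M V\<^esub> mres M U V (s i)) = \<zero>\<^bsub>msec M V\<^esub>}\<rparr>),
      mres = (\<lambda>V W a. \<lambda>i\<in>{..<n}. res \<X> V W (a i))\<rparr>"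

definition coherent :: "('p, 'a) rspace \<Rightarrow> ('p, 'a, 'b, 'z) omod_scheme \<Rightarrow> bool" where
  "coherent \<X> M \<longleftrightarrow>
     omodule \<X> M \<and> finite_type \<X> M \<and>
     (\<forall>U n s. openin (topo \<X>) U \<and> s \<in> {..<n} \<rightarrow> carrier (msec M U) \<longrightarrow>
        finite_type (restrict_rspace \<X> U) (relation_sheaf \<X> M U n s))"


section \<open>Sheaves of modules with a group action\<close>

record ('p, 'a, 'b, 'g) gmod = "('p, 'a, 'b) omod" +
  gact :: "'g \<Rightarrow> 'p set \<Rightarrow> 'b \<Rightarrow> 'b"

definition omod_hom ::
  "('p, 'a) rspace \<Rightarrow> ('p, 'a, 'b, 'z) omod_scheme \<Rightarrow> ('p, 'a, 'c, 'y) omod_scheme \<Rightarrow> ('p set \<Rightarrow> 'b \<Rightarrow> 'c) \<Rightarrow> bool"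
  where
  "omod_hom \<X> M N \<phi> \<longleftrightarrow>
     (\<forall>U. openin (topo \<X>) U \<longrightarrow> \<phi> U \<in> module_homs (sec \<X> U) (msec M U) (msec N U)) \<and>
     (\<forall>U V. openin (topo \<X>) U \<and> openin (topo \<X>) V \<and> V \<subseteq> U \<longrightarrow>
        (\<forall>s\<in>carrier (msec M U). \<phi> V (mres M U V s) = mres N U V (\<phi> U s)))"

definition gmodule ::
  "('p, 'a) rspace \<Rightarrow> ('g, 'm) monoid_scheme \<Rightarrow> ('p, 'a, 'b, 'g) gmod \<Rightarrow> bool" where
  "gmodule \<X> G M \<longleftrightarrow>
     omodule \<X> M \<and>
     (\<forall>g\<in>carrier G. omod_hom \<X> M M (gact M g)) \<and>
     (\<forall>U. openin (topo \<X>) U \<longrightarrow> (\<forall>s\<in>carrier (msec M U).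
        gact M \<one>\<^bsub>G\<^esub> U s = s \<and>
        (\<forall>g\<in>carrier G. \<forall>h\<in>carrier G. gact M (g \<otimes>\<^bsub>G\<^esub> h) U s = gact M g U (gact M h U s))))"

definition gmod_iso ::
  "('p, 'a) rspace \<Rightarrow> ('g, 'm) monoid_scheme \<Rightarrow> ('p, 'a, 'b, 'g) gmod \<Rightarrow> ('p, 'a, 'c, 'g) gmod \<Rightarrow>
   ('p set \<Rightarrow> 'b \<Rightarrow> 'c) \<Rightarrow> bool" where
  "gmod_iso \<X> G M N \<phi> \<longleftrightarrow>
     omod_hom \<X> M N \<phi> \<and>
     (\<forall>U. openin (topo \<X>) U \<longrightarrow>
        bij_betw (\<phi> U) (carrier (msec M U)) (carrier (msec N U)) \<and>
        (\<forall>g\<in>carrier G. \<forall>s\<in>carrier (msec M U). \<phi> U (gact M g U s) = gact N g U (\<phi> U s)))"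

definition trivial_action :: "('p, 'a, 'b) omod \<Rightarrow> ('p, 'a, 'b, 'g) gmod" where
  "trivial_action F = omod.extend F (gmod.fields (\<lambda>g U s. s))"

definition dsum_gmod :: "'i set \<Rightarrow> ('i \<Rightarrow> ('p, 'a, 'b, 'g) gmod) \<Rightarrow> ('p, 'a, 'i \<Rightarrow> 'b, 'g) gmod" where
  "dsum_gmod I M =
     \<lparr>msec = (\<lambda>U. dsum_module I (\<lambda>i. msec (M i) U)),
      mres = (\<lambda>U V x. \<lambda>i\<in>I. mres (M i) U V (x i)),
      gact = (\<lambda>g U x. \<lambda>i\<in>I. gact (M i) g U (x i))\<rparr>"

definition dsum_in :: "'i set \<Rightarrow> ('i \<Rightarrow> ('p, 'a, 'b, 'g) gmod) \<Rightarrow> 'i \<Rightarrow> 'p set \<Rightarrow> 'b \<Rightarrow> 'i \<Rightarrow> 'b" where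
  "dsum_in I M i U s = (\<lambda>j\<in>I. if j = i then s else \<zero>\<^bsub>msec (M j) U\<^esub>)"

definition gstalk ::
  "('p, 'a) rspace \<Rightarrow> ('p, 'a, 'b, 'g) gmod \<Rightarrow> 'p \<Rightarrow> (('p set \<times> 'a) set, ('p set \<times> 'b) set, 'g) rep" where
  "gstalk \<X> M x = module.extend (stalk \<X> M x)
     (rep.fields (\<lambda>g C. \<Union>(U, s)\<in>C. mgerm \<X> M x U (gact M g U s)))"

text \<open>The sheaf associated to a presheaf \<open>P\<close> of modules with group action: sections are families of
  germs that are locally the germs of a section of \<open>P\<close>.\<close>

definition sheafify :: "('p, 'a) rspace \<Rightarrow> ('p, 'a, 'b, 'g) gmod \<Rightarrow> ('p, 'a, 'p \<Rightarrow> ('p set \<times> 'b) set, 'g) gmod"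
  where
  "sheafify \<X> P =
     \<lparr>msec = (\<lambda>U.
        \<lparr>carrier = {s \<in> (\<Pi>\<^sub>E x\<in>U. carrier (stalk \<X> P x)).
           \<forall>x\<in>U. \<exists>V t. openin (topo \<X>) V \<and> x \<in> V \<and> V \<subseteq> U \<and> t \<in> carrier (msec P V) \<and>
             (\<forall>y\<in>V. s y = mgerm \<X> P y V t)},
         monoid.mult = undefined, monoid.one = undefined,
         ring.zero = (\<lambda>x\<in>U. \<zero>\<^bsub>stalk \<X> P x\<^esub>),
         ring.add = (\<lambda>s t. \<lambda>x\<in>U. s x \<oplus>\<^bsub>stalk \<X> P x\<^esub> t x),
         module.smult = (\<lambda>a s. \<lambda>x\<in>U. rgerm \<X> x U a \<odot>\<^bsub>stalk \<X> P x\<^esub> s x)\<rparr>),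
      mres = (\<lambda>U V s. restrict s V),
      gact = (\<lambda>g U s. \<lambda>x\<in>U. ract (gstalk \<X> P x) g (s x))\<rparr>"

definition tensor_gmod ::
  "('p, 'a) rspace \<Rightarrow> ('p, 'a, 'b, 'g) gmod \<Rightarrow> ('p, 'a, 'c, 'g) gmod \<Rightarrow>
   ('p, 'a, 'p \<Rightarrow> ('p set \<times> ('b \<times> 'c \<Rightarrow>\<^sub>0 int) set) set, 'g) gmod" where
  "tensor_gmod \<X> M N = sheafify \<X>
     \<lparr>msec = (\<lambda>U. tensor (sec \<X> U) (module.smult (msec M U)) (msec M U) (msec N U)),
      mres = (\<lambda>U V. tensor_map (sec \<X> V) (module.smult (msec M V)) (msec M V) (msec N V) (mres M U V) (mres N U V)),
      gact = (\<lambda>g U. tensor_map (sec \<X> U) (module.smult (msec M U)) (msec M U) (msec N U) (gact M g U) (gact N g U))\<rparr>"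

text \<open>The action of \<open>k\<close> on a ring \<open>B\<close> through \<open>h\<close>, and the representation \<open>B \<otimes>\<^sub>k V\<close> over \<open>B\<close>.\<close>

definition alg_scale :: "'b ring \<Rightarrow> ('k \<Rightarrow> 'b) \<Rightarrow> 'k \<Rightarrow> 'b \<Rightarrow> 'b" where
  "alg_scale B h c b = h c \<otimes>\<^bsub>B\<^esub> b"

definition base_change :: "'k ring \<Rightarrow> 'b ring \<Rightarrow> ('k \<Rightarrow> 'b) \<Rightarrow> ('k, 'v, 'g) rep \<Rightarrow>
   ('b, ('b \<times> 'v \<Rightarrow>\<^sub>0 int) set, 'g) rep" where
  "base_change k B h V = module.extend (tensor k (alg_scale B h) (ring_module B) V)
     (rep.fields (\<lambda>g. tensor_map k (alg_scale B h) (ring_module B) V id (ract V g)))"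

text \<open>The sheaf of modules \<open>\<O>(V)\<close>, i.e. the tensor product over \<open>k\<close> of the structure sheaf with \<open>V\<close>.\<close>

definition rep_sheaf ::
  "'k ring \<Rightarrow> ('p, 'a) rspace \<Rightarrow> ('k \<Rightarrow> 'a) \<Rightarrow> ('k, 'v, 'g) rep \<Rightarrow>
   ('p, 'a, 'p \<Rightarrow> ('p set \<times> ('a \<times> 'v \<Rightarrow>\<^sub>0 int) set) set, 'g) gmod" where
  "rep_sheaf k \<X> \<kappa> V = sheafify \<X>
     \<lparr>msec = (\<lambda>U. module.truncate (base_change k (sec \<X> U) (const_sec \<X> \<kappa> U) V)),
      mres = (\<lambda>U U'. tensor_map k (alg_scale (sec \<X> U') (const_sec \<X> \<kappa> U')) (ring_module (sec \<X> U')) V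
                (res \<X> U U') id),
      gact = (\<lambda>g U. ract (base_change k (sec \<X> U) (const_sec \<X> \<kappa> U) V) g)\<rparr>"

definition has_type ::
  "'k ring \<Rightarrow> ('g, 'm) monoid_scheme \<Rightarrow> ('p, 'a) rspace \<Rightarrow> ('k \<Rightarrow> 'a) \<Rightarrow> 'p \<Rightarrow>
   ('p, 'a, 'b, 'g) gmod \<Rightarrow> ('k, 'w, 'g) rep \<Rightarrow> bool" where
  "has_type k G \<X> \<kappa> \<epsilon> E W \<longleftrightarrow>
     rep_isomorphic (stalk_ring \<X> \<epsilon>) G (gstalk \<X> E \<epsilon>)
       (base_change k (stalk_ring \<X> \<epsilon>) (\<lambda>c. rgerm \<X> \<epsilon> (points \<X>) (\<kappa> c)) W)"

text \<open>The image \<open>eE\<close> of an idempotent \<open>e\<close> of the group algebra; as \<open>e\<close> is idempotent, the presheaf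
  image is a sheaf.\<close>

definition galg_act ::
  "('g, 'm) monoid_scheme \<Rightarrow> ('p, 'a) rspace \<Rightarrow> ('k \<Rightarrow> 'a) \<Rightarrow> ('p, 'a, 'b, 'g) gmod \<Rightarrow> ('g \<Rightarrow> 'k) \<Rightarrow> 'p set \<Rightarrow> 'b \<Rightarrow> 'b"
  where
  "galg_act G \<X> \<kappa> E a U s = (\<Oplus>\<^bsub>msec E U\<^esub>g\<in>carrier G. const_sec \<X> \<kappa> U (a g) \<odot>\<^bsub>msec E U\<^esub> gact E g U s)"

definition idempotent_part ::
  "('g, 'm) monoid_scheme \<Rightarrow> ('p, 'a) rspace \<Rightarrow> ('k \<Rightarrow> 'a) \<Rightarrow> ('p, 'a, 'b, 'g) gmod \<Rightarrow> ('g \<Rightarrow> 'k) \<Rightarrow>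
   ('p, 'a, 'b, 'g) gmod" where
  "idempotent_part G \<X> \<kappa> E e =
     E\<lparr>msec := \<lambda>U. (msec E U)\<lparr>carrier := galg_act G \<X> \<kappa> E e U ` carrier (msec E U)\<rparr>\<rparr>"

end

theory Submission
  imports Defs
begin

text \<open>For a basis \<open>(w b)\<close> of \<open>V i\<close> with dual basis \<open>(\<gamma> b)\<close>, the group algebra contains matrix units
  acting on \<open>V i\<close> as \<open>y \<mapsto> \<gamma> b y \<cdot> w c\<close> and on the other \<open>V j\<close> as zero; here Schur's lemma and the
  invertibility of the group order are used. Their diagonal elements sum up to the central
  idempotent of \<open>V i\<close>. Let \<open>F i\<close> be the image in \<open>E\<close> of one diagonal matrix unit. The other units
  move it onto the images of the remaining diagonal ones, so the isotypical part is a direct sum of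
  \<open>dim (V i)\<close> copies of \<open>F i\<close>, and on these copies \<open>G\<close> acts through the matrices of \<open>V i\<close>. Since
  \<open>\<O>(V i)\<close> is free on the basis \<open>w\<close>, this direct sum is \<open>\<O>(V i) \<otimes> F i\<close>, already before
  sheafification. On the stalk at the generic point, the type provides coordinates in which the
  diagonal unit projects onto the \<open>n i\<close> coordinates belonging to one fixed basis vector of each copy
  of \<open>V i\<close>; this is the rank of \<open>F i\<close>.\<close>

section \<open>Finite sums, linear combinations, and bases given by coordinate functionals\<close>

section \<open>Finite sums and bases\<close>

text \<open>The natural multiplicity sheaf Hom_G(V i, E) is replaced by its image under evaluation
  at one basis vector. This is the image of a diagonal matrix unit, a subsheaf of \<open>E\<close>,
  whose sheaf property is inherited. Sections of \<open>E\<close> are infinite-dimensional over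
  \<open>k\<close> in general, so nothing is decomposed there: identities between matrix units are
  checked on the finite-dimensional \<open>V j\<close> and hold, as identities of the group algebra,
  on every representation. This requires the group algebra to act faithfully on the
  \<open>V j\<close> together; there completeness of the list enters, through an irreducible
  subrepresentation of the regular one. The scalar in a matrix unit is dim / |G|. Only the group
  order is inverted, so the dimension need not be known to be nonzero in \<open>k\<close>. Bases
  carry coordinate functionals, which identify tensor products with a free factor by an explicit
  inverse. Since a presheaf isomorphic to a sheaf is a sheaf, and sheafification does not change a
  sheaf, stalks of tensor products are never computed.\<close>

lemma hom_finsum_additive:
  assumes M: "abelian_group M" and N: "abelian_group N"
    and f: "f \<in> carrier M \<rightarrow> carrier N"
    and add: "\<And>x y. \<lbrakk>x \<in> carrier M; y \<in> carrier M\<rbrakk> \<Longrightarrow> f (x \<oplus>\<^bsub>M\<^esub> y) = f x \<oplus>\<^bsub>N\<^esub> f y"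
  shows additive_zero: "f \<zero>\<^bsub>M\<^esub> = \<zero>\<^bsub>N\<^esub>"
    and "x \<in> A \<rightarrow> carrier M \<Longrightarrow> f (finsum M x A) = (\<Oplus>\<^bsub>N\<^esub>i\<in>A. f (x i))"
proof -
  interpret M: abelian_group M by fact
  interpret N: abelian_group N by fact
  have "f \<zero>\<^bsub>M\<^esub> \<oplus>\<^bsub>N\<^esub> f \<zero>\<^bsub>M\<^esub> = f \<zero>\<^bsub>M\<^esub>"
    using add[of "\<zero>\<^bsub>M\<^esub>" "\<zero>\<^bsub>M\<^esub>"] by simp
  then show zero: "f \<zero>\<^bsub>M\<^esub> = \<zero>\<^bsub>N\<^esub>"
    using f by (metis M.zero_closed N.add.l_cancel_one PiE)
  show "f (finsum M x A) = (\<Oplus>\<^bsub>N\<^esub>i\<in>A. f (x i))" if "x \<in> A \<rightarrow> carrier M"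
    using that
  \<comment> \<open>The infinite case rests on the default value zero of \<open>finsum\<close>,
    which \<open>f\<close> preserves.\<close>
  proof (induction A rule: infinite_finite_induct)
    case (insert a A)
    then have "x \<in> A \<rightarrow> carrier M" "x a \<in> carrier M" "(\<lambda>i. f (x i)) \<in> A \<rightarrow> carrier N" "f (x a) \<in> carrier N"
      using f by auto
    with insert show ?case by (simp add: add)
  qed (simp_all add: zero)
qed

lemma additive_minus:
  assumes M: "abelian_group M" and N: "abelian_group N"
    and f: "f \<in> carrier M \<rightarrow> carrier N"
    and add: "\<And>x y. \<lbrakk>x \<in> carrier M; y \<in> carrier M\<rbrakk> \<Longrightarrow> f (x \<oplus>\<^bsub>M\<^esub> y) = f x \<oplus>\<^bsub>N\<^esub> f y"
    and x: "x \<in> carrier M"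
  shows "f (\<ominus>\<^bsub>M\<^esub> x) = \<ominus>\<^bsub>N\<^esub> f x"
proof -
  interpret M: abelian_group M by fact
  interpret N: abelian_group N by fact
  have "f (\<ominus>\<^bsub>M\<^esub> x) \<oplus>\<^bsub>N\<^esub> f x = \<zero>\<^bsub>N\<^esub>"
    using add[of "\<ominus>\<^bsub>M\<^esub> x" x] x additive_zero[OF M N f add] by (simp add: M.l_neg)
  then show ?thesis
    using f x by (metis M.a_inv_closed N.minus_equality PiE)
qed

context abelian_monoid
begin

lemma finsum_delta:
  assumes "finite A" "j \<in> A" "x \<in> carrier G"
  shows "(\<Oplus>i\<in>A. if i = j then x else \<zero>) = x"
proof -
  have "(\<Oplus>i\<in>A. if j = i then (\<lambda>_. x) i else \<zero>) = (\<lambda>_. x) j"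
    by (rule finsum_singleton) (use assms in auto)
  then show ?thesis by (simp add: eq_commute)
qed

lemma finsum_swap:
  assumes "finite A" "finite B" "\<And>i j. \<lbrakk>i \<in> A; j \<in> B\<rbrakk> \<Longrightarrow> f i j \<in> carrier G"
  shows "(\<Oplus>i\<in>A. \<Oplus>j\<in>B. f i j) = (\<Oplus>j\<in>B. \<Oplus>i\<in>A. f i j)"
  using assms(1,3)
proof (induction A)
  case empty
  then show ?case by simp
next
  case (insert a A)
  have f: "f a \<in> B \<rightarrow> carrier G" "(\<lambda>j. \<Oplus>i\<in>A. f i j) \<in> B \<rightarrow> carrier G" "(\<lambda>i. \<Oplus>j\<in>B. f i j) \<in> A \<rightarrow> carrier G"
    using insert.prems by (auto intro!: finsum_closed)
  have "(\<Oplus>j\<in>B. \<Oplus>i\<in>insert a A. f i j) = (\<Oplus>j\<in>B. f a j \<oplus> (\<Oplus>i\<in>A. f i j))"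
    by (rule finsum_cong') (use insert f in \<open>auto intro!: finsum_insert a_closed\<close>)
  then show ?case
    using insert f by (simp add: finsum_addf)
qed

end

context module
begin

lemma lincomb_closed:
  "\<lbrakk>c \<in> B \<rightarrow> carrier R; w \<in> B \<rightarrow> carrier M\<rbrakk> \<Longrightarrow> (\<Oplus>\<^bsub>M\<^esub>b\<in>B. c b \<odot>\<^bsub>M\<^esub> w b) \<in> carrier M"
  by (auto intro!: M.finsum_closed)

lemma lincomb_add:
  assumes "c \<in> B \<rightarrow> carrier R" "d \<in> B \<rightarrow> carrier R" "w \<in> B \<rightarrow> carrier M"
  shows "(\<Oplus>\<^bsub>M\<^esub>b\<in>B. (c b \<oplus> d b) \<odot>\<^bsub>M\<^esub> w b) = (\<Oplus>\<^bsub>M\<^esub>b\<in>B. c b \<odot>\<^bsub>M\<^esub> w b) \<oplus>\<^bsub>M\<^esub> (\<Oplus>\<^bsub>M\<^esub>b\<in>B. d b \<odot>\<^bsub>M\<^esub> w b)"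
proof -
  have "(\<Oplus>\<^bsub>M\<^esub>b\<in>B. (c b \<oplus> d b) \<odot>\<^bsub>M\<^esub> w b) = (\<Oplus>\<^bsub>M\<^esub>b\<in>B. c b \<odot>\<^bsub>M\<^esub> w b \<oplus>\<^bsub>M\<^esub> d b \<odot>\<^bsub>M\<^esub> w b)"
    by (rule M.finsum_cong') (use assms in \<open>auto simp: smult_l_distr Pi_iff\<close>)
  also have "\<dots> = (\<Oplus>\<^bsub>M\<^esub>b\<in>B. c b \<odot>\<^bsub>M\<^esub> w b) \<oplus>\<^bsub>M\<^esub> (\<Oplus>\<^bsub>M\<^esub>b\<in>B. d b \<odot>\<^bsub>M\<^esub> w b)"
    by (rule M.finsum_addf) (use assms in auto)
  finally show ?thesis .
qed

lemma lincomb_smult: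
  assumes "finite B" "a \<in> carrier R" "c \<in> B \<rightarrow> carrier R" "w \<in> B \<rightarrow> carrier M"
  shows "(\<Oplus>\<^bsub>M\<^esub>b\<in>B. (a \<otimes> c b) \<odot>\<^bsub>M\<^esub> w b) = a \<odot>\<^bsub>M\<^esub> (\<Oplus>\<^bsub>M\<^esub>b\<in>B. c b \<odot>\<^bsub>M\<^esub> w b)"
proof -
  have "(\<Oplus>\<^bsub>M\<^esub>b\<in>B. (a \<otimes> c b) \<odot>\<^bsub>M\<^esub> w b) = (\<Oplus>\<^bsub>M\<^esub>b\<in>B. a \<odot>\<^bsub>M\<^esub> (c b \<odot>\<^bsub>M\<^esub> w b))"
    by (rule M.finsum_cong') (use assms in \<open>auto simp: smult_assoc1 Pi_iff\<close>)
  also have "\<dots> = a \<odot>\<^bsub>M\<^esub> (\<Oplus>\<^bsub>M\<^esub>b\<in>B. c b \<odot>\<^bsub>M\<^esub> w b)"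
    by (rule finsum_smult_ldistr[symmetric]) (use assms in auto)
  finally show ?thesis .
qed

lemma finsum_smult_rdistr:
  assumes "c \<in> B \<rightarrow> carrier R" "x \<in> carrier M"
  shows "(\<Oplus>b\<in>B. c b) \<odot>\<^bsub>M\<^esub> x = (\<Oplus>\<^bsub>M\<^esub>b\<in>B. c b \<odot>\<^bsub>M\<^esub> x)"
  by (rule hom_finsum_additive(2)[of R M "\<lambda>a. a \<odot>\<^bsub>M\<^esub> x"])
    (use assms in \<open>auto simp: smult_l_distr R.abelian_group_axioms M.abelian_group_axioms\<close>)

end

lemma ring_module_simps [simp]:
  "carrier (ring_module R) = carrier R"
  "a \<oplus>\<^bsub>ring_module R\<^esub> b = a \<oplus>\<^bsub>R\<^esub> b"
  "\<zero>\<^bsub>ring_module R\<^esub> = \<zero>\<^bsub>R\<^esub>"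
  "a \<odot>\<^bsub>ring_module R\<^esub> b = a \<otimes>\<^bsub>R\<^esub> b"
  by (simp_all add: ring_module_def ring.defs module.defs)

lemma module_ring_module:
  assumes "cring R"
  shows "module R (ring_module R)"
proof -
  interpret cring R by fact
  show ?thesis
    by (rule moduleI)
      (auto simp: assms l_distr r_distr m_assoc a_assoc intro!: abelian_groupI intro: a_comm l_neg)
qed

lemma finsum_record_cong:
  "\<lbrakk>carrier M = carrier N; ring.add M = ring.add N; ring.zero M = ring.zero N\<rbrakk> \<Longrightarrow> finsum M f A = finsum N f A"
  by (simp add: finsum_def finprod_def)

lemma finsum_ring_module: "finsum (ring_module R) f A = finsum R f A"
  by (rule finsum_record_cong) (simp_all add: ring_module_def ring.defs module.defs)

lemma module_homsD:
  assumes "h \<in> module_homs R M N"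
  shows "x \<in> carrier M \<Longrightarrow> h x \<in> carrier N"
    and "\<lbrakk>x \<in> carrier M; y \<in> carrier M\<rbrakk> \<Longrightarrow> h (x \<oplus>\<^bsub>M\<^esub> y) = h x \<oplus>\<^bsub>N\<^esub> h y"
    and "\<lbrakk>a \<in> carrier R; x \<in> carrier M\<rbrakk> \<Longrightarrow> h (a \<odot>\<^bsub>M\<^esub> x) = a \<odot>\<^bsub>N\<^esub> h x"
  using assms by (auto simp: module_homs_def)

lemma module_homsI:
  assumes "\<And>x. x \<in> carrier M \<Longrightarrow> h x \<in> carrier N"
    and "\<And>x y. \<lbrakk>x \<in> carrier M; y \<in> carrier M\<rbrakk> \<Longrightarrow> h (x \<oplus>\<^bsub>M\<^esub> y) = h x \<oplus>\<^bsub>N\<^esub> h y"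
    and "\<And>a x. \<lbrakk>a \<in> carrier R; x \<in> carrier M\<rbrakk> \<Longrightarrow> h (a \<odot>\<^bsub>M\<^esub> x) = a \<odot>\<^bsub>N\<^esub> h x"
  shows "h \<in> module_homs R M N"
  using assms by (auto simp: module_homs_def)

lemma module_hom_lincomb:
  assumes "module R M" "module R N" and h: "h \<in> module_homs R M N"
    and cw: "c \<in> B \<rightarrow> carrier R" "w \<in> B \<rightarrow> carrier M"
  shows "h (\<Oplus>\<^bsub>M\<^esub>b\<in>B. c b \<odot>\<^bsub>M\<^esub> w b) = (\<Oplus>\<^bsub>N\<^esub>b\<in>B. c b \<odot>\<^bsub>N\<^esub> h (w b))"
proof -
  interpret M: module R M by fact
  interpret N: module R N by fact
  have "h (\<Oplus>\<^bsub>M\<^esub>b\<in>B. c b \<odot>\<^bsub>M\<^esub> w b) = (\<Oplus>\<^bsub>N\<^esub>b\<in>B. h (c b \<odot>\<^bsub>M\<^esub> w b))"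
    by (rule hom_finsum_additive(2)[OF M.abelian_group_axioms N.abelian_group_axioms])
      (use cw module_homsD[OF h] in auto)
  also have "\<dots> = (\<Oplus>\<^bsub>N\<^esub>b\<in>B. c b \<odot>\<^bsub>N\<^esub> h (w b))"
    by (rule N.finsum_cong') (use cw in \<open>auto simp: module_homsD[OF h] Pi_iff\<close>)
  finally show ?thesis .
qed

text \<open>Independence is expressed by functionals biorthogonal to the vectors. Coordinates are
  then linear maps that commute with sums and survive base change, and a free choice of the index
  type allows bases indexed by group elements or by nested pairs.\<close>

definition dual_basis ::
  "'a ring \<Rightarrow> ('a, 'v, 'n) module_scheme \<Rightarrow> 'i set \<Rightarrow> ('i \<Rightarrow> 'v) \<Rightarrow> ('i \<Rightarrow> 'v \<Rightarrow> 'a) \<Rightarrow> bool" where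
  "dual_basis R V J w \<gamma> \<longleftrightarrow> finite J \<and> w \<in> J \<rightarrow> carrier V \<and>
     (\<forall>j\<in>J. \<gamma> j \<in> module_homs R V (ring_module R)) \<and>
     (\<forall>x\<in>carrier V. x = (\<Oplus>\<^bsub>V\<^esub>j\<in>J. \<gamma> j x \<odot>\<^bsub>V\<^esub> w j)) \<and>
     (\<forall>i\<in>J. \<forall>j\<in>J. \<gamma> i (w j) = (if i = j then \<one>\<^bsub>R\<^esub> else \<zero>\<^bsub>R\<^esub>))"

lemma dual_basisD:
  assumes "dual_basis R V J w \<gamma>"
  shows "finite J" "w \<in> J \<rightarrow> carrier V" "j \<in> J \<Longrightarrow> \<gamma> j \<in> module_homs R V (ring_module R)"
    "j \<in> J \<Longrightarrow> w j \<in> carrier V"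
    "\<lbrakk>i \<in> J; j \<in> J\<rbrakk> \<Longrightarrow> \<gamma> i (w j) = (if i = j then \<one>\<^bsub>R\<^esub> else \<zero>\<^bsub>R\<^esub>)"
    "\<lbrakk>j \<in> J; x \<in> carrier V\<rbrakk> \<Longrightarrow> \<gamma> j x \<in> carrier R"
    "\<lbrakk>j \<in> J; x \<in> carrier V; y \<in> carrier V\<rbrakk> \<Longrightarrow> \<gamma> j (x \<oplus>\<^bsub>V\<^esub> y) = \<gamma> j x \<oplus>\<^bsub>R\<^esub> \<gamma> j y"
    "\<lbrakk>j \<in> J; a \<in> carrier R; x \<in> carrier V\<rbrakk> \<Longrightarrow> \<gamma> j (a \<odot>\<^bsub>V\<^esub> x) = a \<otimes>\<^bsub>R\<^esub> \<gamma> j x"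
  using assms module_homsD[of "\<gamma> j" R V "ring_module R"] by (auto simp: dual_basis_def)

lemma dual_basis_expand:
  "\<lbrakk>dual_basis R V J w \<gamma>; x \<in> carrier V\<rbrakk> \<Longrightarrow> x = (\<Oplus>\<^bsub>V\<^esub>j\<in>J. \<gamma> j x \<odot>\<^bsub>V\<^esub> w j)"
  by (simp add: dual_basis_def)

lemma dual_basis_coord_finsum:
  assumes "dual_basis R V J w \<gamma>" "module R V" "j \<in> J" "x \<in> A \<rightarrow> carrier V"
  shows "\<gamma> j (finsum V x A) = (\<Oplus>\<^bsub>R\<^esub>i\<in>A. \<gamma> j (x i))"
proof -
  interpret module R V by fact
  show ?thesis
    by (rule hom_finsum_additive(2)[OF M.abelian_group_axioms R.abelian_group_axioms])
      (use assms dual_basisD[OF assms(1)] in auto)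
qed

lemma dual_basis_eqI:
  assumes "dual_basis R V J w \<gamma>" "module R V" "x \<in> carrier V" "y \<in> carrier V" "\<And>j. j \<in> J \<Longrightarrow> \<gamma> j x = \<gamma> j y"
  shows "x = y"
proof -
  interpret module R V by fact
  have "(\<Oplus>\<^bsub>V\<^esub>j\<in>J. \<gamma> j x \<odot>\<^bsub>V\<^esub> w j) = (\<Oplus>\<^bsub>V\<^esub>j\<in>J. \<gamma> j y \<odot>\<^bsub>V\<^esub> w j)"
    by (rule M.finsum_cong') (use assms dual_basisD[OF assms(1)] in auto)
  then show ?thesis
    using assms dual_basis_expand[OF assms(1)] by metis
qed

text \<open>Gaussian elimination, by induction on the equations: a pivot in equation
  \<open>i0\<close> eliminates one unknown and leaves one equation and one unknown fewer. An
  equation without pivot holds for every vector.\<close>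

lemma (in field) homogeneous_system_solution:
  assumes "finite I" "finite J" "card I < card J" "\<And>i j. \<lbrakk>i \<in> I; j \<in> J\<rbrakk> \<Longrightarrow> a i j \<in> carrier R"
  shows "\<exists>c\<in>J \<rightarrow> carrier R. (\<exists>j\<in>J. c j \<noteq> \<zero>) \<and> (\<forall>i\<in>I. (\<Oplus>j\<in>J. a i j \<otimes> c j) = \<zero>)"
  using assms
proof (induction I arbitrary: J a)
  case empty
  then have "J \<noteq> {}" by auto
  \<comment> \<open>Without equations any nonzero vector is a solution, and \<open>J\<close> is
    nonempty.\<close>
  then show ?case
    by (intro bexI[of _ "\<lambda>_. \<one>"]) auto
next
  case (insert i0 I)
  show ?case
  proof (cases "\<forall>j\<in>J. a i0 j = \<zero>")
    case True
    have "card I < card J"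
      using insert.prems insert.hyps by simp
    then obtain c where c: "c \<in> J \<rightarrow> carrier R" "\<exists>j\<in>J. c j \<noteq> \<zero>" "\<forall>i\<in>I. (\<Oplus>j\<in>J. a i j \<otimes> c j) = \<zero>"
      using insert.IH[of J a] insert.prems by blast
    have "(\<Oplus>j\<in>J. a i0 j \<otimes> c j) = (\<Oplus>j\<in>J. \<zero>)"
      by (rule finsum_cong') (use True c in \<open>auto simp: Pi_iff\<close>)
    with c show ?thesis by auto
  next
    case False
    then obtain p where p: "p \<in> J" "a i0 p \<noteq> \<zero>" by blast
    define K where "K = J - {p}"
    have J: "J = insert p K" and K: "finite K" "p \<notin> K"
      using p insert.prems by (auto simp: K_def)
    define q where "q = inv (a i0 p)"
    have ap: "a i0 p \<in> carrier R" using insert.prems p by auto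
    have q: "q \<in> carrier R" "a i0 p \<otimes> q = \<one>"
      using ap p(2) field_Units unfolding q_def by auto
    \<comment> \<open>Row operation: subtracting this multiple of row \<open>i0\<close> clears
      column \<open>p\<close> in row \<open>i\<close>.\<close>
    define a' where "a' = (\<lambda>i j. a i j \<ominus> (a i p \<otimes> q) \<otimes> a i0 j)"
    have "card I < card K"
      using insert.prems insert.hyps K unfolding J by simp
    moreover have "a' i j \<in> carrier R" if "i \<in> I" "j \<in> K" for i j
      using that insert.prems q unfolding a'_def J by auto
    ultimately obtain c where c: "c \<in> K \<rightarrow> carrier R" "\<exists>j\<in>K. c j \<noteq> \<zero>" "\<forall>i\<in>I. (\<Oplus>j\<in>K. a' i j \<otimes> c j) = \<zero>"
      using insert.IH[of K a'] K by blast
    define S where "S = (\<Oplus>j\<in>K. a i0 j \<otimes> c j)"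
    have aK: "a i j \<in> carrier R" if "i \<in> insert i0 I" "j \<in> J" for i j
      using that insert.prems by auto
    have S: "S \<in> carrier R"
      unfolding S_def by (rule finsum_closed) (use c aK J in \<open>auto simp: Pi_iff\<close>)
    \<comment> \<open>The pivot unknown is solved from equation \<open>i0\<close>; the other
      unknowns keep the solution of the reduced system.\<close>
    define d where "d = c(p := \<ominus> (q \<otimes> S))"
    have sum: "(\<Oplus>j\<in>J. a i j \<otimes> d j) = a i p \<otimes> \<ominus> (q \<otimes> S) \<oplus> (\<Oplus>j\<in>K. a i j \<otimes> c j)" if "i \<in> insert i0 I" for i
    proof -
      have "(\<Oplus>j\<in>J. a i j \<otimes> d j) = a i p \<otimes> d p \<oplus> (\<Oplus>j\<in>K. a i j \<otimes> d j)"
        unfolding J by (rule finsum_insert) (use K c aK[OF that] q S J in \<open>auto simp: d_def Pi_iff\<close>)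
      also have "(\<Oplus>j\<in>K. a i j \<otimes> d j) = (\<Oplus>j\<in>K. a i j \<otimes> c j)"
        by (rule finsum_cong') (use K c aK[OF that] J in \<open>auto simp: d_def Pi_iff\<close>)
      finally show ?thesis by (simp add: d_def)
    qed
    have "(\<Oplus>j\<in>J. a i0 j \<otimes> d j) = \<zero>"
    proof -
      have "a i0 p \<otimes> \<ominus> (q \<otimes> S) = \<ominus> ((a i0 p \<otimes> q) \<otimes> S)"
        using ap q(1) S by (simp add: r_minus m_assoc)
      then show ?thesis
        using sum[of i0] S q(2) by (simp add: S_def[symmetric] l_neg)
    qed
    moreover have "(\<Oplus>j\<in>J. a i j \<otimes> d j) = \<zero>" if i: "i \<in> I" for i
    proof -
      have ai: "a i p \<in> carrier R" "\<And>j. j \<in> K \<Longrightarrow> a i j \<in> carrier R" "\<And>j. j \<in> K \<Longrightarrow> a i0 j \<in> carrier R"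
        using aK i J by auto
      \<comment> \<open>Expanding the reduced row: the correction terms add up to a multiple of
        \<open>S\<close>, which is exactly what the pivot unknown contributes to row
        \<open>i\<close>.\<close>
      have "(\<Oplus>j\<in>K. a' i j \<otimes> c j) = (\<Oplus>j\<in>K. a i j \<otimes> c j \<oplus> (\<ominus> (a i p \<otimes> q)) \<otimes> (a i0 j \<otimes> c j))"
      proof (rule finsum_cong')
        fix j assume "j \<in> K"
        then have "c j \<in> carrier R" "a i j \<in> carrier R" "a i0 j \<in> carrier R"
          using c ai by auto
        with ai(1) q(1) show "a' i j \<otimes> c j = a i j \<otimes> c j \<oplus> (\<ominus> (a i p \<otimes> q)) \<otimes> (a i0 j \<otimes> c j)"
          unfolding a'_def by (simp add: a_minus_def l_distr l_minus m_assoc)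
      qed (use ai c q in \<open>auto simp: Pi_iff\<close>)
      also have "\<dots> = (\<Oplus>j\<in>K. a i j \<otimes> c j) \<oplus> (\<Oplus>j\<in>K. (\<ominus> (a i p \<otimes> q)) \<otimes> (a i0 j \<otimes> c j))"
        by (rule finsum_addf) (use ai c q in \<open>auto simp: Pi_iff\<close>)
      also have "(\<Oplus>j\<in>K. (\<ominus> (a i p \<otimes> q)) \<otimes> (a i0 j \<otimes> c j)) = (\<ominus> (a i p \<otimes> q)) \<otimes> S"
        unfolding S_def by (rule finsum_rdistr[symmetric]) (use ai c q K in \<open>auto simp: Pi_iff\<close>)
      also have "\<dots> = a i p \<otimes> \<ominus> (q \<otimes> S)"
        using ai(1) q(1) S by (simp add: l_minus r_minus m_assoc)
      finally have "(\<Oplus>j\<in>K. a i j \<otimes> c j) \<oplus> a i p \<otimes> \<ominus> (q \<otimes> S) = \<zero>"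
        using c(3) i by simp
      moreover have "(\<Oplus>j\<in>K. a i j \<otimes> c j) \<in> carrier R"
        by (rule finsum_closed) (use ai c in \<open>auto simp: Pi_iff\<close>)
      ultimately show ?thesis
        using sum[of i] i ai(1) q(1) S by (simp add: a_comm)
    qed
    moreover have "d \<in> J \<rightarrow> carrier R" "\<exists>j\<in>J. d j \<noteq> \<zero>"
      using c K q S unfolding J d_def by auto
    ultimately show ?thesis by blast
  qed
qed

text \<open>Taking coordinates turns the relation into \<open>card J\<close> homogeneous equations
  in \<open>card S\<close> unknowns.\<close>

lemma dual_basis_dependent:
  assumes k: "field R" and "module R V" and db: "dual_basis R V J w \<gamma>"
    and "finite S" "card J < card S" and x: "x \<in> S \<rightarrow> carrier V"
  obtains c where "c \<in> S \<rightarrow> carrier R" "\<exists>s\<in>S. c s \<noteq> \<zero>\<^bsub>R\<^esub>" "(\<Oplus>\<^bsub>V\<^esub>s\<in>S. c s \<odot>\<^bsub>V\<^esub> x s) = \<zero>\<^bsub>V\<^esub>"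
proof -
  interpret module R V by fact
  interpret k: field R by fact
  note db' = dual_basisD[OF db]
  have "\<gamma> j (x s) \<in> carrier R" if "j \<in> J" "s \<in> S" for j s
    using that x db'(6) by auto
  then obtain c where c: "c \<in> S \<rightarrow> carrier R" "\<exists>s\<in>S. c s \<noteq> \<zero>\<^bsub>R\<^esub>"
      "\<forall>j\<in>J. (\<Oplus>\<^bsub>R\<^esub>s\<in>S. \<gamma> j (x s) \<otimes>\<^bsub>R\<^esub> c s) = \<zero>\<^bsub>R\<^esub>"
    using k.homogeneous_system_solution[of J S "\<lambda>j s. \<gamma> j (x s)"] \<open>finite S\<close> \<open>card J < card S\<close> db'(1) by blast
  have "\<gamma> j (\<Oplus>\<^bsub>V\<^esub>s\<in>S. c s \<odot>\<^bsub>V\<^esub> x s) = \<gamma> j \<zero>\<^bsub>V\<^esub>" if j: "j \<in> J" for j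
  proof -
    have "\<gamma> j (\<Oplus>\<^bsub>V\<^esub>s\<in>S. c s \<odot>\<^bsub>V\<^esub> x s) = (\<Oplus>\<^bsub>R\<^esub>s\<in>S. \<gamma> j (c s \<odot>\<^bsub>V\<^esub> x s))"
      by (rule dual_basis_coord_finsum[OF db]) (use assms j c in \<open>auto simp: Pi_iff\<close>)
    also have "\<dots> = (\<Oplus>\<^bsub>R\<^esub>s\<in>S. \<gamma> j (x s) \<otimes>\<^bsub>R\<^esub> c s)"
      by (rule R.finsum_cong') (use j c x db' in \<open>auto simp: R.m_comm Pi_iff\<close>)
    also have "\<dots> = \<gamma> j \<zero>\<^bsub>V\<^esub>"
      using db'(8)[OF j, of "\<zero>\<^bsub>R\<^esub>" "\<zero>\<^bsub>V\<^esub>"] db'(6)[OF j, of "\<zero>\<^bsub>V\<^esub>"] c(3) j by simp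
    finally show ?thesis .
  qed
  then have "(\<Oplus>\<^bsub>V\<^esub>s\<in>S. c s \<odot>\<^bsub>V\<^esub> x s) = \<zero>\<^bsub>V\<^esub>"
    by (rule dual_basis_eqI[OF db \<open>module R V\<close> lincomb_closed[OF c(1) x] M.zero_closed])
  with c(1,2) show thesis by (rule that)
qed

text \<open>A spanning subfamily of minimal cardinality is a basis, since a nontrivial relation
  would allow one vector to be dropped. Uniqueness of coefficients then makes the chosen coefficient
  functions linear.\<close>

lemma finite_spanning_imp_dual_basis:
  fixes R :: "'a ring"
  assumes k: "field R" and V: "module R V" and S: "finite S" "w \<in> S \<rightarrow> carrier V"
    and span: "\<And>x. x \<in> carrier V \<Longrightarrow> \<exists>c\<in>S \<rightarrow> carrier R. x = (\<Oplus>\<^bsub>V\<^esub>s\<in>S. c s \<odot>\<^bsub>V\<^esub> w s)"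
  obtains B \<gamma> where "B \<subseteq> S" "dual_basis R V B w \<gamma>"
proof -
  interpret module R V by fact
  interpret k: field R by fact
  define P where "P B \<longleftrightarrow> B \<subseteq> S \<and>
    (\<forall>x\<in>carrier V. \<exists>c\<in>B \<rightarrow> carrier R. x = (\<Oplus>\<^bsub>V\<^esub>s\<in>B. c s \<odot>\<^bsub>V\<^esub> w s))" for B
  have "P S" using S span by (simp add: P_def)
  then obtain B where B: "P B" "\<And>B'. P B' \<Longrightarrow> card B \<le> card B'"
    using ex_has_least_nat[of P S card] by blast
  have subS: "B \<subseteq> S" and sp: "\<And>x. x \<in> carrier V \<Longrightarrow> \<exists>c\<in>B \<rightarrow> carrier R. x = (\<Oplus>\<^bsub>V\<^esub>s\<in>B. c s \<odot>\<^bsub>V\<^esub> w s)"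
    using B(1) by (auto simp: P_def)
  have fin: "finite B" using S(1) subS by (rule finite_subset[rotated])
  have id: "w \<in> B \<rightarrow> carrier V" using S(2) subS by auto
  have indep: "c b0 = \<zero>\<^bsub>R\<^esub>" if c: "c \<in> B \<rightarrow> carrier R" and 0: "(\<Oplus>\<^bsub>V\<^esub>b\<in>B. c b \<odot>\<^bsub>V\<^esub> w b) = \<zero>\<^bsub>V\<^esub>" and b0: "b0 \<in> B" for c b0
  proof (rule ccontr)
    assume nz: "c b0 \<noteq> \<zero>\<^bsub>R\<^esub>"
    define q where "q = inv\<^bsub>R\<^esub> (c b0)"
    have q: "q \<in> carrier R" "q \<otimes>\<^bsub>R\<^esub> c b0 = \<one>\<^bsub>R\<^esub>"
    proof -
      have "c b0 \<in> Units R" using nz c b0 by (auto simp: k.field_Units)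
      then show "q \<in> carrier R" "q \<otimes>\<^bsub>R\<^esub> c b0 = \<one>\<^bsub>R\<^esub>" by (auto simp: q_def)
    qed
    have "P (B - {b0})"
      unfolding P_def
    proof (intro conjI ballI)
      fix x assume x: "x \<in> carrier V"
      obtain d where d: "d \<in> B \<rightarrow> carrier R" "x = (\<Oplus>\<^bsub>V\<^esub>s\<in>B. d s \<odot>\<^bsub>V\<^esub> w s)"
        using sp[OF x] by blast
      \<comment> \<open>\<open>t\<close> is chosen such that adding \<open>t\<close> times the
        relation to the expansion of \<open>x\<close> annuls the coefficient at
        \<open>b0\<close>.\<close>
      define t where "t = \<ominus>\<^bsub>R\<^esub> (d b0 \<otimes>\<^bsub>R\<^esub> q)"
      have t: "t \<in> carrier R" using d b0 q by (auto simp: t_def)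
      define e where "e = (\<lambda>b. d b \<oplus>\<^bsub>R\<^esub> t \<otimes>\<^bsub>R\<^esub> c b)"
      have e: "e \<in> B \<rightarrow> carrier R" using c d t by (auto simp: e_def)
      have e0: "e b0 = \<zero>\<^bsub>R\<^esub>"
      proof -
        have m: "d b0 \<in> carrier R" "c b0 \<in> carrier R" using d c b0 by auto
        then have "t \<otimes>\<^bsub>R\<^esub> c b0 = \<ominus>\<^bsub>R\<^esub> (d b0 \<otimes>\<^bsub>R\<^esub> (q \<otimes>\<^bsub>R\<^esub> c b0))"
          using q(1) by (simp add: t_def R.l_minus R.m_assoc)
        then show ?thesis using m by (simp add: e_def q(2) R.r_neg)
      qed
      have "(\<Oplus>\<^bsub>V\<^esub>b\<in>B. e b \<odot>\<^bsub>V\<^esub> w b) = x \<oplus>\<^bsub>V\<^esub> (\<Oplus>\<^bsub>V\<^esub>b\<in>B. (t \<otimes>\<^bsub>R\<^esub> c b) \<odot>\<^bsub>V\<^esub> w b)"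
        unfolding e_def d(2) by (rule lincomb_add) (use c d t id in \<open>auto simp: Pi_iff\<close>)
      also have "(\<Oplus>\<^bsub>V\<^esub>b\<in>B. (t \<otimes>\<^bsub>R\<^esub> c b) \<odot>\<^bsub>V\<^esub> w b) = \<zero>\<^bsub>V\<^esub>"
        using lincomb_smult[OF fin t c id] 0 t by simp
      finally have "x = (\<Oplus>\<^bsub>V\<^esub>b\<in>B. e b \<odot>\<^bsub>V\<^esub> w b)" using x by simp
      also have "\<dots> = (\<Oplus>\<^bsub>V\<^esub>b\<in>insert b0 (B - {b0}). e b \<odot>\<^bsub>V\<^esub> w b)"
        using b0 by (simp add: insert_absorb)
      also have "\<dots> = e b0 \<odot>\<^bsub>V\<^esub> w b0 \<oplus>\<^bsub>V\<^esub> (\<Oplus>\<^bsub>V\<^esub>b\<in>B - {b0}. e b \<odot>\<^bsub>V\<^esub> w b)"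
        by (rule M.finsum_insert) (use fin e id b0 in \<open>auto simp: Pi_iff\<close>)
      also have "\<dots> = (\<Oplus>\<^bsub>V\<^esub>b\<in>B - {b0}. e b \<odot>\<^bsub>V\<^esub> w b)"
      proof -
        have "(\<Oplus>\<^bsub>V\<^esub>b\<in>B - {b0}. e b \<odot>\<^bsub>V\<^esub> w b) \<in> carrier V"
          using e id by (auto intro!: M.finsum_closed)
        moreover have "w b0 \<in> carrier V" using b0 id by auto
        ultimately show ?thesis by (simp add: e0)
      qed
      finally show "\<exists>c\<in>B - {b0} \<rightarrow> carrier R. x = (\<Oplus>\<^bsub>V\<^esub>s\<in>B - {b0}. c s \<odot>\<^bsub>V\<^esub> w s)"
        using e by blast
    qed (use subS in \<open>auto simp: Pi_iff\<close>)
    from B(2)[OF this] show False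
      using fin b0 by (metis card_Diff1_less not_le)
  qed
  \<comment> \<open>Coefficients are picked for each vector separately; \<open>uniq\<close> makes
    these choices compatible with the module operations.\<close>
  obtain c where c: "\<And>x. x \<in> carrier V \<Longrightarrow> c x \<in> B \<rightarrow> carrier R" "\<And>x. x \<in> carrier V \<Longrightarrow> x = (\<Oplus>\<^bsub>V\<^esub>s\<in>B. c x s \<odot>\<^bsub>V\<^esub> w s)"
    using sp by metis
  have uniq: "d b = e b" if d: "d \<in> B \<rightarrow> carrier R" and e: "e \<in> B \<rightarrow> carrier R"
     and eq: "(\<Oplus>\<^bsub>V\<^esub>b\<in>B. d b \<odot>\<^bsub>V\<^esub> w b) = (\<Oplus>\<^bsub>V\<^esub>b\<in>B. e b \<odot>\<^bsub>V\<^esub> w b)" and b: "b \<in> B" for d e b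
  proof -
    \<comment> \<open>With \<open>?m\<close> as a factor, a difference of linear combinations
      becomes a sum.\<close>
    let ?m = "\<ominus>\<^bsub>R\<^esub> \<one>\<^bsub>R\<^esub>"
    have "(\<Oplus>\<^bsub>V\<^esub>b\<in>B. (d b \<oplus>\<^bsub>R\<^esub> ?m \<otimes>\<^bsub>R\<^esub> e b) \<odot>\<^bsub>V\<^esub> w b)
        = (\<Oplus>\<^bsub>V\<^esub>b\<in>B. d b \<odot>\<^bsub>V\<^esub> w b) \<oplus>\<^bsub>V\<^esub> (\<Oplus>\<^bsub>V\<^esub>b\<in>B. (?m \<otimes>\<^bsub>R\<^esub> e b) \<odot>\<^bsub>V\<^esub> w b)"
      by (rule lincomb_add) (use d e id in \<open>auto simp: Pi_iff\<close>)
    also have "(\<Oplus>\<^bsub>V\<^esub>b\<in>B. (?m \<otimes>\<^bsub>R\<^esub> e b) \<odot>\<^bsub>V\<^esub> w b) = ?m \<odot>\<^bsub>V\<^esub> (\<Oplus>\<^bsub>V\<^esub>b\<in>B. e b \<odot>\<^bsub>V\<^esub> w b)"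
      by (rule lincomb_smult) (use fin e id in \<open>auto simp: Pi_iff\<close>)
    finally have "(\<Oplus>\<^bsub>V\<^esub>b\<in>B. (d b \<oplus>\<^bsub>R\<^esub> ?m \<otimes>\<^bsub>R\<^esub> e b) \<odot>\<^bsub>V\<^esub> w b) = \<zero>\<^bsub>V\<^esub>"
      using lincomb_closed[OF e id] eq by (simp add: smult_l_minus M.r_neg)
    then have "d b \<oplus>\<^bsub>R\<^esub> ?m \<otimes>\<^bsub>R\<^esub> e b = \<zero>\<^bsub>R\<^esub>"
      by (intro indep[of "\<lambda>b. d b \<oplus>\<^bsub>R\<^esub> ?m \<otimes>\<^bsub>R\<^esub> e b"]) (use d e b in \<open>auto simp: Pi_iff\<close>)
    moreover have "d b \<in> carrier R" "e b \<in> carrier R" using d e b by auto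
    ultimately show "d b = e b"
      using R.minus_equality[of "d b" "\<ominus>\<^bsub>R\<^esub> e b"] by (simp add: R.l_minus)
  qed
  have "dual_basis R V B w (\<lambda>b x. c x b)"
    unfolding dual_basis_def
  proof (intro conjI ballI)
    fix b assume b: "b \<in> B"
    show "(\<lambda>x. c x b) \<in> module_homs R V (ring_module R)"
    proof (rule module_homsI)
      fix x y assume xy: "x \<in> carrier V" "y \<in> carrier V"
      have "(\<Oplus>\<^bsub>V\<^esub>b\<in>B. (c x b \<oplus>\<^bsub>R\<^esub> c y b) \<odot>\<^bsub>V\<^esub> w b) = x \<oplus>\<^bsub>V\<^esub> y"
        using lincomb_add[OF c(1)[OF xy(1)] c(1)[OF xy(2)] id] c(2)[OF xy(1)] c(2)[OF xy(2)] by simp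
      also have "\<dots> = (\<Oplus>\<^bsub>V\<^esub>b\<in>B. c (x \<oplus>\<^bsub>V\<^esub> y) b \<odot>\<^bsub>V\<^esub> w b)" by (rule c(2)) (use xy in auto)
      finally have "c x b \<oplus>\<^bsub>R\<^esub> c y b = c (x \<oplus>\<^bsub>V\<^esub> y) b"
        by (intro uniq[of "\<lambda>b. c x b \<oplus>\<^bsub>R\<^esub> c y b"]) (use b xy c(1) in \<open>auto simp: Pi_iff\<close>)
      then show "c (x \<oplus>\<^bsub>V\<^esub> y) b = c x b \<oplus>\<^bsub>ring_module R\<^esub> c y b" by simp
    next
      fix a x assume ax: "a \<in> carrier R" "x \<in> carrier V"
      have "(\<Oplus>\<^bsub>V\<^esub>b\<in>B. (a \<otimes>\<^bsub>R\<^esub> c x b) \<odot>\<^bsub>V\<^esub> w b) = a \<odot>\<^bsub>V\<^esub> x"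
        using lincomb_smult[OF fin ax(1) c(1)[OF ax(2)] id] c(2)[OF ax(2)] by simp
      also have "\<dots> = (\<Oplus>\<^bsub>V\<^esub>b\<in>B. c (a \<odot>\<^bsub>V\<^esub> x) b \<odot>\<^bsub>V\<^esub> w b)" by (rule c(2)) (use ax in auto)
      finally have "a \<otimes>\<^bsub>R\<^esub> c x b = c (a \<odot>\<^bsub>V\<^esub> x) b"
        by (intro uniq[of "\<lambda>b. a \<otimes>\<^bsub>R\<^esub> c x b"]) (use b ax c(1) in \<open>auto simp: Pi_iff\<close>)
      then show "c (a \<odot>\<^bsub>V\<^esub> x) b = a \<odot>\<^bsub>ring_module R\<^esub> c x b" by simp
    qed (use c(1) b in \<open>auto simp: Pi_iff\<close>)
  next
    fix b b' assume b: "b \<in> B" "b' \<in> B"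
    let ?d = "\<lambda>b. if b = b' then \<one>\<^bsub>R\<^esub> else \<zero>\<^bsub>R\<^esub>"
    have "(\<Oplus>\<^bsub>V\<^esub>b\<in>B. ?d b \<odot>\<^bsub>V\<^esub> w b) = (\<Oplus>\<^bsub>V\<^esub>b\<in>B. if b = b' then w b' else \<zero>\<^bsub>V\<^esub>)"
      by (rule M.finsum_cong') (use id b in \<open>auto simp: Pi_iff\<close>)
    also have "\<dots> = w b'" by (rule M.finsum_delta) (use fin b id in \<open>auto simp: Pi_iff\<close>)
    also have "\<dots> = (\<Oplus>\<^bsub>V\<^esub>b\<in>B. c (w b') b \<odot>\<^bsub>V\<^esub> w b)" by (rule c(2)) (use b id in auto)
    finally have "?d b = c (w b') b"
      by (intro uniq[of ?d]) (use b c(1) id in \<open>auto simp: Pi_iff\<close>)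
    then show "c (w b') b = (if b = b' then \<one>\<^bsub>R\<^esub> else \<zero>\<^bsub>R\<^esub>)" by simp
  qed (use fin id c(2) in \<open>blast+\<close>)
  with subS show thesis by (rule that)
qed

section \<open>Eigenvectors over an algebraically closed field and Schur's lemma\<close>

section \<open>Schur's lemma\<close>

text \<open>Polynomials are coefficient lists with the leading coefficient first, hence the reversed
  range; evaluation peels off the top degree.\<close>

lemma (in ring) eval_map_rev_upt:
  assumes "x \<in> carrier R" "\<And>j. j \<le> m \<Longrightarrow> c j \<in> carrier R"
  shows "eval (map c (rev [0..<Suc m])) x = (\<Oplus>j\<in>{..m}. c j \<otimes> x [^] j)"
  using assms(2)
proof (induction m)
  case 0
  then show ?case using assms(1) by simp
next
  case (Suc m)
  have "{..Suc m} = insert (Suc m) {..m}" by auto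
  then have "(\<Oplus>j\<in>{..Suc m}. c j \<otimes> x [^] j) = c (Suc m) \<otimes> x [^] Suc m \<oplus> (\<Oplus>j\<in>{..m}. c j \<otimes> x [^] j)"
    using Suc.prems assms(1) by (simp del: finsum_Suc add: Pi_iff finsum_insert)
  moreover have "eval (map c (rev [0..<Suc (Suc m)])) x = c (Suc m) \<otimes> x [^] Suc m \<oplus> eval (map c (rev [0..<Suc m])) x"
    by simp
  ultimately show ?case using Suc by simp
qed

text \<open>The polynomial splits, so it has as many roots, counted with multiplicity, as its degree
  \<open>m\<close>, which is positive.\<close>

lemma (in algebraically_closed) exists_root:
  fixes m :: nat
  assumes c: "\<And>j. j \<le> m \<Longrightarrow> c j \<in> carrier L" "c m \<noteq> \<zero>" and m: "0 < m"
  shows "\<exists>x\<in>carrier L. (\<Oplus>j\<in>{..m}. c j \<otimes> x [^] j) = \<zero>"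
proof -
  define p where "p = map c (rev [0..<Suc m])"
  have "set p \<subseteq> carrier L" "p \<noteq> []" "lead_coeff p \<noteq> \<zero>" "degree p = m"
    using c by (auto simp: p_def)
  then have p: "p \<in> carrier (poly_ring L)"
    by (simp add: univ_poly_carrier[symmetric] polynomial_def)
  have "size (roots p) = m"
    using roots_over_carrier[OF p] \<open>degree p = m\<close> by (simp add: splitted_def)
  then obtain x where "x \<in># roots p"
    using m by (metis multiset_nonemptyE not_gr_zero size_empty)
  then have "x \<in> carrier L" "eval p x = \<zero>"
    using roots_mem_iff_is_root[OF p] by (auto simp: is_root_def)
  then show ?thesis
    using eval_map_rev_upt[of x m c] c(1) unfolding p_def by auto
qed

lemma funpow_module_hom:
  assumes "T \<in> module_homs R M M"
  shows "(T ^^ j) \<in> module_homs R M M"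
  by (induction j) (use assms in \<open>auto simp: module_homs_def Pi_iff\<close>)

text \<open>A vector annihilated by a polynomial in \<open>T\<close> of minimal degree is mapped to an eigenvector
  by the quotient of that polynomial by a linear factor; \<open>d\<close> is the list of coefficients of this
  quotient.\<close>

lemma exists_eigenvector:
  assumes k: "algebraically_closed k" and V: "module k V" and db: "dual_basis k V J w \<gamma>"
    and ne: "carrier V \<noteq> {\<zero>\<^bsub>V\<^esub>}" and T: "T \<in> module_homs k V V"
  shows "\<exists>l\<in>carrier k. \<exists>x\<in>carrier V - {\<zero>\<^bsub>V\<^esub>}. T x = l \<odot>\<^bsub>V\<^esub> x"
proof -
  interpret module k V by fact
  interpret k: algebraically_closed k by fact
  note Tj = module_homsD[OF funpow_module_hom[OF T]] and T' = module_homsD[OF T]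
  define P where "P m \<longleftrightarrow> (\<exists>c x. (\<forall>j. c j \<in> carrier k) \<and> c m \<noteq> \<zero>\<^bsub>k\<^esub> \<and> x \<in> carrier V \<and> x \<noteq> \<zero>\<^bsub>V\<^esub> \<and>
      (\<Oplus>\<^bsub>V\<^esub>j\<in>{..m}. c j \<odot>\<^bsub>V\<^esub> (T ^^ j) x) = \<zero>\<^bsub>V\<^esub>)" for m :: nat
  obtain x0 where x0: "x0 \<in> carrier V" "x0 \<noteq> \<zero>\<^bsub>V\<^esub>"
    using ne M.zero_closed by blast
  have "\<exists>m. P m"
  proof -
    \<comment> \<open>The \<open>card J + 1\<close> iterates of \<open>x0\<close> are linearly
      dependent; the last index with a nonzero coefficient is the degree of the annihilating
      polynomial.\<close>
    obtain c where c: "c \<in> {..card J} \<rightarrow> carrier k" "\<exists>s\<in>{..card J}. c s \<noteq> \<zero>\<^bsub>k\<^esub>"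
        "(\<Oplus>\<^bsub>V\<^esub>j\<in>{..card J}. c j \<odot>\<^bsub>V\<^esub> (T ^^ j) x0) = \<zero>\<^bsub>V\<^esub>"
      by (rule dual_basis_dependent[OF k.field_axioms V db, of "{..card J}" "\<lambda>j. (T ^^ j) x0"])
        (use Tj x0 in auto)
    define c' where "c' j = (if j \<le> card J then c j else \<zero>\<^bsub>k\<^esub>)" for j
    have c': "c' j \<in> carrier k" for j using c(1) by (auto simp: c'_def Pi_iff)
    define m where "m = Max {j \<in> {..card J}. c j \<noteq> \<zero>\<^bsub>k\<^esub>}"
    have "m \<in> {j \<in> {..card J}. c j \<noteq> \<zero>\<^bsub>k\<^esub>}"
      unfolding m_def by (rule Max_in) (use c(2) in auto)
    then have m: "m \<le> card J" "c' m \<noteq> \<zero>\<^bsub>k\<^esub>" by (auto simp: c'_def)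
    have zero: "c j = \<zero>\<^bsub>k\<^esub>" if "j \<le> card J" "m < j" for j
    proof (rule ccontr)
      assume "c j \<noteq> \<zero>\<^bsub>k\<^esub>"
      then have "j \<le> m" unfolding m_def by (intro Max_ge) (use that in auto)
      with \<open>m < j\<close> show False by linarith
    qed
    have "(\<Oplus>\<^bsub>V\<^esub>j\<in>{..m}. c' j \<odot>\<^bsub>V\<^esub> (T ^^ j) x0) = (\<Oplus>\<^bsub>V\<^esub>j\<in>{..card J}. c j \<odot>\<^bsub>V\<^esub> (T ^^ j) x0)"
      by (rule M.add.finprod_mono_neutral_cong_left)
        (use m zero c Tj x0 in \<open>auto simp: c'_def Pi_iff\<close>)
    then show ?thesis
      unfolding P_def using c' m x0 c(3) by auto
  qed
  then obtain m where Pm: "P m" and least: "\<And>m'. m' < m \<Longrightarrow> \<not> P m'"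
    using exists_least_iff[of P] by blast
  from Pm obtain c x where c: "\<And>j. c j \<in> carrier k" "c m \<noteq> \<zero>\<^bsub>k\<^esub>"
    and x: "x \<in> carrier V" "x \<noteq> \<zero>\<^bsub>V\<^esub>"
    and sum0: "(\<Oplus>\<^bsub>V\<^esub>j\<in>{..m}. c j \<odot>\<^bsub>V\<^esub> (T ^^ j) x) = \<zero>\<^bsub>V\<^esub>"
    by (auto simp: P_def)
  have m: "0 < m"
  proof (rule ccontr)
    assume "\<not> 0 < m"
    with sum0 x c have "c 0 \<odot>\<^bsub>V\<^esub> x = \<zero>\<^bsub>V\<^esub>" by simp
    moreover have "c 0 \<in> Units k" using c \<open>\<not> 0 < m\<close> by (auto simp: k.field_Units)
    ultimately have "(inv\<^bsub>k\<^esub> (c 0) \<otimes>\<^bsub>k\<^esub> c 0) \<odot>\<^bsub>V\<^esub> x = \<zero>\<^bsub>V\<^esub>"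
      using x c by (subst smult_assoc1) auto
    then show False using \<open>c 0 \<in> Units k\<close> x by simp
  qed
  obtain l where l: "l \<in> carrier k" "(\<Oplus>\<^bsub>k\<^esub>j\<in>{..m}. c j \<otimes>\<^bsub>k\<^esub> l [^]\<^bsub>k\<^esub> j) = \<zero>\<^bsub>k\<^esub>"
    using k.exists_root[of m c] c m by blast
  \<comment> \<open>Synthetic division by \<open>X - l\<close>: \<open>d j\<close> is the
    coefficient of degree \<open>j\<close> of the quotient, so \<open>d m\<close> is zero and
    \<open>d (m - 1)\<close> equals \<open>c m\<close>.\<close>
  define d where "d j = (\<Oplus>\<^bsub>k\<^esub>t\<in>{j<..m}. c t \<otimes>\<^bsub>k\<^esub> l [^]\<^bsub>k\<^esub> (t - Suc j))" for j
  have d: "d j \<in> carrier k" for j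
    unfolding d_def by (rule R.finsum_closed) (use c l in auto)
  have pull: "(\<Oplus>\<^bsub>k\<^esub>t\<in>{j<..m}. c t \<otimes>\<^bsub>k\<^esub> l [^]\<^bsub>k\<^esub> (t - j)) = l \<otimes>\<^bsub>k\<^esub> d j" for j
  proof -
    have "(\<Oplus>\<^bsub>k\<^esub>t\<in>{j<..m}. c t \<otimes>\<^bsub>k\<^esub> l [^]\<^bsub>k\<^esub> (t - j)) = (\<Oplus>\<^bsub>k\<^esub>t\<in>{j<..m}. l \<otimes>\<^bsub>k\<^esub> (c t \<otimes>\<^bsub>k\<^esub> l [^]\<^bsub>k\<^esub> (t - Suc j)))"
    proof (rule R.finsum_cong')
      fix t assume "t \<in> {j<..m}"
      then have "t - j = Suc (t - Suc j)" by auto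
      then have "l [^]\<^bsub>k\<^esub> (t - j) = l [^]\<^bsub>k\<^esub> (t - Suc j) \<otimes>\<^bsub>k\<^esub> l" by simp
      then show "c t \<otimes>\<^bsub>k\<^esub> l [^]\<^bsub>k\<^esub> (t - j) = l \<otimes>\<^bsub>k\<^esub> (c t \<otimes>\<^bsub>k\<^esub> l [^]\<^bsub>k\<^esub> (t - Suc j))"
        using c l by (simp add: R.m_assoc R.m_comm R.m_lcomm)
    qed (use c l in auto)
    also have "\<dots> = l \<otimes>\<^bsub>k\<^esub> d j"
      unfolding d_def by (rule R.finsum_rdistr[symmetric]) (use c l in auto)
    finally show ?thesis .
  qed
  \<comment> \<open>The remainder of the division is the value of the polynomial at
    \<open>l\<close>, hence zero.\<close>
  have d0: "c 0 \<oplus>\<^bsub>k\<^esub> l \<otimes>\<^bsub>k\<^esub> d 0 = \<zero>\<^bsub>k\<^esub>"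
  proof -
    have "{..m} = insert 0 {0<..m}" by auto
    then have "(\<Oplus>\<^bsub>k\<^esub>j\<in>{..m}. c j \<otimes>\<^bsub>k\<^esub> l [^]\<^bsub>k\<^esub> j) = c 0 \<otimes>\<^bsub>k\<^esub> l [^]\<^bsub>k\<^esub> (0::nat) \<oplus>\<^bsub>k\<^esub> (\<Oplus>\<^bsub>k\<^esub>j\<in>{0<..m}. c j \<otimes>\<^bsub>k\<^esub> l [^]\<^bsub>k\<^esub> j)"
      using c l by (simp add: R.finsum_insert Pi_iff)
    then show ?thesis using l pull[of 0] c by simp
  qed
  have dSuc: "c (Suc j) \<oplus>\<^bsub>k\<^esub> l \<otimes>\<^bsub>k\<^esub> d (Suc j) = d j" if "j < m" for j
  proof -
    have "{j<..m} = insert (Suc j) {Suc j<..m}" using that by auto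
    then have "d j = c (Suc j) \<oplus>\<^bsub>k\<^esub> (\<Oplus>\<^bsub>k\<^esub>t\<in>{Suc j<..m}. c t \<otimes>\<^bsub>k\<^esub> l [^]\<^bsub>k\<^esub> (t - Suc j))"
      unfolding d_def using c l by (simp add: R.finsum_insert Pi_iff)
    then show ?thesis using pull[of "Suc j"] by simp
  qed
  have dm: "d m = \<zero>\<^bsub>k\<^esub>" by (simp add: d_def)
  define y where "y n = (\<Oplus>\<^bsub>V\<^esub>j\<in>{..<n}. d j \<odot>\<^bsub>V\<^esub> (T ^^ j) x)" for n
  have Tjx: "(T ^^ j) x \<in> carrier V" for j using Tj x by blast
  have y: "y n \<in> carrier V" for n
    unfolding y_def by (rule M.finsum_closed) (use d Tjx in auto)
  have ySuc: "y (Suc n) = d n \<odot>\<^bsub>V\<^esub> (T ^^ n) x \<oplus>\<^bsub>V\<^esub> y n" for n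
    unfolding y_def lessThan_Suc by (rule M.finsum_insert) (use d Tjx in auto)
  \<comment> \<open>The partial sums of the polynomial telescope against those of the quotient. At
    \<open>n = m\<close> the sum on the left vanishes and \<open>y (Suc m)\<close> equals
    \<open>y m\<close>, which makes \<open>y m\<close> an eigenvector unless it is zero.\<close>
  have step: "(\<Oplus>\<^bsub>V\<^esub>j\<in>{..n}. c j \<odot>\<^bsub>V\<^esub> (T ^^ j) x) \<oplus>\<^bsub>V\<^esub> l \<odot>\<^bsub>V\<^esub> y (Suc n) = T (y n)" if "n \<le> m" for n
    using that
  proof (induction n)
    case 0
    have "y 0 = \<zero>\<^bsub>V\<^esub>" by (simp add: y_def)
    moreover have "T \<zero>\<^bsub>V\<^esub> = \<zero>\<^bsub>V\<^esub>"
      by (rule additive_zero[OF M.abelian_group_axioms M.abelian_group_axioms]) (use T' in auto)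
    moreover have "c 0 \<odot>\<^bsub>V\<^esub> x \<oplus>\<^bsub>V\<^esub> l \<odot>\<^bsub>V\<^esub> (d 0 \<odot>\<^bsub>V\<^esub> x) = (c 0 \<oplus>\<^bsub>k\<^esub> l \<otimes>\<^bsub>k\<^esub> d 0) \<odot>\<^bsub>V\<^esub> x"
      using c l d x by (simp add: smult_l_distr smult_assoc1)
    ultimately show ?case using c d x l d0 ySuc[of 0] by simp
  next
    case (Suc n)
    define s t where "s = (\<Oplus>\<^bsub>V\<^esub>j\<in>{..n}. c j \<odot>\<^bsub>V\<^esub> (T ^^ j) x)" and "t = (T ^^ Suc n) x"
    have s: "s \<in> carrier V" unfolding s_def by (rule M.finsum_closed) (use c Tjx in auto)
    have t: "t \<in> carrier V" using Tjx[of "Suc n"] by (simp add: t_def)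
    have "(\<Oplus>\<^bsub>V\<^esub>j\<in>{..Suc n}. c j \<odot>\<^bsub>V\<^esub> (T ^^ j) x) = c (Suc n) \<odot>\<^bsub>V\<^esub> t \<oplus>\<^bsub>V\<^esub> s"
      unfolding s_def t_def atMost_Suc by (rule M.finsum_insert) (use c Tjx in \<open>auto simp del: funpow.simps\<close>)
    moreover have "l \<odot>\<^bsub>V\<^esub> y (Suc (Suc n)) = (l \<otimes>\<^bsub>k\<^esub> d (Suc n)) \<odot>\<^bsub>V\<^esub> t \<oplus>\<^bsub>V\<^esub> l \<odot>\<^bsub>V\<^esub> y (Suc n)"
      unfolding ySuc[of "Suc n"] t_def[symmetric] using l d y t by (simp add: smult_r_distr smult_assoc1)
    ultimately have "(\<Oplus>\<^bsub>V\<^esub>j\<in>{..Suc n}. c j \<odot>\<^bsub>V\<^esub> (T ^^ j) x) \<oplus>\<^bsub>V\<^esub> l \<odot>\<^bsub>V\<^esub> y (Suc (Suc n))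
       = (c (Suc n) \<odot>\<^bsub>V\<^esub> t \<oplus>\<^bsub>V\<^esub> (l \<otimes>\<^bsub>k\<^esub> d (Suc n)) \<odot>\<^bsub>V\<^esub> t) \<oplus>\<^bsub>V\<^esub> (s \<oplus>\<^bsub>V\<^esub> l \<odot>\<^bsub>V\<^esub> y (Suc n))"
      using c l d y s t by (simp add: M.a_ac)
    also have "\<dots> = (c (Suc n) \<oplus>\<^bsub>k\<^esub> l \<otimes>\<^bsub>k\<^esub> d (Suc n)) \<odot>\<^bsub>V\<^esub> t \<oplus>\<^bsub>V\<^esub> T (y n)"
      using Suc c l d t by (simp add: s_def[symmetric] smult_l_distr)
    also have "\<dots> = T (y (Suc n))"
      using Suc.prems dSuc[of n] d y T' Tjx[of n] by (simp add: ySuc[of n] t_def)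
    finally show ?case .
  qed
  have "y (Suc m) = y m" using ySuc[of m] dm Tjx y by simp
  with step[of m] sum0 l y have "T (y m) = l \<odot>\<^bsub>V\<^esub> y m" by simp
  \<comment> \<open>Otherwise the quotient, with leading coefficient \<open>c m\<close>, would
    annihilate \<open>x\<close> in degree \<open>m - 1\<close>.\<close>
  moreover have "y m \<noteq> \<zero>\<^bsub>V\<^esub>"
  proof
    assume "y m = \<zero>\<^bsub>V\<^esub>"
    obtain n where n: "m = Suc n" using m by (cases m) auto
    have "c m \<oplus>\<^bsub>k\<^esub> l \<otimes>\<^bsub>k\<^esub> d m = d n" using dSuc[of n] n by simp
    then have "d n \<noteq> \<zero>\<^bsub>k\<^esub>" using dm c l by simp
    moreover have "(\<Oplus>\<^bsub>V\<^esub>j\<in>{..n}. d j \<odot>\<^bsub>V\<^esub> (T ^^ j) x) = \<zero>\<^bsub>V\<^esub>"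
      using \<open>y m = \<zero>\<^bsub>V\<^esub>\<close> by (simp add: y_def n lessThan_Suc_atMost)
    ultimately have "P n" unfolding P_def using d x by blast
    then show False using least[of n] n by simp
  qed
  ultimately show ?thesis using l y by blast
qed

lemma representationD:
  assumes "representation R G V"
  shows "module R V"
    "g \<in> carrier G \<Longrightarrow> ract V g \<in> module_homs R V V"
    "\<lbrakk>g \<in> carrier G; v \<in> carrier V\<rbrakk> \<Longrightarrow> ract V g v \<in> carrier V"
    "\<lbrakk>g \<in> carrier G; v \<in> carrier V; v' \<in> carrier V\<rbrakk> \<Longrightarrow> ract V g (v \<oplus>\<^bsub>V\<^esub> v') = ract V g v \<oplus>\<^bsub>V\<^esub> ract V g v'"
    "\<lbrakk>g \<in> carrier G; a \<in> carrier R; v \<in> carrier V\<rbrakk> \<Longrightarrow> ract V g (a \<odot>\<^bsub>V\<^esub> v) = a \<odot>\<^bsub>V\<^esub> ract V g v"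
    "v \<in> carrier V \<Longrightarrow> ract V \<one>\<^bsub>G\<^esub> v = v"
    "\<lbrakk>g \<in> carrier G; h \<in> carrier G; v \<in> carrier V\<rbrakk> \<Longrightarrow> ract V g (ract V h v) = ract V (g \<otimes>\<^bsub>G\<^esub> h) v"
  using assms by (auto simp: representation_def module_homs_def)

lemma irreducible_repD:
  assumes "irreducible_rep R G V"
  shows "representation R G V" "carrier V \<noteq> {\<zero>\<^bsub>V\<^esub>}"
    "\<lbrakk>submodule W R V; \<And>g x. \<lbrakk>g \<in> carrier G; x \<in> W\<rbrakk> \<Longrightarrow> ract V g x \<in> W\<rbrakk> \<Longrightarrow> W = {\<zero>\<^bsub>V\<^esub>} \<or> W = carrier V"
  using assms by (auto simp: irreducible_rep_def)

text \<open>Negation is multiplication by minus one, so closure under additive inverses follows from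
  closure under scalars.\<close>

lemma submoduleI':
  assumes "module R V" "W \<subseteq> carrier V" "\<zero>\<^bsub>V\<^esub> \<in> W"
    and add: "\<And>x y. \<lbrakk>x \<in> W; y \<in> W\<rbrakk> \<Longrightarrow> x \<oplus>\<^bsub>V\<^esub> y \<in> W"
    and smult: "\<And>a x. \<lbrakk>a \<in> carrier R; x \<in> W\<rbrakk> \<Longrightarrow> a \<odot>\<^bsub>V\<^esub> x \<in> W"
  shows "submodule W R V"
proof -
  interpret module R V by fact
  show ?thesis
  proof (rule submoduleI)
    fix x assume "x \<in> W"
    then have "(\<ominus>\<^bsub>R\<^esub> \<one>\<^bsub>R\<^esub>) \<odot>\<^bsub>V\<^esub> x = \<ominus>\<^bsub>V\<^esub> x"
      using assms(2) by (subst smult_l_minus) auto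
    then show "\<ominus>\<^bsub>V\<^esub> x \<in> W"
      using smult[of "\<ominus>\<^bsub>R\<^esub> \<one>\<^bsub>R\<^esub>" x] \<open>x \<in> W\<close> by simp
  qed (use assms in auto)
qed

definition equivariant_homs ::
  "('a, 'm) ring_scheme \<Rightarrow> ('g, 'n) monoid_scheme \<Rightarrow> ('a, 'v, 'g) rep \<Rightarrow> ('a, 'w, 'g) rep \<Rightarrow> ('v \<Rightarrow> 'w) set" where
  "equivariant_homs R G V W =
     {f \<in> module_homs R V W. \<forall>g\<in>carrier G. \<forall>v\<in>carrier V. f (ract V g v) = ract W g (f v)}"

text \<open>An eigenspace of \<open>T\<close> is a nonzero subrepresentation, hence
  everything.\<close>

lemma schur_scalar:
  fixes V :: "('k, 'v, 'g) rep"
  assumes k: "algebraically_closed k" and irr: "irreducible_rep k G V" and db: "dual_basis k V J w \<gamma>"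
    and T: "T \<in> equivariant_homs k G V V"
  shows "\<exists>l\<in>carrier k. \<forall>x\<in>carrier V. T x = l \<odot>\<^bsub>V\<^esub> x"
proof -
  note V = representationD[OF irreducible_repD(1)[OF irr]]
  have T1: "T \<in> module_homs k V V" and T2: "\<And>g v. \<lbrakk>g \<in> carrier G; v \<in> carrier V\<rbrakk> \<Longrightarrow> T (ract V g v) = ract V g (T v)"
    using T by (auto simp: equivariant_homs_def)
  interpret module k V by (rule V)
  obtain l x where l: "l \<in> carrier k" and x: "x \<in> carrier V" "x \<noteq> \<zero>\<^bsub>V\<^esub>" "T x = l \<odot>\<^bsub>V\<^esub> x"
    using exists_eigenvector[OF k V(1) db irreducible_repD(2)[OF irr] T1] by blast
  define W where "W = {x \<in> carrier V. T x = l \<odot>\<^bsub>V\<^esub> x}"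
  have "T \<zero>\<^bsub>V\<^esub> = \<zero>\<^bsub>V\<^esub>"
    by (rule additive_zero[OF M.abelian_group_axioms M.abelian_group_axioms]) (use module_homsD[OF T1] in auto)
  then have "submodule W k V"
    by (intro submoduleI'[OF V(1)])
      (use l module_homsD[OF T1] in \<open>auto simp: W_def smult_r_distr smult_assoc1[symmetric] m_comm\<close>)
  moreover have "ract V g x \<in> W" if "g \<in> carrier G" "x \<in> W" for g x
    using that V T2 l by (auto simp: W_def)
  ultimately have "W = {\<zero>\<^bsub>V\<^esub>} \<or> W = carrier V"
    by (rule irreducible_repD(3)[OF irr])
  moreover have "x \<in> W" using x by (simp add: W_def)
  ultimately have "W = carrier V" using x by auto
  then show ?thesis using l by (auto simp: W_def)
qed

text \<open>Kernel and image are subrepresentations. A nonzero value makes the kernel zero and the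
  image everything, which would be an isomorphism.\<close>

lemma schur_zero:
  fixes V :: "('k, 'v, 'g) rep" and W :: "('k, 'w, 'g) rep"
  assumes V: "irreducible_rep k G V" and W: "irreducible_rep k G W" and noniso: "\<not> rep_isomorphic k G V W"
    and T: "T \<in> equivariant_homs k G V W" and x: "x \<in> carrier V"
  shows "T x = \<zero>\<^bsub>W\<^esub>"
proof (rule ccontr)
  assume nz: "T x \<noteq> \<zero>\<^bsub>W\<^esub>"
  note V' = representationD[OF irreducible_repD(1)[OF V]]
  note W' = representationD[OF irreducible_repD(1)[OF W]]
  interpret V: module k V by (rule V')
  interpret W: module k W by (rule W')
  have T1: "T \<in> module_homs k V W" and T2: "\<And>g v. \<lbrakk>g \<in> carrier G; v \<in> carrier V\<rbrakk> \<Longrightarrow> T (ract V g v) = ract W g (T v)"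
    using T by (auto simp: equivariant_homs_def)
  note T' = module_homsD[OF T1]
  have T0: "T \<zero>\<^bsub>V\<^esub> = \<zero>\<^bsub>W\<^esub>"
    by (rule additive_zero[OF V.M.abelian_group_axioms W.M.abelian_group_axioms]) (use T' in auto)
  define K where "K = {v \<in> carrier V. T v = \<zero>\<^bsub>W\<^esub>}"
  have W0: "ract W g \<zero>\<^bsub>W\<^esub> = \<zero>\<^bsub>W\<^esub>" if "g \<in> carrier G" for g
    by (rule additive_zero[OF W.M.abelian_group_axioms W.M.abelian_group_axioms]) (use W' that in auto)
  have "submodule K k V"
    by (intro submoduleI'[OF V'(1)]) (use T' T0 in \<open>auto simp: K_def\<close>)
  moreover have "ract V g v \<in> K" if "g \<in> carrier G" "v \<in> K" for g v
    using that V' T2 W0 by (auto simp: K_def)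
  ultimately have "K = {\<zero>\<^bsub>V\<^esub>} \<or> K = carrier V"
    by (rule irreducible_repD(3)[OF V])
  then have K: "K = {\<zero>\<^bsub>V\<^esub>}" using x nz by (auto simp: K_def)
  have "submodule (T ` carrier V) k W"
  proof (rule submoduleI'[OF W'(1)])
    show "\<zero>\<^bsub>W\<^esub> \<in> T ` carrier V" using T0 by (metis V.M.zero_closed image_eqI)
    show "a \<oplus>\<^bsub>W\<^esub> b \<in> T ` carrier V" if ab: "a \<in> T ` carrier V" "b \<in> T ` carrier V" for a b
    proof -
      from ab obtain v v' where "v \<in> carrier V" "v' \<in> carrier V" "a = T v" "b = T v'" by blast
      then show ?thesis by (intro image_eqI[of _ _ "v \<oplus>\<^bsub>V\<^esub> v'"]) (auto simp: T')
    qed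
    show "a \<odot>\<^bsub>W\<^esub> b \<in> T ` carrier V" if ab: "a \<in> carrier k" "b \<in> T ` carrier V" for a b
    proof -
      from ab obtain v where "v \<in> carrier V" "b = T v" by blast
      then show ?thesis using ab by (intro image_eqI[of _ _ "a \<odot>\<^bsub>V\<^esub> v"]) (auto simp: T')
    qed
  qed (use T' in auto)
  moreover have "ract W g y \<in> T ` carrier V" if "g \<in> carrier G" "y \<in> T ` carrier V" for g y
    using that V'(3) T2 by (metis (no_types, lifting) imageE image_eqI)
  ultimately have "T ` carrier V = {\<zero>\<^bsub>W\<^esub>} \<or> T ` carrier V = carrier W"
    by (rule irreducible_repD(3)[OF W])
  then have surj: "T ` carrier V = carrier W" using x nz by blast
  have "inj_on T (carrier V)"
  proof (rule inj_onI)
    fix a b assume ab: "a \<in> carrier V" "b \<in> carrier V" "T a = T b"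
    have "T (\<ominus>\<^bsub>V\<^esub> b) = \<ominus>\<^bsub>W\<^esub> T b"
      by (rule additive_minus[OF V.M.abelian_group_axioms W.M.abelian_group_axioms]) (use T' ab in auto)
    then have "a \<oplus>\<^bsub>V\<^esub> \<ominus>\<^bsub>V\<^esub> b \<in> K"
      using ab T' by (simp add: K_def W.M.r_neg)
    then show "a = b" using K ab by (simp add: V.M.add.inv_solve_right')
  qed
  with surj have "rep_isomorphic k G V W"
    unfolding rep_isomorphic_def bij_betw_def using T1 T2 by blast
  with noniso show False ..
qed

section \<open>The group algebra as operators, and irreducible subrepresentations\<close>

section \<open>The group algebra acting on representations\<close>

lemma (in group) finsum_translate_left:
  assumes "abelian_monoid M" "h \<in> carrier G" "f \<in> carrier G \<rightarrow> carrier M"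
  shows "(\<Oplus>\<^bsub>M\<^esub>g\<in>carrier G. f (h \<otimes> g)) = (\<Oplus>\<^bsub>M\<^esub>g\<in>carrier G. f g)"
proof -
  interpret M: abelian_monoid M by fact
  have "finsum M f ((\<lambda>g. h \<otimes> g) ` carrier G) = (\<Oplus>\<^bsub>M\<^esub>g\<in>carrier G. f (h \<otimes> g))"
    by (rule M.finsum_reindex) (use assms inj_on_cmult in \<open>auto simp: Pi_iff\<close>)
  then show ?thesis using assms(2) by (simp add: surj_const_mult)
qed

lemma (in group) finsum_translate_right:
  assumes "abelian_monoid M" "h \<in> carrier G" "f \<in> carrier G \<rightarrow> carrier M"
  shows "(\<Oplus>\<^bsub>M\<^esub>g\<in>carrier G. f (g \<otimes> h)) = (\<Oplus>\<^bsub>M\<^esub>g\<in>carrier G. f g)"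
proof -
  interpret M: abelian_monoid M by fact
  have "(\<lambda>g. g \<otimes> h) ` carrier G = carrier G"
  proof (intro equalityI subsetI)
    fix x assume "x \<in> carrier G"
    then show "x \<in> (\<lambda>g. g \<otimes> h) ` carrier G"
      using assms(2) by (intro image_eqI[of _ _ "x \<otimes> inv h"]) (auto simp: m_assoc)
  qed (use assms in auto)
  moreover have "finsum M f ((\<lambda>g. g \<otimes> h) ` carrier G) = (\<Oplus>\<^bsub>M\<^esub>g\<in>carrier G. f (g \<otimes> h))"
    by (rule M.finsum_reindex) (use assms inj_on_multc in \<open>auto simp: Pi_iff\<close>)
  ultimately show ?thesis by simp
qed

lemma submodule_finsum_closed:
  assumes "module R V" "submodule W R V" "x \<in> A \<rightarrow> W"
  shows "finsum V x A \<in> W"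
proof -
  interpret module R V by fact
  note W = submoduleE[OF assms(2)]
  have W0: "\<zero>\<^bsub>V\<^esub> \<in> W" using W(1,2,4) by (metis R.zero_closed all_not_in_conv smult_l_null subsetD)
  show ?thesis
    using assms(3)
  proof (induction A rule: infinite_finite_induct)
    case (insert a A)
    then have "finsum V x (insert a A) = x a \<oplus>\<^bsub>V\<^esub> finsum V x A"
      by (intro M.finsum_insert) (use W(1) in auto)
    with insert W(5) show ?case by auto
  qed (use W0 in auto)
qed

text \<open>A matrix coefficient of \<open>V\<close>. With the inverse, replacing \<open>v\<close>
  by its image under \<open>h\<close> amounts to left translation of the function by
  \<open>h\<close>, so that \<open>v\<close> is mapped equivariantly into the group algebra.\<close>

definition coef :: "('g, 'm) monoid_scheme \<Rightarrow> ('k, 'v, 'g) rep \<Rightarrow> ('v \<Rightarrow> 'k) \<Rightarrow> 'v \<Rightarrow> 'g \<Rightarrow> 'k" where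
  "coef G V f v g = f (ract V (inv\<^bsub>G\<^esub> g) v)"

locale fin_group_field = k: algebraically_closed k + G: group G
  for k :: "'k ring" and G :: "'g monoid" +
  assumes fin: "finite (carrier G)" and char: "\<not> ring_char k dvd order G"
begin

context
  fixes M :: "('k, 'm, 'g) rep"
  assumes M: "representation k G M"
begin

interpretation module k M by (rule representationD(1)[OF M])

lemmas rD = representationD[OF M]

lemma alg_act_closed:
  "\<lbrakk>\<And>g. g \<in> carrier G \<Longrightarrow> a g \<in> carrier k; x \<in> carrier M\<rbrakk> \<Longrightarrow> alg_act G M a x \<in> carrier M"
  unfolding alg_act_def by (rule M.finsum_closed) (use rD in auto)

lemma alg_act_cong:
  "\<lbrakk>\<And>g. g \<in> carrier G \<Longrightarrow> a g = b g; \<And>g. g \<in> carrier G \<Longrightarrow> b g \<in> carrier k; x \<in> carrier M\<rbrakk>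
    \<Longrightarrow> alg_act G M a x = alg_act G M b x"
  unfolding alg_act_def by (rule M.finsum_cong') (use rD in auto)

lemma alg_act_hom:
  assumes a: "\<And>g. g \<in> carrier G \<Longrightarrow> a g \<in> carrier k"
  shows "alg_act G M a \<in> module_homs k M M"
proof (rule module_homsI)
  fix x y assume xy: "x \<in> carrier M" "y \<in> carrier M"
  have "alg_act G M a (x \<oplus>\<^bsub>M\<^esub> y) = (\<Oplus>\<^bsub>M\<^esub>g\<in>carrier G. a g \<odot>\<^bsub>M\<^esub> ract M g x \<oplus>\<^bsub>M\<^esub> a g \<odot>\<^bsub>M\<^esub> ract M g y)"
    unfolding alg_act_def by (rule M.finsum_cong') (use a xy rD in \<open>auto simp: smult_r_distr\<close>)
  also have "\<dots> = alg_act G M a x \<oplus>\<^bsub>M\<^esub> alg_act G M a y"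
    unfolding alg_act_def by (rule M.finsum_addf) (use a xy rD in auto)
  finally show "alg_act G M a (x \<oplus>\<^bsub>M\<^esub> y) = alg_act G M a x \<oplus>\<^bsub>M\<^esub> alg_act G M a y" .
next
  fix c x assume cx: "c \<in> carrier k" "x \<in> carrier M"
  have "alg_act G M a (c \<odot>\<^bsub>M\<^esub> x) = (\<Oplus>\<^bsub>M\<^esub>g\<in>carrier G. c \<odot>\<^bsub>M\<^esub> (a g \<odot>\<^bsub>M\<^esub> ract M g x))"
    unfolding alg_act_def
    by (rule M.finsum_cong') (use a cx rD in \<open>auto simp: smult_assoc1[symmetric] k.m_comm\<close>)
  also have "\<dots> = c \<odot>\<^bsub>M\<^esub> alg_act G M a x"
    unfolding alg_act_def by (rule finsum_smult_ldistr[symmetric]) (use a cx rD fin in auto)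
  finally show "alg_act G M a (c \<odot>\<^bsub>M\<^esub> x) = c \<odot>\<^bsub>M\<^esub> alg_act G M a x" .
qed (use alg_act_closed a in blast)

lemma alg_act_smult_coeff:
  assumes a: "\<And>g. g \<in> carrier G \<Longrightarrow> a g \<in> carrier k" and c: "c \<in> carrier k" and x: "x \<in> carrier M"
  shows "alg_act G M (\<lambda>g. c \<otimes>\<^bsub>k\<^esub> a g) x = c \<odot>\<^bsub>M\<^esub> alg_act G M a x"
  unfolding alg_act_def by (rule lincomb_smult) (use a c x rD fin in auto)

lemma alg_act_add_coeff:
  assumes "\<And>g. g \<in> carrier G \<Longrightarrow> a g \<in> carrier k" "\<And>g. g \<in> carrier G \<Longrightarrow> b g \<in> carrier k" and "x \<in> carrier M"
  shows "alg_act G M (\<lambda>g. a g \<oplus>\<^bsub>k\<^esub> b g) x = alg_act G M a x \<oplus>\<^bsub>M\<^esub> alg_act G M b x"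
  unfolding alg_act_def by (rule lincomb_add) (use assms rD in auto)

lemma alg_act_finsum_coeff:
  assumes I: "finite I" and a: "\<And>i g. \<lbrakk>i \<in> I; g \<in> carrier G\<rbrakk> \<Longrightarrow> a i g \<in> carrier k" and x: "x \<in> carrier M"
  shows "alg_act G M (\<lambda>g. \<Oplus>\<^bsub>k\<^esub>i\<in>I. a i g) x = (\<Oplus>\<^bsub>M\<^esub>i\<in>I. alg_act G M (a i) x)"
proof -
  have "alg_act G M (\<lambda>g. \<Oplus>\<^bsub>k\<^esub>i\<in>I. a i g) x = (\<Oplus>\<^bsub>M\<^esub>g\<in>carrier G. \<Oplus>\<^bsub>M\<^esub>i\<in>I. a i g \<odot>\<^bsub>M\<^esub> ract M g x)"
    unfolding alg_act_def
    by (rule M.finsum_cong') (use a x rD in \<open>auto intro!: finsum_smult_rdistr M.finsum_closed\<close>)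
  also have "\<dots> = (\<Oplus>\<^bsub>M\<^esub>i\<in>I. alg_act G M (a i) x)"
    unfolding alg_act_def by (rule M.finsum_swap) (use I fin a x rD in auto)
  finally show ?thesis .
qed

text \<open>Reindexing the sum by left translation with \<open>h\<close> shifts the action of
  \<open>h\<close> to the coefficients.\<close>

lemma ract_alg_act:
  assumes a: "\<And>g. g \<in> carrier G \<Longrightarrow> a g \<in> carrier k" and h: "h \<in> carrier G" and x: "x \<in> carrier M"
  shows "ract M h (alg_act G M a x) = alg_act G M (\<lambda>g. a (inv\<^bsub>G\<^esub> h \<otimes>\<^bsub>G\<^esub> g)) x"
proof -
  have "ract M h (alg_act G M a x) = (\<Oplus>\<^bsub>M\<^esub>g\<in>carrier G. a g \<odot>\<^bsub>M\<^esub> ract M h (ract M g x))"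
    unfolding alg_act_def by (rule module_hom_lincomb[OF rD(1) rD(1)]) (use rD a h x in auto)
  also have "\<dots> = (\<Oplus>\<^bsub>M\<^esub>g\<in>carrier G. a (inv\<^bsub>G\<^esub> h \<otimes>\<^bsub>G\<^esub> (h \<otimes>\<^bsub>G\<^esub> g)) \<odot>\<^bsub>M\<^esub> ract M (h \<otimes>\<^bsub>G\<^esub> g) x)"
    by (rule M.finsum_cong') (use rD a h x in \<open>auto simp: G.m_assoc[symmetric]\<close>)
  also have "\<dots> = alg_act G M (\<lambda>g. a (inv\<^bsub>G\<^esub> h \<otimes>\<^bsub>G\<^esub> g)) x"
    unfolding alg_act_def
    by (rule G.finsum_translate_left[OF M.abelian_monoid_axioms h]) (use rD a h x in auto)
  finally show ?thesis .
qed

text \<open>The same reindexing on the other side, by right translation.\<close>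

lemma alg_act_ract:
  assumes a: "\<And>g. g \<in> carrier G \<Longrightarrow> a g \<in> carrier k" and h: "h \<in> carrier G" and x: "x \<in> carrier M"
  shows "alg_act G M a (ract M h x) = alg_act G M (\<lambda>g. a (g \<otimes>\<^bsub>G\<^esub> inv\<^bsub>G\<^esub> h)) x"
proof -
  have "alg_act G M a (ract M h x) = (\<Oplus>\<^bsub>M\<^esub>g\<in>carrier G. a (g \<otimes>\<^bsub>G\<^esub> h \<otimes>\<^bsub>G\<^esub> inv\<^bsub>G\<^esub> h) \<odot>\<^bsub>M\<^esub> ract M (g \<otimes>\<^bsub>G\<^esub> h) x)"
    unfolding alg_act_def by (rule M.finsum_cong') (use rD a h x in \<open>auto simp: G.m_assoc\<close>)
  also have "\<dots> = alg_act G M (\<lambda>g. a (g \<otimes>\<^bsub>G\<^esub> inv\<^bsub>G\<^esub> h)) x"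
    unfolding alg_act_def
    by (rule G.finsum_translate_right[OF M.abelian_monoid_axioms h]) (use rD a h x in auto)
  finally show ?thesis .
qed

text \<open>Each \<open>h\<close> translates the coefficients of \<open>b\<close>; weighting by
  \<open>a h\<close> and summing over \<open>h\<close> produces the convolution.\<close>

lemma alg_act_group_algebra_mult:
  assumes a: "a \<in> carrier (group_algebra k G)" and b: "b \<in> carrier (group_algebra k G)" and x: "x \<in> carrier M"
  shows "alg_act G M (a \<otimes>\<^bsub>group_algebra k G\<^esub> b) x = alg_act G M a (alg_act G M b x)"
proof -
  have ab: "\<And>g. g \<in> carrier G \<Longrightarrow> a g \<in> carrier k" "\<And>g. g \<in> carrier G \<Longrightarrow> b g \<in> carrier k"
    using a b by (auto simp: group_algebra_def)
  have "alg_act G M a (alg_act G M b x) = (\<Oplus>\<^bsub>M\<^esub>h\<in>carrier G. alg_act G M (\<lambda>g. a h \<otimes>\<^bsub>k\<^esub> b (inv\<^bsub>G\<^esub> h \<otimes>\<^bsub>G\<^esub> g)) x)"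
    unfolding alg_act_def[of _ _ a]
  proof (rule M.finsum_cong')
    fix h assume h: "h \<in> carrier G"
    show "a h \<odot>\<^bsub>M\<^esub> ract M h (alg_act G M b x) = alg_act G M (\<lambda>g. a h \<otimes>\<^bsub>k\<^esub> b (inv\<^bsub>G\<^esub> h \<otimes>\<^bsub>G\<^esub> g)) x"
      using ract_alg_act[of b h x] alg_act_smult_coeff[of "\<lambda>g. b (inv\<^bsub>G\<^esub> h \<otimes>\<^bsub>G\<^esub> g)" "a h" x] ab h x by simp
  qed (use ab x in \<open>auto intro!: alg_act_closed\<close>)
  also have "\<dots> = alg_act G M (\<lambda>g. \<Oplus>\<^bsub>k\<^esub>h\<in>carrier G. a h \<otimes>\<^bsub>k\<^esub> b (inv\<^bsub>G\<^esub> h \<otimes>\<^bsub>G\<^esub> g)) x"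
    by (rule alg_act_finsum_coeff[symmetric]) (use ab x fin in auto)
  also have "\<dots> = alg_act G M (a \<otimes>\<^bsub>group_algebra k G\<^esub> b) x"
    by (rule alg_act_cong[symmetric])
      (use ab x in \<open>auto simp: group_algebra_def intro!: k.finsum_closed\<close>)
  finally show ?thesis by simp
qed

end

lemma equivariant_hom_alg_act:
  assumes V: "representation k G V" and W: "representation k G W" and f: "f \<in> equivariant_homs k G V W"
    and a: "\<And>g. g \<in> carrier G \<Longrightarrow> a g \<in> carrier k" and x: "x \<in> carrier V"
  shows "f (alg_act G V a x) = alg_act G W a (f x)"
proof -
  note V' = representationD[OF V] and W' = representationD[OF W]
  interpret W: module k W by (rule W')
  have f1: "f \<in> module_homs k V W" and f2: "\<And>g v. \<lbrakk>g \<in> carrier G; v \<in> carrier V\<rbrakk> \<Longrightarrow> f (ract V g v) = ract W g (f v)"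
    using f by (auto simp: equivariant_homs_def)
  have "f (alg_act G V a x) = (\<Oplus>\<^bsub>W\<^esub>g\<in>carrier G. a g \<odot>\<^bsub>W\<^esub> f (ract V g x))"
    unfolding alg_act_def by (rule module_hom_lincomb[OF V'(1) W'(1) f1]) (use V' a x in auto)
  also have "\<dots> = alg_act G W a (f x)"
    unfolding alg_act_def by (rule W.M.finsum_cong') (use V' W' a x f2 module_homsD[OF f1] in auto)
  finally show ?thesis .
qed

lemma alg_act_delta:
  assumes M: "representation k G M" and x: "x \<in> carrier M"
  shows "alg_act G M (\<lambda>g. if g = \<one>\<^bsub>G\<^esub> then \<one>\<^bsub>k\<^esub> else \<zero>\<^bsub>k\<^esub>) x = x"
proof -
  note M' = representationD[OF M]
  interpret module k M by (rule M')
  have "alg_act G M (\<lambda>g. if g = \<one>\<^bsub>G\<^esub> then \<one>\<^bsub>k\<^esub> else \<zero>\<^bsub>k\<^esub>) x = (\<Oplus>\<^bsub>M\<^esub>g\<in>carrier G. if g = \<one>\<^bsub>G\<^esub> then x else \<zero>\<^bsub>M\<^esub>)"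
    unfolding alg_act_def by (rule M.finsum_cong') (use M' x in auto)
  also have "\<dots> = x" by (rule M.finsum_delta) (use fin x in auto)
  finally show ?thesis .
qed

lemma coef_closed:
  assumes "representation k G V" "f \<in> module_homs k V (ring_module k)" "v \<in> carrier V" "g \<in> carrier G"
  shows "coef G V f v g \<in> carrier k"
  using module_homsD(1)[OF assms(2)] representationD(3)[OF assms(1)] assms by (auto simp: coef_def)

text \<open>The coefficient function of a translated vector is the left translate of the coefficient
  function. Each vector \<open>x\<close> of an arbitrary representation thus yields an equivariant
  map on \<open>V\<close>; these are the maps to which Schur's lemma is applied.\<close>

lemma alg_act_coef_equivariant:
  assumes V: "representation k G V" and f: "f \<in> module_homs k V (ring_module k)"
    and M: "representation k G M" and x: "x \<in> carrier M"
  shows "(\<lambda>v. alg_act G M (coef G V f v) x) \<in> equivariant_homs k G V M"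
proof -
  note V' = representationD[OF V] and f' = module_homsD[OF f]
  show ?thesis
    unfolding equivariant_homs_def
  proof (intro CollectI conjI ballI module_homsI)
    fix v assume v: "v \<in> carrier V"
    then show "alg_act G M (coef G V f v) x \<in> carrier M"
      using coef_closed[OF V f] x by (intro alg_act_closed[OF M]) auto
    fix h assume h: "h \<in> carrier G"
    have "ract M h (alg_act G M (coef G V f v) x) = alg_act G M (\<lambda>g. coef G V f v (inv\<^bsub>G\<^esub> h \<otimes>\<^bsub>G\<^esub> g)) x"
      by (rule ract_alg_act[OF M]) (use coef_closed[OF V f] v h x in auto)
    also have "\<dots> = alg_act G M (coef G V f (ract V h v)) x"
      by (rule alg_act_cong[OF M])
        (use f'(1) V' v h x in \<open>auto simp: coef_def G.inv_mult_group\<close>)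
    finally show "alg_act G M (coef G V f (ract V h v)) x = ract M h (alg_act G M (coef G V f v) x)" by simp
  next
    fix v v' assume v: "v \<in> carrier V" "v' \<in> carrier V"
    have "alg_act G M (coef G V f (v \<oplus>\<^bsub>V\<^esub> v')) x = alg_act G M (\<lambda>g. coef G V f v g \<oplus>\<^bsub>k\<^esub> coef G V f v' g) x"
      by (rule alg_act_cong[OF M]) (use V' f' v x in \<open>auto simp: coef_def\<close>)
    also have "\<dots> = alg_act G M (coef G V f v) x \<oplus>\<^bsub>M\<^esub> alg_act G M (coef G V f v') x"
      by (rule alg_act_add_coeff[OF M]) (use coef_closed[OF V f] v x in auto)
    finally show "alg_act G M (coef G V f (v \<oplus>\<^bsub>V\<^esub> v')) x = \<dots>" .
  next
    fix c v assume v: "c \<in> carrier k" "v \<in> carrier V"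
    have "alg_act G M (coef G V f (c \<odot>\<^bsub>V\<^esub> v)) x = alg_act G M (\<lambda>g. c \<otimes>\<^bsub>k\<^esub> coef G V f v g) x"
      by (rule alg_act_cong[OF M]) (use V' f' v x in \<open>auto simp: coef_def\<close>)
    also have "\<dots> = c \<odot>\<^bsub>M\<^esub> alg_act G M (coef G V f v) x"
      by (rule alg_act_smult_coeff[OF M]) (use coef_closed[OF V f] v x in auto)
    finally show "alg_act G M (coef G V f (c \<odot>\<^bsub>V\<^esub> v)) x = \<dots>" .
  qed
qed

text \<open>The orbit of a nonzero vector spans a subrepresentation, hence all of \<open>V\<close>.
  The basis is extracted from this orbit, which is why group elements can serve as indices.\<close>

lemma irreducible_dual_basis:
  assumes irr: "irreducible_rep k G V"
  shows "\<exists>(J :: 'g set) w \<gamma>. dual_basis k V J w \<gamma>"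
proof -
  have V: "representation k G V" by (rule irreducible_repD(1)[OF irr])
  note V' = representationD[OF V]
  interpret module k V by (rule V')
  obtain v where v: "v \<in> carrier V" "v \<noteq> \<zero>\<^bsub>V\<^esub>"
    using irreducible_repD(2)[OF irr] M.zero_closed by blast
  define W where "W = {alg_act G V a v |a. \<forall>g\<in>carrier G. a g \<in> carrier k}"
  have "submodule W k V"
  proof (rule submoduleI'[OF V'(1)])
    show "W \<subseteq> carrier V" using v alg_act_closed[OF V] by (auto simp: W_def)
    have "alg_act G V (\<lambda>_. \<zero>\<^bsub>k\<^esub>) v = (\<Oplus>\<^bsub>V\<^esub>g\<in>carrier G. \<zero>\<^bsub>V\<^esub>)"
      unfolding alg_act_def by (rule M.finsum_cong') (use V' v in auto)
    then have "\<zero>\<^bsub>V\<^esub> = alg_act G V (\<lambda>_. \<zero>\<^bsub>k\<^esub>) v" by simp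
    then show "\<zero>\<^bsub>V\<^esub> \<in> W" unfolding W_def by blast
  next
    fix x y assume "x \<in> W" "y \<in> W"
    then obtain a b where ab: "\<forall>g\<in>carrier G. a g \<in> carrier k" "\<forall>g\<in>carrier G. b g \<in> carrier k"
        "x = alg_act G V a v" "y = alg_act G V b v" by (auto simp: W_def)
    then have "x \<oplus>\<^bsub>V\<^esub> y = alg_act G V (\<lambda>g. a g \<oplus>\<^bsub>k\<^esub> b g) v"
      using v by (simp add: alg_act_add_coeff[OF V])
    then show "x \<oplus>\<^bsub>V\<^esub> y \<in> W"
      unfolding W_def using ab by blast
  next
    fix c x assume "c \<in> carrier k" "x \<in> W"
    then obtain a where a: "\<forall>g\<in>carrier G. a g \<in> carrier k" "x = alg_act G V a v" by (auto simp: W_def)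
    then have "c \<odot>\<^bsub>V\<^esub> x = alg_act G V (\<lambda>g. c \<otimes>\<^bsub>k\<^esub> a g) v"
      using v \<open>c \<in> carrier k\<close> by (simp add: alg_act_smult_coeff[OF V])
    then show "c \<odot>\<^bsub>V\<^esub> x \<in> W"
      unfolding W_def using a \<open>c \<in> carrier k\<close> by blast
  qed
  moreover have "ract V h x \<in> W" if h: "h \<in> carrier G" and "x \<in> W" for h x
  proof -
    from \<open>x \<in> W\<close> obtain a where a: "\<forall>g\<in>carrier G. a g \<in> carrier k" "x = alg_act G V a v" by (auto simp: W_def)
    have "ract V h x = alg_act G V (\<lambda>g. a (inv\<^bsub>G\<^esub> h \<otimes>\<^bsub>G\<^esub> g)) v"
      unfolding a(2) by (rule ract_alg_act[OF V]) (use a h v in auto)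
    then show ?thesis
      unfolding W_def using a h by blast
  qed
  ultimately have "W = {\<zero>\<^bsub>V\<^esub>} \<or> W = carrier V"
    by (rule irreducible_repD(3)[OF irr])
  \<comment> \<open>\<open>v\<close> itself is obtained from the identity of the group
    algebra.\<close>
  moreover have "v \<in> W"
  proof -
    let ?d = "\<lambda>g. if g = \<one>\<^bsub>G\<^esub> then \<one>\<^bsub>k\<^esub> else \<zero>\<^bsub>k\<^esub>"
    have "v = alg_act G V ?d v" by (rule alg_act_delta[OF V v(1), symmetric])
    then show ?thesis unfolding W_def by force
  qed
  ultimately have W: "W = carrier V" using v by blast
  obtain J \<gamma> where "dual_basis k V J (\<lambda>g. ract V g v) \<gamma>"
  proof (rule finite_spanning_imp_dual_basis[OF k.field_axioms V'(1) fin, of "\<lambda>g. ract V g v"])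
    show "\<exists>c\<in>carrier G \<rightarrow> carrier k. x = (\<Oplus>\<^bsub>V\<^esub>g\<in>carrier G. c g \<odot>\<^bsub>V\<^esub> ract V g v)" if "x \<in> carrier V" for x
      using that unfolding W[symmetric] W_def alg_act_def by blast
  qed (use V' v in auto)
  then show ?thesis by blast
qed

text \<open>Without a minimal nonzero subrepresentation inside \<open>L\<close> there would be an
  infinite strictly decreasing chain \<open>F\<close>. Vectors of \<open>F n\<close> outside
  \<open>F (Suc n)\<close> would be independent, against finite dimension.\<close>

lemma exists_irreducible_subrep:
  assumes M: "representation k G M" and db: "dual_basis k M J w \<gamma>"
    and L: "submodule L k M" "\<And>g x. \<lbrakk>g \<in> carrier G; x \<in> L\<rbrakk> \<Longrightarrow> ract M g x \<in> L" "L \<noteq> {\<zero>\<^bsub>M\<^esub>}"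
  shows "\<exists>W\<subseteq>L. irreducible_rep k G (M\<lparr>carrier := W\<rparr>) \<and> W \<subseteq> carrier M"
proof -
  note M' = representationD[OF M]
  interpret module k M by (rule M')
  define P where "P W \<longleftrightarrow> submodule W k M \<and> (\<forall>g\<in>carrier G. ract M g ` W \<subseteq> W) \<and> W \<noteq> {\<zero>\<^bsub>M\<^esub>} \<and> W \<subseteq> L" for W
  have PL: "P L" using L by (auto simp: P_def)
  have "\<exists>W. P W \<and> (\<forall>W'. P W' \<longrightarrow> \<not> W' \<subset> W)"
  proof (rule ccontr)
    assume "\<not> ?thesis"
    then have desc: "\<exists>W'. P W' \<and> W' \<subset> W" if "P W" for W using that by blast
    have "\<exists>F. \<forall>n. P (F n) \<and> F (Suc n) \<subset> F n"
    proof (rule dependent_nat_choice)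
      show "\<exists>W. P W" using PL by (rule exI)
    qed (rule desc)
    then obtain F where F': "\<forall>n. P (F n) \<and> F (Suc n) \<subset> F n" by (rule exE)
    have F: "P (F n)" "F (Suc n) \<subset> F n" for n using F' by simp_all
    have "\<exists>x. x \<in> F n \<and> x \<notin> F (Suc n)" for n using psubset_imp_ex_mem[OF F(2)[of n]] by simp
    then obtain x where x: "\<And>n. x n \<in> F n" "\<And>n. x n \<notin> F (Suc n)" by metis
    have sub: "submodule (F n) k M" for n using F by (auto simp: P_def)
    have xM: "x n \<in> carrier M" for n using x(1)[of n] submoduleE(1)[OF sub[of n]] by blast
    have mono: "F n \<subseteq> F m" if "m \<le> n" for m n
      using that by (induction rule: dec_induct) (use F(2) in blast)+
    let ?N = "card J"
    obtain c where c: "c \<in> {..?N} \<rightarrow> carrier k" "\<exists>s\<in>{..?N}. c s \<noteq> \<zero>\<^bsub>k\<^esub>" "(\<Oplus>\<^bsub>M\<^esub>s\<in>{..?N}. c s \<odot>\<^bsub>M\<^esub> x s) = \<zero>\<^bsub>M\<^esub>"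
      by (rule dual_basis_dependent[OF k.field_axioms M'(1) db, of "{..?N}" x]) (use xM in auto)
    \<comment> \<open>With \<open>j\<close> the first index of a nonzero coefficient, the relation
      expresses \<open>x j\<close> by vectors of \<open>F (Suc j)\<close>, contrary to its
      choice.\<close>
    define j where "j = (LEAST j. j \<le> ?N \<and> c j \<noteq> \<zero>\<^bsub>k\<^esub>)"
    have "\<exists>j. j \<le> ?N \<and> c j \<noteq> \<zero>\<^bsub>k\<^esub>" using c(2) by auto
    then have "j \<le> ?N \<and> c j \<noteq> \<zero>\<^bsub>k\<^esub>" unfolding j_def by (rule LeastI_ex)
    then have j: "j \<le> ?N" "c j \<noteq> \<zero>\<^bsub>k\<^esub>" by blast+
    have below: "c i = \<zero>\<^bsub>k\<^esub>" if "i < j" for i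
      using not_less_Least[OF that[unfolded j_def]] less_imp_le[OF less_le_trans[OF that j(1)]] by blast
    define t where "t = (\<Oplus>\<^bsub>M\<^esub>s\<in>{j<..?N}. c s \<odot>\<^bsub>M\<^esub> x s)"
    have cs: "c s \<in> carrier k" if "s \<le> ?N" for s using c(1) that by auto
    have "t \<in> F (Suc j)"
      unfolding t_def
    proof (rule submodule_finsum_closed[OF M'(1) sub])
      show "(\<lambda>s. c s \<odot>\<^bsub>M\<^esub> x s) \<in> {j<..?N} \<rightarrow> F (Suc j)"
      proof
        fix s assume s: "s \<in> {j<..?N}"
        then have "x s \<in> F (Suc j)" using x(1)[of s] mono[of "Suc j" s] by auto
        then show "c s \<odot>\<^bsub>M\<^esub> x s \<in> F (Suc j)" using s by (intro submoduleE(4)[OF sub] cs) auto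
      qed
    qed
    then have t: "t \<in> carrier M" "\<ominus>\<^bsub>M\<^esub> t \<in> F (Suc j)"
      using submoduleE(1,3)[OF sub] by blast+
    have "(\<Oplus>\<^bsub>M\<^esub>s\<in>insert j {j<..?N}. c s \<odot>\<^bsub>M\<^esub> x s) = (\<Oplus>\<^bsub>M\<^esub>s\<in>{..?N}. c s \<odot>\<^bsub>M\<^esub> x s)"
      by (rule M.add.finprod_mono_neutral_cong_left) (use j below cs xM in \<open>auto simp: not_less_iff_gr_or_eq\<close>)
    moreover have "(\<Oplus>\<^bsub>M\<^esub>s\<in>insert j {j<..?N}. c s \<odot>\<^bsub>M\<^esub> x s) = c j \<odot>\<^bsub>M\<^esub> x j \<oplus>\<^bsub>M\<^esub> t"
      unfolding t_def by (rule M.finsum_insert) (use j cs xM in auto)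
    ultimately have "c j \<odot>\<^bsub>M\<^esub> x j \<oplus>\<^bsub>M\<^esub> t = \<zero>\<^bsub>M\<^esub>" using c(3) by simp
    then have "c j \<odot>\<^bsub>M\<^esub> x j = \<ominus>\<^bsub>M\<^esub> t"
      using M.minus_equality[of "c j \<odot>\<^bsub>M\<^esub> x j" t] t cs j xM by simp
    moreover have u: "c j \<in> Units k" using j cs by (auto simp: k.field_Units)
    then have "inv\<^bsub>k\<^esub> (c j) \<odot>\<^bsub>M\<^esub> (c j \<odot>\<^bsub>M\<^esub> x j) = x j"
      using xM cs j by (simp add: smult_assoc1[symmetric])
    moreover have "inv\<^bsub>k\<^esub> (c j) \<odot>\<^bsub>M\<^esub> (\<ominus>\<^bsub>M\<^esub> t) \<in> F (Suc j)"
      using submoduleE(4)[OF sub] u t(2) by blast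
    ultimately show False using x(2)[of j] by simp
  qed
  then obtain W where W: "P W" "\<And>W'. P W' \<Longrightarrow> \<not> W' \<subset> W" by blast
  have subW: "submodule W k M" and stable: "\<And>g x. \<lbrakk>g \<in> carrier G; x \<in> W\<rbrakk> \<Longrightarrow> ract M g x \<in> W"
    and WL: "W \<subseteq> L" "W \<noteq> {\<zero>\<^bsub>M\<^esub>}" using W(1) by (auto simp: P_def)
  have WM: "W \<subseteq> carrier M" using submoduleE(1)[OF subW] .
  have modW: "module k (M\<lparr>carrier := W\<rparr>)"
    by (rule submodule.submodule_is_module[OF subW M'(1)])
  have "representation k G (M\<lparr>carrier := W\<rparr>)"
    unfolding representation_def
  proof (intro conjI ballI)
    fix g assume "g \<in> carrier G"
    then show "ract (M\<lparr>carrier := W\<rparr>) g \<in> module_homs k (M\<lparr>carrier := W\<rparr>) (M\<lparr>carrier := W\<rparr>)"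
      using M' stable by (intro module_homsI) (auto simp: subsetD[OF WM])
  qed (use modW M' in \<open>auto simp: subsetD[OF WM]\<close>)
  \<comment> \<open>A subrepresentation of \<open>W\<close> is one of \<open>M\<close> inside
    \<open>L\<close>, so minimality of \<open>W\<close> applies to it.\<close>
  moreover have "W' = {\<zero>\<^bsub>M\<^esub>} \<or> W' = W"
    if W': "submodule W' k (M\<lparr>carrier := W\<rparr>)" "\<forall>g\<in>carrier G. ract M g ` W' \<subseteq> W'" for W'
  proof -
    note W'' = module.submoduleE[OF modW W'(1)]
    have "\<zero>\<^bsub>M\<^esub> \<in> W'"
      using W'(1) unfolding submodule_def subgroup_def by simp
    then have "submodule W' k M"
      using W'' WM by (intro submoduleI'[OF M'(1)]) auto
    moreover have "W' \<subseteq> W" using W''(1) by simp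
    ultimately have "W' = W" if "W' \<noteq> {\<zero>\<^bsub>M\<^esub>}"
      using that W(2)[of W'] W'(2) WL(1) unfolding P_def by blast
    then show ?thesis by blast
  qed
  ultimately have "irreducible_rep k G (M\<lparr>carrier := W\<rparr>)"
    using WL by (auto simp: irreducible_rep_def)
  then show ?thesis using WL WM by blast
qed

text \<open>The left regular representation. Its vectors have the type for which
  \<open>irreducibles\<close> states completeness, and its carrier is also that of the group
  algebra.\<close>

definition regular_rep :: "('k, 'g \<Rightarrow> 'k, 'g) rep" where
  "regular_rep =
     \<lparr>carrier = carrier G \<rightarrow>\<^sub>E carrier k, monoid.mult = undefined, monoid.one = undefined,
      ring.zero = (\<lambda>g\<in>carrier G. \<zero>\<^bsub>k\<^esub>),
      ring.add = (\<lambda>a b. \<lambda>g\<in>carrier G. a g \<oplus>\<^bsub>k\<^esub> b g),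
      module.smult = (\<lambda>c a. \<lambda>g\<in>carrier G. c \<otimes>\<^bsub>k\<^esub> a g),
      ract = (\<lambda>h a. \<lambda>g\<in>carrier G. a (inv\<^bsub>G\<^esub> h \<otimes>\<^bsub>G\<^esub> g))\<rparr>"

lemma regular_rep_simps [simp]:
  "carrier regular_rep = carrier G \<rightarrow>\<^sub>E carrier k"
  "\<zero>\<^bsub>regular_rep\<^esub> = (\<lambda>g\<in>carrier G. \<zero>\<^bsub>k\<^esub>)"
  "a \<oplus>\<^bsub>regular_rep\<^esub> b = (\<lambda>g\<in>carrier G. a g \<oplus>\<^bsub>k\<^esub> b g)"
  "c \<odot>\<^bsub>regular_rep\<^esub> a = (\<lambda>g\<in>carrier G. c \<otimes>\<^bsub>k\<^esub> a g)"
  "ract regular_rep h a = (\<lambda>g\<in>carrier G. a (inv\<^bsub>G\<^esub> h \<otimes>\<^bsub>G\<^esub> g))"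
  by (simp_all add: regular_rep_def)

lemma module_regular_rep: "module k regular_rep"
proof (rule moduleI)
  show "abelian_group regular_rep"
  proof (rule abelian_groupI)
    fix a assume "a \<in> carrier regular_rep"
    then have "(\<lambda>g\<in>carrier G. \<ominus>\<^bsub>k\<^esub> a g) \<in> carrier regular_rep"
      "(\<lambda>g\<in>carrier G. \<ominus>\<^bsub>k\<^esub> a g) \<oplus>\<^bsub>regular_rep\<^esub> a = \<zero>\<^bsub>regular_rep\<^esub>"
      by (auto simp: PiE_iff k.l_neg)
    then show "\<exists>b\<in>carrier regular_rep. b \<oplus>\<^bsub>regular_rep\<^esub> a = \<zero>\<^bsub>regular_rep\<^esub>" by blast
  qed (auto simp: PiE_iff k.a_ac intro!: restrict_ext extensionalityI[of _ "carrier G"])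
qed (auto simp: PiE_iff k.l_distr k.r_distr k.m_assoc k.is_cring
       intro!: restrict_ext extensionalityI[of _ "carrier G"])

lemma representation_regular_rep: "representation k G regular_rep"
  unfolding representation_def
proof (intro conjI ballI)
  fix g assume "g \<in> carrier G"
  then show "ract regular_rep g \<in> module_homs k regular_rep regular_rep"
    by (intro module_homsI) (auto simp: PiE_iff)
qed (auto simp: module_regular_rep PiE_iff G.inv_mult_group G.m_assoc
      intro!: restrict_ext extensionalityI[of _ "carrier G"])

lemma regular_rep_dual_basis:
  "dual_basis k regular_rep (carrier G) (\<lambda>h. \<lambda>g\<in>carrier G. if h = g then \<one>\<^bsub>k\<^esub> else \<zero>\<^bsub>k\<^esub>) (\<lambda>h a. a h)"
proof -
  interpret M: module k regular_rep by (rule module_regular_rep)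
  have coord: "(\<lambda>a. a g) \<in> module_homs k regular_rep (ring_module k)" if "g \<in> carrier G" for g
    using that by (intro module_homsI) (auto simp: PiE_iff)
  show ?thesis
    unfolding dual_basis_def
  proof (intro conjI ballI)
    fix a assume a: "a \<in> carrier regular_rep"
    let ?w = "\<lambda>h. \<lambda>g\<in>carrier G. if h = g then \<one>\<^bsub>k\<^esub> else \<zero>\<^bsub>k\<^esub>"
    have w: "?w \<in> carrier G \<rightarrow> carrier regular_rep" by auto
    have "(\<Oplus>\<^bsub>regular_rep\<^esub>h\<in>carrier G. a h \<odot>\<^bsub>regular_rep\<^esub> ?w h) \<in> carrier regular_rep"
      by (rule M.lincomb_closed) (use a w in \<open>auto simp: PiE_iff\<close>)
    moreover have "(\<Oplus>\<^bsub>regular_rep\<^esub>h\<in>carrier G. a h \<odot>\<^bsub>regular_rep\<^esub> ?w h) g = a g" if g: "g \<in> carrier G" for g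
    proof -
      have "(\<Oplus>\<^bsub>regular_rep\<^esub>h\<in>carrier G. a h \<odot>\<^bsub>regular_rep\<^esub> ?w h) g
          = (\<Oplus>\<^bsub>ring_module k\<^esub>h\<in>carrier G. a h \<odot>\<^bsub>ring_module k\<^esub> ?w h g)"
        by (rule module_hom_lincomb[OF module_regular_rep module_ring_module[OF k.is_cring] coord[OF g]])
          (use a w in \<open>auto simp: PiE_iff\<close>)
      also have "\<dots> = (\<Oplus>\<^bsub>k\<^esub>h\<in>carrier G. if h = g then a g else \<zero>\<^bsub>k\<^esub>)"
        unfolding finsum_ring_module by (rule k.finsum_cong') (use a g in \<open>auto simp: PiE_iff\<close>)
      also have "\<dots> = a g" by (rule k.finsum_delta) (use fin a g in \<open>auto simp: PiE_iff\<close>)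
      finally show ?thesis .
    qed
    ultimately show "a = (\<Oplus>\<^bsub>regular_rep\<^esub>h\<in>carrier G. a h \<odot>\<^bsub>regular_rep\<^esub> ?w h)"
      using a by (intro PiE_ext[of a "carrier G" "\<lambda>_. carrier k"]) auto
  qed (use fin coord in auto)
qed

text \<open>Left translation by \<open>h\<close> moves the delta function of the identity to that of
  \<open>h\<close>, so the result is the expansion of \<open>a\<close> in delta functions. An
  element of the group algebra is thereby recovered from its action.\<close>

lemma alg_act_regular_one:
  assumes a: "a \<in> carrier G \<rightarrow>\<^sub>E carrier k"
  shows "alg_act G regular_rep a (\<lambda>g\<in>carrier G. if g = \<one>\<^bsub>G\<^esub> then \<one>\<^bsub>k\<^esub> else \<zero>\<^bsub>k\<^esub>) = a"
proof -
  interpret M: module k regular_rep by (rule module_regular_rep)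
  let ?w = "\<lambda>h. \<lambda>g\<in>carrier G. if h = g then \<one>\<^bsub>k\<^esub> else \<zero>\<^bsub>k\<^esub>"
  have "ract regular_rep h (\<lambda>g\<in>carrier G. if g = \<one>\<^bsub>G\<^esub> then \<one>\<^bsub>k\<^esub> else \<zero>\<^bsub>k\<^esub>) = ?w h" if h: "h \<in> carrier G" for h
    using h by (auto intro!: restrict_ext simp: G.inv_solve_left')
  then have "alg_act G regular_rep a (\<lambda>g\<in>carrier G. if g = \<one>\<^bsub>G\<^esub> then \<one>\<^bsub>k\<^esub> else \<zero>\<^bsub>k\<^esub>)
    = (\<Oplus>\<^bsub>regular_rep\<^esub>h\<in>carrier G. a h \<odot>\<^bsub>regular_rep\<^esub> ?w h)"
    unfolding alg_act_def by (intro M.M.finsum_cong') (use a in \<open>auto simp: PiE_iff\<close>)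
  also have "\<dots> = a"
    by (rule dual_basis_expand[OF regular_rep_dual_basis, symmetric]) (use a in simp)
  finally show ?thesis .
qed

end

section \<open>Matrix units of the irreducible representations\<close>

section \<open>Matrix units in the group algebra\<close>

text \<open>The inclusion of the smaller carrier is additive.\<close>

lemma finsum_carrier_update:
  assumes "abelian_group M" "abelian_group (M\<lparr>carrier := W\<rparr>)" "W \<subseteq> carrier M" "f \<in> A \<rightarrow> W"
  shows "finsum (M\<lparr>carrier := W\<rparr>) f A = finsum M f A"
  using hom_finsum_additive(2)[OF assms(2,1), of "\<lambda>x. x" f A] assms(3,4) by auto

locale irr_system = fin_group_field k G
  for k :: "'k ring" and G :: "'g monoid" +
  fixes r :: nat and V :: "nat \<Rightarrow> ('k, 'v, 'g) rep"
    and J :: "nat \<Rightarrow> 'i set" and w :: "nat \<Rightarrow> 'i \<Rightarrow> 'v" and \<gamma> :: "nat \<Rightarrow> 'i \<Rightarrow> 'v \<Rightarrow> 'k"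
  assumes irr: "irreducibles k G r V"
    and db: "i \<le> r \<Longrightarrow> dual_basis k (V i) (J i) (w i) (\<gamma> i)"
begin

lemma irreducible_V: "i \<le> r \<Longrightarrow> irreducible_rep k G (V i)"
  using irr by (simp add: irreducibles_def)

lemma representation_V: "i \<le> r \<Longrightarrow> representation k G (V i)"
  by (rule irreducible_repD(1)[OF irreducible_V])

text \<open>The cardinality as an element of \<open>k\<close>, written as a sum so that
  distributivity turns products with it into sums over the set.\<close>

abbreviation card_k :: "'x set \<Rightarrow> 'k" where
  "card_k A \<equiv> \<Oplus>\<^bsub>k\<^esub>_\<in>A. \<one>\<^bsub>k\<^esub>"

text \<open>Let \<open>p\<close> be the least positive number that is zero in \<open>k\<close>. If
  the group order were zero in \<open>k\<close>, so would be its remainder modulo \<open>p\<close>;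
  by minimality the remainder vanishes, and the characteristic would divide the order.\<close>

lemma card_k_group: "card_k (carrier G) \<in> Units k"
proof -
  have "card_k (carrier G) = [(order G)] \<cdot>\<^bsub>k\<^esub> \<one>\<^bsub>k\<^esub>"
    using k.add.finprod_const[of "\<one>\<^bsub>k\<^esub>" "carrier G"] by (simp add: order_def)
  moreover have "[(order G)] \<cdot>\<^bsub>k\<^esub> \<one>\<^bsub>k\<^esub> \<noteq> \<zero>\<^bsub>k\<^esub>"
  proof
    assume zero: "[(order G)] \<cdot>\<^bsub>k\<^esub> \<one>\<^bsub>k\<^esub> = \<zero>\<^bsub>k\<^esub>"
    define p where "p = (LEAST n::nat. 0 < n \<and> [n] \<cdot>\<^bsub>k\<^esub> \<one>\<^bsub>k\<^esub> = \<zero>\<^bsub>k\<^esub>)"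
    have ex: "\<exists>n::nat. 0 < n \<and> [n] \<cdot>\<^bsub>k\<^esub> \<one>\<^bsub>k\<^esub> = \<zero>\<^bsub>k\<^esub>"
      using zero G.order_gt_0_iff_finite fin by blast
    have p: "0 < p \<and> [p] \<cdot>\<^bsub>k\<^esub> \<one>\<^bsub>k\<^esub> = \<zero>\<^bsub>k\<^esub>"
      unfolding p_def by (rule LeastI_ex[OF ex])
    have "[(order G)] \<cdot>\<^bsub>k\<^esub> \<one>\<^bsub>k\<^esub> = [(p * (order G div p))] \<cdot>\<^bsub>k\<^esub> \<one>\<^bsub>k\<^esub> \<oplus>\<^bsub>k\<^esub> [(order G mod p)] \<cdot>\<^bsub>k\<^esub> \<one>\<^bsub>k\<^esub>"
      by (subst k.add.nat_pow_mult) auto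
    also have "[(p * (order G div p))] \<cdot>\<^bsub>k\<^esub> \<one>\<^bsub>k\<^esub> = \<zero>\<^bsub>k\<^esub>"
      using k.add.nat_pow_pow[of "\<one>\<^bsub>k\<^esub>" "order G div p" p] p by simp
    finally have "[(order G mod p)] \<cdot>\<^bsub>k\<^esub> \<one>\<^bsub>k\<^esub> = \<zero>\<^bsub>k\<^esub>" using zero by simp
    moreover have "order G mod p < p" using p by simp
    ultimately have "order G mod p = 0"
      unfolding p_def by (metis (mono_tags, lifting) not_gr_zero not_less_Least)
    then have "ring_char k dvd order G"
      using ex unfolding ring_char_def p_def by auto
    with char show False by simp
  qed
  ultimately show ?thesis by (simp add: k.field_Units)
qed

text \<open>Fourier inversion: this element of the group algebra acts on \<open>V i\<close> as \<open>y \<mapsto> \<gamma> i b y \<cdot> v\<close> and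
  on the other irreducible representations as zero.\<close>

definition munit :: "nat \<Rightarrow> 'i \<Rightarrow> 'v \<Rightarrow> 'g \<Rightarrow> 'k" where
  "munit i b v = (\<lambda>g\<in>carrier G.
     (card_k (J i) \<otimes>\<^bsub>k\<^esub> inv\<^bsub>k\<^esub> card_k (carrier G)) \<otimes>\<^bsub>k\<^esub> coef G (V i) (\<gamma> i b) v g)"

lemma coef_\<gamma>_closed:
  "\<lbrakk>i \<le> r; b \<in> J i; v \<in> carrier (V i); g \<in> carrier G\<rbrakk> \<Longrightarrow> coef G (V i) (\<gamma> i b) v g \<in> carrier k"
  by (rule coef_closed[OF representation_V dual_basisD(3)[OF db]])

lemma munit_closed:
  "\<lbrakk>i \<le> r; b \<in> J i; v \<in> carrier (V i)\<rbrakk> \<Longrightarrow> munit i b v \<in> carrier (group_algebra k G)"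
  using card_k_group coef_\<gamma>_closed by (auto simp: munit_def group_algebra_def)

lemma munit_closed': "\<lbrakk>i \<le> r; b \<in> J i; v \<in> carrier (V i); g \<in> carrier G\<rbrakk> \<Longrightarrow> munit i b v g \<in> carrier k"
  using munit_closed[of i b v] by (auto simp: group_algebra_def)

lemma alg_act_munit:
  assumes M: "representation k G M" and i: "i \<le> r" "b \<in> J i" "v \<in> carrier (V i)" and x: "x \<in> carrier M"
  shows "alg_act G M (munit i b v) x
    = (card_k (J i) \<otimes>\<^bsub>k\<^esub> inv\<^bsub>k\<^esub> card_k (carrier G)) \<odot>\<^bsub>M\<^esub> alg_act G M (coef G (V i) (\<gamma> i b) v) x"
proof -
  have "alg_act G M (munit i b v) x =
    alg_act G M (\<lambda>g. (card_k (J i) \<otimes>\<^bsub>k\<^esub> inv\<^bsub>k\<^esub> card_k (carrier G)) \<otimes>\<^bsub>k\<^esub> coef G (V i) (\<gamma> i b) v g) x"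
    by (rule alg_act_cong[OF M]) (use card_k_group coef_\<gamma>_closed i x in \<open>auto simp: munit_def\<close>)
  also have "\<dots> = (card_k (J i) \<otimes>\<^bsub>k\<^esub> inv\<^bsub>k\<^esub> card_k (carrier G)) \<odot>\<^bsub>M\<^esub> alg_act G M (coef G (V i) (\<gamma> i b) v) x"
    by (rule alg_act_smult_coeff[OF M]) (use card_k_group coef_\<gamma>_closed i x in auto)
  finally show ?thesis .
qed

text \<open>For fixed \<open>b\<close> the vector \<open>v\<close> enters \<open>munit i b v\<close>
  only through its matrix coefficient, which depends on it linearly and equivariantly; the scalar in
  front is central.\<close>

lemma munit_equivariant:
  assumes M: "representation k G M" and i: "i \<le> r" "b \<in> J i" and x: "x \<in> carrier M"
  shows "(\<lambda>v. alg_act G M (munit i b v) x) \<in> equivariant_homs k G (V i) M"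
proof -
  note M' = representationD[OF M] and Vi = representationD[OF representation_V[OF i(1)]]
  interpret M: module k M by (rule M')
  let ?T = "\<lambda>v. alg_act G M (coef G (V i) (\<gamma> i b) v) x"
  have "?T \<in> equivariant_homs k G (V i) M"
    by (rule alg_act_coef_equivariant[OF representation_V[OF i(1)] dual_basisD(3)[OF db[OF i(1)] i(2)] M x])
  then have T: "?T \<in> module_homs k (V i) M"
    "\<And>g v. \<lbrakk>g \<in> carrier G; v \<in> carrier (V i)\<rbrakk> \<Longrightarrow> ?T (ract (V i) g v) = ract M g (?T v)"
    by (auto simp: equivariant_homs_def)
  note T' = module_homsD[OF T(1)]
  let ?s = "card_k (J i) \<otimes>\<^bsub>k\<^esub> inv\<^bsub>k\<^esub> card_k (carrier G)"
  have s: "?s \<in> carrier k" using card_k_group by auto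
  have eq: "\<And>v. v \<in> carrier (V i) \<Longrightarrow> alg_act G M (munit i b v) x = ?s \<odot>\<^bsub>M\<^esub> ?T v"
    by (rule alg_act_munit[OF M i _ x])
  interpret Vi: module k "V i" by (rule Vi)
  have c: "?T v \<in> carrier M" if "v \<in> carrier (V i)" for v using T'(1) that .
  show ?thesis
    unfolding equivariant_homs_def
  proof (intro CollectI conjI ballI module_homsI)
    fix v assume v: "v \<in> carrier (V i)"
    show "alg_act G M (munit i b v) x \<in> carrier M" unfolding eq[OF v] by (rule M.smult_closed[OF s c[OF v]])
    fix g assume g: "g \<in> carrier G"
    show "alg_act G M (munit i b (ract (V i) g v)) x = ract M g (alg_act G M (munit i b v) x)"
      unfolding eq[OF v] eq[OF Vi(3)[OF g v]] T(2)[OF g v] M'(5)[OF g s c[OF v]] ..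
  next
    fix v v' assume v: "v \<in> carrier (V i)" "v' \<in> carrier (V i)"
    show "alg_act G M (munit i b (v \<oplus>\<^bsub>V i\<^esub> v')) x = alg_act G M (munit i b v) x \<oplus>\<^bsub>M\<^esub> alg_act G M (munit i b v') x"
      unfolding eq[OF v(1)] eq[OF v(2)] eq[OF Vi.M.a_closed[OF v]] T'(2)[OF v]
      by (rule M.smult_r_distr[OF s c[OF v(1)] c[OF v(2)]])
  next
    fix a v assume v: "a \<in> carrier k" "v \<in> carrier (V i)"
    show "alg_act G M (munit i b (a \<odot>\<^bsub>V i\<^esub> v)) x = a \<odot>\<^bsub>M\<^esub> alg_act G M (munit i b v) x"
      unfolding eq[OF v(2)] eq[OF Vi.smult_closed[OF v]] T'(3)[OF v]
      using s v c[OF v(2)] by (simp add: M.smult_assoc1[symmetric] k.m_comm)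
  qed
qed

text \<open>The trace of the scalar \<open>l\<close> provided by Schur's lemma is computed in two ways.\<close>

lemma munit_act_same:
  assumes i: "i \<le> r" and b: "b \<in> J i" and v: "v \<in> carrier (V i)" and y: "y \<in> carrier (V i)"
  shows "alg_act G (V i) (munit i b v) y = \<gamma> i b y \<odot>\<^bsub>V i\<^esub> v"
proof -
  note Vi = representationD[OF representation_V[OF i]] and d = dual_basisD[OF db[OF i]]
  interpret M: module k "V i" by (rule Vi)
  let ?T = "\<lambda>v. alg_act G (V i) (coef G (V i) (\<gamma> i b) v) y"
  \<comment> \<open>The scalar depends on \<open>b\<close> and \<open>y\<close>, which are fixed
    here; the trace determines its value.\<close>
  obtain l where l: "l \<in> carrier k" "\<And>v. v \<in> carrier (V i) \<Longrightarrow> ?T v = l \<odot>\<^bsub>V i\<^esub> v"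
    using schur_scalar[OF k.algebraically_closed_axioms irreducible_V[OF i] db[OF i]
        alg_act_coef_equivariant[OF representation_V[OF i] d(3)[OF b] representation_V[OF i] y]] by blast
  have gy: "ract (V i) g y \<in> carrier (V i)" if "g \<in> carrier G" for g using Vi(3) that y .
  have wa: "ract (V i) (inv\<^bsub>G\<^esub> g) (w i a) \<in> carrier (V i)" if "g \<in> carrier G" "a \<in> J i" for g a
    using Vi(3) that d(4) by simp
  have "card_k (J i) \<otimes>\<^bsub>k\<^esub> l = (\<Oplus>\<^bsub>k\<^esub>a\<in>J i. \<one>\<^bsub>k\<^esub> \<otimes>\<^bsub>k\<^esub> l)"
    by (rule k.finsum_ldistr) (use l d(1) in auto)
  also have "\<dots> = (\<Oplus>\<^bsub>k\<^esub>a\<in>J i. \<gamma> i a (?T (w i a)))"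
    by (rule k.finsum_cong') (use l d in auto)
  also have "\<dots> = (\<Oplus>\<^bsub>k\<^esub>a\<in>J i. \<Oplus>\<^bsub>k\<^esub>g\<in>carrier G. \<gamma> i b (ract (V i) (inv\<^bsub>G\<^esub> g) (w i a)) \<otimes>\<^bsub>k\<^esub> \<gamma> i a (ract (V i) g y))"
  proof (rule k.finsum_cong')
    fix a assume a: "a \<in> J i"
    have "\<gamma> i a (?T (w i a)) = (\<Oplus>\<^bsub>ring_module k\<^esub>g\<in>carrier G.
        coef G (V i) (\<gamma> i b) (w i a) g \<odot>\<^bsub>ring_module k\<^esub> \<gamma> i a (ract (V i) g y))"
      unfolding alg_act_def
      by (rule module_hom_lincomb[OF Vi(1) module_ring_module[OF k.is_cring] d(3)[OF a]])
        (use coef_\<gamma>_closed i b a d(4) gy in auto)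
    then show "\<gamma> i a (?T (w i a)) = (\<Oplus>\<^bsub>k\<^esub>g\<in>carrier G. \<gamma> i b (ract (V i) (inv\<^bsub>G\<^esub> g) (w i a)) \<otimes>\<^bsub>k\<^esub> \<gamma> i a (ract (V i) g y))"
      by (simp add: finsum_ring_module coef_def)
  qed (use d wa gy b in \<open>auto intro!: k.finsum_closed\<close>)
  also have "\<dots> = (\<Oplus>\<^bsub>k\<^esub>g\<in>carrier G. \<Oplus>\<^bsub>k\<^esub>a\<in>J i. \<gamma> i b (ract (V i) (inv\<^bsub>G\<^esub> g) (w i a)) \<otimes>\<^bsub>k\<^esub> \<gamma> i a (ract (V i) g y))"
    by (rule k.finsum_swap) (use d wa gy b fin in auto)
  also have "\<dots> = (\<Oplus>\<^bsub>k\<^esub>g\<in>carrier G. \<one>\<^bsub>k\<^esub> \<otimes>\<^bsub>k\<^esub> \<gamma> i b y)"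
  proof (rule k.finsum_cong')
    \<comment> \<open>For fixed \<open>g\<close> the sum over the basis is the expansion of the
      translate of \<open>y\<close> by \<open>g\<close>, to which the inverse of \<open>g\<close> is
      applied again; so each \<open>g\<close> contributes the same amount.\<close>
    fix g assume g: "g \<in> carrier G"
    define f where "f x = \<gamma> i b (ract (V i) (inv\<^bsub>G\<^esub> g) x)" for x
    have f: "f \<in> module_homs k (V i) (ring_module k)"
      unfolding f_def by (rule module_homsI) (use Vi d b g in auto)
    have "f (ract (V i) g y) = f (\<Oplus>\<^bsub>V i\<^esub>a\<in>J i. \<gamma> i a (ract (V i) g y) \<odot>\<^bsub>V i\<^esub> w i a)"
      using dual_basis_expand[OF db[OF i] gy[OF g]] by simp
    also have "\<dots> = (\<Oplus>\<^bsub>ring_module k\<^esub>a\<in>J i. \<gamma> i a (ract (V i) g y) \<odot>\<^bsub>ring_module k\<^esub> f (w i a))"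
      by (rule module_hom_lincomb[OF Vi(1) module_ring_module[OF k.is_cring] f]) (use d gy[OF g] in auto)
    also have "\<dots> = (\<Oplus>\<^bsub>k\<^esub>a\<in>J i. f (w i a) \<otimes>\<^bsub>k\<^esub> \<gamma> i a (ract (V i) g y))"
      unfolding finsum_ring_module
      by (rule k.finsum_cong') (use d gy[OF g] module_homsD(1)[OF f] in \<open>auto simp: k.m_comm\<close>)
    finally have "(\<Oplus>\<^bsub>k\<^esub>a\<in>J i. f (w i a) \<otimes>\<^bsub>k\<^esub> \<gamma> i a (ract (V i) g y)) = f (ract (V i) g y)" by (rule sym)
    also have "\<dots> = \<gamma> i b y" using g y Vi(6,7) by (simp add: f_def)
    also have "\<dots> = \<one>\<^bsub>k\<^esub> \<otimes>\<^bsub>k\<^esub> \<gamma> i b y" using d(6)[OF b y] by simp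
    finally show "(\<Oplus>\<^bsub>k\<^esub>a\<in>J i. \<gamma> i b (ract (V i) (inv\<^bsub>G\<^esub> g) (w i a)) \<otimes>\<^bsub>k\<^esub> \<gamma> i a (ract (V i) g y)) = \<one>\<^bsub>k\<^esub> \<otimes>\<^bsub>k\<^esub> \<gamma> i b y"
      by (simp add: f_def)
  qed (use d y b in auto)
  also have "\<dots> = card_k (carrier G) \<otimes>\<^bsub>k\<^esub> \<gamma> i b y"
    by (rule k.finsum_ldistr[symmetric]) (use fin d y b in auto)
  finally have tr: "card_k (J i) \<otimes>\<^bsub>k\<^esub> l = card_k (carrier G) \<otimes>\<^bsub>k\<^esub> \<gamma> i b y" .
  have cJ: "card_k (J i) \<in> carrier k" by (rule k.finsum_closed) auto
  have "(card_k (J i) \<otimes>\<^bsub>k\<^esub> inv\<^bsub>k\<^esub> card_k (carrier G)) \<otimes>\<^bsub>k\<^esub> l = inv\<^bsub>k\<^esub> card_k (carrier G) \<otimes>\<^bsub>k\<^esub> (card_k (J i) \<otimes>\<^bsub>k\<^esub> l)"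
    using card_k_group cJ l by (simp add: k.m_ac)
  also have "\<dots> = \<gamma> i b y"
    unfolding tr using card_k_group d(6)[OF b y] by (simp add: k.m_assoc[symmetric])
  finally have "(card_k (J i) \<otimes>\<^bsub>k\<^esub> inv\<^bsub>k\<^esub> card_k (carrier G)) \<otimes>\<^bsub>k\<^esub> l = \<gamma> i b y" .
  then show ?thesis
    using alg_act_munit[OF representation_V[OF i] i b v y] l v cJ card_k_group
    by (simp add: M.smult_assoc1[symmetric])
qed

text \<open>Sending \<open>v\<close> to the action of \<open>munit i b v\<close> on \<open>y\<close>
  is an equivariant map between non-isomorphic irreducible representations.\<close>

lemma munit_act_other:
  assumes i: "i \<le> r" "j \<le> r" "i \<noteq> j" and b: "b \<in> J i" and v: "v \<in> carrier (V i)" and y: "y \<in> carrier (V j)"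
  shows "alg_act G (V j) (munit i b v) y = \<zero>\<^bsub>V j\<^esub>"
proof -
  have "\<not> rep_isomorphic k G (V i) (V j)"
    using irr i unfolding irreducibles_def by blast
  then show ?thesis
    using schur_zero[OF irreducible_V[OF i(1)] irreducible_V[OF i(2)] _
        munit_equivariant[OF representation_V[OF i(2)] i(1) b y] v] by blast
qed

text \<open>Equivariant maps commute with the group algebra, so left multiplication only moves the
  vector argument of the matrix unit.\<close>

lemma alg_act_munit_left:
  assumes M: "representation k G M" and i: "i \<le> r" and b: "b \<in> J i" and v: "v \<in> carrier (V i)" and x: "x \<in> carrier M"
    and a: "\<And>g. g \<in> carrier G \<Longrightarrow> a g \<in> carrier k"
  shows "alg_act G M a (alg_act G M (munit i b v) x) = alg_act G M (munit i b (alg_act G (V i) a v)) x"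
  using equivariant_hom_alg_act[OF representation_V[OF i] M munit_equivariant[OF M i b x] a v] by simp

lemma munit_zero:
  assumes M: "representation k G M" and i: "i \<le> r" and b: "b \<in> J i" and x: "x \<in> carrier M"
  shows "alg_act G M (munit i b \<zero>\<^bsub>V i\<^esub>) x = \<zero>\<^bsub>M\<^esub>"
proof -
  interpret M: module k M by (rule representationD[OF M])
  interpret Vi: module k "V i" by (rule representationD[OF representation_V[OF i]])
  show ?thesis
    by (rule additive_zero[OF Vi.M.abelian_group_axioms M.M.abelian_group_axioms])
      (use munit_equivariant[OF M i b x] in \<open>auto simp: equivariant_homs_def module_homs_def\<close>)
qed

text \<open>The outer unit is moved onto the vector \<open>y\<close> of \<open>V j\<close>, where
  its action is known. The product rule thus holds in an arbitrary representation without
  decomposing it.\<close>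

lemma munit_munit:
  assumes M: "representation k G M" and i: "i \<le> r" "b \<in> J i" "v \<in> carrier (V i)"
    and j: "j \<le> r" "c \<in> J j" "y \<in> carrier (V j)" and x: "x \<in> carrier M"
  shows "alg_act G M (munit i b v) (alg_act G M (munit j c y) x) =
    (if i = j then \<gamma> i b y \<odot>\<^bsub>M\<^esub> alg_act G M (munit i c v) x else \<zero>\<^bsub>M\<^esub>)"
proof -
  have "alg_act G M (munit i b v) (alg_act G M (munit j c y) x)
    = alg_act G M (munit j c (alg_act G (V j) (munit i b v) y)) x"
    by (rule alg_act_munit_left[OF M j x]) (use munit_closed' i in auto)
  also have "\<dots> = (if i = j then \<gamma> i b y \<odot>\<^bsub>M\<^esub> alg_act G M (munit i c v) x else \<zero>\<^bsub>M\<^esub>)"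
  proof (cases "i = j")
    case True
    then show ?thesis
      using munit_act_same[of i b v y] i j dual_basisD(6)[OF db]
        munit_equivariant[OF M j(1,2) x] by (auto simp: equivariant_homs_def module_homs_def)
  next
    case False
    then show ?thesis using munit_act_other[of i j b v y] i j munit_zero[OF M j(1,2) x] by auto
  qed
  finally show ?thesis .
qed

text \<open>Right translation of \<open>munit i b v\<close> by \<open>h\<close> gives a combination
  of the \<open>munit i c v\<close>, with the row of index \<open>b\<close> of the matrix of
  \<open>h\<close> as coefficients. Hence being killed by all matrix units is a condition stable
  under the group.\<close>

lemma munit_ract:
  assumes M: "representation k G M" and i: "i \<le> r" "b \<in> J i" "v \<in> carrier (V i)" and h: "h \<in> carrier G" and x: "x \<in> carrier M"
    and zero: "\<And>c. c \<in> J i \<Longrightarrow> alg_act G M (munit i c v) x = \<zero>\<^bsub>M\<^esub>"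
  shows "alg_act G M (munit i b v) (ract M h x) = \<zero>\<^bsub>M\<^esub>"
proof -
  note Vi = representationD[OF representation_V[OF i(1)]] and d = dual_basisD[OF db[OF i(1)]]
  interpret Vi: module k "V i" by (rule Vi)
  interpret M: module k M by (rule representationD(1)[OF M])
  let ?s = "card_k (J i) \<otimes>\<^bsub>k\<^esub> inv\<^bsub>k\<^esub> card_k (carrier G)"
  have s: "?s \<in> carrier k" using card_k_group by auto
  let ?m = "\<lambda>c. \<gamma> i b (ract (V i) h (w i c))"
  have m: "?m c \<in> carrier k" if "c \<in> J i" for c using that d i(2) Vi(3)[OF h] by auto
  have "alg_act G M (munit i b v) (ract M h x) = alg_act G M (\<lambda>g. munit i b v (g \<otimes>\<^bsub>G\<^esub> inv\<^bsub>G\<^esub> h)) x"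
    by (rule alg_act_ract[OF M]) (use munit_closed' i h x in auto)
  also have "\<dots> = alg_act G M (\<lambda>g. \<Oplus>\<^bsub>k\<^esub>c\<in>J i. ?m c \<otimes>\<^bsub>k\<^esub> munit i c v g) x"
  proof (rule alg_act_cong[OF M _ _ x])
    fix g assume g: "g \<in> carrier G"
    let ?z = "ract (V i) (inv\<^bsub>G\<^esub> g) v"
    have z: "?z \<in> carrier (V i)" using Vi(3) g i(3) by simp
    let ?f = "\<lambda>x. \<gamma> i b (ract (V i) h x)"
    have f: "?f \<in> module_homs k (V i) (ring_module k)"
      by (rule module_homsI) (use Vi d i(2) h in auto)
    have "coef G (V i) (\<gamma> i b) v (g \<otimes>\<^bsub>G\<^esub> inv\<^bsub>G\<^esub> h) = ?f ?z"
      using Vi(7) g h i(3) by (simp add: coef_def G.inv_mult_group)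
    \<comment> \<open>Expanding in the basis separates the dependence on \<open>h\<close> from that
      on \<open>g\<close>.\<close>
    also have "?f ?z = ?f (\<Oplus>\<^bsub>V i\<^esub>c\<in>J i. \<gamma> i c ?z \<odot>\<^bsub>V i\<^esub> w i c)"
      using dual_basis_expand[OF db[OF i(1)] z] by simp
    also have "\<dots> = (\<Oplus>\<^bsub>ring_module k\<^esub>c\<in>J i. \<gamma> i c ?z \<odot>\<^bsub>ring_module k\<^esub> ?f (w i c))"
      by (rule module_hom_lincomb[OF Vi(1) module_ring_module[OF k.is_cring] f]) (use d z in auto)
    also have "\<dots> = (\<Oplus>\<^bsub>k\<^esub>c\<in>J i. \<gamma> i c ?z \<otimes>\<^bsub>k\<^esub> ?m c)" by (simp add: finsum_ring_module)
    finally have "munit i b v (g \<otimes>\<^bsub>G\<^esub> inv\<^bsub>G\<^esub> h) = ?s \<otimes>\<^bsub>k\<^esub> (\<Oplus>\<^bsub>k\<^esub>c\<in>J i. \<gamma> i c ?z \<otimes>\<^bsub>k\<^esub> ?m c)"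
      using g h by (simp add: munit_def)
    also have "\<dots> = (\<Oplus>\<^bsub>k\<^esub>c\<in>J i. ?s \<otimes>\<^bsub>k\<^esub> (\<gamma> i c ?z \<otimes>\<^bsub>k\<^esub> ?m c))"
      by (rule k.finsum_rdistr) (use d z m s in auto)
    also have "\<dots> = (\<Oplus>\<^bsub>k\<^esub>c\<in>J i. ?m c \<otimes>\<^bsub>k\<^esub> munit i c v g)"
    proof (rule k.finsum_cong')
      fix c assume c: "c \<in> J i"
      have q: "\<gamma> i c ?z \<in> carrier k" using d(6) c z .
      show "?s \<otimes>\<^bsub>k\<^esub> (\<gamma> i c ?z \<otimes>\<^bsub>k\<^esub> ?m c) = ?m c \<otimes>\<^bsub>k\<^esub> munit i c v g"
        using q m[OF c] s g k.m_lcomm[OF s q m[OF c]] k.m_comm[of "?m c" "?s \<otimes>\<^bsub>k\<^esub> \<gamma> i c ?z"] k.m_assoc[OF s q m[OF c]]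
        by (simp add: munit_def coef_def)
    qed (use m munit_closed' i g in auto)
    finally show "munit i b v (g \<otimes>\<^bsub>G\<^esub> inv\<^bsub>G\<^esub> h) = (\<Oplus>\<^bsub>k\<^esub>c\<in>J i. ?m c \<otimes>\<^bsub>k\<^esub> munit i c v g)" .
  qed (use m munit_closed' i in \<open>auto intro!: k.finsum_closed\<close>)
  also have "\<dots> = (\<Oplus>\<^bsub>M\<^esub>c\<in>J i. alg_act G M (\<lambda>g. ?m c \<otimes>\<^bsub>k\<^esub> munit i c v g) x)"
    by (rule alg_act_finsum_coeff[OF M]) (use d m munit_closed' i x in auto)
  also have "\<dots> = (\<Oplus>\<^bsub>M\<^esub>c\<in>J i. \<zero>\<^bsub>M\<^esub>)"
  proof (rule M.M.finsum_cong')
    fix c assume c: "c \<in> J i"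
    have "alg_act G M (\<lambda>g. ?m c \<otimes>\<^bsub>k\<^esub> munit i c v g) x = ?m c \<odot>\<^bsub>M\<^esub> alg_act G M (munit i c v) x"
      by (rule alg_act_smult_coeff[OF M]) (use m munit_closed' i x c in auto)
    then show "alg_act G M (\<lambda>g. ?m c \<otimes>\<^bsub>k\<^esub> munit i c v g) x = \<zero>\<^bsub>M\<^esub>" using zero[OF c] m[OF c] by simp
  qed auto
  finally show ?thesis by simp
qed

text \<open>A vector of the regular representation killed by all matrix units generates a
  subrepresentation killed by all of them, which has no irreducible constituent.\<close>

lemma munit_annihilator:
  assumes x: "x \<in> carrier regular_rep"
    and zero: "\<And>i b v. \<lbrakk>i \<le> r; b \<in> J i; v \<in> carrier (V i)\<rbrakk> \<Longrightarrow> alg_act G regular_rep (munit i b v) x = \<zero>\<^bsub>regular_rep\<^esub>"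
  shows "x = \<zero>\<^bsub>regular_rep\<^esub>"
proof (rule ccontr)
  let ?R = "regular_rep :: ('k, 'g \<Rightarrow> 'k, 'g) rep"
  note R = representation_regular_rep and R' = representationD[OF representation_regular_rep]
  interpret M: module k ?R by (rule R')
  define L where "L = {x \<in> carrier ?R. \<forall>i b v. i \<le> r \<and> b \<in> J i \<and> v \<in> carrier (V i) \<longrightarrow>
      alg_act G ?R (munit i b v) x = \<zero>\<^bsub>?R\<^esub>}"
  have hom: "alg_act G ?R (munit i b v) \<in> module_homs k ?R ?R" if "i \<le> r" "b \<in> J i" "v \<in> carrier (V i)" for i b v
    by (rule alg_act_hom[OF R]) (use munit_closed' that in auto)
  assume "x \<noteq> \<zero>\<^bsub>?R\<^esub>"
  moreover have "x \<in> L" using x zero unfolding L_def by blast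
  ultimately have "L \<noteq> {\<zero>\<^bsub>?R\<^esub>}" by blast
  moreover have "submodule L k ?R"
  proof (rule submoduleI'[OF R'(1)])
    show "\<zero>\<^bsub>?R\<^esub> \<in> L"
      unfolding L_def
      using additive_zero[OF M.M.abelian_group_axioms M.M.abelian_group_axioms] module_homsD[OF hom]
      by (intro CollectI conjI allI impI M.M.zero_closed) blast
  next
    fix a b assume ab: "a \<in> L" "b \<in> L"
    show "a \<oplus>\<^bsub>?R\<^esub> b \<in> L"
      unfolding L_def
    proof (intro CollectI conjI allI impI)
      fix i c v assume "i \<le> r \<and> c \<in> J i \<and> v \<in> carrier (V i)"
      then show "alg_act G ?R (munit i c v) (a \<oplus>\<^bsub>?R\<^esub> b) = \<zero>\<^bsub>?R\<^esub>"
        using ab module_homsD(2)[OF hom, of i c v a b] M.M.l_zero[OF M.M.zero_closed]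
        unfolding L_def by (simp del: regular_rep_simps)
    qed (use ab M.M.a_closed in \<open>auto simp: L_def simp del: regular_rep_simps\<close>)
  next
    fix c a assume ca: "c \<in> carrier k" "a \<in> L"
    show "c \<odot>\<^bsub>?R\<^esub> a \<in> L"
      unfolding L_def
    proof (intro CollectI conjI allI impI)
      fix i b v assume "i \<le> r \<and> b \<in> J i \<and> v \<in> carrier (V i)"
      then show "alg_act G ?R (munit i b v) (c \<odot>\<^bsub>?R\<^esub> a) = \<zero>\<^bsub>?R\<^esub>"
        using ca module_homsD(3)[OF hom, of i b v c a] M.smult_r_null[OF ca(1)]
        unfolding L_def by (simp del: regular_rep_simps)
    qed (use ca M.smult_closed in \<open>auto simp: L_def simp del: regular_rep_simps\<close>)
  qed (auto simp: L_def)
  moreover have "ract ?R h a \<in> L" if h: "h \<in> carrier G" and a: "a \<in> L" for h a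
    unfolding L_def
  proof (intro CollectI conjI allI impI)
    fix i b v assume i: "i \<le> r \<and> b \<in> J i \<and> v \<in> carrier (V i)"
    show "alg_act G ?R (munit i b v) (ract ?R h a) = \<zero>\<^bsub>?R\<^esub>"
      by (rule munit_ract[OF R]) (use i h a in \<open>auto simp: L_def\<close>)
  qed (use h a R'(3) in \<open>auto simp: L_def simp del: regular_rep_simps\<close>)
  ultimately obtain W where W: "W \<subseteq> L" "irreducible_rep k G (?R\<lparr>carrier := W\<rparr>)" "W \<subseteq> carrier ?R"
    using exists_irreducible_subrep[OF R regular_rep_dual_basis] by metis
  let ?W = "?R\<lparr>carrier := W\<rparr>"
  \<comment> \<open>\<open>W\<close> has the vector type of the regular representation, for which
    the list is known to be complete.\<close>
  obtain i where i: "i \<le> r" "rep_isomorphic k G ?W (V i)"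
    using irr W(2) unfolding irreducibles_def by blast
  then obtain f where f: "f \<in> equivariant_homs k G ?W (V i)" "bij_betw f W (carrier (V i))"
    unfolding rep_isomorphic_def equivariant_homs_def by auto
  note Vi = representationD[OF representation_V[OF i(1)]]
  interpret Vi: module k "V i" by (rule Vi)
  obtain y where y: "y \<in> carrier (V i)" "y \<noteq> \<zero>\<^bsub>V i\<^esub>"
    using irreducible_repD(2)[OF irreducible_V[OF i(1)]] Vi.M.zero_closed by blast
  obtain x where x: "x \<in> W" "f x = y"
    using f(2) y(1) unfolding bij_betw_def by (metis imageE)
  have repW: "representation k G ?W" by (rule irreducible_repD(1)[OF W(2)])
  interpret W: module k ?W by (rule representationD(1)[OF repW])
  \<comment> \<open>The diagonal unit of index \<open>b\<close> kills the preimage \<open>x\<close>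
    of \<open>y\<close>, but sends \<open>y\<close> to its component along \<open>w i b\<close>; so
    every coordinate of \<open>y\<close> vanishes.\<close>
  have "\<gamma> i b y = \<gamma> i b \<zero>\<^bsub>V i\<^esub>" if b: "b \<in> J i" for b
  proof -
    have wb: "w i b \<in> carrier (V i)" using dual_basisD(4)[OF db[OF i(1)] b] .
    have "alg_act G ?W (munit i b (w i b)) x = \<zero>\<^bsub>?R\<^esub>"
    proof -
      \<comment> \<open>The action on the subrepresentation is computed in the regular
        representation, where \<open>x\<close> lies in \<open>L\<close>.\<close>
      have "alg_act G ?W (munit i b (w i b)) x = alg_act G ?R (munit i b (w i b)) x"
        unfolding alg_act_def
      proof -
        have "munit i b (w i b) g \<odot>\<^bsub>?W\<^esub> ract ?W g x \<in> carrier ?W" if "g \<in> carrier G" for g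
          using W.smult_closed[of "munit i b (w i b) g" "ract ?W g x"] representationD(3)[OF repW that] x(1)
            munit_closed'[OF i(1) b wb that] by simp
        then have "finsum ?W (\<lambda>g. munit i b (w i b) g \<odot>\<^bsub>?W\<^esub> ract ?W g x) (carrier G)
          = finsum ?R (\<lambda>g. munit i b (w i b) g \<odot>\<^bsub>?W\<^esub> ract ?W g x) (carrier G)"
          by (intro finsum_carrier_update[OF M.M.abelian_group_axioms W.M.abelian_group_axioms W(3)]) auto
        then show "finsum ?W (\<lambda>g. munit i b (w i b) g \<odot>\<^bsub>?W\<^esub> ract ?W g x) (carrier G)
          = finsum ?R (\<lambda>g. munit i b (w i b) g \<odot>\<^bsub>?R\<^esub> ract ?R g x) (carrier G)" by simp
      qed
      also have "\<dots> = \<zero>\<^bsub>?R\<^esub>"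
        using x(1) W(1) i(1) b wb unfolding L_def by blast
      finally show ?thesis .
    qed
    then have "f \<zero>\<^bsub>?R\<^esub> = alg_act G (V i) (munit i b (w i b)) y"
      using equivariant_hom_alg_act[OF repW representation_V[OF i(1)] f(1), of "munit i b (w i b)" x]
        munit_closed'[OF i(1) b wb] x by simp
    moreover have "f \<zero>\<^bsub>?W\<^esub> = \<zero>\<^bsub>V i\<^esub>"
      by (rule additive_zero[OF W.M.abelian_group_axioms Vi.M.abelian_group_axioms])
        (use f(1) in \<open>auto simp: equivariant_homs_def module_homs_def simp del: regular_rep_simps\<close>)
    ultimately have "\<gamma> i b y \<odot>\<^bsub>V i\<^esub> w i b = \<zero>\<^bsub>V i\<^esub>"
      using munit_act_same[OF i(1) b wb y(1)] by simp
    then have "\<gamma> i b y \<otimes>\<^bsub>k\<^esub> \<gamma> i b (w i b) = \<gamma> i b \<zero>\<^bsub>V i\<^esub>"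
      using dual_basisD(8)[OF db[OF i(1)] b _ wb, of "\<gamma> i b y"] dual_basisD(6)[OF db[OF i(1)] b y(1)] by simp
    then show ?thesis
      using dual_basisD(5)[OF db[OF i(1)] b b] dual_basisD(6)[OF db[OF i(1)] b y(1)] by simp
  qed
  then have "y = \<zero>\<^bsub>V i\<^esub>"
    by (rule dual_basis_eqI[OF db[OF i(1)] Vi(1) y(1) Vi.M.zero_closed])
  with y show False by simp
qed

end

section \<open>The resolution of the identity, faithfulness, and the central idempotents\<close>

context irr_system
begin

lemma munit_basis_closed:
  "\<lbrakk>representation k G M; i \<le> r; b \<in> J i; x \<in> carrier M\<rbrakk> \<Longrightarrow> alg_act G M (munit i b (w i b)) x \<in> carrier M"
  by (rule alg_act_closed) (use munit_closed' dual_basisD(4)[OF db] in auto)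

text \<open>Of all diagonal units only the one of indices \<open>i\<close> and \<open>b\<close>
  survives multiplication by \<open>munit i b v\<close> from the left, and that one is
  absorbed.\<close>

lemma munit_absorb_sum:
  assumes M: "representation k G M" and i: "i \<le> r" "b \<in> J i" "v \<in> carrier (V i)" and x: "x \<in> carrier M"
  shows "alg_act G M (munit i b v) (\<Oplus>\<^bsub>M\<^esub>j\<in>{..r}. \<Oplus>\<^bsub>M\<^esub>c\<in>J j. alg_act G M (munit j c (w j c)) x) = alg_act G M (munit i b v) x"
proof -
  interpret M: module k M by (rule representationD[OF M])
  let ?U = "alg_act G M (munit i b v)"
  have U: "?U \<in> module_homs k M M" by (rule alg_act_hom[OF M]) (use munit_closed' i in auto)
  note U' = module_homsD[OF U] and d = dual_basisD[OF db]
  have Ux: "?U x \<in> carrier M" using U'(1) x .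
  have "?U (\<Oplus>\<^bsub>M\<^esub>j\<in>{..r}. \<Oplus>\<^bsub>M\<^esub>c\<in>J j. alg_act G M (munit j c (w j c)) x)
      = (\<Oplus>\<^bsub>M\<^esub>j\<in>{..r}. ?U (\<Oplus>\<^bsub>M\<^esub>c\<in>J j. alg_act G M (munit j c (w j c)) x))"
    by (rule hom_finsum_additive(2)[OF M.M.abelian_group_axioms M.M.abelian_group_axioms])
      (use U' munit_basis_closed[OF M _ _ x] in \<open>auto intro!: M.M.finsum_closed\<close>)
  also have "\<dots> = (\<Oplus>\<^bsub>M\<^esub>j\<in>{..r}. if j = i then ?U x else \<zero>\<^bsub>M\<^esub>)"
  proof (rule M.M.finsum_cong')
    fix j assume "j \<in> {..r}"
    then have j: "j \<le> r" by simp
    have "?U (\<Oplus>\<^bsub>M\<^esub>c\<in>J j. alg_act G M (munit j c (w j c)) x) = (\<Oplus>\<^bsub>M\<^esub>c\<in>J j. ?U (alg_act G M (munit j c (w j c)) x))"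
      by (rule hom_finsum_additive(2)[OF M.M.abelian_group_axioms M.M.abelian_group_axioms])
        (use U' munit_basis_closed[OF M _ _ x] j in auto)
    also have "\<dots> = (\<Oplus>\<^bsub>M\<^esub>c\<in>J j. if c = b then (if i = j then ?U x else \<zero>\<^bsub>M\<^esub>) else \<zero>\<^bsub>M\<^esub>)"
    proof (rule M.M.finsum_cong')
      fix c assume c: "c \<in> J j"
      show "?U (alg_act G M (munit j c (w j c)) x) = (if c = b then (if i = j then ?U x else \<zero>\<^bsub>M\<^esub>) else \<zero>\<^bsub>M\<^esub>)"
        using munit_munit[OF M i j c d(4)[OF j c] x] d(5)[OF i(1), of b c] i c Ux
          alg_act_closed[OF M munit_closed'[OF i(1) _ i(3)] x]
        by auto
    qed (use Ux in auto)
    also have "\<dots> = (if j = i then ?U x else \<zero>\<^bsub>M\<^esub>)"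
    proof (cases "j = i")
      case True
      then show ?thesis using M.M.finsum_delta[of "J j" b "?U x"] d(1)[OF j] i Ux by simp
    next
      case False
      then have "(\<lambda>c. if c = b then if i = j then ?U x else \<zero>\<^bsub>M\<^esub> else \<zero>\<^bsub>M\<^esub>) = (\<lambda>_. \<zero>\<^bsub>M\<^esub>)" by auto
      then show ?thesis using False by simp
    qed
    finally show "?U (\<Oplus>\<^bsub>M\<^esub>c\<in>J j. alg_act G M (munit j c (w j c)) x) = (if j = i then ?U x else \<zero>\<^bsub>M\<^esub>)" .
  qed (use Ux in auto)
  also have "\<dots> = ?U x" by (rule M.M.finsum_delta) (use i Ux in auto)
  finally show ?thesis .
qed

text \<open>The difference of \<open>x\<close> and the sum of its components is killed by all matrix
  units, hence zero.\<close>

lemma munit_sum_regular: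
  assumes x: "x \<in> carrier regular_rep"
  shows "(\<Oplus>\<^bsub>regular_rep\<^esub>j\<in>{..r}. \<Oplus>\<^bsub>regular_rep\<^esub>c\<in>J j. alg_act G regular_rep (munit j c (w j c)) x) = x" (is "?S = x")
proof -
  note R = representation_regular_rep
  interpret M: module k regular_rep by (rule module_regular_rep)
  have S: "?S \<in> carrier regular_rep"
    by (intro M.M.finsum_closed funcsetI munit_basis_closed[OF R _ _ x]) auto
  have "x \<ominus>\<^bsub>regular_rep\<^esub> ?S = \<zero>\<^bsub>regular_rep\<^esub>"
  proof (rule munit_annihilator)
    show "x \<ominus>\<^bsub>regular_rep\<^esub> ?S \<in> carrier regular_rep" by (rule M.M.minus_closed[OF x S])
    fix i b v assume i: "i \<le> r" "b \<in> J i" "v \<in> carrier (V i)"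
    let ?U = "alg_act G regular_rep (munit i b v)"
    have U: "?U \<in> module_homs k regular_rep regular_rep" by (rule alg_act_hom[OF R]) (use munit_closed' i in auto)
    note U' = module_homsD[OF U]
    have "?U (\<ominus>\<^bsub>regular_rep\<^esub> ?S) = \<ominus>\<^bsub>regular_rep\<^esub> ?U ?S"
      by (rule additive_minus[OF M.M.abelian_group_axioms M.M.abelian_group_axioms _ _ S])
        (use U' in \<open>auto simp del: regular_rep_simps\<close>)
    then show "?U (x \<ominus>\<^bsub>regular_rep\<^esub> ?S) = \<zero>\<^bsub>regular_rep\<^esub>"
      unfolding a_minus_def U'(2)[OF x M.M.a_inv_closed[OF S]] munit_absorb_sum[OF R i x]
      by (simp only: M.M.r_neg[OF U'(1)[OF x]])
  qed
  then have "\<ominus>\<^bsub>regular_rep\<^esub> (\<ominus>\<^bsub>regular_rep\<^esub> ?S) = x"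
    unfolding a_minus_def by (rule M.M.minus_equality[OF _ M.M.a_inv_closed[OF S] x])
  then show ?thesis by (simp only: M.M.minus_minus[OF S])
qed

lemma alg_act_munit_sum:
  assumes M: "representation k G M" and x: "x \<in> carrier M"
  shows "alg_act G M (\<lambda>g\<in>carrier G. \<Oplus>\<^bsub>k\<^esub>j\<in>{..r}. \<Oplus>\<^bsub>k\<^esub>c\<in>J j. munit j c (w j c) g) x
    = (\<Oplus>\<^bsub>M\<^esub>j\<in>{..r}. \<Oplus>\<^bsub>M\<^esub>c\<in>J j. alg_act G M (munit j c (w j c)) x)"
proof -
  interpret M: module k M by (rule representationD[OF M])
  note d = dual_basisD[OF db]
  have u: "\<And>j c g. \<lbrakk>j \<le> r; c \<in> J j; g \<in> carrier G\<rbrakk> \<Longrightarrow> munit j c (w j c) g \<in> carrier k"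
    using munit_closed' d(4) by auto
  have "alg_act G M (\<lambda>g\<in>carrier G. \<Oplus>\<^bsub>k\<^esub>j\<in>{..r}. \<Oplus>\<^bsub>k\<^esub>c\<in>J j. munit j c (w j c) g) x
      = alg_act G M (\<lambda>g. \<Oplus>\<^bsub>k\<^esub>j\<in>{..r}. \<Oplus>\<^bsub>k\<^esub>c\<in>J j. munit j c (w j c) g) x"
    by (rule alg_act_cong[OF M]) (use x u in \<open>auto intro!: k.finsum_closed\<close>)
  also have "\<dots> = (\<Oplus>\<^bsub>M\<^esub>j\<in>{..r}. alg_act G M (\<lambda>g. \<Oplus>\<^bsub>k\<^esub>c\<in>J j. munit j c (w j c) g) x)"
    by (rule alg_act_finsum_coeff[OF M]) (use x u in \<open>auto intro!: k.finsum_closed\<close>)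
  also have "\<dots> = (\<Oplus>\<^bsub>M\<^esub>j\<in>{..r}. \<Oplus>\<^bsub>M\<^esub>c\<in>J j. alg_act G M (munit j c (w j c)) x)"
    by (rule M.M.finsum_cong')
      (use d(1) x u munit_basis_closed[OF M _ _ x] in \<open>auto intro!: alg_act_finsum_coeff[OF M] M.M.finsum_closed\<close>)
  finally show ?thesis .
qed

text \<open>Evaluation at the delta function of the identity turns the equation on the regular
  representation into one between coefficient functions. In this form it applies to every
  representation.\<close>

lemma munit_sum_coeff:
  "(\<lambda>g\<in>carrier G. \<Oplus>\<^bsub>k\<^esub>j\<in>{..r}. \<Oplus>\<^bsub>k\<^esub>c\<in>J j. munit j c (w j c) g)
    = (\<lambda>g\<in>carrier G. if g = \<one>\<^bsub>G\<^esub> then \<one>\<^bsub>k\<^esub> else \<zero>\<^bsub>k\<^esub>)" (is "?E = ?one")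
proof -
  have one: "?one \<in> carrier regular_rep" by auto
  have "munit j c (w j c) g \<in> carrier k" if "j \<le> r" "c \<in> J j" "g \<in> carrier G" for j c g
    using munit_closed' dual_basisD(4)[OF db] that by auto
  then have "?E \<in> carrier G \<rightarrow>\<^sub>E carrier k" by (auto intro!: k.finsum_closed)
  then have "?E = alg_act G regular_rep ?E ?one" by (rule alg_act_regular_one[symmetric])
  also have "\<dots> = ?one"
    using alg_act_munit_sum[OF representation_regular_rep one] munit_sum_regular[OF one] by (rule trans)
  finally show ?thesis .
qed

lemma munit_sum:
  assumes M: "representation k G M" and x: "x \<in> carrier M"
  shows "(\<Oplus>\<^bsub>M\<^esub>j\<in>{..r}. \<Oplus>\<^bsub>M\<^esub>c\<in>J j. alg_act G M (munit j c (w j c)) x) = x"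
proof -
  have "alg_act G M (\<lambda>g\<in>carrier G. if g = \<one>\<^bsub>G\<^esub> then \<one>\<^bsub>k\<^esub> else \<zero>\<^bsub>k\<^esub>) x
      = alg_act G M (\<lambda>g. if g = \<one>\<^bsub>G\<^esub> then \<one>\<^bsub>k\<^esub> else \<zero>\<^bsub>k\<^esub>) x"
    by (rule alg_act_cong[OF M]) (use x in auto)
  then show ?thesis
    using alg_act_munit_sum[OF M x] alg_act_delta[OF M x] by (simp add: munit_sum_coeff)
qed

text \<open>Multiplying the resolution of the identity by \<open>a\<close> from the left writes
  \<open>a\<close> as a sum of matrix units whose vector arguments are the images of the basis
  vectors under \<open>a\<close>. So \<open>a\<close> depends only on its action on the
  \<open>V j\<close>.\<close>

lemma group_algebra_faithful:
  assumes a: "a \<in> carrier (group_algebra k G)" and a': "a' \<in> carrier (group_algebra k G)"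
    and eq: "\<And>i v. \<lbrakk>i \<le> r; v \<in> carrier (V i)\<rbrakk> \<Longrightarrow> alg_act G (V i) a v = alg_act G (V i) a' v"
  shows "a = a'"
proof -
  note R = representation_regular_rep and d = dual_basisD[OF db]
  interpret M: module k regular_rep by (rule module_regular_rep)
  define one where "one = (\<lambda>g\<in>carrier G. if g = \<one>\<^bsub>G\<^esub> then \<one>\<^bsub>k\<^esub> else \<zero>\<^bsub>k\<^esub>)"
  have one: "one \<in> carrier regular_rep" by (auto simp: one_def)
  have exp: "a = (\<Oplus>\<^bsub>regular_rep\<^esub>j\<in>{..r}. \<Oplus>\<^bsub>regular_rep\<^esub>c\<in>J j.
      alg_act G regular_rep (munit j c (alg_act G (V j) a (w j c))) one)"
    if a: "a \<in> carrier (group_algebra k G)" for a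
  proof -
    have a1: "\<And>g. g \<in> carrier G \<Longrightarrow> a g \<in> carrier k" using a by (auto simp: group_algebra_def)
    have A: "alg_act G regular_rep a \<in> module_homs k regular_rep regular_rep" by (rule alg_act_hom[OF R a1])
    note A' = module_homsD[OF A]
    have u: "alg_act G regular_rep (munit j c (w j c)) one \<in> carrier regular_rep" if "j \<le> r" "c \<in> J j" for j c
      by (rule munit_basis_closed[OF R that one])
    have v: "alg_act G regular_rep a (alg_act G regular_rep (munit j c (w j c)) one)
        = alg_act G regular_rep (munit j c (alg_act G (V j) a (w j c))) one" if "j \<le> r" "c \<in> J j" for j c
      by (rule alg_act_munit_left[OF R that d(4)[OF that] one a1])
    have v': "alg_act G regular_rep (munit j c (alg_act G (V j) a (w j c))) one \<in> carrier regular_rep" if "j \<le> r" "c \<in> J j" for j c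
      using A'(1)[OF u[OF that]] unfolding v[OF that] .
    have "a = alg_act G regular_rep a one"
      using a unfolding one_def by (intro alg_act_regular_one[symmetric]) (simp add: group_algebra_def)
    also have "\<dots> = alg_act G regular_rep a (\<Oplus>\<^bsub>regular_rep\<^esub>j\<in>{..r}. \<Oplus>\<^bsub>regular_rep\<^esub>c\<in>J j.
        alg_act G regular_rep (munit j c (w j c)) one)"
      by (simp only: munit_sum_regular[OF one])
    also have "\<dots> = (\<Oplus>\<^bsub>regular_rep\<^esub>j\<in>{..r}. alg_act G regular_rep a (\<Oplus>\<^bsub>regular_rep\<^esub>c\<in>J j.
        alg_act G regular_rep (munit j c (w j c)) one))"
      by (rule hom_finsum_additive(2)[OF M.M.abelian_group_axioms M.M.abelian_group_axioms])
        (use A' u in \<open>auto intro!: M.M.finsum_closed simp del: regular_rep_simps\<close>)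
    also have "\<dots> = (\<Oplus>\<^bsub>regular_rep\<^esub>j\<in>{..r}. \<Oplus>\<^bsub>regular_rep\<^esub>c\<in>J j.
      alg_act G regular_rep (munit j c (alg_act G (V j) a (w j c))) one)"
    proof (rule M.M.finsum_cong')
      fix j assume "j \<in> {..r}"
      then have j: "j \<le> r" by simp
      have "alg_act G regular_rep a (\<Oplus>\<^bsub>regular_rep\<^esub>c\<in>J j. alg_act G regular_rep (munit j c (w j c)) one)
        = (\<Oplus>\<^bsub>regular_rep\<^esub>c\<in>J j. alg_act G regular_rep a (alg_act G regular_rep (munit j c (w j c)) one))"
        by (rule hom_finsum_additive(2)[OF M.M.abelian_group_axioms M.M.abelian_group_axioms])
          (use A' u j in \<open>auto simp del: regular_rep_simps\<close>)
      also have "\<dots> = (\<Oplus>\<^bsub>regular_rep\<^esub>c\<in>J j. alg_act G regular_rep (munit j c (alg_act G (V j) a (w j c))) one)"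
        by (rule M.M.finsum_cong') (use v v' j in \<open>auto simp del: regular_rep_simps\<close>)
      finally show "alg_act G regular_rep a (\<Oplus>\<^bsub>regular_rep\<^esub>c\<in>J j. alg_act G regular_rep (munit j c (w j c)) one)
        = (\<Oplus>\<^bsub>regular_rep\<^esub>c\<in>J j. alg_act G regular_rep (munit j c (alg_act G (V j) a (w j c))) one)" .
    qed (use v' in \<open>auto intro!: M.M.finsum_closed simp del: regular_rep_simps\<close>)
    finally show ?thesis .
  qed
  have "(\<Oplus>\<^bsub>regular_rep\<^esub>j\<in>{..r}. \<Oplus>\<^bsub>regular_rep\<^esub>c\<in>J j.
      alg_act G regular_rep (munit j c (alg_act G (V j) a (w j c))) one)
    = (\<Oplus>\<^bsub>regular_rep\<^esub>j\<in>{..r}. \<Oplus>\<^bsub>regular_rep\<^esub>c\<in>J j.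
      alg_act G regular_rep (munit j c (alg_act G (V j) a' (w j c))) one)"
  proof (rule M.M.finsum_cong'[OF refl])
    have a1: "\<And>g. g \<in> carrier G \<Longrightarrow> a' g \<in> carrier k" using a' by (auto simp: group_algebra_def)
    have v: "alg_act G regular_rep (munit j c (alg_act G (V j) a' (w j c))) one \<in> carrier regular_rep"
      if j: "j \<le> r" "c \<in> J j" for j c
      by (rule alg_act_closed[OF R munit_closed'[OF j alg_act_closed[OF representation_V[OF j(1)] a1 d(4)[OF j]]] one])
    then show "(\<lambda>j. \<Oplus>\<^bsub>regular_rep\<^esub>c\<in>J j. alg_act G regular_rep (munit j c (alg_act G (V j) a' (w j c))) one)
        \<in> {..r} \<rightarrow> carrier regular_rep"
      by (auto intro!: M.M.finsum_closed simp del: regular_rep_simps)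
    fix j assume "j \<in> {..r}"
    then have j: "j \<le> r" by simp
    show "(\<Oplus>\<^bsub>regular_rep\<^esub>c\<in>J j. alg_act G regular_rep (munit j c (alg_act G (V j) a (w j c))) one)
      = (\<Oplus>\<^bsub>regular_rep\<^esub>c\<in>J j. alg_act G regular_rep (munit j c (alg_act G (V j) a' (w j c))) one)"
      by (rule M.M.finsum_cong') (use v[OF j] eq[OF j d(4)[OF j]] in \<open>auto simp del: regular_rep_simps\<close>)
  qed
  then show ?thesis using exp[OF a] exp[OF a'] by argo
qed

text \<open>Unfolded, this is the classical formula: dim / |G| times the character of
  \<open>V i\<close> at the inverse of \<open>g\<close>.\<close>

definition isotypical :: "nat \<Rightarrow> 'g \<Rightarrow> 'k" where
  "isotypical i = (\<lambda>g\<in>carrier G. \<Oplus>\<^bsub>k\<^esub>b\<in>J i. munit i b (w i b) g)"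

lemma isotypical_closed: "i \<le> r \<Longrightarrow> isotypical i \<in> carrier (group_algebra k G)"
  using munit_closed' dual_basisD(4)[OF db]
  by (auto simp: isotypical_def group_algebra_def intro!: k.finsum_closed)

lemma isotypical_closed': "\<lbrakk>i \<le> r; g \<in> carrier G\<rbrakk> \<Longrightarrow> isotypical i g \<in> carrier k"
  using isotypical_closed[of i] by (auto simp: group_algebra_def)

lemma alg_act_isotypical:
  assumes M: "representation k G M" and i: "i \<le> r" and x: "x \<in> carrier M"
  shows "alg_act G M (isotypical i) x = (\<Oplus>\<^bsub>M\<^esub>b\<in>J i. alg_act G M (munit i b (w i b)) x)"
proof -
  note d = dual_basisD[OF db[OF i]]
  have "alg_act G M (isotypical i) x = alg_act G M (\<lambda>g. \<Oplus>\<^bsub>k\<^esub>b\<in>J i. munit i b (w i b) g) x"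
    by (rule alg_act_cong[OF M])
      (use x munit_closed' i d(4) in \<open>auto simp: isotypical_def intro!: k.finsum_closed\<close>)
  also have "\<dots> = (\<Oplus>\<^bsub>M\<^esub>b\<in>J i. alg_act G M (munit i b (w i b)) x)"
    by (rule alg_act_finsum_coeff[OF M]) (use x munit_closed' i d in auto)
  finally show ?thesis .
qed

lemma isotypical_act_V:
  assumes i: "i \<le> r" and j: "j \<le> r" and v: "v \<in> carrier (V j)"
  shows "alg_act G (V j) (isotypical i) v = (if j = i then v else \<zero>\<^bsub>V j\<^esub>)"
proof -
  note d = dual_basisD[OF db[OF i]]
  interpret Vj: module k "V j" by (rule representationD[OF representation_V[OF j]])
  have "alg_act G (V j) (isotypical i) v = (\<Oplus>\<^bsub>V j\<^esub>b\<in>J i. alg_act G (V j) (munit i b (w i b)) v)"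
    by (rule alg_act_isotypical[OF representation_V[OF j] i v])
  also have "\<dots> = (if j = i then v else \<zero>\<^bsub>V j\<^esub>)"
  proof (cases "j = i")
    case True
    have "(\<Oplus>\<^bsub>V j\<^esub>b\<in>J i. alg_act G (V j) (munit i b (w i b)) v) = (\<Oplus>\<^bsub>V j\<^esub>b\<in>J i. \<gamma> i b v \<odot>\<^bsub>V j\<^esub> w i b)"
      by (rule Vj.M.finsum_cong') (use True v d munit_act_same[OF i] Vj.smult_closed in auto)
    then show ?thesis using dual_basis_expand[OF db[OF i], of v] True v by simp
  next
    case False
    have "(\<Oplus>\<^bsub>V j\<^esub>b\<in>J i. alg_act G (V j) (munit i b (w i b)) v) = (\<Oplus>\<^bsub>V j\<^esub>b\<in>J i. \<zero>\<^bsub>V j\<^esub>)"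
      by (rule Vj.M.finsum_cong') (use False v d munit_act_other[OF i j] in auto)
    then show ?thesis using False by simp
  qed
  finally show ?thesis .
qed

lemma group_algebra_mult_closed:
  assumes "a \<in> carrier (group_algebra k G)" "b \<in> carrier (group_algebra k G)"
  shows "a \<otimes>\<^bsub>group_algebra k G\<^esub> b \<in> carrier (group_algebra k G)"
  using assms by (auto simp: group_algebra_def PiE_iff intro!: k.finsum_closed)

text \<open>By faithfulness, idempotency, centrality and uniqueness can all be tested on the
  \<open>V j\<close>, where the element acts as one or as zero. This makes the definite description
  meaningful and explicit.\<close>

lemma isotypical_idempotent_eq:
  assumes i: "i \<le> r"
  shows "isotypical_idempotent k G r V i = isotypical i"
  unfolding isotypical_idempotent_def
proof (rule the_equality)
  let ?A = "group_algebra k G" and ?e = "isotypical i"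
  note e = isotypical_closed[OF i]
  have zero: "alg_act G (V j) a \<zero>\<^bsub>V j\<^esub> = \<zero>\<^bsub>V j\<^esub>" if "j \<le> r" "a \<in> carrier ?A" for j a
  proof -
    interpret Vj: module k "V j" by (rule representationD[OF representation_V[OF that(1)]])
    have a: "\<And>g. g \<in> carrier G \<Longrightarrow> a g \<in> carrier k" using that by (auto simp: group_algebra_def)
    show ?thesis
      by (rule additive_zero[OF Vj.M.abelian_group_axioms Vj.M.abelian_group_axioms])
        (use module_homsD[OF alg_act_hom[OF representation_V[OF that(1)] a]] in auto)
  qed
  have cl: "alg_act G (V j) a v \<in> carrier (V j)" if "j \<le> r" "a \<in> carrier ?A" "v \<in> carrier (V j)" for j a v
    by (rule alg_act_closed[OF representation_V[OF that(1)] _ that(3)]) (use that in \<open>auto simp: group_algebra_def\<close>)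
  have mult: "alg_act G (V j) (a \<otimes>\<^bsub>?A\<^esub> b) v = alg_act G (V j) a (alg_act G (V j) b v)"
    if "j \<le> r" "a \<in> carrier ?A" "b \<in> carrier ?A" "v \<in> carrier (V j)" for j a b v
    by (rule alg_act_group_algebra_mult[OF representation_V[OF that(1)] that(2,3,4)])
  show "?e \<in> carrier ?A \<and> ?e \<otimes>\<^bsub>?A\<^esub> ?e = ?e \<and> (\<forall>a\<in>carrier ?A. ?e \<otimes>\<^bsub>?A\<^esub> a = a \<otimes>\<^bsub>?A\<^esub> ?e) \<and>
     (\<forall>v\<in>carrier (V i). alg_act G (V i) ?e v = v) \<and>
     (\<forall>j\<le>r. j \<noteq> i \<longrightarrow> (\<forall>v\<in>carrier (V j). alg_act G (V j) ?e v = \<zero>\<^bsub>V j\<^esub>))"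
  proof (intro conjI ballI allI impI)
    show "?e \<otimes>\<^bsub>?A\<^esub> ?e = ?e"
      by (rule group_algebra_faithful)
        (use e group_algebra_mult_closed i in \<open>auto simp: mult isotypical_act_V zero\<close>)
    fix a assume a: "a \<in> carrier ?A"
    show "?e \<otimes>\<^bsub>?A\<^esub> a = a \<otimes>\<^bsub>?A\<^esub> ?e"
      by (rule group_algebra_faithful)
        (use e a group_algebra_mult_closed i in \<open>auto simp: mult isotypical_act_V zero cl\<close>)
  qed (use e isotypical_act_V i in auto)
  fix e' assume e': "e' \<in> carrier ?A \<and> e' \<otimes>\<^bsub>?A\<^esub> e' = e' \<and> (\<forall>a\<in>carrier ?A. e' \<otimes>\<^bsub>?A\<^esub> a = a \<otimes>\<^bsub>?A\<^esub> e') \<and>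
     (\<forall>v\<in>carrier (V i). alg_act G (V i) e' v = v) \<and>
     (\<forall>j\<le>r. j \<noteq> i \<longrightarrow> (\<forall>v\<in>carrier (V j). alg_act G (V j) e' v = \<zero>\<^bsub>V j\<^esub>))"
  show "e' = ?e"
  proof (rule group_algebra_faithful)
    show "alg_act G (V j) e' v = alg_act G (V j) ?e v" if "j \<le> r" "v \<in> carrier (V j)" for j v
      using e' that isotypical_act_V[OF i that] by (cases "j = i") auto
  qed (use e' e in auto)
qed

end

section \<open>Universal property and functoriality of tensor products\<close>

section \<open>Tensor products\<close>

text \<open>Only additivity is recorded, since maps of tensor products may connect modules over
  different rings, as restriction maps do; compatibility with scalars is established
  separately.\<close>

definition add_homs :: "('b, 'm) ring_scheme \<Rightarrow> ('c, 'n) ring_scheme \<Rightarrow> ('b \<Rightarrow> 'c) set" where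
  "add_homs M N = {f \<in> carrier M \<rightarrow> carrier N.
     \<forall>x\<in>carrier M. \<forall>y\<in>carrier M. f (x \<oplus>\<^bsub>M\<^esub> y) = f x \<oplus>\<^bsub>N\<^esub> f y}"

lemma add_homsD:
  assumes "f \<in> add_homs M N"
  shows "x \<in> carrier M \<Longrightarrow> f x \<in> carrier N"
    and "\<lbrakk>x \<in> carrier M; y \<in> carrier M\<rbrakk> \<Longrightarrow> f (x \<oplus>\<^bsub>M\<^esub> y) = f x \<oplus>\<^bsub>N\<^esub> f y"
  using assms by (auto simp: add_homs_def)

lemma add_homsI:
  assumes "\<And>x. x \<in> carrier M \<Longrightarrow> f x \<in> carrier N"
    and "\<And>x y. \<lbrakk>x \<in> carrier M; y \<in> carrier M\<rbrakk> \<Longrightarrow> f (x \<oplus>\<^bsub>M\<^esub> y) = f x \<oplus>\<^bsub>N\<^esub> f y"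
  shows "f \<in> add_homs M N"
  using assms by (auto simp: add_homs_def)

lemma add_homs_zero: "\<lbrakk>abelian_group M; abelian_group N; f \<in> add_homs M N\<rbrakk> \<Longrightarrow> f \<zero>\<^bsub>M\<^esub> = \<zero>\<^bsub>N\<^esub>"
  by (rule additive_zero) (auto simp: add_homs_def)

lemma add_homs_finsum:
  "\<lbrakk>abelian_group M; abelian_group N; f \<in> add_homs M N; x \<in> A \<rightarrow> carrier M\<rbrakk>
    \<Longrightarrow> f (finsum M x A) = (\<Oplus>\<^bsub>N\<^esub>i\<in>A. f (x i))"
  by (rule hom_finsum_additive(2)) (auto simp: add_homs_def)

lemma module_homs_add_homs: "f \<in> module_homs R M N \<Longrightarrow> f \<in> add_homs M N"
  by (auto simp: add_homs_def module_homs_def)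

text \<open>The ring of the balancing action \<open>act\<close> and the scalars of the record
  \<open>M\<close> are kept apart, which covers both base change along a ring homomorphism and
  tensor products over the structure sheaf.\<close>

locale tensor_factors = M: abelian_group M + N: abelian_group N
  for R :: "('r, 'm) ring_scheme" and act :: "'r \<Rightarrow> 'b \<Rightarrow> 'b"
    and M :: "('s, 'b, 'n) module_scheme" and N :: "('r, 'c, 'o) module_scheme" +
  assumes act_closed: "\<lbrakk>a \<in> carrier R; x \<in> carrier M\<rbrakk> \<Longrightarrow> act a x \<in> carrier M"
    and smult_N_closed: "\<lbrakk>a \<in> carrier R; y \<in> carrier N\<rbrakk> \<Longrightarrow> a \<odot>\<^bsub>N\<^esub> y \<in> carrier N"
begin

abbreviation FA :: "('b \<times> 'c \<Rightarrow>\<^sub>0 int) monoid" where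
  "FA \<equiv> free_Abelian_group (carrier M \<times> carrier N)"

abbreviation cls :: "('b \<times> 'c \<Rightarrow>\<^sub>0 int) \<Rightarrow> ('b \<times> 'c \<Rightarrow>\<^sub>0 int) set" where
  "cls \<equiv> tensor_class R act M N"

abbreviation T :: "('s, ('b \<times> 'c \<Rightarrow>\<^sub>0 int) set) module" where
  "T \<equiv> tensor R act M N"

definition pure :: "'b \<Rightarrow> 'c \<Rightarrow> ('b \<times> 'c \<Rightarrow>\<^sub>0 int) set" where
  "pure x y = cls (frag_of (x, y))"

definition rels :: "('b \<times> 'c \<Rightarrow>\<^sub>0 int) set" where
  "rels = {frag_of (x \<oplus>\<^bsub>M\<^esub> x', y) - frag_of (x, y) - frag_of (x', y) | x x' y.
         x \<in> carrier M \<and> x' \<in> carrier M \<and> y \<in> carrier N} \<union>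
      {frag_of (x, y \<oplus>\<^bsub>N\<^esub> y') - frag_of (x, y) - frag_of (x, y') | x y y'.
         x \<in> carrier M \<and> y \<in> carrier N \<and> y' \<in> carrier N} \<union>
      {frag_of (act r x, y) - frag_of (x, r \<odot>\<^bsub>N\<^esub> y) | r x y.
         r \<in> carrier R \<and> x \<in> carrier M \<and> y \<in> carrier N}"

lemma tensor_rel_eq: "tensor_rel R act M N = generate FA rels"
  by (simp add: tensor_rel_def rels_def)

sublocale FA: comm_group FA
  by (rule abelian_free_Abelian_group)

lemma FA_diff: "\<lbrakk>x \<in> carrier FA; y \<in> carrier FA\<rbrakk> \<Longrightarrow> x - y \<in> carrier FA"
  using FA.m_closed[of x "inv\<^bsub>FA\<^esub> y"] FA.inv_closed[of y] by simp

lemma rels_subset: "rels \<subseteq> carrier FA"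
proof -
  have f: "frag_of (x, y) \<in> carrier FA" if "x \<in> carrier M" "y \<in> carrier N" for x y
    using that by (simp only: frag_of_in_free_Abelian_group) simp
  show ?thesis
    unfolding rels_def
    by (auto simp del: carrier_free_Abelian_group_iff intro!: FA_diff f act_closed smult_N_closed)
qed

lemma subgroup_tensor_rel: "subgroup (tensor_rel R act M N) FA"
  unfolding tensor_rel_eq by (rule FA.generate_is_subgroup[OF rels_subset])

lemma normal_tensor_rel: "tensor_rel R act M N \<lhd> FA"
  using subgroup_tensor_rel by (simp add: FA.normal_iff_subgroup)

lemma tensor_simps:
  "carrier T = cls ` carrier FA"
  "\<zero>\<^bsub>T\<^esub> = tensor_rel R act M N"
  "C \<oplus>\<^bsub>T\<^esub> D = C <#>\<^bsub>FA\<^esub> D"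
  "s \<odot>\<^bsub>T\<^esub> C = tensor_map R act M N (\<lambda>x. s \<odot>\<^bsub>M\<^esub> x) id C"
  by (simp_all add: tensor_def Let_def carrier_FactGroup tensor_class_def[abs_def])

lemma cls_closed: "z \<in> carrier FA \<Longrightarrow> cls z \<in> carrier T"
  by (simp add: tensor_simps del: carrier_free_Abelian_group_iff)

lemma cls_add: "\<lbrakk>z \<in> carrier FA; z' \<in> carrier FA\<rbrakk> \<Longrightarrow> cls z \<oplus>\<^bsub>T\<^esub> cls z' = cls (z + z')"
  using normal.rcos_sum[OF normal_tensor_rel, of z z']
  by (simp add: tensor_simps tensor_class_def)

lemma cls_zero: "cls 0 = \<zero>\<^bsub>T\<^esub>"
  using FA.coset_join2[OF FA.one_closed subgroup_tensor_rel subgroup.one_closed[OF subgroup_tensor_rel]]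
  by (simp add: tensor_simps tensor_class_def)

text \<open>The additive structure is literally that of the quotient group, so the laws are copied
  from there.\<close>

lemma abelian_group_tensor: "abelian_group T"
proof -
  interpret Q: comm_group "FA Mod tensor_rel R act M N"
    by (rule FA.abelian_FactGroup[OF subgroup_tensor_rel])
  have eq: "carrier T = carrier (FA Mod tensor_rel R act M N)"
    "ring.add T = monoid.mult (FA Mod tensor_rel R act M N)"
    "ring.zero T = monoid.one (FA Mod tensor_rel R act M N)"
    by (simp_all add: tensor_def Let_def)
  show ?thesis
    by (rule abelian_groupI; unfold eq)
      (rule Q.m_closed Q.one_closed Q.m_assoc Q.m_comm Q.l_one Q.l_inv_ex; assumption)+
qed

sublocale T: abelian_group T
  by (rule abelian_group_tensor)

lemma cls_in: "z \<in> carrier FA \<Longrightarrow> z \<in> cls z"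
  using FA.rcos_self[OF _ subgroup_tensor_rel] by (simp add: tensor_class_def)

lemma cls_memD:
  assumes "z \<in> carrier FA" "z' \<in> cls z"
  obtains t where "t \<in> tensor_rel R act M N" "z' = t + z" "z' \<in> carrier FA"
proof -
  obtain t where t: "t \<in> tensor_rel R act M N" "z' = t + z"
    using assms unfolding tensor_class_def r_coset_def by auto
  have "t \<in> carrier FA" using t(1) subgroup.subset[OF subgroup_tensor_rel] by blast
  then have "z' \<in> carrier FA" using FA.m_closed[of t z] assms(1) t(2) by simp
  with t show ?thesis by (rule that)
qed

lemma cls_eqI:
  assumes "z \<in> carrier FA" "z' \<in> carrier FA" "z - z' \<in> tensor_rel R act M N"
  shows "cls z = cls z'"
proof -
  have "z \<in> tensor_rel R act M N #>\<^bsub>FA\<^esub> z'"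
    unfolding r_coset_def using assms(3) by force
  then show ?thesis
    unfolding tensor_class_def using FA.repr_independence[OF _ assms(2) subgroup_tensor_rel] by simp
qed

lemma frag_of_closed: "\<lbrakk>x \<in> carrier M; y \<in> carrier N\<rbrakk> \<Longrightarrow> frag_of (x, y) \<in> carrier FA"
  by (simp only: frag_of_in_free_Abelian_group) simp

lemma pure_closed: "\<lbrakk>x \<in> carrier M; y \<in> carrier N\<rbrakk> \<Longrightarrow> pure x y \<in> carrier T"
  unfolding pure_def by (intro cls_closed frag_of_closed)

lemma rels_imp_tensor_rel: "z \<in> rels \<Longrightarrow> z \<in> tensor_rel R act M N"
  unfolding tensor_rel_eq by (rule generate.incl)

lemma pure_add_left:
  assumes "x \<in> carrier M" "x' \<in> carrier M" "y \<in> carrier N"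
  shows "pure (x \<oplus>\<^bsub>M\<^esub> x') y = pure x y \<oplus>\<^bsub>T\<^esub> pure x' y"
proof -
  have "frag_of (x \<oplus>\<^bsub>M\<^esub> x', y) - (frag_of (x, y) + frag_of (x', y)) \<in> tensor_rel R act M N"
    by (rule rels_imp_tensor_rel) (use assms in \<open>auto simp: rels_def diff_diff_eq\<close>)
  then show ?thesis
    unfolding pure_def cls_add[OF frag_of_closed[OF assms(1,3)] frag_of_closed[OF assms(2,3)]]
    using assms FA.m_closed[OF frag_of_closed[OF assms(1,3)] frag_of_closed[OF assms(2,3)]]
    by (intro cls_eqI frag_of_closed) simp_all
qed

lemma pure_add_right:
  assumes "x \<in> carrier M" "y \<in> carrier N" "y' \<in> carrier N"
  shows "pure x (y \<oplus>\<^bsub>N\<^esub> y') = pure x y \<oplus>\<^bsub>T\<^esub> pure x y'"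
proof -
  have "frag_of (x, y \<oplus>\<^bsub>N\<^esub> y') - (frag_of (x, y) + frag_of (x, y')) \<in> tensor_rel R act M N"
    by (rule rels_imp_tensor_rel) (use assms in \<open>auto simp: rels_def diff_diff_eq\<close>)
  then show ?thesis
    unfolding pure_def cls_add[OF frag_of_closed[OF assms(1,2)] frag_of_closed[OF assms(1,3)]]
    using assms FA.m_closed[OF frag_of_closed[OF assms(1,2)] frag_of_closed[OF assms(1,3)]]
    by (intro cls_eqI frag_of_closed) simp_all
qed

lemma pure_balanced:
  assumes "a \<in> carrier R" "x \<in> carrier M" "y \<in> carrier N"
  shows "pure (act a x) y = pure x (a \<odot>\<^bsub>N\<^esub> y)"
proof -
  have "frag_of (act a x, y) - frag_of (x, a \<odot>\<^bsub>N\<^esub> y) \<in> tensor_rel R act M N"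
    by (rule rels_imp_tensor_rel) (use assms in \<open>auto simp: rels_def\<close>)
  then show ?thesis
    unfolding pure_def using assms by (intro cls_eqI frag_of_closed act_closed smult_N_closed)
qed

lemma pure_left_add_hom: "y \<in> carrier N \<Longrightarrow> (\<lambda>x. pure x y) \<in> add_homs M T"
  by (rule add_homsI) (simp_all add: pure_closed pure_add_left)

lemma pure_right_add_hom: "x \<in> carrier M \<Longrightarrow> pure x \<in> add_homs N T"
  by (rule add_homsI) (simp_all add: pure_closed pure_add_right)

text \<open>A homomorphism respecting bilinearity and balancing vanishes on the generating
  relations, hence on the subgroup they generate. This is the well-definedness behind both
  \<open>tensor_lift\<close> and \<open>tensor_map\<close>.\<close>

lemma hom_constant_on_cls:
  assumes Z: "abelian_group Z" and h: "h \<in> hom FA (add_monoid Z)"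
    and left: "\<And>x x' y. \<lbrakk>x \<in> carrier M; x' \<in> carrier M; y \<in> carrier N\<rbrakk> \<Longrightarrow>
      h (frag_of (x \<oplus>\<^bsub>M\<^esub> x', y)) = h (frag_of (x, y)) \<oplus>\<^bsub>Z\<^esub> h (frag_of (x', y))"
    and right: "\<And>x y y'. \<lbrakk>x \<in> carrier M; y \<in> carrier N; y' \<in> carrier N\<rbrakk> \<Longrightarrow>
      h (frag_of (x, y \<oplus>\<^bsub>N\<^esub> y')) = h (frag_of (x, y)) \<oplus>\<^bsub>Z\<^esub> h (frag_of (x, y'))"
    and bal: "\<And>a x y. \<lbrakk>a \<in> carrier R; x \<in> carrier M; y \<in> carrier N\<rbrakk> \<Longrightarrow>
      h (frag_of (act a x, y)) = h (frag_of (x, a \<odot>\<^bsub>N\<^esub> y))"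
    and z: "z \<in> carrier FA" "z' \<in> cls z"
  shows "h z' = h z"
proof -
  interpret Z: abelian_group Z by fact
  have hc: "h z \<in> carrier Z" if "z \<in> carrier FA" for z
    using h that by (auto simp: hom_def)
  have hadd: "h (z + z') = h z \<oplus>\<^bsub>Z\<^esub> h z'" if "z \<in> carrier FA" "z' \<in> carrier FA" for z z'
    using h that by (auto simp: hom_def)
  have hdiff: "h (z - z') \<oplus>\<^bsub>Z\<^esub> h z' = h z" if "z \<in> carrier FA" "z' \<in> carrier FA" for z z'
    using hadd[OF FA_diff[OF that] that(2)] by simp
  interpret h: group_hom FA "add_monoid Z" h
    by unfold_locales (rule h)
  have eq0: "h (z - z') = \<zero>\<^bsub>Z\<^esub>" if "z \<in> carrier FA" "z' \<in> carrier FA" "h z = h z'" for z z'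
    using hdiff[OF that(1,2)] Z.add.r_cancel_one[OF hc[OF that(2)] hc[OF FA_diff[OF that(1,2)]]] that(3)
    by simp
  have add_closed: "u + v \<in> carrier FA" if "u \<in> carrier FA" "v \<in> carrier FA" for u v
    using FA.m_closed[OF that] by simp
  have "h t = \<zero>\<^bsub>Z\<^esub>" if "t \<in> rels" for t
    using that unfolding rels_def
  proof (elim UnE CollectE exE conjE)
    fix x x' y
    assume t: "t = frag_of (x \<oplus>\<^bsub>M\<^esub> x', y) - frag_of (x, y) - frag_of (x', y)"
      and xy: "x \<in> carrier M" "x' \<in> carrier M" "y \<in> carrier N"
    show ?thesis
      unfolding t diff_diff_eq
    proof (rule eq0)
      show "h (frag_of (x \<oplus>\<^bsub>M\<^esub> x', y)) = h (frag_of (x, y) + frag_of (x', y))"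
        unfolding left[OF xy] hadd[OF frag_of_closed[OF xy(1,3)] frag_of_closed[OF xy(2,3)]] ..
    qed (intro add_closed frag_of_closed M.a_closed xy)+
  next
    fix x y y'
    assume t: "t = frag_of (x, y \<oplus>\<^bsub>N\<^esub> y') - frag_of (x, y) - frag_of (x, y')"
      and xy: "x \<in> carrier M" "y \<in> carrier N" "y' \<in> carrier N"
    show ?thesis
      unfolding t diff_diff_eq
    proof (rule eq0)
      show "h (frag_of (x, y \<oplus>\<^bsub>N\<^esub> y')) = h (frag_of (x, y) + frag_of (x, y'))"
        unfolding right[OF xy] hadd[OF frag_of_closed[OF xy(1,2)] frag_of_closed[OF xy(1,3)]] ..
    qed (intro add_closed frag_of_closed N.a_closed xy)+
  next
    fix a x y
    assume t: "t = frag_of (act a x, y) - frag_of (x, a \<odot>\<^bsub>N\<^esub> y)"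
      and xy: "a \<in> carrier R" "x \<in> carrier M" "y \<in> carrier N"
    show ?thesis
      unfolding t by (intro eq0 frag_of_closed act_closed smult_N_closed bal xy)
  qed
  then have "rels \<subseteq> kernel FA (add_monoid Z) h"
    using rels_subset by (auto simp: kernel_def simp del: carrier_free_Abelian_group_iff)
  then have ker: "tensor_rel R act M N \<subseteq> kernel FA (add_monoid Z) h"
    unfolding tensor_rel_eq by (rule FA.generate_subgroup_incl[OF _ h.subgroup_kernel])
  obtain t where t: "t \<in> tensor_rel R act M N" "z' = t + z"
    using cls_memD[OF z] by blast
  then have "t \<in> carrier FA" "h t = \<zero>\<^bsub>Z\<^esub>" using ker by (auto simp: kernel_def)
  then show ?thesis using hadd[of t z] t z hc[OF z(1)] by simp
qed

text \<open>The universal property: extend to the free abelian group, then evaluate at any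
  representative of a class.\<close>

lemma tensor_lift:
  assumes Z: "abelian_group Z"
    and fc: "\<And>x y. \<lbrakk>x \<in> carrier M; y \<in> carrier N\<rbrakk> \<Longrightarrow> f x y \<in> carrier Z"
    and left: "\<And>x x' y. \<lbrakk>x \<in> carrier M; x' \<in> carrier M; y \<in> carrier N\<rbrakk> \<Longrightarrow> f (x \<oplus>\<^bsub>M\<^esub> x') y = f x y \<oplus>\<^bsub>Z\<^esub> f x' y"
    and right: "\<And>x y y'. \<lbrakk>x \<in> carrier M; y \<in> carrier N; y' \<in> carrier N\<rbrakk> \<Longrightarrow> f x (y \<oplus>\<^bsub>N\<^esub> y') = f x y \<oplus>\<^bsub>Z\<^esub> f x y'"
    and bal: "\<And>a x y. \<lbrakk>a \<in> carrier R; x \<in> carrier M; y \<in> carrier N\<rbrakk> \<Longrightarrow> f (act a x) y = f x (a \<odot>\<^bsub>N\<^esub> y)"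
  obtains L where "L \<in> add_homs T Z" "\<And>x y. \<lbrakk>x \<in> carrier M; y \<in> carrier N\<rbrakk> \<Longrightarrow> L (pure x y) = f x y"
proof -
  interpret Z: abelian_group Z by fact
  obtain h where h: "h \<in> hom FA (add_monoid Z)"
    and h_of: "\<And>p. p \<in> carrier M \<times> carrier N \<Longrightarrow> h (frag_of p) = (case p of (x, y) \<Rightarrow> f x y)"
  proof (rule Z.add.free_Abelian_group_universal[of "\<lambda>p. case p of (x, y) \<Rightarrow> f x y" "carrier M \<times> carrier N"])
    show "(\<lambda>p. case p of (x, y) \<Rightarrow> f x y) ` (carrier M \<times> carrier N) \<subseteq> carrier Z" using fc by auto
  qed (use that in auto)
  have h_of': "h (frag_of (x, y)) = f x y" if "x \<in> carrier M" "y \<in> carrier N" for x y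
    using h_of[of "(x, y)"] that by simp
  have const: "h z' = h z" if "z \<in> carrier FA" "z' \<in> cls z" for z z'
    by (rule hom_constant_on_cls[OF Z h _ _ _ that])
      (simp_all add: h_of' left right bal act_closed smult_N_closed)
  define L where "L C = h (SOME z. z \<in> C)" for C
  have L: "L (cls z) = h z" if "z \<in> carrier FA" for z
    unfolding L_def by (rule const[OF that]) (rule someI[of "\<lambda>z'. z' \<in> cls z", OF cls_in[OF that]])
  have hc: "h z \<in> carrier Z" if "z \<in> carrier FA" for z
    using h that by (auto simp: hom_def)
  have hadd: "h (z + z') = h z \<oplus>\<^bsub>Z\<^esub> h z'" if "z \<in> carrier FA" "z' \<in> carrier FA" for z z'
    using h that by (auto simp: hom_def)
  have "L \<in> add_homs T Z"
  proof (rule add_homsI)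
    fix C assume "C \<in> carrier T"
    then show "L C \<in> carrier Z" using L hc by (auto simp: tensor_simps(1) simp del: carrier_free_Abelian_group_iff)
  next
    fix C D assume "C \<in> carrier T" "D \<in> carrier T"
    then obtain z z' where z: "z \<in> carrier FA" "C = cls z" "z' \<in> carrier FA" "D = cls z'"
      by (auto simp: tensor_simps(1) simp del: carrier_free_Abelian_group_iff)
    moreover have "z + z' \<in> carrier FA" using FA.m_closed[OF z(1,3)] by simp
    ultimately show "L (C \<oplus>\<^bsub>T\<^esub> D) = L C \<oplus>\<^bsub>Z\<^esub> L D"
      by (simp add: cls_add L hadd del: carrier_free_Abelian_group_iff)
  qed
  moreover have "L (pure x y) = f x y" if "x \<in> carrier M" "y \<in> carrier N" for x y
    unfolding pure_def using L[OF frag_of_closed[OF that]] h_of'[OF that] by simp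
  ultimately show thesis by (rule that)
qed

lemma tensor_induct:
  assumes C: "C \<in> carrier T"
    and pure: "\<And>x y. \<lbrakk>x \<in> carrier M; y \<in> carrier N\<rbrakk> \<Longrightarrow> P (pure x y)"
    and add: "\<And>C D. \<lbrakk>C \<in> carrier T; D \<in> carrier T; P C; P D\<rbrakk> \<Longrightarrow> P (C \<oplus>\<^bsub>T\<^esub> D)"
  shows "P C"
proof -
  obtain z where z: "z \<in> carrier FA" "C = cls z"
    using C by (auto simp: tensor_simps(1) simp del: carrier_free_Abelian_group_iff)
  have keys: "Poly_Mapping.keys z \<subseteq> carrier M \<times> carrier N" using z by simp
  \<comment> \<open>The induction on the free group proceeds through differences, whereas
    \<open>P\<close> is only known to respect sums. Carrying along the class of \<open>- z\<close>
    closes the gap, because the negative of a pure tensor is again pure.\<close>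
  have "z \<in> carrier FA \<and> P (cls z) \<and> P (cls (- z))"
    using keys
  proof (induction z rule: free_Abelian_group_induct[consumes 1, case_names zero diff one])
    case zero
    have "pure \<zero>\<^bsub>M\<^esub> \<zero>\<^bsub>N\<^esub> = \<zero>\<^bsub>T\<^esub>"
      by (rule add_homs_zero[OF M.abelian_group_axioms T.abelian_group_axioms pure_left_add_hom]) simp
    then show ?case using pure[of "\<zero>\<^bsub>M\<^esub>" "\<zero>\<^bsub>N\<^esub>"] cls_zero by simp
  next
    case (diff a b)
    have ab: "a \<in> carrier FA" "b \<in> carrier FA" "- a \<in> carrier FA" "- b \<in> carrier FA"
      using diff FA.inv_closed[of a] FA.inv_closed[of b] by auto
    have "cls (a - b) = cls a \<oplus>\<^bsub>T\<^esub> cls (- b)" "cls (- (a - b)) = cls (- a) \<oplus>\<^bsub>T\<^esub> cls b"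
      using cls_add[OF ab(1,4)] cls_add[OF ab(3,2)] by (simp_all add: algebra_simps)
    then show ?case
      using add[of "cls a" "cls (- b)"] add[of "cls (- a)" "cls b"] ab diff cls_closed FA_diff by metis
  next
    case (one p)
    then obtain x y where p: "p = (x, y)" "x \<in> carrier M" "y \<in> carrier N" by auto
    have "cls (- frag_of p) = pure (\<ominus>\<^bsub>M\<^esub> x) y"
    proof -
      have f: "frag_of p \<in> carrier FA" "- frag_of p \<in> carrier FA"
        using frag_of_closed[OF p(2,3)] FA.inv_closed[of "frag_of p"] p(1) by auto
      have "cls (- frag_of p) \<oplus>\<^bsub>T\<^esub> pure x y = \<zero>\<^bsub>T\<^esub>"
        using cls_add[OF f(2,1)] cls_zero p(1) by (simp add: pure_def)
      moreover have "pure (\<ominus>\<^bsub>M\<^esub> x) y \<oplus>\<^bsub>T\<^esub> pure x y = \<zero>\<^bsub>T\<^esub>"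
        using pure_add_left[of "\<ominus>\<^bsub>M\<^esub> x" x y] p add_homs_zero[OF M.abelian_group_axioms T.abelian_group_axioms pure_left_add_hom[OF p(3)]]
        by (simp add: M.l_neg)
      ultimately show ?thesis
        using pure_closed cls_closed[OF f(2)] p by (metis M.a_inv_closed T.minus_equality)
    qed
    then show ?case
      using pure[of "\<ominus>\<^bsub>M\<^esub> x" y] pure[OF p(2,3)] p frag_of_closed by (simp add: pure_def)
  qed
  then show ?thesis using z by simp
qed

text \<open>Pure tensors generate the tensor product under addition.\<close>

lemma tensor_hom_eq:
  assumes f: "f \<in> add_homs T Z" and g: "g \<in> add_homs T Z"
    and eq: "\<And>x y. \<lbrakk>x \<in> carrier M; y \<in> carrier N\<rbrakk> \<Longrightarrow> f (pure x y) = g (pure x y)"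
    and C: "C \<in> carrier T"
  shows "f C = g C"
  by (rule tensor_induct[OF C]) (simp_all add: eq add_homsD[OF f] add_homsD[OF g])

text \<open>All representatives of a class have the same image class, so the union in
  \<open>tensor_map\<close> runs over a constant family.\<close>

lemma tensor_map_hom:
  fixes R' :: "('r2, 'm2) ring_scheme" and M' :: "('s2, 'b2, 'n2) module_scheme" and N' :: "('r2, 'c2, 'o2) module_scheme"
  assumes src: "tensor_factors R' act' M' N'"
    and f: "f \<in> add_homs M' M" and g: "g \<in> add_homs N' N"
    and bal: "\<And>a x y. \<lbrakk>a \<in> carrier R'; x \<in> carrier M'; y \<in> carrier N'\<rbrakk> \<Longrightarrow>
       pure (f (act' a x)) (g y) = pure (f x) (g (a \<odot>\<^bsub>N'\<^esub> y))"
  shows "tensor_map R act M N f g \<in> add_homs (tensor R' act' M' N') T"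
    and "\<lbrakk>x \<in> carrier M'; y \<in> carrier N'\<rbrakk> \<Longrightarrow>
      tensor_map R act M N f g (tensor_factors.pure R' act' M' N' x y) = pure (f x) (g y)"
proof -
  interpret S: tensor_factors R' act' M' N' by (rule src)
  let ?e = "frag_extend (\<lambda>(x, y). frag_of (f x, g y))"
  note f' = add_homsD[OF f] and g' = add_homsD[OF g]
  have e: "?e z \<in> carrier FA" if "z \<in> carrier S.FA" for z
  proof -
    have "Poly_Mapping.keys z \<subseteq> carrier M' \<times> carrier N'" using that by simp
    then show ?thesis
    proof (induction z rule: free_Abelian_group_induct[consumes 1, case_names zero diff one])
      case (one p)
      then show ?case using f' g' frag_of_closed by (auto simp del: carrier_free_Abelian_group_iff)
    qed (use FA_diff FA.one_closed in \<open>auto simp: frag_extend_diff simp del: carrier_free_Abelian_group_iff\<close>)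
  qed
  have hom: "(\<lambda>z. cls (?e z)) \<in> hom S.FA (add_monoid T)"
    using e cls_closed cls_add
    by (auto simp: hom_def frag_extend_add simp del: carrier_free_Abelian_group_iff)
  have const: "cls (?e z') = cls (?e z)" if "z \<in> carrier S.FA" "z' \<in> S.cls z" for z z'
    by (rule S.hom_constant_on_cls[OF T.abelian_group_axioms hom _ _ _ that])
      (simp_all add: f' g' pure_def[symmetric] pure_add_left pure_add_right bal)
  have map: "tensor_map R act M N f g (S.cls z) = cls (?e z)" if "z \<in> carrier S.FA" for z
    unfolding tensor_map_def using const[OF that] S.cls_in[OF that] by blast
  show "tensor_map R act M N f g \<in> add_homs S.T T"
  proof (rule add_homsI)
    fix C assume "C \<in> carrier S.T"
    then obtain z where "z \<in> carrier S.FA" "C = S.cls z"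
      by (auto simp: S.tensor_simps(1) simp del: carrier_free_Abelian_group_iff)
    then show "tensor_map R act M N f g C \<in> carrier T"
      using map cls_closed[OF e] by simp
  next
    fix C D assume "C \<in> carrier S.T" "D \<in> carrier S.T"
    then obtain z z' where z: "z \<in> carrier S.FA" "C = S.cls z" "z' \<in> carrier S.FA" "D = S.cls z'"
      by (auto simp: S.tensor_simps(1) simp del: carrier_free_Abelian_group_iff)
    have "z + z' \<in> carrier S.FA" using S.FA.m_closed[OF z(1,3)] by simp
    then show "tensor_map R act M N f g (C \<oplus>\<^bsub>S.T\<^esub> D) = tensor_map R act M N f g C \<oplus>\<^bsub>T\<^esub> tensor_map R act M N f g D"
      using z cls_add[OF e[OF z(1)] e[OF z(3)]] by (simp add: map S.cls_add frag_extend_add del: carrier_free_Abelian_group_iff)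
  qed
  show "tensor_map R act M N f g (S.pure x y) = pure (f x) (g y)" if "x \<in> carrier M'" "y \<in> carrier N'"
    unfolding S.pure_def map[OF S.frag_of_closed[OF that]] by (simp add: pure_def)
qed

end

lemma add_homs_comp: "\<lbrakk>f \<in> add_homs M N; g \<in> add_homs N P\<rbrakk> \<Longrightarrow> (\<lambda>x. g (f x)) \<in> add_homs M P"
  by (rule add_homsI) (simp_all add: add_homsD)

text \<open>A criterion with an explicit inverse: \<open>z\<close> is sent to the sum over
  \<open>B\<close> of the pure tensors of \<open>p b z\<close> and \<open>q b z\<close>. One
  composite needs checking on pure tensors only. It serves twice with basis expansions, for the base
  change of a free module and for the isotypical pieces.\<close>

lemma (in tensor_factors) tensor_iso:
  assumes Z: "abelian_group Z"
    and fc: "\<And>x y. \<lbrakk>x \<in> carrier M; y \<in> carrier N\<rbrakk> \<Longrightarrow> f x y \<in> carrier Z"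
    and left: "\<And>x x' y. \<lbrakk>x \<in> carrier M; x' \<in> carrier M; y \<in> carrier N\<rbrakk> \<Longrightarrow> f (x \<oplus>\<^bsub>M\<^esub> x') y = f x y \<oplus>\<^bsub>Z\<^esub> f x' y"
    and right: "\<And>x y y'. \<lbrakk>x \<in> carrier M; y \<in> carrier N; y' \<in> carrier N\<rbrakk> \<Longrightarrow> f x (y \<oplus>\<^bsub>N\<^esub> y') = f x y \<oplus>\<^bsub>Z\<^esub> f x y'"
    and bal: "\<And>a x y. \<lbrakk>a \<in> carrier R; x \<in> carrier M; y \<in> carrier N\<rbrakk> \<Longrightarrow> f (act a x) y = f x (a \<odot>\<^bsub>N\<^esub> y)"
    and pq: "\<And>b z. \<lbrakk>b \<in> B; z \<in> carrier Z\<rbrakk> \<Longrightarrow> p b z \<in> carrier M" "\<And>b z. \<lbrakk>b \<in> B; z \<in> carrier Z\<rbrakk> \<Longrightarrow> q b z \<in> carrier N"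
    and LJ: "\<And>z. z \<in> carrier Z \<Longrightarrow> (\<Oplus>\<^bsub>Z\<^esub>b\<in>B. f (p b z) (q b z)) = z"
    and JL: "\<And>x y. \<lbrakk>x \<in> carrier M; y \<in> carrier N\<rbrakk> \<Longrightarrow> (\<Oplus>\<^bsub>T\<^esub>b\<in>B. pure (p b (f x y)) (q b (f x y))) = pure x y"
    and add: "\<And>b. b \<in> B \<Longrightarrow> (\<lambda>z. pure (p b z) (q b z)) \<in> add_homs Z T"
  shows "\<exists>L\<in>add_homs T Z. (\<forall>x\<in>carrier M. \<forall>y\<in>carrier N. L (pure x y) = f x y) \<and> bij_betw L (carrier T) (carrier Z)"
proof -
  interpret Z: abelian_group Z by fact
  obtain L where L: "L \<in> add_homs T Z" and L_pure: "\<And>x y. \<lbrakk>x \<in> carrier M; y \<in> carrier N\<rbrakk> \<Longrightarrow> L (pure x y) = f x y"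
    using tensor_lift[OF Z fc left right bal] by blast
  define j where "j z = (\<Oplus>\<^bsub>T\<^esub>b\<in>B. pure (p b z) (q b z))" for z
  have jc: "j z \<in> carrier T" if "z \<in> carrier Z" for z
    unfolding j_def using that pq pure_closed by (intro T.finsum_closed) auto
  have j: "j \<in> add_homs Z T"
  proof (rule add_homsI)
    fix z z' assume z: "z \<in> carrier Z" "z' \<in> carrier Z"
    have "j (z \<oplus>\<^bsub>Z\<^esub> z') = (\<Oplus>\<^bsub>T\<^esub>b\<in>B. pure (p b z) (q b z) \<oplus>\<^bsub>T\<^esub> pure (p b z') (q b z'))"
      unfolding j_def by (rule T.finsum_cong') (use z add_homsD(2)[OF add] pq pure_closed in auto)
    also have "\<dots> = j z \<oplus>\<^bsub>T\<^esub> j z'"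
      unfolding j_def by (rule T.finsum_addf) (use z pq pure_closed in auto)
    finally show "j (z \<oplus>\<^bsub>Z\<^esub> z') = j z \<oplus>\<^bsub>T\<^esub> j z'" .
  qed (rule jc)
  have Lj: "L (j z) = z" if z: "z \<in> carrier Z" for z
  proof -
    have "L (j z) = (\<Oplus>\<^bsub>Z\<^esub>b\<in>B. L (pure (p b z) (q b z)))"
      unfolding j_def
      by (rule add_homs_finsum[OF T.abelian_group_axioms Z L]) (use z pq pure_closed in auto)
    also have "\<dots> = (\<Oplus>\<^bsub>Z\<^esub>b\<in>B. f (p b z) (q b z))"
      by (rule Z.finsum_cong') (use z pq L_pure fc in auto)
    finally show ?thesis using LJ[OF z] by simp
  qed
  have jL: "j (L C) = C" if C: "C \<in> carrier T" for C
  proof -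
    have "(\<lambda>C. j (L C)) \<in> add_homs T T"
      by (rule add_homs_comp[OF L j])
    moreover have "(\<lambda>C. C) \<in> add_homs T T" by (simp add: add_homs_def)
    ultimately show ?thesis
      by (rule tensor_hom_eq[OF _ _ _ C]) (simp add: L_pure j_def JL)
  qed
  have "bij_betw L (carrier T) (carrier Z)"
    by (rule bij_betw_byWitness[of _ j]) (use Lj jL add_homsD(1)[OF L] jc in auto)
  with L L_pure show ?thesis by blast
qed

section \<open>Coordinates on the tensor product of a ring with a finite-dimensional space\<close>

section \<open>Base change of a free module\<close>

lemma dsum_module_simps [simp]:
  "carrier (dsum_module I M) = (\<Pi>\<^sub>E i\<in>I. carrier (M i))"
  "\<zero>\<^bsub>dsum_module I M\<^esub> = (\<lambda>i\<in>I. \<zero>\<^bsub>M i\<^esub>)"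
  "x \<oplus>\<^bsub>dsum_module I M\<^esub> y = (\<lambda>i\<in>I. x i \<oplus>\<^bsub>M i\<^esub> y i)"
  "a \<odot>\<^bsub>dsum_module I M\<^esub> x = (\<lambda>i\<in>I. a \<odot>\<^bsub>M i\<^esub> x i)"
  by (simp_all add: dsum_module_def)

lemma module_dsum_module:
  assumes R: "cring R" and M: "\<And>i. i \<in> I \<Longrightarrow> module R (M i)"
  shows "module R (dsum_module I M)"
proof (rule moduleI[OF R])
  note M' = M[THEN module.axioms(2)]
  show "abelian_group (dsum_module I M)"
  proof (rule abelian_groupI)
    fix x assume x: "x \<in> carrier (dsum_module I M)"
    have "(\<lambda>i\<in>I. \<ominus>\<^bsub>M i\<^esub> x i) \<in> carrier (dsum_module I M)"
      using x by (auto simp: PiE_iff intro!: abelian_group.a_inv_closed[OF M'])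
    moreover have "(\<lambda>i\<in>I. \<ominus>\<^bsub>M i\<^esub> x i) \<oplus>\<^bsub>dsum_module I M\<^esub> x = \<zero>\<^bsub>dsum_module I M\<^esub>"
      using x by (auto simp: PiE_iff intro!: restrict_ext abelian_group.l_neg[OF M'])
    ultimately show "\<exists>y\<in>carrier (dsum_module I M). y \<oplus>\<^bsub>dsum_module I M\<^esub> x = \<zero>\<^bsub>dsum_module I M\<^esub>" by blast
  next
    fix x y z assume "x \<in> carrier (dsum_module I M)" "y \<in> carrier (dsum_module I M)" "z \<in> carrier (dsum_module I M)"
    then show "x \<oplus>\<^bsub>dsum_module I M\<^esub> y \<oplus>\<^bsub>dsum_module I M\<^esub> z = x \<oplus>\<^bsub>dsum_module I M\<^esub> (y \<oplus>\<^bsub>dsum_module I M\<^esub> z)"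
      using abelian_groupE(3)[OF M'] by (auto simp: PiE_iff intro!: restrict_ext)
  next
    fix x y assume "x \<in> carrier (dsum_module I M)" "y \<in> carrier (dsum_module I M)"
    then show "x \<oplus>\<^bsub>dsum_module I M\<^esub> y = y \<oplus>\<^bsub>dsum_module I M\<^esub> x"
      "x \<oplus>\<^bsub>dsum_module I M\<^esub> y \<in> carrier (dsum_module I M)"
      using abelian_groupE(1,4)[OF M'] by (auto simp: PiE_iff intro!: restrict_ext)
  next
    fix x assume "x \<in> carrier (dsum_module I M)"
    then show "\<zero>\<^bsub>dsum_module I M\<^esub> \<oplus>\<^bsub>dsum_module I M\<^esub> x = x"
      using abelian_groupE(5)[OF M'] by (auto simp: PiE_iff intro!: extensionalityI[of _ I])
  qed (use abelian_groupE(2)[OF M'] in auto)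
next
  fix a x assume "a \<in> carrier R" "x \<in> carrier (dsum_module I M)"
  then show "a \<odot>\<^bsub>dsum_module I M\<^esub> x \<in> carrier (dsum_module I M)"
    using module.smult_closed[OF M] by auto
next
  fix a b x assume "a \<in> carrier R" "b \<in> carrier R" "x \<in> carrier (dsum_module I M)"
  then show "(a \<oplus>\<^bsub>R\<^esub> b) \<odot>\<^bsub>dsum_module I M\<^esub> x = a \<odot>\<^bsub>dsum_module I M\<^esub> x \<oplus>\<^bsub>dsum_module I M\<^esub> b \<odot>\<^bsub>dsum_module I M\<^esub> x"
    "(a \<otimes>\<^bsub>R\<^esub> b) \<odot>\<^bsub>dsum_module I M\<^esub> x = a \<odot>\<^bsub>dsum_module I M\<^esub> (b \<odot>\<^bsub>dsum_module I M\<^esub> x)"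
    using module.smult_l_distr[OF M] module.smult_assoc1[OF M] by (auto simp: PiE_iff intro!: restrict_ext)
next
  fix a x y assume "a \<in> carrier R" "x \<in> carrier (dsum_module I M)" "y \<in> carrier (dsum_module I M)"
  then show "a \<odot>\<^bsub>dsum_module I M\<^esub> (x \<oplus>\<^bsub>dsum_module I M\<^esub> y) = a \<odot>\<^bsub>dsum_module I M\<^esub> x \<oplus>\<^bsub>dsum_module I M\<^esub> a \<odot>\<^bsub>dsum_module I M\<^esub> y"
    using module.smult_r_distr[OF M] by (auto simp: PiE_iff intro!: restrict_ext)
next
  fix x assume "x \<in> carrier (dsum_module I M)"
  then show "\<one>\<^bsub>R\<^esub> \<odot>\<^bsub>dsum_module I M\<^esub> x = x"
    using module.smult_one[OF M] by (auto simp: PiE_iff intro!: extensionalityI[of _ I])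
qed

text \<open>The projection to one component is additive.\<close>

lemma finsum_dsum_module:
  assumes R: "cring R" and M: "\<And>i. i \<in> I \<Longrightarrow> module R (M i)"
    and x: "x \<in> A \<rightarrow> carrier (dsum_module I M)" and i: "i \<in> I"
  shows "finsum (dsum_module I M) x A i = (\<Oplus>\<^bsub>M i\<^esub>a\<in>A. x a i)"
  by (rule hom_finsum_additive(2)[of "dsum_module I M" "M i" "\<lambda>y. y i"])
    (use assms module.axioms(2)[OF module_dsum_module[OF R M]] module.axioms(2)[OF M] in auto)

abbreviation free_module :: "'b ring \<Rightarrow> 'i set \<Rightarrow> ('b, 'i \<Rightarrow> 'b) module" where
  "free_module B J \<equiv> dsum_module J (\<lambda>_. ring_module B)"

locale free_base_change = k: cring k + B: cring B + V: module k V
  for k :: "'k ring" and B :: "'b ring" and h :: "'k \<Rightarrow> 'b" and V :: "('k, 'v, 'g) rep"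
    and J :: "'i set" and w :: "'i \<Rightarrow> 'v" and \<gamma> :: "'i \<Rightarrow> 'v \<Rightarrow> 'k" +
  assumes h: "h \<in> ring_hom k B" and db: "dual_basis k V J w \<gamma>"
begin

lemma tensor_factors_base_change: "tensor_factors k (alg_scale B h) (ring_module B) V"
proof -
  interpret RB: module B "ring_module B" by (rule module_ring_module[OF B.is_cring])
  show ?thesis
    by unfold_locales (use ring_hom_closed[OF h] in \<open>auto simp: alg_scale_def\<close>)
qed

sublocale BC: tensor_factors k "alg_scale B h" "ring_module B" V
  by (rule tensor_factors_base_change)

lemma module_free: "module B (free_module B J)"
  by (rule module_dsum_module[OF B.is_cring module_ring_module[OF B.is_cring]])

sublocale F: module B "free_module B J"
  by (rule module_free)

definition is_coords :: "(('b \<times> 'v \<Rightarrow>\<^sub>0 int) set \<Rightarrow> 'i \<Rightarrow> 'b) \<Rightarrow> bool" where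
  "is_coords L \<longleftrightarrow> L \<in> add_homs BC.T (free_module B J) \<and>
     (\<forall>x\<in>carrier B. \<forall>y\<in>carrier V. L (BC.pure x y) = (\<lambda>j\<in>J. x \<otimes>\<^bsub>B\<^esub> h (\<gamma> j y))) \<and>
     bij_betw L (carrier BC.T) (carrier (free_module B J))"

lemma h_simps:
  "a \<in> carrier k \<Longrightarrow> h a \<in> carrier B"
  "\<lbrakk>a \<in> carrier k; b \<in> carrier k\<rbrakk> \<Longrightarrow> h (a \<oplus>\<^bsub>k\<^esub> b) = h a \<oplus>\<^bsub>B\<^esub> h b"
  "\<lbrakk>a \<in> carrier k; b \<in> carrier k\<rbrakk> \<Longrightarrow> h (a \<otimes>\<^bsub>k\<^esub> b) = h a \<otimes>\<^bsub>B\<^esub> h b"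
  "h \<one>\<^bsub>k\<^esub> = \<one>\<^bsub>B\<^esub>" "h \<zero>\<^bsub>k\<^esub> = \<zero>\<^bsub>B\<^esub>"
  using h ring_hom_zero[OF h k.ring_axioms B.ring_axioms] by (auto simp: ring_hom_def)

text \<open>The inverse sends \<open>z\<close> to the sum of the pure tensors of \<open>z j\<close>
  and \<open>w j\<close>. Balancing moves the coordinates of \<open>y\<close> across the tensor
  sign, where they recombine to \<open>y\<close>.\<close>

lemma exists_coords: "\<exists>L. is_coords L"
proof -
  note d = dual_basisD[OF db]
  have "\<exists>L\<in>add_homs BC.T (free_module B J).
     (\<forall>x\<in>carrier (ring_module B). \<forall>y\<in>carrier V. L (BC.pure x y) = (\<lambda>j\<in>J. x \<otimes>\<^bsub>B\<^esub> h (\<gamma> j y))) \<and>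
     bij_betw L (carrier BC.T) (carrier (free_module B J))"
  proof (rule BC.tensor_iso[where B = J and p = "\<lambda>j z. z j" and q = "\<lambda>j z. w j"])
    show "abelian_group (free_module B J)" by (rule F.M.abelian_group_axioms)
    show "(\<lambda>j\<in>J. x \<otimes>\<^bsub>B\<^esub> h (\<gamma> j y)) \<in> carrier (free_module B J)"
      if "x \<in> carrier (ring_module B)" "y \<in> carrier V" for x y
      using that d h_simps by auto
    show "(\<lambda>j\<in>J. (x \<oplus>\<^bsub>ring_module B\<^esub> x') \<otimes>\<^bsub>B\<^esub> h (\<gamma> j y))
       = (\<lambda>j\<in>J. x \<otimes>\<^bsub>B\<^esub> h (\<gamma> j y)) \<oplus>\<^bsub>free_module B J\<^esub> (\<lambda>j\<in>J. x' \<otimes>\<^bsub>B\<^esub> h (\<gamma> j y))"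
      if "x \<in> carrier (ring_module B)" "x' \<in> carrier (ring_module B)" "y \<in> carrier V" for x x' y
      using that d h_simps by (auto simp: B.l_distr intro!: restrict_ext)
    show "(\<lambda>j\<in>J. x \<otimes>\<^bsub>B\<^esub> h (\<gamma> j (y \<oplus>\<^bsub>V\<^esub> y')))
       = (\<lambda>j\<in>J. x \<otimes>\<^bsub>B\<^esub> h (\<gamma> j y)) \<oplus>\<^bsub>free_module B J\<^esub> (\<lambda>j\<in>J. x \<otimes>\<^bsub>B\<^esub> h (\<gamma> j y'))"
      if "x \<in> carrier (ring_module B)" "y \<in> carrier V" "y' \<in> carrier V" for x y y'
      using that d h_simps by (auto simp: B.r_distr intro!: restrict_ext)
    show "(\<lambda>j\<in>J. alg_scale B h a x \<otimes>\<^bsub>B\<^esub> h (\<gamma> j y)) = (\<lambda>j\<in>J. x \<otimes>\<^bsub>B\<^esub> h (\<gamma> j (a \<odot>\<^bsub>V\<^esub> y)))"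
      if "a \<in> carrier k" "x \<in> carrier (ring_module B)" "y \<in> carrier V" for a x y
      using that d h_simps by (auto simp: alg_scale_def B.m_ac intro!: restrict_ext)
    show "z j \<in> carrier (ring_module B)" if "j \<in> J" "z \<in> carrier (free_module B J)" for j z
      using that by auto
    show "w j \<in> carrier V" if "j \<in> J" for j
      using that d by auto
    show "(\<Oplus>\<^bsub>free_module B J\<^esub>j\<in>J. (\<lambda>i\<in>J. z j \<otimes>\<^bsub>B\<^esub> h (\<gamma> i (w j)))) = z" if z: "z \<in> carrier (free_module B J)" for z
    proof (rule PiE_ext[of _ J "\<lambda>_. carrier B"])
      have fn: "(\<lambda>j. \<lambda>i\<in>J. z j \<otimes>\<^bsub>B\<^esub> h (\<gamma> i (w j))) \<in> J \<rightarrow> carrier (free_module B J)"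
        using z d h_simps by (auto simp: PiE_iff)
      then show "(\<Oplus>\<^bsub>free_module B J\<^esub>j\<in>J. (\<lambda>i\<in>J. z j \<otimes>\<^bsub>B\<^esub> h (\<gamma> i (w j)))) \<in> J \<rightarrow>\<^sub>E carrier B"
        using F.M.finsum_closed[OF fn] by simp
      fix i assume i: "i \<in> J"
      have "finsum (free_module B J) (\<lambda>j. \<lambda>i\<in>J. z j \<otimes>\<^bsub>B\<^esub> h (\<gamma> i (w j))) J i
        = (\<Oplus>\<^bsub>ring_module B\<^esub>j\<in>J. (\<lambda>i\<in>J. z j \<otimes>\<^bsub>B\<^esub> h (\<gamma> i (w j))) i)"
        by (rule finsum_dsum_module[OF B.is_cring module_ring_module[OF B.is_cring] fn i])
      also have "\<dots> = (\<Oplus>\<^bsub>B\<^esub>j\<in>J. if j = i then z i else \<zero>\<^bsub>B\<^esub>)"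
        unfolding finsum_ring_module
        by (rule B.finsum_cong') (use i z d(4,5) h_simps in \<open>auto simp: PiE_iff\<close>)
      also have "\<dots> = z i" by (rule B.finsum_delta) (use i z d in \<open>auto simp: PiE_iff\<close>)
      finally show "finsum (free_module B J) (\<lambda>j. \<lambda>i\<in>J. z j \<otimes>\<^bsub>B\<^esub> h (\<gamma> i (w j))) J i = z i" .
    qed (use z in simp)
    show "(\<Oplus>\<^bsub>BC.T\<^esub>j\<in>J. BC.pure ((\<lambda>j\<in>J. x \<otimes>\<^bsub>B\<^esub> h (\<gamma> j y)) j) (w j)) = BC.pure x y"
      if x: "x \<in> carrier (ring_module B)" and y: "y \<in> carrier V" for x y
    proof -
      have "(\<Oplus>\<^bsub>BC.T\<^esub>j\<in>J. BC.pure ((\<lambda>j\<in>J. x \<otimes>\<^bsub>B\<^esub> h (\<gamma> j y)) j) (w j)) = (\<Oplus>\<^bsub>BC.T\<^esub>j\<in>J. BC.pure x (\<gamma> j y \<odot>\<^bsub>V\<^esub> w j))"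
      proof (rule BC.T.finsum_cong')
        fix j assume j: "j \<in> J"
        have "(\<lambda>j\<in>J. x \<otimes>\<^bsub>B\<^esub> h (\<gamma> j y)) j = alg_scale B h (\<gamma> j y) x"
          using j x y d h_simps by (simp add: alg_scale_def B.m_comm)
        then show "BC.pure ((\<lambda>j\<in>J. x \<otimes>\<^bsub>B\<^esub> h (\<gamma> j y)) j) (w j) = BC.pure x (\<gamma> j y \<odot>\<^bsub>V\<^esub> w j)"
          using BC.pure_balanced[of "\<gamma> j y" x "w j"] j x y d by simp
      qed (use x y d in \<open>auto intro!: BC.pure_closed\<close>)
      also have "\<dots> = BC.pure x (\<Oplus>\<^bsub>V\<^esub>j\<in>J. \<gamma> j y \<odot>\<^bsub>V\<^esub> w j)"
        by (rule add_homs_finsum[OF V.M.abelian_group_axioms BC.T.abelian_group_axioms BC.pure_right_add_hom[OF x], symmetric])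
          (use y d in auto)
      also have "\<dots> = BC.pure x y" using dual_basis_expand[OF db y] by simp
      finally show ?thesis .
    qed
    show "(\<lambda>z. BC.pure (z j) (w j)) \<in> add_homs (free_module B J) BC.T" if j: "j \<in> J" for j
      using j d(4)[OF j] BC.pure_closed[of "_ j" "w j"] BC.pure_add_left[of "_ j" "_ j" "w j"]
      by (intro add_homsI) (auto simp: PiE_iff)
  qed
  then show ?thesis unfolding is_coords_def by auto
qed

definition coords :: "('b \<times> 'v \<Rightarrow>\<^sub>0 int) set \<Rightarrow> 'i \<Rightarrow> 'b" where
  "coords = (SOME L. is_coords L)"

lemma is_coords: "is_coords coords"
  unfolding coords_def by (rule someI_ex[OF exists_coords])

lemma coords_add_hom: "coords \<in> add_homs BC.T (free_module B J)"
  and coords_pure: "\<lbrakk>x \<in> carrier B; y \<in> carrier V\<rbrakk> \<Longrightarrow> coords (BC.pure x y) = (\<lambda>j\<in>J. x \<otimes>\<^bsub>B\<^esub> h (\<gamma> j y))"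
  and coords_bij: "bij_betw coords (carrier BC.T) (carrier (free_module B J))"
  using is_coords by (auto simp: is_coords_def)

text \<open>The scalar multiplication of the record is itself a \<open>tensor_map\<close>; it
  respects balancing because multiplication by \<open>s\<close> commutes with the image of
  \<open>k\<close> in \<open>B\<close>.\<close>

lemma smult_hom:
  assumes s: "s \<in> carrier B"
  shows "(\<lambda>t. s \<odot>\<^bsub>BC.T\<^esub> t) \<in> add_homs BC.T BC.T"
    and "\<lbrakk>x \<in> carrier B; y \<in> carrier V\<rbrakk> \<Longrightarrow> s \<odot>\<^bsub>BC.T\<^esub> BC.pure x y = BC.pure (s \<otimes>\<^bsub>B\<^esub> x) y"
proof -
  have f: "(\<lambda>x. s \<odot>\<^bsub>ring_module B\<^esub> x) \<in> add_homs (ring_module B) (ring_module B)"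
    using s by (auto intro!: add_homsI simp: B.r_distr)
  have g: "id \<in> add_homs V V" by (auto intro!: add_homsI)
  have bal: "BC.pure (s \<odot>\<^bsub>ring_module B\<^esub> alg_scale B h a x) (id y) = BC.pure (s \<odot>\<^bsub>ring_module B\<^esub> x) (id (a \<odot>\<^bsub>V\<^esub> y))"
    if "a \<in> carrier k" "x \<in> carrier (ring_module B)" "y \<in> carrier V" for a x y
  proof -
    have "s \<otimes>\<^bsub>B\<^esub> (h a \<otimes>\<^bsub>B\<^esub> x) = h a \<otimes>\<^bsub>B\<^esub> (s \<otimes>\<^bsub>B\<^esub> x)"
      using s that h_simps by (intro B.m_lcomm) auto
    then show ?thesis using BC.pure_balanced[of a "s \<otimes>\<^bsub>B\<^esub> x" y] that s by (simp add: alg_scale_def)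
  qed
  note tm = BC.tensor_map_hom[OF tensor_factors_base_change f g bal]
  show "(\<lambda>t. s \<odot>\<^bsub>BC.T\<^esub> t) \<in> add_homs BC.T BC.T" unfolding BC.tensor_simps(4) by (rule tm(1))
  show "s \<odot>\<^bsub>BC.T\<^esub> BC.pure x y = BC.pure (s \<otimes>\<^bsub>B\<^esub> x) y" if "x \<in> carrier B" "y \<in> carrier V"
    using tm(2)[of x y] that unfolding BC.tensor_simps(4) ring_module_simps id_apply by blast
qed

lemma coords_smult:
  assumes s: "s \<in> carrier B" and t: "t \<in> carrier BC.T"
  shows "s \<odot>\<^bsub>BC.T\<^esub> t \<in> carrier BC.T" "coords (s \<odot>\<^bsub>BC.T\<^esub> t) = s \<odot>\<^bsub>free_module B J\<^esub> coords t"
proof -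
  show "s \<odot>\<^bsub>BC.T\<^esub> t \<in> carrier BC.T" using add_homsD(1)[OF smult_hom(1)[OF s] t] .
  note c = add_homsD[OF coords_add_hom] and sh = add_homsD[OF smult_hom(1)[OF s]]
  show "coords (s \<odot>\<^bsub>BC.T\<^esub> t) = s \<odot>\<^bsub>free_module B J\<^esub> coords t"
  proof (rule BC.tensor_hom_eq[of "\<lambda>t. coords (s \<odot>\<^bsub>BC.T\<^esub> t)" "free_module B J" "\<lambda>t. s \<odot>\<^bsub>free_module B J\<^esub> coords t", OF _ _ _ t])
    show "(\<lambda>t. coords (s \<odot>\<^bsub>BC.T\<^esub> t)) \<in> add_homs BC.T (free_module B J)"
      by (rule add_homsI) (simp_all add: c sh del: dsum_module_simps)
    show "(\<lambda>t. s \<odot>\<^bsub>free_module B J\<^esub> coords t) \<in> add_homs BC.T (free_module B J)"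
      by (rule add_homsI) (simp_all add: c s F.smult_r_distr del: dsum_module_simps)
    fix x y assume "x \<in> carrier (ring_module B)" "y \<in> carrier V"
    then show "coords (s \<odot>\<^bsub>BC.T\<^esub> BC.pure x y) = s \<odot>\<^bsub>free_module B J\<^esub> coords (BC.pure x y)"
      using s dual_basisD[OF db] h_simps by (auto simp: smult_hom coords_pure B.m_assoc intro!: restrict_ext)
  qed
qed

text \<open>Both sides are additive, and on pure tensors they express \<rho> by its matrix in the
  basis \<open>w\<close>, with entries pushed into \<open>B\<close> by \<open>h\<close>.\<close>

lemma coords_ract:
  assumes g: "\<rho> \<in> module_homs k V V" and t: "t \<in> carrier BC.T"
  defines "A \<equiv> tensor_map k (alg_scale B h) (ring_module B) V id \<rho>"
  shows "A t \<in> carrier BC.T"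
    "coords (A t) = (\<lambda>j\<in>J. \<Oplus>\<^bsub>B\<^esub>l\<in>J. h (\<gamma> j (\<rho> (w l))) \<otimes>\<^bsub>B\<^esub> coords t l)"
proof -
  note g' = module_homsD[OF g] and d = dual_basisD[OF db]
  have A: "A \<in> add_homs BC.T BC.T" "\<And>x y. \<lbrakk>x \<in> carrier B; y \<in> carrier V\<rbrakk> \<Longrightarrow> A (BC.pure x y) = BC.pure x (\<rho> y)"
    unfolding A_def
    using BC.tensor_map_hom[OF tensor_factors_base_change, of id \<rho>] module_homs_add_homs[OF g] g' BC.pure_balanced
    by (auto simp: add_homs_def alg_scale_def)
  show "A t \<in> carrier BC.T" using add_homsD(1)[OF A(1) t] .
  note c = add_homsD[OF coords_add_hom] and Ah = add_homsD[OF A(1)]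
  let ?m = "\<lambda>z. \<lambda>j\<in>J. \<Oplus>\<^bsub>B\<^esub>l\<in>J. h (\<gamma> j (\<rho> (w l))) \<otimes>\<^bsub>B\<^esub> z l"
  have m: "h (\<gamma> j (\<rho> (w l))) \<in> carrier B" if "j \<in> J" "l \<in> J" for j l
    using that d g' h_simps by auto
  have "?m \<in> add_homs (free_module B J) (free_module B J)"
  proof (rule add_homsI)
    fix z z' assume z: "z \<in> carrier (free_module B J)" "z' \<in> carrier (free_module B J)"
    have key: "(\<Oplus>\<^bsub>B\<^esub>l\<in>J. h (\<gamma> j (\<rho> (w l))) \<otimes>\<^bsub>B\<^esub> (z \<oplus>\<^bsub>free_module B J\<^esub> z') l)
      = (\<Oplus>\<^bsub>B\<^esub>l\<in>J. h (\<gamma> j (\<rho> (w l))) \<otimes>\<^bsub>B\<^esub> z l) \<oplus>\<^bsub>B\<^esub> (\<Oplus>\<^bsub>B\<^esub>l\<in>J. h (\<gamma> j (\<rho> (w l))) \<otimes>\<^bsub>B\<^esub> z' l)"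
      if j: "j \<in> J" for j
    proof -
      have "(\<Oplus>\<^bsub>B\<^esub>l\<in>J. h (\<gamma> j (\<rho> (w l))) \<otimes>\<^bsub>B\<^esub> (z \<oplus>\<^bsub>free_module B J\<^esub> z') l)
        = (\<Oplus>\<^bsub>B\<^esub>l\<in>J. h (\<gamma> j (\<rho> (w l))) \<otimes>\<^bsub>B\<^esub> z l \<oplus>\<^bsub>B\<^esub> h (\<gamma> j (\<rho> (w l))) \<otimes>\<^bsub>B\<^esub> z' l)"
        by (rule B.finsum_cong') (use m j z in \<open>auto simp: PiE_iff B.r_distr\<close>)
      also have "\<dots> = (\<Oplus>\<^bsub>B\<^esub>l\<in>J. h (\<gamma> j (\<rho> (w l))) \<otimes>\<^bsub>B\<^esub> z l) \<oplus>\<^bsub>B\<^esub> (\<Oplus>\<^bsub>B\<^esub>l\<in>J. h (\<gamma> j (\<rho> (w l))) \<otimes>\<^bsub>B\<^esub> z' l)"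
        by (rule B.finsum_addf) (use m j z in \<open>auto simp: PiE_iff\<close>)
      finally show ?thesis .
    qed
    show "?m (z \<oplus>\<^bsub>free_module B J\<^esub> z') = ?m z \<oplus>\<^bsub>free_module B J\<^esub> ?m z'"
      unfolding dsum_module_simps(3)[of J "\<lambda>_. ring_module B" "?m z" "?m z'"]
      by (rule restrict_ext) (simp only: key restrict_apply' ring_module_simps)
  qed (use m in \<open>auto simp: PiE_iff intro!: B.finsum_closed\<close>)
  note mh = add_homsD[OF this]
  show "coords (A t) = (\<lambda>j\<in>J. \<Oplus>\<^bsub>B\<^esub>l\<in>J. h (\<gamma> j (\<rho> (w l))) \<otimes>\<^bsub>B\<^esub> coords t l)"
  proof (rule BC.tensor_hom_eq[of "\<lambda>t. coords (A t)" "free_module B J" "\<lambda>t. ?m (coords t)", OF _ _ _ t])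
    show "(\<lambda>t. coords (A t)) \<in> add_homs BC.T (free_module B J)"
      by (rule add_homsI) (simp_all add: c Ah del: dsum_module_simps)
    show "(\<lambda>t. ?m (coords t)) \<in> add_homs BC.T (free_module B J)"
      by (rule add_homsI) (use mh c in blast, simp only: mh c)
    fix x y assume xy: "x \<in> carrier (ring_module B)" "y \<in> carrier V"
    have x: "x \<in> carrier B" using xy by simp
    \<comment> \<open>The expansion of \<open>y\<close> is pushed through the functional composed
      with \<rho>, and then through \<open>h\<close>.\<close>
    have "x \<otimes>\<^bsub>B\<^esub> h (\<gamma> j (\<rho> y)) = (\<Oplus>\<^bsub>B\<^esub>l\<in>J. h (\<gamma> j (\<rho> (w l))) \<otimes>\<^bsub>B\<^esub> (x \<otimes>\<^bsub>B\<^esub> h (\<gamma> l y)))" if j: "j \<in> J" for j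
    proof -
      have f: "(\<lambda>y. \<gamma> j (\<rho> y)) \<in> module_homs k V (ring_module k)"
        by (rule module_homsI) (use g' d j in auto)
      have "\<gamma> j (\<rho> y) = \<gamma> j (\<rho> (\<Oplus>\<^bsub>V\<^esub>l\<in>J. \<gamma> l y \<odot>\<^bsub>V\<^esub> w l))"
        using dual_basis_expand[OF db xy(2)] by simp
      also have "\<dots> = (\<Oplus>\<^bsub>ring_module k\<^esub>l\<in>J. \<gamma> l y \<odot>\<^bsub>ring_module k\<^esub> \<gamma> j (\<rho> (w l)))"
        by (rule module_hom_lincomb[OF V.module_axioms module_ring_module[OF k.is_cring] f]) (use d xy in auto)
      also have "\<dots> = (\<Oplus>\<^bsub>k\<^esub>l\<in>J. \<gamma> l y \<otimes>\<^bsub>k\<^esub> \<gamma> j (\<rho> (w l)))" by (simp add: finsum_ring_module)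
      finally have "h (\<gamma> j (\<rho> y)) = h (\<Oplus>\<^bsub>k\<^esub>l\<in>J. \<gamma> l y \<otimes>\<^bsub>k\<^esub> \<gamma> j (\<rho> (w l)))" by simp
      also have "\<dots> = (\<Oplus>\<^bsub>B\<^esub>l\<in>J. h (\<gamma> l y \<otimes>\<^bsub>k\<^esub> \<gamma> j (\<rho> (w l))))"
        by (rule hom_finsum_additive(2)[OF k.is_abelian_group B.is_abelian_group])
          (use h_simps d xy g' j in auto)
      finally have "x \<otimes>\<^bsub>B\<^esub> h (\<gamma> j (\<rho> y)) = x \<otimes>\<^bsub>B\<^esub> (\<Oplus>\<^bsub>B\<^esub>l\<in>J. h (\<gamma> l y \<otimes>\<^bsub>k\<^esub> \<gamma> j (\<rho> (w l))))" by simp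
      also have "\<dots> = (\<Oplus>\<^bsub>B\<^esub>l\<in>J. x \<otimes>\<^bsub>B\<^esub> h (\<gamma> l y \<otimes>\<^bsub>k\<^esub> \<gamma> j (\<rho> (w l))))"
        by (rule B.finsum_rdistr) (use h_simps d xy g' j in auto)
      also have "\<dots> = (\<Oplus>\<^bsub>B\<^esub>l\<in>J. h (\<gamma> j (\<rho> (w l))) \<otimes>\<^bsub>B\<^esub> (x \<otimes>\<^bsub>B\<^esub> h (\<gamma> l y)))"
        by (rule B.finsum_cong') (use h_simps d xy g' j in \<open>auto simp: B.m_ac\<close>)
      finally show ?thesis .
    qed
    then have "(\<lambda>j\<in>J. x \<otimes>\<^bsub>B\<^esub> h (\<gamma> j (\<rho> y))) = (\<lambda>j\<in>J. \<Oplus>\<^bsub>B\<^esub>l\<in>J. h (\<gamma> j (\<rho> (w l))) \<otimes>\<^bsub>B\<^esub> (x \<otimes>\<^bsub>B\<^esub> h (\<gamma> l y)))"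
      by (intro restrict_ext)
    also have "\<dots> = ?m (\<lambda>j\<in>J. x \<otimes>\<^bsub>B\<^esub> h (\<gamma> j y))"
      by (intro restrict_ext B.finsum_cong') (use h_simps d xy m in auto)
    finally show "coords (A (BC.pure x y)) = ?m (coords (BC.pure x y))"
      using A(2)[OF x xy(2)] coords_pure[OF x xy(2)] coords_pure[OF x g'(1)[OF xy(2)]] by simp
  qed
qed

text \<open>Coordinates are natural in the ring. For \<sigma> a restriction map this makes the
  coordinates over the various open sets into a morphism of presheaves.\<close>

lemma coords_base_change:
  assumes fbc: "free_base_change k B' h' V J w \<gamma>"
    and \<sigma>: "\<sigma> \<in> ring_hom B B'" and comp: "\<And>a. a \<in> carrier k \<Longrightarrow> h' a = \<sigma> (h a)" and t: "t \<in> carrier BC.T"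
  defines "A \<equiv> tensor_map k (alg_scale B' h') (ring_module B') V \<sigma> id"
  shows "A t \<in> carrier (tensor k (alg_scale B' h') (ring_module B') V)"
    "free_base_change.coords k B' h' V J \<gamma> (A t) = (\<lambda>j\<in>J. \<sigma> (coords t j))"
proof -
  interpret B': free_base_change k B' h' V J w \<gamma> by fact
  note d = dual_basisD[OF db]
  have s: "\<And>a. a \<in> carrier B \<Longrightarrow> \<sigma> a \<in> carrier B'"
    "\<And>a b. \<lbrakk>a \<in> carrier B; b \<in> carrier B\<rbrakk> \<Longrightarrow> \<sigma> (a \<oplus>\<^bsub>B\<^esub> b) = \<sigma> a \<oplus>\<^bsub>B'\<^esub> \<sigma> b"
    "\<And>a b. \<lbrakk>a \<in> carrier B; b \<in> carrier B\<rbrakk> \<Longrightarrow> \<sigma> (a \<otimes>\<^bsub>B\<^esub> b) = \<sigma> a \<otimes>\<^bsub>B'\<^esub> \<sigma> b"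
    using \<sigma> by (auto simp: ring_hom_def)
  have A: "A \<in> add_homs BC.T B'.BC.T" "\<And>x y. \<lbrakk>x \<in> carrier B; y \<in> carrier V\<rbrakk> \<Longrightarrow> A (BC.pure x y) = B'.BC.pure (\<sigma> x) y"
  proof -
    have f: "\<sigma> \<in> add_homs (ring_module B) (ring_module B')" using s by (auto intro!: add_homsI)
    have g: "id \<in> add_homs V V" by (auto intro!: add_homsI)
    have bal: "B'.BC.pure (\<sigma> (alg_scale B h a x)) (id y) = B'.BC.pure (\<sigma> x) (id (a \<odot>\<^bsub>V\<^esub> y))"
      if "a \<in> carrier k" "x \<in> carrier (ring_module B)" "y \<in> carrier V" for a x y
      using B'.BC.pure_balanced[of a "\<sigma> x" y] that s h_simps comp by (simp add: alg_scale_def)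
    note tm = B'.BC.tensor_map_hom[OF tensor_factors_base_change f g bal]
    show "A \<in> add_homs BC.T B'.BC.T" unfolding A_def by (rule tm(1))
    show "A (BC.pure x y) = B'.BC.pure (\<sigma> x) y" if "x \<in> carrier B" "y \<in> carrier V" for x y
      using tm(2)[of x y] that unfolding A_def ring_module_simps id_apply by blast
  qed
  show "A t \<in> carrier B'.BC.T" using add_homsD(1)[OF A(1) t] .
  note c = add_homsD[OF coords_add_hom] and c' = add_homsD[OF B'.coords_add_hom] and Ah = add_homsD[OF A(1)]
  show "B'.coords (A t) = (\<lambda>j\<in>J. \<sigma> (coords t j))"
  proof (rule BC.tensor_hom_eq[of "\<lambda>t. B'.coords (A t)" "free_module B' J" "\<lambda>t. \<lambda>j\<in>J. \<sigma> (coords t j)", OF _ _ _ t])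
    show "(\<lambda>t. B'.coords (A t)) \<in> add_homs BC.T (free_module B' J)"
      by (rule add_homsI) (simp_all add: c' Ah del: dsum_module_simps)
    have cl: "coords t j \<in> carrier B" if "t \<in> carrier BC.T" "j \<in> J" for t j
      using c(1)[OF that(1)] that(2) by auto
    show "(\<lambda>t. \<lambda>j\<in>J. \<sigma> (coords t j)) \<in> add_homs BC.T (free_module B' J)"
    proof (rule add_homsI)
      fix t t' assume tt: "t \<in> carrier BC.T" "t' \<in> carrier BC.T"
      show "(\<lambda>j\<in>J. \<sigma> (coords (t \<oplus>\<^bsub>BC.T\<^esub> t') j)) = (\<lambda>j\<in>J. \<sigma> (coords t j)) \<oplus>\<^bsub>free_module B' J\<^esub> (\<lambda>j\<in>J. \<sigma> (coords t' j))"
        unfolding c(2)[OF tt] using cl[OF tt(1)] cl[OF tt(2)] s by (auto intro!: restrict_ext)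
    qed (use cl s in auto)
    fix x y assume "x \<in> carrier (ring_module B)" "y \<in> carrier V"
    then show "B'.coords (A (BC.pure x y)) = (\<lambda>j\<in>J. \<sigma> (coords (BC.pure x y) j))"
      using s d h_simps comp by (auto simp: A coords_pure B'.coords_pure intro!: restrict_ext)
  qed
qed

end

section \<open>Germs, stalks, and the operations on them\<close>

section \<open>Germs and stalks\<close>

context set_sheaf
begin

text \<open>Given agreement on \<open>W\<close>, a representative of one germ is compared with the
  other section on the intersection of \<open>W\<close> with the neighbourhood that makes it a
  representative.\<close>

lemma germ_eq_iff:
  assumes "openin T U" "x \<in> U" "s \<in> F U" "openin T V" "x \<in> V" "t \<in> F V"
  shows "germ T F \<rho> x U s = germ T F \<rho> x V t \<longleftrightarrow>
    (\<exists>W. openin T W \<and> x \<in> W \<and> W \<subseteq> U \<inter> V \<and> \<rho> U W s = \<rho> V W t)" (is "_ \<longleftrightarrow> ?R")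
proof
  assume "germ T F \<rho> x U s = germ T F \<rho> x V t"
  moreover have "(V, t) \<in> germ T F \<rho> x V t"
    using assms unfolding germ_def by blast
  ultimately have "(V, t) \<in> germ T F \<rho> x U s" by simp
  then obtain W where "openin T W" "x \<in> W" "W \<subseteq> U \<inter> V" "\<rho> V W t = \<rho> U W s"
    by (auto simp: germ_def)
  then show ?R by (intro exI[of _ W]) simp
next
  assume ?R
  then obtain W where W: "openin T W" "x \<in> W" "W \<subseteq> U" "W \<subseteq> V" "\<rho> U W s = \<rho> V W t" by blast
  have aux: "germ T F \<rho> x U s \<subseteq> germ T F \<rho> x V t"
    if U: "openin T U" "s \<in> F U" and V: "openin T V" "t \<in> F V" and W: "openin T W" "x \<in> W" "W \<subseteq> U" "W \<subseteq> V" "\<rho> U W s = \<rho> V W t"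
    for U s V t
  proof
    fix p assume "p \<in> germ T F \<rho> x U s"
    then obtain U' s' W' where p: "p = (U', s')" "openin T U'" "x \<in> U'" "s' \<in> F U'"
      and W': "openin T W'" "x \<in> W'" "W' \<subseteq> U" "W' \<subseteq> U'" "\<rho> U' W' s' = \<rho> U W' s"
      unfolding germ_def by blast
    let ?W = "W \<inter> W'"
    have o: "openin T ?W" using W W' by (simp add: openin_Int)
    have "\<rho> U' ?W s' = \<rho> W' ?W (\<rho> U' W' s')"
      using res_res[of U' W' ?W s'] p W' o by simp
    also have "\<dots> = \<rho> U ?W s" using res_res[of U W' ?W s] U W' o by simp
    also have "\<dots> = \<rho> W ?W (\<rho> U W s)" using res_res[of U W ?W s] U W o by simp
    also have "\<dots> = \<rho> V ?W t" using res_res[of V W ?W t] V W o by simp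
    finally show "p \<in> germ T F \<rho> x V t"
      using p o W W' unfolding germ_def by blast
  qed
  show "germ T F \<rho> x U s = germ T F \<rho> x V t"
    using aux[OF assms(1,3,4,6) W] aux[OF assms(4,6,1,3) W(1,2,4,3) W(5)[symmetric]] by blast
qed

lemma germ_memD:
  assumes "(V, t) \<in> germ T F \<rho> x U s" "openin T U" "x \<in> U" "s \<in> F U"
  shows "openin T V" "x \<in> V" "t \<in> F V" "germ T F \<rho> x V t = germ T F \<rho> x U s"
proof -
  show V: "openin T V" "x \<in> V" "t \<in> F V" using assms(1) by (auto simp: germ_def)
  obtain W where "openin T W" "x \<in> W" "W \<subseteq> U \<inter> V" "\<rho> V W t = \<rho> U W s"
    using assms(1) by (auto simp: germ_def)
  then show "germ T F \<rho> x V t = germ T F \<rho> x U s"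
    unfolding germ_eq_iff[OF V assms(2-4)] by blast
qed

lemma germ_self: "\<lbrakk>openin T U; x \<in> U; s \<in> F U\<rbrakk> \<Longrightarrow> (U, s) \<in> germ T F \<rho> x U s"
  unfolding germ_def by blast

lemma germ_res:
  assumes "openin T U" "openin T V" "x \<in> V" "V \<subseteq> U" "s \<in> F U"
  shows "germ T F \<rho> x V (\<rho> U V s) = germ T F \<rho> x U s"
proof -
  have "x \<in> U" using assms by blast
  then show ?thesis
    using assms res_closed[OF assms(1,2,4,5)] res_id[OF assms(2)] res_res[OF assms(1,2,2) _ assms(4,5)]
    by (subst germ_eq_iff) (auto intro!: exI[of _ V])
qed

text \<open>The operations on stalks are unions over representatives. If all of them give
  \<open>C\<close>, the union is \<open>C\<close>, as a germ contains the section it was formed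
  from.\<close>

lemma germ_UN1:
  assumes "openin T U" "x \<in> U" "s \<in> F U"
    and "\<And>V t. \<lbrakk>openin T V; x \<in> V; t \<in> F V; germ T F \<rho> x V t = germ T F \<rho> x U s\<rbrakk> \<Longrightarrow> f V t = C"
  shows "(\<Union>(V, t)\<in>germ T F \<rho> x U s. f V t) = C"
proof -
  have "(case p of (V, t) \<Rightarrow> f V t) = C" if p: "p \<in> germ T F \<rho> x U s" for p
  proof -
    obtain V t where Vt: "p = (V, t)" by (cases p)
    show ?thesis
      using assms(4)[OF germ_memD[OF p[unfolded Vt] assms(1-3)]] by (simp add: Vt)
  qed
  then have "(\<Union>(V, t)\<in>germ T F \<rho> x U s. f V t) = (\<Union>p\<in>germ T F \<rho> x U s. C)"
    by (rule SUP_cong[OF refl])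
  also have "\<dots> = C" using germ_self[OF assms(1-3)] by blast
  finally show ?thesis .
qed

lemma locality':
  assumes U: "openin T U" and s: "s \<in> F U" "t \<in> F U"
    and loc: "\<And>x. x \<in> U \<Longrightarrow> \<exists>V. openin T V \<and> x \<in> V \<and> V \<subseteq> U \<and> \<rho> U V s = \<rho> U V t"
  shows "s = t"
proof -
  define \<U> where "\<U> = {V. openin T V \<and> V \<subseteq> U \<and> \<rho> U V s = \<rho> U V t}"
  have UU: "\<Union>\<U> = U" using loc unfolding \<U>_def by blast
  show ?thesis
  proof (rule locality[of \<U>])
    show "s \<in> F (\<Union>\<U>)" "t \<in> F (\<Union>\<U>)" using s by (simp_all add: UU)
    show "openin T V" "\<rho> (\<Union>\<U>) V s = \<rho> (\<Union>\<U>) V t" if "V \<in> \<U>" for V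
      using that unfolding UU by (simp_all add: \<U>_def)
  qed
qed

lemma germ_locality:
  assumes U: "openin T U" and s: "s \<in> F U" "t \<in> F U"
    and eq: "\<And>x. x \<in> U \<Longrightarrow> germ T F \<rho> x U s = germ T F \<rho> x U t"
  shows "s = t"
proof (rule locality'[OF U s])
  fix x assume x: "x \<in> U"
  show "\<exists>V. openin T V \<and> x \<in> V \<and> V \<subseteq> U \<and> \<rho> U V s = \<rho> U V t"
    using eq[OF x] unfolding germ_eq_iff[OF U x s(1) U x s(2)] by blast
qed

end

lemma set_sheafI:
  assumes "\<And>U V s. \<lbrakk>openin T U; openin T V; V \<subseteq> U; s \<in> F U\<rbrakk> \<Longrightarrow> \<rho> U V s \<in> F V"
    and "\<And>U s. \<lbrakk>openin T U; s \<in> F U\<rbrakk> \<Longrightarrow> \<rho> U U s = s"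
    and "\<And>U V W s. \<lbrakk>openin T U; openin T V; openin T W; W \<subseteq> V; V \<subseteq> U; s \<in> F U\<rbrakk> \<Longrightarrow> \<rho> V W (\<rho> U V s) = \<rho> U W s"
    and "\<And>\<U> s t. \<lbrakk>\<And>V. V \<in> \<U> \<Longrightarrow> openin T V; s \<in> F (\<Union>\<U>); t \<in> F (\<Union>\<U>);
        \<And>V. V \<in> \<U> \<Longrightarrow> \<rho> (\<Union>\<U>) V s = \<rho> (\<Union>\<U>) V t\<rbrakk> \<Longrightarrow> s = t"
    and "\<And>\<U> \<sigma>. \<lbrakk>\<And>V. V \<in> \<U> \<Longrightarrow> openin T V; \<And>V. V \<in> \<U> \<Longrightarrow> \<sigma> V \<in> F V;
        \<And>V W. \<lbrakk>V \<in> \<U>; W \<in> \<U>\<rbrakk> \<Longrightarrow> \<rho> V (V \<inter> W) (\<sigma> V) = \<rho> W (V \<inter> W) (\<sigma> W)\<rbrakk> \<Longrightarrow>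
       \<exists>t\<in>F (\<Union>\<U>). \<forall>V\<in>\<U>. \<rho> (\<Union>\<U>) V t = \<sigma> V"
  shows "set_sheaf T F \<rho>"
  by unfold_locales (fact assms)+

locale ringed =
  fixes \<X> :: "('p, 'a) rspace"
  assumes ringed: "ringed_space \<X>"
begin

abbreviation opn :: "'p set \<Rightarrow> bool" where
  "opn \<equiv> openin (topo \<X>)"

sublocale O: set_sheaf "topo \<X>" "\<lambda>U. carrier (sec \<X> U)" "res \<X>"
  using ringed by (simp add: ringed_space_def)

lemma cring_sec: "opn U \<Longrightarrow> cring (sec \<X> U)"
  and res_hom: "\<lbrakk>opn U; opn V; V \<subseteq> U\<rbrakk> \<Longrightarrow> res \<X> U V \<in> ring_hom (sec \<X> U) (sec \<X> V)"
  using ringed by (auto simp: ringed_space_def)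

lemma res_simps:
  assumes "opn U" "opn V" "V \<subseteq> U"
  shows "a \<in> carrier (sec \<X> U) \<Longrightarrow> res \<X> U V a \<in> carrier (sec \<X> V)"
    "\<lbrakk>a \<in> carrier (sec \<X> U); b \<in> carrier (sec \<X> U)\<rbrakk> \<Longrightarrow> res \<X> U V (a \<oplus>\<^bsub>sec \<X> U\<^esub> b) = res \<X> U V a \<oplus>\<^bsub>sec \<X> V\<^esub> res \<X> U V b"
    "\<lbrakk>a \<in> carrier (sec \<X> U); b \<in> carrier (sec \<X> U)\<rbrakk> \<Longrightarrow> res \<X> U V (a \<otimes>\<^bsub>sec \<X> U\<^esub> b) = res \<X> U V a \<otimes>\<^bsub>sec \<X> V\<^esub> res \<X> U V b"
    "res \<X> U V \<one>\<^bsub>sec \<X> U\<^esub> = \<one>\<^bsub>sec \<X> V\<^esub>"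
    "res \<X> U V \<zero>\<^bsub>sec \<X> U\<^esub> = \<zero>\<^bsub>sec \<X> V\<^esub>"
  using res_hom[OF assms] ring_hom_zero[OF res_hom[OF assms] cring.axioms(1)[OF cring_sec] cring.axioms(1)[OF cring_sec]] assms
  by (auto simp: ring_hom_def)

lemma opn_points: "opn (points \<X>)" and opn_Int: "\<lbrakk>opn U; opn V\<rbrakk> \<Longrightarrow> opn (U \<inter> V)"
  by (simp_all add: openin_Int)

lemma opn_subset: "opn U \<Longrightarrow> U \<subseteq> points \<X>"
  by (rule openin_subset)

end

locale omod = ringed \<X> for \<X> :: "('p, 'a) rspace" +
  fixes M :: "('p, 'a, 'b, 'z) omod_scheme"
  assumes omodule: "omodule \<X> M"
begin

sublocale S: set_sheaf "topo \<X>" "\<lambda>U. carrier (msec M U)" "mres M"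
  using omodule by (simp add: omodule_def)

lemma module_msec: "opn U \<Longrightarrow> module (sec \<X> U) (msec M U)"
  using omodule by (simp add: omodule_def)

lemma abelian_msec: "opn U \<Longrightarrow> abelian_group (msec M U)"
  by (rule module.axioms(2)[OF module_msec])

lemma mres_simps:
  assumes "opn U" "opn V" "V \<subseteq> U"
  shows "x \<in> carrier (msec M U) \<Longrightarrow> mres M U V x \<in> carrier (msec M V)"
    "\<lbrakk>x \<in> carrier (msec M U); y \<in> carrier (msec M U)\<rbrakk> \<Longrightarrow> mres M U V (x \<oplus>\<^bsub>msec M U\<^esub> y) = mres M U V x \<oplus>\<^bsub>msec M V\<^esub> mres M U V y"
    "\<lbrakk>a \<in> carrier (sec \<X> U); x \<in> carrier (msec M U)\<rbrakk> \<Longrightarrow> mres M U V (a \<odot>\<^bsub>msec M U\<^esub> x) = res \<X> U V a \<odot>\<^bsub>msec M V\<^esub> mres M U V x"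
    "mres M U V \<zero>\<^bsub>msec M U\<^esub> = \<zero>\<^bsub>msec M V\<^esub>"
proof -
  show 1: "x \<in> carrier (msec M U) \<Longrightarrow> mres M U V x \<in> carrier (msec M V)" for x
    using S.res_closed assms by blast
  have "\<forall>U V. opn U \<and> opn V \<and> V \<subseteq> U \<longrightarrow>
      (\<forall>x\<in>carrier (msec M U). \<forall>y\<in>carrier (msec M U).
         mres M U V (x \<oplus>\<^bsub>msec M U\<^esub> y) = mres M U V x \<oplus>\<^bsub>msec M V\<^esub> mres M U V y) \<and>
      (\<forall>a\<in>carrier (sec \<X> U). \<forall>x\<in>carrier (msec M U).
         mres M U V (a \<odot>\<^bsub>msec M U\<^esub> x) = res \<X> U V a \<odot>\<^bsub>msec M V\<^esub> mres M U V x)"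
    using omodule unfolding omodule_def by (elim conjE)
  note * = this[rule_format, OF conjI[OF assms(1) conjI[OF assms(2,3)]]]
  show 2: "\<lbrakk>x \<in> carrier (msec M U); y \<in> carrier (msec M U)\<rbrakk> \<Longrightarrow> mres M U V (x \<oplus>\<^bsub>msec M U\<^esub> y) = mres M U V x \<oplus>\<^bsub>msec M V\<^esub> mres M U V y" for x y
    using conjunct1[OF *] by simp
  show "\<lbrakk>a \<in> carrier (sec \<X> U); x \<in> carrier (msec M U)\<rbrakk> \<Longrightarrow> mres M U V (a \<odot>\<^bsub>msec M U\<^esub> x) = res \<X> U V a \<odot>\<^bsub>msec M V\<^esub> mres M U V x" for a x
    using conjunct2[OF *] by simp
  show "mres M U V \<zero>\<^bsub>msec M U\<^esub> = \<zero>\<^bsub>msec M V\<^esub>"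
    by (rule additive_zero[OF abelian_msec[OF assms(1)] abelian_msec[OF assms(2)] funcsetI[OF 1] 2])
qed

lemma msec_closed:
  assumes "opn U"
  shows "\<lbrakk>x \<in> carrier (msec M U); y \<in> carrier (msec M U)\<rbrakk> \<Longrightarrow> x \<oplus>\<^bsub>msec M U\<^esub> y \<in> carrier (msec M U)"
    "\<lbrakk>a \<in> carrier (sec \<X> U); x \<in> carrier (msec M U)\<rbrakk> \<Longrightarrow> a \<odot>\<^bsub>msec M U\<^esub> x \<in> carrier (msec M U)"
    "\<zero>\<^bsub>msec M U\<^esub> \<in> carrier (msec M U)"
  using abelian_groupE(1,2)[OF abelian_msec[OF assms]] module.smult_closed[OF module_msec[OF assms]] by auto

lemma stalk_carrierE:
  assumes "C \<in> carrier (stalk \<X> M x)"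
  obtains U s where "opn U" "x \<in> U" "s \<in> carrier (msec M U)" "C = mgerm \<X> M x U s"
  using assms by (auto simp: stalk_def)

lemma mgerm_closed: "\<lbrakk>opn U; x \<in> U; s \<in> carrier (msec M U)\<rbrakk> \<Longrightarrow> mgerm \<X> M x U s \<in> carrier (stalk \<X> M x)"
  by (auto simp: stalk_def)

lemma mgerm_res:
  "\<lbrakk>opn U; opn V; x \<in> V; V \<subseteq> U; s \<in> carrier (msec M U)\<rbrakk> \<Longrightarrow> mgerm \<X> M x V (mres M U V s) = mgerm \<X> M x U s"
  by (rule S.germ_res)

text \<open>On the intersection of the neighbourhoods where the representatives agree, both sums
  restrict to the same section; this makes addition of germs well defined.\<close>

lemma mgerm_add_Int:
  assumes U: "opn U" "x \<in> U" "s \<in> carrier (msec M U)" and V: "opn V" "x \<in> V" "t \<in> carrier (msec M V)"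
    and U': "opn U'" "x \<in> U'" "s' \<in> carrier (msec M U')" and V': "opn V'" "x \<in> V'" "t' \<in> carrier (msec M V')"
    and eq: "mgerm \<X> M x U s = mgerm \<X> M x U' s'" "mgerm \<X> M x V t = mgerm \<X> M x V' t'"
  shows "mgerm \<X> M x (U \<inter> V) (mres M U (U \<inter> V) s \<oplus>\<^bsub>msec M (U \<inter> V)\<^esub> mres M V (U \<inter> V) t)
    = mgerm \<X> M x (U' \<inter> V') (mres M U' (U' \<inter> V') s' \<oplus>\<^bsub>msec M (U' \<inter> V')\<^esub> mres M V' (U' \<inter> V') t')"
proof -
  obtain W1 where W1: "opn W1" "x \<in> W1" "W1 \<subseteq> U \<inter> U'" "mres M U W1 s = mres M U' W1 s'"
    using eq(1) unfolding S.germ_eq_iff[OF U U'] by blast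
  obtain W2 where W2: "opn W2" "x \<in> W2" "W2 \<subseteq> V \<inter> V'" "mres M V W2 t = mres M V' W2 t'"
    using eq(2) unfolding S.germ_eq_iff[OF V V'] by blast
  let ?W = "W1 \<inter> W2"
  have W: "opn ?W" "x \<in> ?W" using W1 W2 opn_Int by auto
  have *: "mres M (U \<inter> V) ?W (mres M U (U \<inter> V) s \<oplus>\<^bsub>msec M (U \<inter> V)\<^esub> mres M V (U \<inter> V) t)
    = mres M W1 ?W (mres M U W1 s) \<oplus>\<^bsub>msec M ?W\<^esub> mres M W2 ?W (mres M V W2 t)"
    if U: "opn U" "s \<in> carrier (msec M U)" and V: "opn V" "t \<in> carrier (msec M V)" and W12: "W1 \<subseteq> U" "W2 \<subseteq> V" for U s V t
  proof -
    have o: "opn (U \<inter> V)" by (rule opn_Int[OF U(1) V(1)])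
    have WI: "?W \<subseteq> U \<inter> V" using W12 by blast
    have r1: "mres M (U \<inter> V) ?W (mres M U (U \<inter> V) s) = mres M W1 ?W (mres M U W1 s)"
      using S.res_res[OF U(1) o W(1) WI Int_lower1 U(2)] S.res_res[OF U(1) W1(1) W(1) Int_lower1 W12(1) U(2)] by simp
    have r2: "mres M (U \<inter> V) ?W (mres M V (U \<inter> V) t) = mres M W2 ?W (mres M V W2 t)"
      using S.res_res[OF V(1) o W(1) WI Int_lower2 V(2)] S.res_res[OF V(1) W2(1) W(1) Int_lower2 W12(2) V(2)] by simp
    show ?thesis
      using mres_simps(2)[OF o W(1) WI mres_simps(1)[OF U(1) o Int_lower1 U(2)] mres_simps(1)[OF V(1) o Int_lower2 V(2)]] r1 r2
      by simp
  qed
  have c: "mres M U (U \<inter> V) s \<oplus>\<^bsub>msec M (U \<inter> V)\<^esub> mres M V (U \<inter> V) t \<in> carrier (msec M (U \<inter> V))"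
    if "opn U" "s \<in> carrier (msec M U)" "opn V" "t \<in> carrier (msec M V)" for U s V t
    using that by (intro msec_closed mres_simps(1) opn_Int) auto
  have "mres M (U \<inter> V) ?W (mres M U (U \<inter> V) s \<oplus>\<^bsub>msec M (U \<inter> V)\<^esub> mres M V (U \<inter> V) t)
    = mres M (U' \<inter> V') ?W (mres M U' (U' \<inter> V') s' \<oplus>\<^bsub>msec M (U' \<inter> V')\<^esub> mres M V' (U' \<inter> V') t')"
    using *[of U s V t] *[of U' s' V' t'] U V U' V' W1 W2 by simp
  then show ?thesis
    using W W1 W2 U V U' V' by (subst S.germ_eq_iff) (auto intro!: opn_Int c exI[of _ ?W])
qed

lemma stalk_add_Int:
  assumes U: "opn U" "x \<in> U" "s \<in> carrier (msec M U)" and V: "opn V" "x \<in> V" "t \<in> carrier (msec M V)"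
  shows "mgerm \<X> M x U s \<oplus>\<^bsub>stalk \<X> M x\<^esub> mgerm \<X> M x V t =
    mgerm \<X> M x (U \<inter> V) (mres M U (U \<inter> V) s \<oplus>\<^bsub>msec M (U \<inter> V)\<^esub> mres M V (U \<inter> V) t)"
proof -
  have "(\<Union>(U', s')\<in>mgerm \<X> M x U s. \<Union>(V', t')\<in>mgerm \<X> M x V t.
      mgerm \<X> M x (U' \<inter> V') (mres M U' (U' \<inter> V') s' \<oplus>\<^bsub>msec M (U' \<inter> V')\<^esub> mres M V' (U' \<inter> V') t'))
    = mgerm \<X> M x (U \<inter> V) (mres M U (U \<inter> V) s \<oplus>\<^bsub>msec M (U \<inter> V)\<^esub> mres M V (U \<inter> V) t)"
    by (intro S.germ_UN1[OF U] S.germ_UN1[OF V] mgerm_add_Int) (use U V in auto)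
  then show ?thesis by (simp add: stalk_def)
qed

lemma stalk_add:
  assumes U: "opn U" "x \<in> U" "s \<in> carrier (msec M U)" "t \<in> carrier (msec M U)"
  shows "mgerm \<X> M x U s \<oplus>\<^bsub>stalk \<X> M x\<^esub> mgerm \<X> M x U t = mgerm \<X> M x U (s \<oplus>\<^bsub>msec M U\<^esub> t)"
  using stalk_add_Int[of U x s U t] U S.res_id by simp

lemma mgerm_smult_Int:
  assumes U: "opn U" "x \<in> U" "s \<in> carrier (sec \<X> U)" and V: "opn V" "x \<in> V" "t \<in> carrier (msec M V)"
    and U': "opn U'" "x \<in> U'" "s' \<in> carrier (sec \<X> U')" and V': "opn V'" "x \<in> V'" "t' \<in> carrier (msec M V')"
    and eq: "rgerm \<X> x U s = rgerm \<X> x U' s'" "mgerm \<X> M x V t = mgerm \<X> M x V' t'"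
  shows "mgerm \<X> M x (U \<inter> V) (res \<X> U (U \<inter> V) s \<odot>\<^bsub>msec M (U \<inter> V)\<^esub> mres M V (U \<inter> V) t)
    = mgerm \<X> M x (U' \<inter> V') (res \<X> U' (U' \<inter> V') s' \<odot>\<^bsub>msec M (U' \<inter> V')\<^esub> mres M V' (U' \<inter> V') t')"
proof -
  obtain W1 where W1: "opn W1" "x \<in> W1" "W1 \<subseteq> U \<inter> U'" "res \<X> U W1 s = res \<X> U' W1 s'"
    using eq(1) unfolding O.germ_eq_iff[OF U U'] by blast
  obtain W2 where W2: "opn W2" "x \<in> W2" "W2 \<subseteq> V \<inter> V'" "mres M V W2 t = mres M V' W2 t'"
    using eq(2) unfolding S.germ_eq_iff[OF V V'] by blast
  let ?W = "W1 \<inter> W2"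
  have W: "opn ?W" "x \<in> ?W" using W1 W2 opn_Int by auto
  have *: "mres M (U \<inter> V) ?W (res \<X> U (U \<inter> V) s \<odot>\<^bsub>msec M (U \<inter> V)\<^esub> mres M V (U \<inter> V) t)
    = res \<X> W1 ?W (res \<X> U W1 s) \<odot>\<^bsub>msec M ?W\<^esub> mres M W2 ?W (mres M V W2 t)"
    if U: "opn U" "s \<in> carrier (sec \<X> U)" and V: "opn V" "t \<in> carrier (msec M V)" and W12: "W1 \<subseteq> U" "W2 \<subseteq> V" for U s V t
  proof -
    have o: "opn (U \<inter> V)" by (rule opn_Int[OF U(1) V(1)])
    have WI: "?W \<subseteq> U \<inter> V" using W12 by blast
    have r1: "res \<X> (U \<inter> V) ?W (res \<X> U (U \<inter> V) s) = res \<X> W1 ?W (res \<X> U W1 s)"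
      using O.res_res[OF U(1) o W(1) WI Int_lower1 U(2)] O.res_res[OF U(1) W1(1) W(1) Int_lower1 W12(1) U(2)] by simp
    have r2: "mres M (U \<inter> V) ?W (mres M V (U \<inter> V) t) = mres M W2 ?W (mres M V W2 t)"
      using S.res_res[OF V(1) o W(1) WI Int_lower2 V(2)] S.res_res[OF V(1) W2(1) W(1) Int_lower2 W12(2) V(2)] by simp
    show ?thesis
      using mres_simps(3)[OF o W(1) WI res_simps(1)[OF U(1) o Int_lower1 U(2)] mres_simps(1)[OF V(1) o Int_lower2 V(2)]] r1 r2
      by simp
  qed
  have c: "res \<X> U (U \<inter> V) s \<odot>\<^bsub>msec M (U \<inter> V)\<^esub> mres M V (U \<inter> V) t \<in> carrier (msec M (U \<inter> V))"
    if "opn U" "s \<in> carrier (sec \<X> U)" "opn V" "t \<in> carrier (msec M V)" for U s V t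
    using that by (intro msec_closed mres_simps(1) res_simps(1) opn_Int) auto
  have "mres M (U \<inter> V) ?W (res \<X> U (U \<inter> V) s \<odot>\<^bsub>msec M (U \<inter> V)\<^esub> mres M V (U \<inter> V) t)
    = mres M (U' \<inter> V') ?W (res \<X> U' (U' \<inter> V') s' \<odot>\<^bsub>msec M (U' \<inter> V')\<^esub> mres M V' (U' \<inter> V') t')"
    using *[of U s V t] *[of U' s' V' t'] U V U' V' W1 W2 by simp
  then show ?thesis
    using W W1 W2 U V U' V' by (subst S.germ_eq_iff) (auto intro!: opn_Int c exI[of _ ?W])
qed

lemma stalk_smult_Int:
  assumes U: "opn U" "x \<in> U" "s \<in> carrier (sec \<X> U)" and V: "opn V" "x \<in> V" "t \<in> carrier (msec M V)"
  shows "rgerm \<X> x U s \<odot>\<^bsub>stalk \<X> M x\<^esub> mgerm \<X> M x V t =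
    mgerm \<X> M x (U \<inter> V) (res \<X> U (U \<inter> V) s \<odot>\<^bsub>msec M (U \<inter> V)\<^esub> mres M V (U \<inter> V) t)"
proof -
  have "(\<Union>(U', s')\<in>rgerm \<X> x U s. \<Union>(V', t')\<in>mgerm \<X> M x V t.
      mgerm \<X> M x (U' \<inter> V') (res \<X> U' (U' \<inter> V') s' \<odot>\<^bsub>msec M (U' \<inter> V')\<^esub> mres M V' (U' \<inter> V') t'))
    = mgerm \<X> M x (U \<inter> V) (res \<X> U (U \<inter> V) s \<odot>\<^bsub>msec M (U \<inter> V)\<^esub> mres M V (U \<inter> V) t)"
    by (intro O.germ_UN1[OF U] S.germ_UN1[OF V] mgerm_smult_Int) (use U V in auto)
  then show ?thesis by (simp add: stalk_def)
qed

lemma stalk_smult: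
  assumes U: "opn U" "x \<in> U" "s \<in> carrier (sec \<X> U)" "t \<in> carrier (msec M U)"
  shows "rgerm \<X> x U s \<odot>\<^bsub>stalk \<X> M x\<^esub> mgerm \<X> M x U t = mgerm \<X> M x U (s \<odot>\<^bsub>msec M U\<^esub> t)"
  using stalk_smult_Int[of U x s U t] U S.res_id O.res_id by simp

text \<open>The stalk takes its zero from the global sections, and restriction sends zero to
  zero.\<close>

lemma stalk_zero:
  assumes "opn U" "x \<in> U"
  shows "\<zero>\<^bsub>stalk \<X> M x\<^esub> = mgerm \<X> M x U \<zero>\<^bsub>msec M U\<^esub>"
  using mgerm_res[OF opn_points assms(1,2) opn_subset[OF assms(1)] msec_closed(3)[OF opn_points]]
    mres_simps(4)[OF opn_points assms(1) opn_subset[OF assms(1)]]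
  by (simp add: stalk_def)

end

section \<open>Transport of structure along isomorphisms of presheaves\<close>

section \<open>Isomorphisms of sheaves of modules with group action\<close>

text \<open>Neither side is assumed to be a sheaf, nor its sections to form modules. Closure of the
  source under all operations is included, so that the axioms can be pulled back from a sheaf
  \<open>N\<close> to a presheaf \<open>M\<close>.\<close>

definition gsheaf_iso ::
  "('p, 'a) rspace \<Rightarrow> ('g, 'm) monoid_scheme \<Rightarrow> ('p, 'a, 'b, 'g) gmod \<Rightarrow> ('p, 'a, 'c, 'g) gmod \<Rightarrow>
   ('p set \<Rightarrow> 'b \<Rightarrow> 'c) \<Rightarrow> bool" where
  "gsheaf_iso \<X> G M N \<theta> \<longleftrightarrow>
     (\<forall>U. openin (topo \<X>) U \<longrightarrow>
        bij_betw (\<theta> U) (carrier (msec M U)) (carrier (msec N U)) \<and>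
        \<zero>\<^bsub>msec M U\<^esub> \<in> carrier (msec M U) \<and> \<theta> U \<zero>\<^bsub>msec M U\<^esub> = \<zero>\<^bsub>msec N U\<^esub> \<and>
        (\<forall>x\<in>carrier (msec M U). \<forall>y\<in>carrier (msec M U).
           x \<oplus>\<^bsub>msec M U\<^esub> y \<in> carrier (msec M U) \<and> \<theta> U (x \<oplus>\<^bsub>msec M U\<^esub> y) = \<theta> U x \<oplus>\<^bsub>msec N U\<^esub> \<theta> U y) \<and>
        (\<forall>a\<in>carrier (sec \<X> U). \<forall>x\<in>carrier (msec M U).
           a \<odot>\<^bsub>msec M U\<^esub> x \<in> carrier (msec M U) \<and> \<theta> U (a \<odot>\<^bsub>msec M U\<^esub> x) = a \<odot>\<^bsub>msec N U\<^esub> \<theta> U x) \<and>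
        (\<forall>g\<in>carrier G. \<forall>x\<in>carrier (msec M U).
           gact M g U x \<in> carrier (msec M U) \<and> \<theta> U (gact M g U x) = gact N g U (\<theta> U x))) \<and>
     (\<forall>U V. openin (topo \<X>) U \<longrightarrow> openin (topo \<X>) V \<longrightarrow> V \<subseteq> U \<longrightarrow>
        (\<forall>x\<in>carrier (msec M U). mres M U V x \<in> carrier (msec M V) \<and> \<theta> V (mres M U V x) = mres N U V (\<theta> U x)))"

lemma gsheaf_isoI:
  assumes "\<And>U. openin (topo \<X>) U \<Longrightarrow> bij_betw (\<theta> U) (carrier (msec M U)) (carrier (msec N U))"
    and "\<And>U. openin (topo \<X>) U \<Longrightarrow> \<zero>\<^bsub>msec M U\<^esub> \<in> carrier (msec M U)"
    and "\<And>U. openin (topo \<X>) U \<Longrightarrow> \<theta> U \<zero>\<^bsub>msec M U\<^esub> = \<zero>\<^bsub>msec N U\<^esub>"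
    and "\<And>U x y. \<lbrakk>openin (topo \<X>) U; x \<in> carrier (msec M U); y \<in> carrier (msec M U)\<rbrakk> \<Longrightarrow> x \<oplus>\<^bsub>msec M U\<^esub> y \<in> carrier (msec M U)"
    and "\<And>U x y. \<lbrakk>openin (topo \<X>) U; x \<in> carrier (msec M U); y \<in> carrier (msec M U)\<rbrakk> \<Longrightarrow> \<theta> U (x \<oplus>\<^bsub>msec M U\<^esub> y) = \<theta> U x \<oplus>\<^bsub>msec N U\<^esub> \<theta> U y"
    and "\<And>U a x. \<lbrakk>openin (topo \<X>) U; a \<in> carrier (sec \<X> U); x \<in> carrier (msec M U)\<rbrakk> \<Longrightarrow> a \<odot>\<^bsub>msec M U\<^esub> x \<in> carrier (msec M U)"
    and "\<And>U a x. \<lbrakk>openin (topo \<X>) U; a \<in> carrier (sec \<X> U); x \<in> carrier (msec M U)\<rbrakk> \<Longrightarrow> \<theta> U (a \<odot>\<^bsub>msec M U\<^esub> x) = a \<odot>\<^bsub>msec N U\<^esub> \<theta> U x"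
    and "\<And>U g x. \<lbrakk>openin (topo \<X>) U; g \<in> carrier G; x \<in> carrier (msec M U)\<rbrakk> \<Longrightarrow> gact M g U x \<in> carrier (msec M U)"
    and "\<And>U g x. \<lbrakk>openin (topo \<X>) U; g \<in> carrier G; x \<in> carrier (msec M U)\<rbrakk> \<Longrightarrow> \<theta> U (gact M g U x) = gact N g U (\<theta> U x)"
    and "\<And>U V x. \<lbrakk>openin (topo \<X>) U; openin (topo \<X>) V; V \<subseteq> U; x \<in> carrier (msec M U)\<rbrakk> \<Longrightarrow> mres M U V x \<in> carrier (msec M V)"
    and "\<And>U V x. \<lbrakk>openin (topo \<X>) U; openin (topo \<X>) V; V \<subseteq> U; x \<in> carrier (msec M U)\<rbrakk> \<Longrightarrow> \<theta> V (mres M U V x) = mres N U V (\<theta> U x)"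
  shows "gsheaf_iso \<X> G M N \<theta>"
  unfolding gsheaf_iso_def by (intro conjI allI impI ballI) (rule assms; assumption)+

lemma gsheaf_isoD:
  assumes "gsheaf_iso \<X> G M N \<theta>"
  shows "openin (topo \<X>) U \<Longrightarrow> bij_betw (\<theta> U) (carrier (msec M U)) (carrier (msec N U))"
    and "openin (topo \<X>) U \<Longrightarrow> \<zero>\<^bsub>msec M U\<^esub> \<in> carrier (msec M U)"
    and "openin (topo \<X>) U \<Longrightarrow> \<theta> U \<zero>\<^bsub>msec M U\<^esub> = \<zero>\<^bsub>msec N U\<^esub>"
    and "\<lbrakk>openin (topo \<X>) U; x \<in> carrier (msec M U); y \<in> carrier (msec M U)\<rbrakk> \<Longrightarrow> x \<oplus>\<^bsub>msec M U\<^esub> y \<in> carrier (msec M U)"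
    and "\<lbrakk>openin (topo \<X>) U; x \<in> carrier (msec M U); y \<in> carrier (msec M U)\<rbrakk> \<Longrightarrow> \<theta> U (x \<oplus>\<^bsub>msec M U\<^esub> y) = \<theta> U x \<oplus>\<^bsub>msec N U\<^esub> \<theta> U y"
    and "\<lbrakk>openin (topo \<X>) U; a \<in> carrier (sec \<X> U); x \<in> carrier (msec M U)\<rbrakk> \<Longrightarrow> a \<odot>\<^bsub>msec M U\<^esub> x \<in> carrier (msec M U)"
    and "\<lbrakk>openin (topo \<X>) U; a \<in> carrier (sec \<X> U); x \<in> carrier (msec M U)\<rbrakk> \<Longrightarrow> \<theta> U (a \<odot>\<^bsub>msec M U\<^esub> x) = a \<odot>\<^bsub>msec N U\<^esub> \<theta> U x"
    and "\<lbrakk>openin (topo \<X>) U; g \<in> carrier G; x \<in> carrier (msec M U)\<rbrakk> \<Longrightarrow> gact M g U x \<in> carrier (msec M U)"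
    and "\<lbrakk>openin (topo \<X>) U; g \<in> carrier G; x \<in> carrier (msec M U)\<rbrakk> \<Longrightarrow> \<theta> U (gact M g U x) = gact N g U (\<theta> U x)"
    and "\<lbrakk>openin (topo \<X>) U; openin (topo \<X>) V; V \<subseteq> U; x \<in> carrier (msec M U)\<rbrakk> \<Longrightarrow> mres M U V x \<in> carrier (msec M V)"
    and "\<lbrakk>openin (topo \<X>) U; openin (topo \<X>) V; V \<subseteq> U; x \<in> carrier (msec M U)\<rbrakk> \<Longrightarrow> \<theta> V (mres M U V x) = mres N U V (\<theta> U x)"
    and "\<lbrakk>openin (topo \<X>) U; x \<in> carrier (msec M U)\<rbrakk> \<Longrightarrow> \<theta> U x \<in> carrier (msec N U)"
    and "\<lbrakk>openin (topo \<X>) U; x \<in> carrier (msec M U); y \<in> carrier (msec M U); \<theta> U x = \<theta> U y\<rbrakk> \<Longrightarrow> x = y"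
    and "\<lbrakk>openin (topo \<X>) U; z \<in> carrier (msec N U)\<rbrakk> \<Longrightarrow> \<exists>x\<in>carrier (msec M U). z = \<theta> U x"
proof -
  note A = conjunct1[OF assms[unfolded gsheaf_iso_def], rule_format]
    and B = conjunct2[OF assms[unfolded gsheaf_iso_def], rule_format]
  show bij: "openin (topo \<X>) U \<Longrightarrow> bij_betw (\<theta> U) (carrier (msec M U)) (carrier (msec N U))" using A[of U] by blast
  show "openin (topo \<X>) U \<Longrightarrow> \<zero>\<^bsub>msec M U\<^esub> \<in> carrier (msec M U)" using A[of U] by blast
  show "openin (topo \<X>) U \<Longrightarrow> \<theta> U \<zero>\<^bsub>msec M U\<^esub> = \<zero>\<^bsub>msec N U\<^esub>" using A[of U] by simp
  show "\<lbrakk>openin (topo \<X>) U; x \<in> carrier (msec M U); y \<in> carrier (msec M U)\<rbrakk> \<Longrightarrow> x \<oplus>\<^bsub>msec M U\<^esub> y \<in> carrier (msec M U)" using A[of U] by simp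
  show "\<lbrakk>openin (topo \<X>) U; x \<in> carrier (msec M U); y \<in> carrier (msec M U)\<rbrakk> \<Longrightarrow> \<theta> U (x \<oplus>\<^bsub>msec M U\<^esub> y) = \<theta> U x \<oplus>\<^bsub>msec N U\<^esub> \<theta> U y" using A[of U] by simp
  show "\<lbrakk>openin (topo \<X>) U; a \<in> carrier (sec \<X> U); x \<in> carrier (msec M U)\<rbrakk> \<Longrightarrow> a \<odot>\<^bsub>msec M U\<^esub> x \<in> carrier (msec M U)" using A[of U] by simp
  show "\<lbrakk>openin (topo \<X>) U; a \<in> carrier (sec \<X> U); x \<in> carrier (msec M U)\<rbrakk> \<Longrightarrow> \<theta> U (a \<odot>\<^bsub>msec M U\<^esub> x) = a \<odot>\<^bsub>msec N U\<^esub> \<theta> U x" using A[of U] by simp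
  show "\<lbrakk>openin (topo \<X>) U; g \<in> carrier G; x \<in> carrier (msec M U)\<rbrakk> \<Longrightarrow> gact M g U x \<in> carrier (msec M U)" using A[of U] by simp
  show "\<lbrakk>openin (topo \<X>) U; g \<in> carrier G; x \<in> carrier (msec M U)\<rbrakk> \<Longrightarrow> \<theta> U (gact M g U x) = gact N g U (\<theta> U x)" using A[of U] by simp
  show "\<lbrakk>openin (topo \<X>) U; openin (topo \<X>) V; V \<subseteq> U; x \<in> carrier (msec M U)\<rbrakk> \<Longrightarrow> mres M U V x \<in> carrier (msec M V)" using B[of U V] by simp
  show "\<lbrakk>openin (topo \<X>) U; openin (topo \<X>) V; V \<subseteq> U; x \<in> carrier (msec M U)\<rbrakk> \<Longrightarrow> \<theta> V (mres M U V x) = mres N U V (\<theta> U x)" using B[of U V] by simp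
  show "\<lbrakk>openin (topo \<X>) U; x \<in> carrier (msec M U)\<rbrakk> \<Longrightarrow> \<theta> U x \<in> carrier (msec N U)" using bij by (auto simp: bij_betw_def)
  show "\<lbrakk>openin (topo \<X>) U; x \<in> carrier (msec M U); y \<in> carrier (msec M U); \<theta> U x = \<theta> U y\<rbrakk> \<Longrightarrow> x = y"
    using bij by (auto simp: bij_betw_def inj_on_def)
  show "\<lbrakk>openin (topo \<X>) U; z \<in> carrier (msec N U)\<rbrakk> \<Longrightarrow> \<exists>x\<in>carrier (msec M U). z = \<theta> U x"
    using bij unfolding bij_betw_def by blast
qed

lemma gsheaf_iso_trans:
  assumes "gsheaf_iso \<X> G M N \<theta>" "gsheaf_iso \<X> G N P \<phi>"
  shows "gsheaf_iso \<X> G M P (\<lambda>U x. \<phi> U (\<theta> U x))"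
proof -
  note a = gsheaf_isoD[OF assms(1)] and b = gsheaf_isoD[OF assms(2)]
  show ?thesis
  proof (rule gsheaf_isoI)
    fix U assume U: "openin (topo \<X>) U"
    show "bij_betw (\<lambda>x. \<phi> U (\<theta> U x)) (carrier (msec M U)) (carrier (msec P U))"
      using bij_betw_trans[OF a(1)[OF U] b(1)[OF U]] by (simp add: comp_def)
  qed (simp_all add: a(2-12) b(2-12))
qed

lemma gsheaf_iso_sym:
  assumes "gsheaf_iso \<X> G M N \<theta>"
  shows "gsheaf_iso \<X> G N M (\<lambda>U. the_inv_into (carrier (msec M U)) (\<theta> U))"
proof -
  note d = gsheaf_isoD[OF assms]
  let ?i = "\<lambda>U. the_inv_into (carrier (msec M U)) (\<theta> U)"
  have i: "?i U (\<theta> U x) = x" if "openin (topo \<X>) U" "x \<in> carrier (msec M U)" for U x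
    using d(1)[OF that(1)] that(2) by (auto simp: bij_betw_def the_inv_into_f_f)
  show ?thesis
  proof (rule gsheaf_isoI)
    fix U assume U: "openin (topo \<X>) U"
    show "bij_betw (?i U) (carrier (msec N U)) (carrier (msec M U))"
      by (rule bij_betw_the_inv_into[OF d(1)[OF U]])
    show "\<zero>\<^bsub>msec N U\<^esub> \<in> carrier (msec N U)" using d(12)[OF U d(2)[OF U]] d(3)[OF U] by simp
    show "?i U \<zero>\<^bsub>msec N U\<^esub> = \<zero>\<^bsub>msec M U\<^esub>" using i[OF U d(2)[OF U]] d(3)[OF U] by simp
    fix z assume "z \<in> carrier (msec N U)"
    then obtain x where x: "x \<in> carrier (msec M U)" "z = \<theta> U x" using d(14)[OF U] by blast
    {
      fix z' assume "z' \<in> carrier (msec N U)"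
      then obtain x' where x': "x' \<in> carrier (msec M U)" "z' = \<theta> U x'" using d(14)[OF U] by blast
      show "z \<oplus>\<^bsub>msec N U\<^esub> z' \<in> carrier (msec N U)"
        using d(12)[OF U d(4)[OF U x(1) x'(1)]] d(5)[OF U x(1) x'(1)] x x' by simp
      show "?i U (z \<oplus>\<^bsub>msec N U\<^esub> z') = ?i U z \<oplus>\<^bsub>msec M U\<^esub> ?i U z'"
        using i[OF U d(4)[OF U x(1) x'(1)]] d(5)[OF U x(1) x'(1)] x x' i[OF U] by simp
    }
    {
      fix a assume a: "a \<in> carrier (sec \<X> U)"
      show "a \<odot>\<^bsub>msec N U\<^esub> z \<in> carrier (msec N U)" using d(12)[OF U d(6)[OF U a x(1)]] d(7)[OF U a x(1)] x by simp
      show "?i U (a \<odot>\<^bsub>msec N U\<^esub> z) = a \<odot>\<^bsub>msec M U\<^esub> ?i U z"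
        using i[OF U d(6)[OF U a x(1)]] d(7)[OF U a x(1)] x i[OF U] by simp
    }
    {
      fix g assume g: "g \<in> carrier G"
      show "gact N g U z \<in> carrier (msec N U)" using d(12)[OF U d(8)[OF U g x(1)]] d(9)[OF U g x(1)] x by simp
      show "?i U (gact N g U z) = gact M g U (?i U z)"
        using i[OF U d(8)[OF U g x(1)]] d(9)[OF U g x(1)] x i[OF U] by simp
    }
    {
      fix V assume V: "openin (topo \<X>) V" "V \<subseteq> U"
      show "mres N U V z \<in> carrier (msec N V)" using d(12)[OF V(1) d(10)[OF U V x(1)]] d(11)[OF U V x(1)] x by simp
      show "?i V (mres N U V z) = mres M U V (?i U z)"
        using i[OF V(1) d(10)[OF U V x(1)]] d(11)[OF U V x(1)] x i[OF U] by simp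
    }
  qed
qed

lemma gsheaf_iso_imp_gmod_iso:
  assumes "gsheaf_iso \<X> G M N \<theta>"
  shows "gmod_iso \<X> G M N \<theta>"
  using gsheaf_isoD[OF assms] unfolding gmod_iso_def omod_hom_def by (auto intro!: module_homsI)

text \<open>Each law is an equation that can be tested after applying the injective map
  \<open>f\<close>; additive inverses come from surjectivity.\<close>

lemma module_pullback:
  assumes N: "module R N" and inj: "inj_on f (carrier M)" and fN: "f ` carrier M = carrier N"
    and zero: "\<zero>\<^bsub>M\<^esub> \<in> carrier M" "f \<zero>\<^bsub>M\<^esub> = \<zero>\<^bsub>N\<^esub>"
    and add: "\<And>x y. \<lbrakk>x \<in> carrier M; y \<in> carrier M\<rbrakk> \<Longrightarrow> x \<oplus>\<^bsub>M\<^esub> y \<in> carrier M"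
      "\<And>x y. \<lbrakk>x \<in> carrier M; y \<in> carrier M\<rbrakk> \<Longrightarrow> f (x \<oplus>\<^bsub>M\<^esub> y) = f x \<oplus>\<^bsub>N\<^esub> f y"
    and smult: "\<And>a x. \<lbrakk>a \<in> carrier R; x \<in> carrier M\<rbrakk> \<Longrightarrow> a \<odot>\<^bsub>M\<^esub> x \<in> carrier M"
      "\<And>a x. \<lbrakk>a \<in> carrier R; x \<in> carrier M\<rbrakk> \<Longrightarrow> f (a \<odot>\<^bsub>M\<^esub> x) = a \<odot>\<^bsub>N\<^esub> f x"
  shows "module R M"
proof -
  interpret N: module R N by fact
  have fc: "x \<in> carrier M \<Longrightarrow> f x \<in> carrier N" for x using fN by blast
  have eq: "\<lbrakk>x \<in> carrier M; y \<in> carrier M; f x = f y\<rbrakk> \<Longrightarrow> x = y" for x y using inj by (auto simp: inj_on_def)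
  show ?thesis
  proof (rule moduleI[OF N.R.is_cring])
    show "abelian_group M"
    proof (rule abelian_groupI)
      fix x assume x: "x \<in> carrier M"
      have "\<ominus>\<^bsub>N\<^esub> f x \<in> f ` carrier M" unfolding fN by (rule N.M.a_inv_closed[OF fc[OF x]])
      then obtain y where y: "y \<in> carrier M" "f y = \<ominus>\<^bsub>N\<^esub> f x" by force
      have "y \<oplus>\<^bsub>M\<^esub> x = \<zero>\<^bsub>M\<^esub>"
        by (rule eq) (use x y fc in \<open>simp_all add: add zero N.M.l_neg\<close>)
      then show "\<exists>y\<in>carrier M. y \<oplus>\<^bsub>M\<^esub> x = \<zero>\<^bsub>M\<^esub>" using y(1) by blast
    next
      show "x \<oplus>\<^bsub>M\<^esub> y \<oplus>\<^bsub>M\<^esub> z = x \<oplus>\<^bsub>M\<^esub> (y \<oplus>\<^bsub>M\<^esub> z)" if "x \<in> carrier M" "y \<in> carrier M" "z \<in> carrier M" for x y z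
        by (rule eq) (use that fc in \<open>simp_all add: add N.M.a_assoc\<close>)
      show "x \<oplus>\<^bsub>M\<^esub> y = y \<oplus>\<^bsub>M\<^esub> x" if "x \<in> carrier M" "y \<in> carrier M" for x y
        by (rule eq) (use that fc N.M.a_comm in \<open>simp_all add: add\<close>)
      show "\<zero>\<^bsub>M\<^esub> \<oplus>\<^bsub>M\<^esub> x = x" if "x \<in> carrier M" for x
        by (rule eq) (use that fc in \<open>simp_all add: add zero\<close>)
    qed (fact zero(1) add(1))+
  next
    show "(a \<oplus>\<^bsub>R\<^esub> b) \<odot>\<^bsub>M\<^esub> x = a \<odot>\<^bsub>M\<^esub> x \<oplus>\<^bsub>M\<^esub> b \<odot>\<^bsub>M\<^esub> x" if "a \<in> carrier R" "b \<in> carrier R" "x \<in> carrier M" for a b x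
      by (rule eq) (use that fc in \<open>simp_all add: add smult N.smult_l_distr\<close>)
    show "a \<odot>\<^bsub>M\<^esub> (x \<oplus>\<^bsub>M\<^esub> y) = a \<odot>\<^bsub>M\<^esub> x \<oplus>\<^bsub>M\<^esub> a \<odot>\<^bsub>M\<^esub> y" if "a \<in> carrier R" "x \<in> carrier M" "y \<in> carrier M" for a x y
      by (rule eq) (use that fc in \<open>simp_all add: add smult N.smult_r_distr\<close>)
    show "(a \<otimes>\<^bsub>R\<^esub> b) \<odot>\<^bsub>M\<^esub> x = a \<odot>\<^bsub>M\<^esub> (b \<odot>\<^bsub>M\<^esub> x)" if "a \<in> carrier R" "b \<in> carrier R" "x \<in> carrier M" for a b x
      by (rule eq) (use that fc in \<open>simp_all add: smult N.smult_assoc1\<close>)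
    show "\<one>\<^bsub>R\<^esub> \<odot>\<^bsub>M\<^esub> x = x" if "x \<in> carrier M" for x
      by (rule eq) (use that fc in \<open>simp_all add: smult\<close>)
  qed (fact smult(1))
qed

lemma omoduleI:
  assumes "set_sheaf (topo \<X>) (\<lambda>U. carrier (msec M U)) (mres M)"
    and "\<And>U. openin (topo \<X>) U \<Longrightarrow> module (sec \<X> U) (msec M U)"
    and "\<And>U V x y. \<lbrakk>openin (topo \<X>) U; openin (topo \<X>) V; V \<subseteq> U; x \<in> carrier (msec M U); y \<in> carrier (msec M U)\<rbrakk> \<Longrightarrow>
      mres M U V (x \<oplus>\<^bsub>msec M U\<^esub> y) = mres M U V x \<oplus>\<^bsub>msec M V\<^esub> mres M U V y"
    and "\<And>U V a x. \<lbrakk>openin (topo \<X>) U; openin (topo \<X>) V; V \<subseteq> U; a \<in> carrier (sec \<X> U); x \<in> carrier (msec M U)\<rbrakk> \<Longrightarrow>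
      mres M U V (a \<odot>\<^bsub>msec M U\<^esub> x) = res \<X> U V a \<odot>\<^bsub>msec M V\<^esub> mres M U V x"
  shows "omodule \<X> M"
  unfolding omodule_def by (simp add: assms)

text \<open>The sheaf conditions are read through \<theta>: injectivity gives locality, and
  surjectivity supplies the glued section.\<close>

lemma (in ringed) omodule_pullback:
  assumes iso: "gsheaf_iso \<X> G M N \<theta>" and N: "omodule \<X> N"
  shows "omodule \<X> M"
proof -
  interpret N: omod \<X> N by unfold_locales (rule N)
  note d = gsheaf_isoD[OF iso]
  have 1: "set_sheaf (topo \<X>) (\<lambda>U. carrier (msec M U)) (mres M)"
  proof (rule set_sheafI)
    fix U s assume U: "opn U" and s: "s \<in> carrier (msec M U)"
    show "mres M U U s = s"
      by (rule d(13)[OF U d(10)[OF U U subset_refl s] s])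
        (simp only: d(11)[OF U U subset_refl s] N.S.res_id[OF U d(12)[OF U s]])
    fix V W assume V: "opn V" and W: "opn W" and sub: "W \<subseteq> V" "V \<subseteq> U"
    have WU: "W \<subseteq> U" using sub by blast
    note sV = d(10)[OF U V sub(2) s]
    show "mres M V W (mres M U V s) = mres M U W s"
      by (rule d(13)[OF W d(10)[OF V W sub(1) sV] d(10)[OF U W WU s]])
        (simp only: d(11)[OF V W sub(1) sV] d(11)[OF U V sub(2) s] d(11)[OF U W WU s] N.S.res_res[OF U V W sub d(12)[OF U s]])
  next
    fix \<U> s t assume o: "\<And>V. V \<in> \<U> \<Longrightarrow> opn V" and s: "s \<in> carrier (msec M (\<Union>\<U>))" and t: "t \<in> carrier (msec M (\<Union>\<U>))"
      and eq: "\<And>V. V \<in> \<U> \<Longrightarrow> mres M (\<Union>\<U>) V s = mres M (\<Union>\<U>) V t"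
    have UU: "opn (\<Union>\<U>)" using o by blast
    show "s = t"
    proof (rule d(13)[OF UU s t], rule N.S.locality[OF o])
      fix V assume V: "V \<in> \<U>"
      then have VU: "V \<subseteq> \<Union>\<U>" by blast
      show "mres N (\<Union>\<U>) V (\<theta> (\<Union>\<U>) s) = mres N (\<Union>\<U>) V (\<theta> (\<Union>\<U>) t)"
        using d(11)[OF UU o[OF V] VU s] d(11)[OF UU o[OF V] VU t] eq[OF V] by simp
    qed (use d(12)[OF UU] s t in auto)
  next
    fix \<U> \<sigma> assume o: "\<And>V. V \<in> \<U> \<Longrightarrow> opn V" and s: "\<And>V. V \<in> \<U> \<Longrightarrow> \<sigma> V \<in> carrier (msec M V)"
      and eq: "\<And>V W. \<lbrakk>V \<in> \<U>; W \<in> \<U>\<rbrakk> \<Longrightarrow> mres M V (V \<inter> W) (\<sigma> V) = mres M W (V \<inter> W) (\<sigma> W)"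
    have UU: "opn (\<Union>\<U>)" using o by blast
    have "\<exists>t\<in>carrier (msec N (\<Union>\<U>)). \<forall>V\<in>\<U>. mres N (\<Union>\<U>) V t = \<theta> V (\<sigma> V)"
    proof (rule N.S.gluing[OF o])
      fix V W assume VW: "V \<in> \<U>" "W \<in> \<U>"
      note oI = opn_Int[OF o[OF VW(1)] o[OF VW(2)]]
      show "mres N V (V \<inter> W) (\<theta> V (\<sigma> V)) = mres N W (V \<inter> W) (\<theta> W (\<sigma> W))"
        using d(11)[OF o[OF VW(1)] oI Int_lower1 s[OF VW(1)]] d(11)[OF o[OF VW(2)] oI Int_lower2 s[OF VW(2)]] eq[OF VW] by simp
    qed (use d(12) o s in auto)
    then obtain t where t: "t \<in> carrier (msec N (\<Union>\<U>))" "\<And>V. V \<in> \<U> \<Longrightarrow> mres N (\<Union>\<U>) V t = \<theta> V (\<sigma> V)" by blast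
    obtain t' where t': "t' \<in> carrier (msec M (\<Union>\<U>))" "t = \<theta> (\<Union>\<U>) t'" using d(14)[OF UU t(1)] by blast
    have "mres M (\<Union>\<U>) V t' = \<sigma> V" if V: "V \<in> \<U>" for V
    proof -
      have VU: "V \<subseteq> \<Union>\<U>" using V by blast
      show ?thesis
        by (rule d(13)[OF o[OF V] d(10)[OF UU o[OF V] VU t'(1)] s[OF V]])
          (use d(11)[OF UU o[OF V] VU t'(1)] t(2)[OF V] t'(2) in simp)
    qed
    with t'(1) show "\<exists>t\<in>carrier (msec M (\<Union>\<U>)). \<forall>V\<in>\<U>. mres M (\<Union>\<U>) V t = \<sigma> V" by blast
  qed (rule d(10))
  have 2: "module (sec \<X> U) (msec M U)" if U: "opn U" for U
    by (rule module_pullback[OF N.module_msec[OF U] bij_betw_imp_inj_on[OF d(1)[OF U]] bij_betw_imp_surj_on[OF d(1)[OF U]]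
        d(2-7)[OF U]])
  have 3: "mres M U V (x \<oplus>\<^bsub>msec M U\<^esub> y) = mres M U V x \<oplus>\<^bsub>msec M V\<^esub> mres M U V y"
    if o: "opn U" "opn V" "V \<subseteq> U" and x: "x \<in> carrier (msec M U)" "y \<in> carrier (msec M U)" for U V x y
  proof (rule d(13)[OF o(2)])
    show "\<theta> V (mres M U V (x \<oplus>\<^bsub>msec M U\<^esub> y)) = \<theta> V (mres M U V x \<oplus>\<^bsub>msec M V\<^esub> mres M U V y)"
      using d(11)[OF o d(4)[OF o(1) x]] d(5)[OF o(1) x] d(5)[OF o(2) d(10)[OF o x(1)] d(10)[OF o x(2)]] d(11)[OF o x(1)] d(11)[OF o x(2)]
        N.mres_simps(2)[OF o d(12)[OF o(1) x(1)] d(12)[OF o(1) x(2)]] by simp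
  qed (use d(4)[OF o(1) x] d(4)[OF o(2) d(10)[OF o x(1)] d(10)[OF o x(2)]] d(10)[OF o] in auto)
  have 4: "mres M U V (a \<odot>\<^bsub>msec M U\<^esub> x) = res \<X> U V a \<odot>\<^bsub>msec M V\<^esub> mres M U V x"
    if o: "opn U" "opn V" "V \<subseteq> U" and x: "a \<in> carrier (sec \<X> U)" "x \<in> carrier (msec M U)" for U V a x
  proof (rule d(13)[OF o(2)])
    note ra = res_simps(1)[OF o x(1)]
    show "\<theta> V (mres M U V (a \<odot>\<^bsub>msec M U\<^esub> x)) = \<theta> V (res \<X> U V a \<odot>\<^bsub>msec M V\<^esub> mres M U V x)"
      using d(11)[OF o d(6)[OF o(1) x]] d(7)[OF o(1) x] d(7)[OF o(2) ra d(10)[OF o x(2)]] d(11)[OF o x(2)]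
        N.mres_simps(3)[OF o x(1) d(12)[OF o(1) x(2)]] by simp
  qed (use d(6)[OF o(1) x] d(6)[OF o(2) res_simps(1)[OF o x(1)] d(10)[OF o x(2)]] d(10)[OF o] in auto)
  show ?thesis by (rule omoduleI[OF 1 2 3 4])
qed

section \<open>Sheafification leaves a sheaf unchanged\<close>

section \<open>Sheafification of a sheaf\<close>

text \<open>A family of endomorphisms indexed by the group. Sheafification treats each group element
  separately, so the laws of an action stay with \<open>gmodule\<close>.\<close>

locale act_omod = omod \<X> M for \<X> :: "('p, 'a) rspace" and M :: "('p, 'a, 'b, 'g) gmod" +
  fixes G :: "'g monoid"
  assumes gact_hom: "g \<in> carrier G \<Longrightarrow> omod_hom \<X> M M (gact M g)"
begin

lemma gact_simps:
  assumes "g \<in> carrier G" "opn U"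
  shows "x \<in> carrier (msec M U) \<Longrightarrow> gact M g U x \<in> carrier (msec M U)"
    "\<lbrakk>x \<in> carrier (msec M U); y \<in> carrier (msec M U)\<rbrakk> \<Longrightarrow> gact M g U (x \<oplus>\<^bsub>msec M U\<^esub> y) = gact M g U x \<oplus>\<^bsub>msec M U\<^esub> gact M g U y"
    "\<lbrakk>a \<in> carrier (sec \<X> U); x \<in> carrier (msec M U)\<rbrakk> \<Longrightarrow> gact M g U (a \<odot>\<^bsub>msec M U\<^esub> x) = a \<odot>\<^bsub>msec M U\<^esub> gact M g U x"
    "\<lbrakk>opn V; V \<subseteq> U; x \<in> carrier (msec M U)\<rbrakk> \<Longrightarrow> gact M g V (mres M U V x) = mres M U V (gact M g U x)"
proof -
  have "gact M g U \<in> module_homs (sec \<X> U) (msec M U) (msec M U)"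
    and r: "\<forall>U V. opn U \<and> opn V \<and> V \<subseteq> U \<longrightarrow> (\<forall>s\<in>carrier (msec M U). gact M g V (mres M U V s) = mres M U V (gact M g U s))"
    using gact_hom[OF assms(1)] assms(2) by (auto simp: omod_hom_def)
  note h = module_homsD[OF this(1)]
  show "x \<in> carrier (msec M U) \<Longrightarrow> gact M g U x \<in> carrier (msec M U)"
    "\<lbrakk>x \<in> carrier (msec M U); y \<in> carrier (msec M U)\<rbrakk> \<Longrightarrow> gact M g U (x \<oplus>\<^bsub>msec M U\<^esub> y) = gact M g U x \<oplus>\<^bsub>msec M U\<^esub> gact M g U y"
    "\<lbrakk>a \<in> carrier (sec \<X> U); x \<in> carrier (msec M U)\<rbrakk> \<Longrightarrow> gact M g U (a \<odot>\<^bsub>msec M U\<^esub> x) = a \<odot>\<^bsub>msec M U\<^esub> gact M g U x"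
    by (fact h)+
  show "\<lbrakk>opn V; V \<subseteq> U; x \<in> carrier (msec M U)\<rbrakk> \<Longrightarrow> gact M g V (mres M U V x) = mres M U V (gact M g U x)"
    using r assms(2) by simp
qed

text \<open>Two representatives of a germ agree on a neighbourhood, and the action commutes with
  restriction to it.\<close>

lemma ract_gstalk:
  assumes g: "g \<in> carrier G" and U: "opn U" "x \<in> U" "s \<in> carrier (msec M U)"
  shows "ract (gstalk \<X> M x) g (mgerm \<X> M x U s) = mgerm \<X> M x U (gact M g U s)"
proof -
  have "(\<Union>(V, t)\<in>mgerm \<X> M x U s. mgerm \<X> M x V (gact M g V t)) = mgerm \<X> M x U (gact M g U s)"
  proof (rule S.germ_UN1[OF U])
    fix V t assume V: "opn V" "x \<in> V" "t \<in> carrier (msec M V)" and eq: "mgerm \<X> M x V t = mgerm \<X> M x U s"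
    obtain W where W: "opn W" "x \<in> W" "W \<subseteq> V \<inter> U" "mres M V W t = mres M U W s"
      using eq unfolding S.germ_eq_iff[OF V U] by blast
    then have WVU: "W \<subseteq> V" "W \<subseteq> U" by auto
    have "mres M V W (gact M g V t) = mres M U W (gact M g U s)"
      using gact_simps(4)[OF g V(1) W(1) WVU(1) V(3)] gact_simps(4)[OF g U(1) W(1) WVU(2) U(3)] W(4) by simp
    then show "mgerm \<X> M x V (gact M g V t) = mgerm \<X> M x U (gact M g U s)"
      using W by (subst S.germ_eq_iff[OF V(1,2) gact_simps(1)[OF g V(1,3)] U(1,2) gact_simps(1)[OF g U(1,3)]]) blast
  qed
  then show ?thesis by (simp add: gstalk_def module.defs rep.defs)
qed

text \<open>The canonical map is injective because sections with equal germs coincide, and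
  surjective because a family of germs that locally comes from sections can be glued.\<close>

lemma sheafify_iso: "gsheaf_iso \<X> G M (sheafify \<X> M) (\<lambda>U s. \<lambda>x\<in>U. mgerm \<X> M x U s)"
proof (rule gsheaf_isoI)
  fix U assume U: "opn U"
  let ?\<eta> = "\<lambda>U s. \<lambda>x\<in>U. mgerm \<X> M x U s"
  have glue: "\<exists>t\<in>carrier (msec M U). ?\<eta> U t = s" if s: "s \<in> carrier (msec (sheafify \<X> M) U)" for s
  proof -
    have sP: "s \<in> (\<Pi>\<^sub>E x\<in>U. carrier (stalk \<X> M x))"
      and sl: "\<And>x. x \<in> U \<Longrightarrow> \<exists>V t. opn V \<and> x \<in> V \<and> V \<subseteq> U \<and> t \<in> carrier (msec M V) \<and> (\<forall>y\<in>V. s y = mgerm \<X> M y V t)"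
      using s by (auto simp: sheafify_def)
    \<comment> \<open>The cover consists of all open sets on which \<open>s\<close> comes from a
      section. On overlaps the chosen sections have the same germs, hence agree.\<close>
    define \<U> where "\<U> = {V. opn V \<and> V \<subseteq> U \<and> (\<exists>t\<in>carrier (msec M V). \<forall>y\<in>V. s y = mgerm \<X> M y V t)}"
    define \<sigma> where "\<sigma> V = (SOME t. t \<in> carrier (msec M V) \<and> (\<forall>y\<in>V. s y = mgerm \<X> M y V t))" for V
    have \<sigma>: "\<sigma> V \<in> carrier (msec M V) \<and> (\<forall>y\<in>V. s y = mgerm \<X> M y V (\<sigma> V))" if "V \<in> \<U>" for V
      unfolding \<sigma>_def by (rule someI_ex) (use that in \<open>auto simp: \<U>_def\<close>)
    have o: "opn V" if "V \<in> \<U>" for V using that by (simp add: \<U>_def)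
    have UU: "\<Union>\<U> = U"
    proof
      show "\<Union>\<U> \<subseteq> U" by (auto simp: \<U>_def)
      show "U \<subseteq> \<Union>\<U>"
      proof
        fix x assume "x \<in> U"
        from sl[OF this] obtain V where "V \<in> \<U>" "x \<in> V" unfolding \<U>_def by blast
        then show "x \<in> \<Union>\<U>" by blast
      qed
    qed
    have "\<exists>t\<in>carrier (msec M (\<Union>\<U>)). \<forall>V\<in>\<U>. mres M (\<Union>\<U>) V t = \<sigma> V"
    proof (rule S.gluing[OF o])
      fix V W assume VW: "V \<in> \<U>" "W \<in> \<U>"
      note oI = opn_Int[OF o[OF VW(1)] o[OF VW(2)]]
      show "mres M V (V \<inter> W) (\<sigma> V) = mres M W (V \<inter> W) (\<sigma> W)"
      proof (rule S.germ_locality[OF oI])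
        fix x assume x: "x \<in> V \<inter> W"
        have "s x = mgerm \<X> M x V (\<sigma> V)" "s x = mgerm \<X> M x W (\<sigma> W)"
          using \<sigma>[OF VW(1)] \<sigma>[OF VW(2)] x by blast+
        then show "mgerm \<X> M x (V \<inter> W) (mres M V (V \<inter> W) (\<sigma> V)) = mgerm \<X> M x (V \<inter> W) (mres M W (V \<inter> W) (\<sigma> W))"
          using mgerm_res[OF o[OF VW(1)] oI x Int_lower1] mgerm_res[OF o[OF VW(2)] oI x Int_lower2] \<sigma>[OF VW(1)] \<sigma>[OF VW(2)] by simp
      qed (use mres_simps(1)[OF o oI] VW \<sigma> in auto)
    qed (use \<sigma> in auto)
    then obtain t where t: "t \<in> carrier (msec M U)" "\<And>V. V \<in> \<U> \<Longrightarrow> mres M U V t = \<sigma> V" unfolding UU by blast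
    have "?\<eta> U t = s"
    proof (rule PiE_ext[OF _ sP])
      show "?\<eta> U t \<in> (\<Pi>\<^sub>E x\<in>U. carrier (stalk \<X> M x))" using mgerm_closed[OF U _ t(1)] by auto
      fix x assume x: "x \<in> U"
      obtain V where V: "V \<in> \<U>" "x \<in> V" using x UU by blast
      have VU: "V \<subseteq> U" using V by (simp add: \<U>_def)
      show "?\<eta> U t x = s x"
        using mgerm_res[OF U o[OF V(1)] V(2) VU t(1)] t(2)[OF V(1)] \<sigma>[OF V(1)] V x by simp
    qed
    with t(1) show ?thesis by blast
  qed
  have \<eta>c: "?\<eta> U s \<in> carrier (msec (sheafify \<X> M) U)" if s: "s \<in> carrier (msec M U)" for s
    using mgerm_closed[OF U _ s] U s by (auto simp: sheafify_def)
  have inj: "inj_on (?\<eta> U) (carrier (msec M U))"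
  proof (rule inj_onI)
    fix s t assume s: "s \<in> carrier (msec M U)" and t: "t \<in> carrier (msec M U)" and eq: "?\<eta> U s = ?\<eta> U t"
    show "s = t"
    proof (rule S.germ_locality[OF U s t])
      fix x assume "x \<in> U"
      then show "mgerm \<X> M x U s = mgerm \<X> M x U t" using fun_cong[OF eq, of x] by simp
    qed
  qed
  have "?\<eta> U ` carrier (msec M U) = carrier (msec (sheafify \<X> M) U)"
    using glue \<eta>c by blast
  with inj show "bij_betw (?\<eta> U) (carrier (msec M U)) (carrier (msec (sheafify \<X> M) U))"
    by (simp only: bij_betw_def)
  show "?\<eta> U \<zero>\<^bsub>msec M U\<^esub> = \<zero>\<^bsub>msec (sheafify \<X> M) U\<^esub>"
    using stalk_zero[OF U] by (auto simp: sheafify_def intro!: restrict_ext)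
  fix s assume s: "s \<in> carrier (msec M U)"
  show "?\<eta> U (s \<oplus>\<^bsub>msec M U\<^esub> t) = ?\<eta> U s \<oplus>\<^bsub>msec (sheafify \<X> M) U\<^esub> ?\<eta> U t" if t: "t \<in> carrier (msec M U)" for t
    using stalk_add[OF U _ s t] by (simp add: sheafify_def cong: restrict_cong)
  show "?\<eta> U (a \<odot>\<^bsub>msec M U\<^esub> s) = a \<odot>\<^bsub>msec (sheafify \<X> M) U\<^esub> ?\<eta> U s" if a: "a \<in> carrier (sec \<X> U)" for a
    using stalk_smult[OF U _ a s] by (simp add: sheafify_def cong: restrict_cong)
  show "?\<eta> U (gact M g U s) = gact (sheafify \<X> M) g U (?\<eta> U s)" if g: "g \<in> carrier G" for g
    using ract_gstalk[OF g U _ s] by (simp add: sheafify_def cong: restrict_cong)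
  show "?\<eta> V (mres M U V s) = mres (sheafify \<X> M) U V (?\<eta> U s)" if V: "opn V" "V \<subseteq> U" for V
    using mgerm_res[OF U V(1) _ V(2) s] V(2) by (auto simp: sheafify_def restrict_def fun_eq_iff)
qed (use msec_closed mres_simps gact_simps in auto)

end

text \<open>Each law is tested after applying the injective \<theta>, which intertwines the
  actions.\<close>

lemma (in ringed) omod_hom_pullback:
  fixes G :: "'g monoid"
  assumes iso: "gsheaf_iso \<X> G P N \<theta>" and N: "omodule \<X> N"
    and act: "\<And>g. g \<in> carrier G \<Longrightarrow> omod_hom \<X> N N (gact N g)" and g: "g \<in> carrier G"
  shows "omod_hom \<X> P P (gact P g)"
proof -
  interpret N: act_omod \<X> N G by unfold_locales (fact N act)+
  note d = gsheaf_isoD[OF iso]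
  show ?thesis
    unfolding omod_hom_def
  proof (intro conjI allI impI ballI)
    fix U assume U: "opn U"
    show "gact P g U \<in> module_homs (sec \<X> U) (msec P U) (msec P U)"
    proof (rule module_homsI)
      fix x assume x: "x \<in> carrier (msec P U)"
      show "gact P g U x \<in> carrier (msec P U)" by (rule d(8)[OF U g x])
      note gx = d(8)[OF U g x]
      show "gact P g U (x \<oplus>\<^bsub>msec P U\<^esub> y) = gact P g U x \<oplus>\<^bsub>msec P U\<^esub> gact P g U y" if y: "y \<in> carrier (msec P U)" for y
        by (rule d(13)[OF U d(8)[OF U g d(4)[OF U x y]] d(4)[OF U gx d(8)[OF U g y]]])
          (simp only: d(9)[OF U g d(4)[OF U x y]] d(5)[OF U x y] d(5)[OF U gx d(8)[OF U g y]] d(9)[OF U g x] d(9)[OF U g y]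
            N.gact_simps(2)[OF g U d(12)[OF U x] d(12)[OF U y]])
      show "gact P g U (a \<odot>\<^bsub>msec P U\<^esub> x) = a \<odot>\<^bsub>msec P U\<^esub> gact P g U x" if a: "a \<in> carrier (sec \<X> U)" for a
        by (rule d(13)[OF U d(8)[OF U g d(6)[OF U a x]] d(6)[OF U a gx]])
          (simp only: d(9)[OF U g d(6)[OF U a x]] d(7)[OF U a x] d(7)[OF U a gx] d(9)[OF U g x]
            N.gact_simps(3)[OF g U a d(12)[OF U x]])
    qed
  next
    fix U V x assume "opn U \<and> opn V \<and> V \<subseteq> U" and x: "x \<in> carrier (msec P U)"
    then have o: "opn U" "opn V" "V \<subseteq> U" by auto
    note gx = d(8)[OF o(1) g x] and xV = d(10)[OF o x]
    show "gact P g V (mres P U V x) = mres P U V (gact P g U x)"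
      by (rule d(13)[OF o(2) d(8)[OF o(2) g xV] d(10)[OF o gx]])
        (simp only: d(9)[OF o(2) g xV] d(11)[OF o x] d(11)[OF o gx] d(9)[OF o(1) g x] N.gact_simps(4)[OF g o d(12)[OF o(1) x]])
  qed
qed

text \<open>\<open>P\<close> is a sheaf because it is isomorphic to one, so the canonical map to its
  sheafification can be inverted. Both sheafifications in the statement of the theorem, that of O(V)
  and that of the tensor product, are removed in this way.\<close>

lemma (in ringed) sheafify_iso_of_iso:
  fixes G :: "'g monoid"
  assumes iso: "gsheaf_iso \<X> G P N \<theta>" and N: "omodule \<X> N"
    and act: "\<And>g. g \<in> carrier G \<Longrightarrow> omod_hom \<X> N N (gact N g)"
  shows "\<exists>\<Theta>. gsheaf_iso \<X> G (sheafify \<X> P) N \<Theta>"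
proof -
  interpret P: act_omod \<X> P G
    by unfold_locales (rule omodule_pullback[OF iso N] omod_hom_pullback[OF iso N act]; assumption)+
  show ?thesis
    using gsheaf_iso_trans[OF gsheaf_iso_sym[OF P.sheafify_iso] iso] by blast
qed

section \<open>O(V) as a free sheaf with a matrix action\<close>

section \<open>The sheaf associated with a representation\<close>

locale ringed_over = ringed \<X> for \<X> :: "('p, 'a) rspace" +
  fixes k :: "'k ring" and \<kappa> :: "'k \<Rightarrow> 'a"
  assumes cring_k: "cring k" and \<kappa>: "\<kappa> \<in> ring_hom k (sec \<X> (points \<X>))"
begin

lemma const_sec_hom:
  assumes U: "opn U"
  shows "const_sec \<X> \<kappa> U \<in> ring_hom k (sec \<X> U)"
proof -
  have "res \<X> (points \<X>) U \<circ> \<kappa> \<in> ring_hom k (sec \<X> U)"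
    by (rule ring_hom_trans[OF \<kappa> res_hom[OF opn_points U opn_subset[OF U]]])
  then show ?thesis by (simp add: const_sec_def[abs_def] comp_def)
qed

lemma const_sec_res:
  assumes "opn U" "opn V" "V \<subseteq> U" "c \<in> carrier k"
  shows "res \<X> U V (const_sec \<X> \<kappa> U c) = const_sec \<X> \<kappa> V c"
  using O.res_res[OF opn_points assms(1,2,3) opn_subset[OF assms(1)] ring_hom_closed[OF \<kappa> assms(4)]]
  by (simp add: const_sec_def)

lemma const_sec_simps:
  assumes "opn U"
  shows "c \<in> carrier k \<Longrightarrow> const_sec \<X> \<kappa> U c \<in> carrier (sec \<X> U)"
    "\<lbrakk>c \<in> carrier k; d \<in> carrier k\<rbrakk> \<Longrightarrow> const_sec \<X> \<kappa> U (c \<oplus>\<^bsub>k\<^esub> d) = const_sec \<X> \<kappa> U c \<oplus>\<^bsub>sec \<X> U\<^esub> const_sec \<X> \<kappa> U d"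
    "\<lbrakk>c \<in> carrier k; d \<in> carrier k\<rbrakk> \<Longrightarrow> const_sec \<X> \<kappa> U (c \<otimes>\<^bsub>k\<^esub> d) = const_sec \<X> \<kappa> U c \<otimes>\<^bsub>sec \<X> U\<^esub> const_sec \<X> \<kappa> U d"
    "const_sec \<X> \<kappa> U \<one>\<^bsub>k\<^esub> = \<one>\<^bsub>sec \<X> U\<^esub>"
    "const_sec \<X> \<kappa> U \<zero>\<^bsub>k\<^esub> = \<zero>\<^bsub>sec \<X> U\<^esub>"
  using const_sec_hom[OF assms] ring_hom_zero[OF const_sec_hom[OF assms] cring.axioms(1)[OF cring_k] cring.axioms(1)[OF cring_sec[OF assms]]]
  by (auto simp: ring_hom_def)

text \<open>The matrix form of O(V): column vectors over the structure sheaf, on which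
  \<open>g\<close> acts by its matrix in the basis \<open>w\<close>, with entries turned into
  constant sections.\<close>

definition free_gmod :: "('k, 'v, 'g) rep \<Rightarrow> 'i set \<Rightarrow> ('i \<Rightarrow> 'v) \<Rightarrow> ('i \<Rightarrow> 'v \<Rightarrow> 'k) \<Rightarrow> ('p, 'a, 'i \<Rightarrow> 'a, 'g) gmod" where
  "free_gmod V J w \<gamma> =
     \<lparr>msec = (\<lambda>U. free_module (sec \<X> U) J),
      mres = (\<lambda>U U' x. \<lambda>j\<in>J. res \<X> U U' (x j)),
      gact = (\<lambda>g U x. \<lambda>j\<in>J. \<Oplus>\<^bsub>sec \<X> U\<^esub>l\<in>J. const_sec \<X> \<kappa> U (\<gamma> j (ract V g (w l))) \<otimes>\<^bsub>sec \<X> U\<^esub> x l)\<rparr>"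

lemma free_gmod_simps [simp]:
  "msec (free_gmod V J w \<gamma>) U = free_module (sec \<X> U) J"
  "mres (free_gmod V J w \<gamma>) U U' x = (\<lambda>j\<in>J. res \<X> U U' (x j))"
  "gact (free_gmod V J w \<gamma>) g U x =
    (\<lambda>j\<in>J. \<Oplus>\<^bsub>sec \<X> U\<^esub>l\<in>J. const_sec \<X> \<kappa> U (\<gamma> j (ract V g (w l))) \<otimes>\<^bsub>sec \<X> U\<^esub> x l)"
  by (simp_all add: free_gmod_def)

text \<open>Locality and gluing hold in each component separately.\<close>

lemma omodule_free_gmod: "omodule \<X> (free_gmod V J w \<gamma>)"
proof (rule omoduleI)
  let ?F = "free_gmod V J w \<gamma>"
  show "module (sec \<X> U) (msec ?F U)" if "opn U" for U
    using module_dsum_module[OF cring_sec[OF that] module_ring_module[OF cring_sec[OF that]]] by simp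
  show "mres ?F U W (x \<oplus>\<^bsub>msec ?F U\<^esub> y) = mres ?F U W x \<oplus>\<^bsub>msec ?F W\<^esub> mres ?F U W y"
    if "opn U" "opn W" "W \<subseteq> U" "x \<in> carrier (msec ?F U)" "y \<in> carrier (msec ?F U)" for U W x y
    using that(4,5) res_simps[OF that(1-3)] by (auto simp: PiE_iff intro!: restrict_ext)
  show "mres ?F U W (a \<odot>\<^bsub>msec ?F U\<^esub> x) = res \<X> U W a \<odot>\<^bsub>msec ?F W\<^esub> mres ?F U W x"
    if "opn U" "opn W" "W \<subseteq> U" "a \<in> carrier (sec \<X> U)" "x \<in> carrier (msec ?F U)" for U W a x
    using that(4,5) res_simps[OF that(1-3)] by (auto simp: PiE_iff intro!: restrict_ext)
  show "set_sheaf (topo \<X>) (\<lambda>U. carrier (msec ?F U)) (mres ?F)"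
  proof (rule set_sheafI)
    fix U W s assume o: "opn U" "opn W" "W \<subseteq> U" and s: "s \<in> carrier (msec ?F U)"
    show "mres ?F U W s \<in> carrier (msec ?F W)" using s res_simps(1)[OF o] by (auto simp: PiE_iff)
  next
    fix U s assume U: "opn U" and s: "s \<in> carrier (msec ?F U)"
    show "mres ?F U U s = s" using s O.res_id[OF U] by (auto simp: PiE_iff intro!: extensionalityI[of _ J])
  next
    fix U W W' s assume o: "opn U" "opn W" "opn W'" "W' \<subseteq> W" "W \<subseteq> U" and s: "s \<in> carrier (msec ?F U)"
    show "mres ?F W W' (mres ?F U W s) = mres ?F U W' s"
      using s O.res_res[OF o] by (auto simp: PiE_iff intro!: restrict_ext)
  next
    fix \<U> s t assume o: "\<And>W. W \<in> \<U> \<Longrightarrow> opn W" and s: "s \<in> carrier (msec ?F (\<Union>\<U>))" and t: "t \<in> carrier (msec ?F (\<Union>\<U>))"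
      and eq: "\<And>W. W \<in> \<U> \<Longrightarrow> mres ?F (\<Union>\<U>) W s = mres ?F (\<Union>\<U>) W t"
    have sP: "s \<in> J \<rightarrow>\<^sub>E carrier (sec \<X> (\<Union>\<U>))" and tP: "t \<in> J \<rightarrow>\<^sub>E carrier (sec \<X> (\<Union>\<U>))"
      using s t by auto
    show "s = t"
    proof (rule PiE_ext[OF sP tP])
      fix j assume j: "j \<in> J"
      show "s j = t j"
      proof (rule O.locality[OF o])
        fix W assume "W \<in> \<U>"
        from fun_cong[OF eq[OF this], of j] j show "res \<X> (\<Union>\<U>) W (s j) = res \<X> (\<Union>\<U>) W (t j)" by simp
      qed (use sP tP j in auto)
    qed
  next
    fix \<U> \<sigma> assume o: "\<And>W. W \<in> \<U> \<Longrightarrow> opn W" and s: "\<And>W. W \<in> \<U> \<Longrightarrow> \<sigma> W \<in> carrier (msec ?F W)"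
      and eq: "\<And>W W'. \<lbrakk>W \<in> \<U>; W' \<in> \<U>\<rbrakk> \<Longrightarrow> mres ?F W (W \<inter> W') (\<sigma> W) = mres ?F W' (W \<inter> W') (\<sigma> W')"
    have sP: "\<sigma> W \<in> J \<rightarrow>\<^sub>E carrier (sec \<X> W)" if "W \<in> \<U>" for W
      using s[OF that] by simp
    have "\<exists>t. t \<in> carrier (sec \<X> (\<Union>\<U>)) \<and> (\<forall>W\<in>\<U>. res \<X> (\<Union>\<U>) W t = \<sigma> W j)" if j: "j \<in> J" for j
    proof -
      have "\<exists>t\<in>carrier (sec \<X> (\<Union>\<U>)). \<forall>W\<in>\<U>. res \<X> (\<Union>\<U>) W t = \<sigma> W j"
      proof (rule O.gluing[OF o])
        fix W W' assume "W \<in> \<U>" "W' \<in> \<U>"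
        from fun_cong[OF eq[OF this], of j] j show "res \<X> W (W \<inter> W') (\<sigma> W j) = res \<X> W' (W \<inter> W') (\<sigma> W' j)" by simp
      qed (use sP j in auto)
      then show ?thesis by blast
    qed
    then obtain t where t: "\<And>j. j \<in> J \<Longrightarrow> t j \<in> carrier (sec \<X> (\<Union>\<U>)) \<and> (\<forall>W\<in>\<U>. res \<X> (\<Union>\<U>) W (t j) = \<sigma> W j)"
      by metis
    show "\<exists>t\<in>carrier (msec ?F (\<Union>\<U>)). \<forall>W\<in>\<U>. mres ?F (\<Union>\<U>) W t = \<sigma> W"
    proof (intro bexI[of _ "\<lambda>j\<in>J. t j"] ballI)
      show "(\<lambda>j\<in>J. t j) \<in> carrier (msec ?F (\<Union>\<U>))" using t by auto
      fix W assume W: "W \<in> \<U>"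
      show "mres ?F (\<Union>\<U>) W (\<lambda>j\<in>J. t j) = \<sigma> W"
        by (rule PiE_ext[of _ J "\<lambda>_. carrier (sec \<X> W)"]) (use t W sP[OF W] in auto)
    qed
  qed
qed

text \<open>The coordinates over each open set commute with restriction and turn the action into
  multiplication by matrices, already before sheafification. The second claim qualifies the free
  sheaf as a target of \<open>sheafify_iso_of_iso\<close>.\<close>

lemma rep_sheaf_iso:
  fixes G :: "'g monoid" and V :: "('k, 'v, 'g) rep"
  assumes V: "representation k G V" and db: "dual_basis k V J w \<gamma>"
  shows "\<exists>\<zeta>. gsheaf_iso \<X> G (rep_sheaf k \<X> \<kappa> V) (free_gmod V J w \<gamma>) \<zeta>"
    and "g \<in> carrier G \<Longrightarrow> omod_hom \<X> (free_gmod V J w \<gamma>) (free_gmod V J w \<gamma>) (gact (free_gmod V J w \<gamma>) g)"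
proof -
  let ?F = "free_gmod V J w \<gamma>"
  note V' = representationD[OF V] and d = dual_basisD[OF db]
  \<comment> \<open>The presheaf whose sheafification is \<open>rep_sheaf\<close>.\<close>
  define P where "P =
     \<lparr>msec = (\<lambda>U. module.truncate (base_change k (sec \<X> U) (const_sec \<X> \<kappa> U) V)),
      mres = (\<lambda>U U'. tensor_map k (alg_scale (sec \<X> U') (const_sec \<X> \<kappa> U')) (ring_module (sec \<X> U')) V
                (res \<X> U U') id),
      gact = (\<lambda>g U. ract (base_change k (sec \<X> U) (const_sec \<X> \<kappa> U) V) g)\<rparr>"
  have P_simps: "msec P U = tensor k (alg_scale (sec \<X> U) (const_sec \<X> \<kappa> U)) (ring_module (sec \<X> U)) V"
    "mres P U U' = tensor_map k (alg_scale (sec \<X> U') (const_sec \<X> \<kappa> U')) (ring_module (sec \<X> U')) V (res \<X> U U') id"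
    "gact P g U = tensor_map k (alg_scale (sec \<X> U) (const_sec \<X> \<kappa> U)) (ring_module (sec \<X> U)) V id (ract V g)" for U U' g
    by (simp_all add: P_def base_change_def module.defs rep.defs)
  have fbc: "free_base_change k (sec \<X> U) (const_sec \<X> \<kappa> U) V J w \<gamma>" if U: "opn U" for U
    by (intro free_base_change.intro free_base_change_axioms.intro cring_k cring_sec[OF U] V'(1) const_sec_hom[OF U] db)
  let ?c = "\<lambda>U. free_base_change.coords k (sec \<X> U) (const_sec \<X> \<kappa> U) V J \<gamma>"
  have iso: "gsheaf_iso \<X> G P ?F ?c"
  proof (rule gsheaf_isoI)
    fix U assume U: "opn U"
    interpret B: free_base_change k "sec \<X> U" "const_sec \<X> \<kappa> U" V J w \<gamma> by (rule fbc[OF U])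
    note c = add_homsD[OF B.coords_add_hom]
    show "bij_betw (?c U) (carrier (msec P U)) (carrier (msec ?F U))" unfolding P_simps free_gmod_simps by (rule B.coords_bij)
    show "\<zero>\<^bsub>msec P U\<^esub> \<in> carrier (msec P U)" unfolding P_simps by (rule B.BC.T.zero_closed)
    show "?c U \<zero>\<^bsub>msec P U\<^esub> = \<zero>\<^bsub>msec ?F U\<^esub>" unfolding P_simps free_gmod_simps
      by (rule add_homs_zero[OF B.BC.T.abelian_group_axioms B.F.M.abelian_group_axioms B.coords_add_hom])
    fix x assume x: "x \<in> carrier (msec P U)"
    show "x \<oplus>\<^bsub>msec P U\<^esub> y \<in> carrier (msec P U)" "?c U (x \<oplus>\<^bsub>msec P U\<^esub> y) = ?c U x \<oplus>\<^bsub>msec ?F U\<^esub> ?c U y"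
      if "y \<in> carrier (msec P U)" for y
      using x that unfolding P_simps free_gmod_simps by (rule B.BC.T.a_closed, rule c(2))
    show "a \<odot>\<^bsub>msec P U\<^esub> x \<in> carrier (msec P U)" "?c U (a \<odot>\<^bsub>msec P U\<^esub> x) = a \<odot>\<^bsub>msec ?F U\<^esub> ?c U x"
      if "a \<in> carrier (sec \<X> U)" for a
      using that x unfolding P_simps free_gmod_simps by (rule B.coords_smult)+
    show "gact P g U x \<in> carrier (msec P U)" "?c U (gact P g U x) = gact ?F g U (?c U x)" if g: "g \<in> carrier G" for g
      using x B.coords_ract[OF V'(2)[OF g]] unfolding P_simps free_gmod_simps by blast+
    show "mres P U W x \<in> carrier (msec P W)" "?c W (mres P U W x) = mres ?F U W (?c U x)" if W: "opn W" "W \<subseteq> U" for W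
    proof -
      have cc: "const_sec \<X> \<kappa> W a = res \<X> U W (const_sec \<X> \<kappa> U a)" if "a \<in> carrier k" for a
        using const_sec_res[OF U W that] by simp
      show "mres P U W x \<in> carrier (msec P W)" "?c W (mres P U W x) = mres ?F U W (?c U x)"
        using x B.coords_base_change[OF fbc[OF W(1)] res_hom[OF U W] cc] unfolding P_simps free_gmod_simps by blast+
    qed
  qed
  \<comment> \<open>Matrices act linearly over the commutative sections of the structure sheaf, and
    their constant entries restrict to constants.\<close>
  show act: "omod_hom \<X> ?F ?F (gact ?F g)" if g: "g \<in> carrier G" for g
    unfolding omod_hom_def
  proof (intro conjI allI impI ballI)
    have m: "\<gamma> j (ract V g (w l)) \<in> carrier k" if "j \<in> J" "l \<in> J" for j l
      using that d(4,6) V'(3)[OF g] by simp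
    fix U assume U: "opn U"
    interpret B: cring "sec \<X> U" by (rule cring_sec[OF U])
    have m': "const_sec \<X> \<kappa> U (\<gamma> j (ract V g (w l))) \<in> carrier (sec \<X> U)" if "j \<in> J" "l \<in> J" for j l
      by (rule const_sec_simps(1)[OF U m[OF that]])
    show "gact ?F g U \<in> module_homs (sec \<X> U) (msec ?F U) (msec ?F U)"
    proof (rule module_homsI)
      fix x assume "x \<in> carrier (msec ?F U)"
      then have x: "x j \<in> carrier (sec \<X> U)" if "j \<in> J" for j using that by auto
      show "gact ?F g U x \<in> carrier (msec ?F U)"
        using m' x by (auto intro!: B.finsum_closed)
      fix y assume "y \<in> carrier (msec ?F U)"
      then have y: "y j \<in> carrier (sec \<X> U)" if "j \<in> J" for j using that by auto
      have "(\<Oplus>\<^bsub>sec \<X> U\<^esub>l\<in>J. const_sec \<X> \<kappa> U (\<gamma> j (ract V g (w l))) \<otimes>\<^bsub>sec \<X> U\<^esub> (\<lambda>j\<in>J. x j \<oplus>\<^bsub>sec \<X> U\<^esub> y j) l)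
        = (\<Oplus>\<^bsub>sec \<X> U\<^esub>l\<in>J. const_sec \<X> \<kappa> U (\<gamma> j (ract V g (w l))) \<otimes>\<^bsub>sec \<X> U\<^esub> x l)
        \<oplus>\<^bsub>sec \<X> U\<^esub> (\<Oplus>\<^bsub>sec \<X> U\<^esub>l\<in>J. const_sec \<X> \<kappa> U (\<gamma> j (ract V g (w l))) \<otimes>\<^bsub>sec \<X> U\<^esub> y l)" if j: "j \<in> J" for j
      proof -
        have "(\<Oplus>\<^bsub>sec \<X> U\<^esub>l\<in>J. const_sec \<X> \<kappa> U (\<gamma> j (ract V g (w l))) \<otimes>\<^bsub>sec \<X> U\<^esub> (\<lambda>j\<in>J. x j \<oplus>\<^bsub>sec \<X> U\<^esub> y j) l)
          = (\<Oplus>\<^bsub>sec \<X> U\<^esub>l\<in>J. const_sec \<X> \<kappa> U (\<gamma> j (ract V g (w l))) \<otimes>\<^bsub>sec \<X> U\<^esub> x l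
              \<oplus>\<^bsub>sec \<X> U\<^esub> const_sec \<X> \<kappa> U (\<gamma> j (ract V g (w l))) \<otimes>\<^bsub>sec \<X> U\<^esub> y l)"
          by (rule B.finsum_cong') (use m' x y j in \<open>auto simp: B.r_distr\<close>)
        also have "\<dots> = (\<Oplus>\<^bsub>sec \<X> U\<^esub>l\<in>J. const_sec \<X> \<kappa> U (\<gamma> j (ract V g (w l))) \<otimes>\<^bsub>sec \<X> U\<^esub> x l)
          \<oplus>\<^bsub>sec \<X> U\<^esub> (\<Oplus>\<^bsub>sec \<X> U\<^esub>l\<in>J. const_sec \<X> \<kappa> U (\<gamma> j (ract V g (w l))) \<otimes>\<^bsub>sec \<X> U\<^esub> y l)"
          by (rule B.finsum_addf) (use m' x y j in auto)
        finally show ?thesis .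
      qed
      then show "gact ?F g U (x \<oplus>\<^bsub>msec ?F U\<^esub> y) = gact ?F g U x \<oplus>\<^bsub>msec ?F U\<^esub> gact ?F g U y"
        by (simp cong: restrict_cong)
    next
      fix a x assume a: "a \<in> carrier (sec \<X> U)" and "x \<in> carrier (msec ?F U)"
      then have x: "x j \<in> carrier (sec \<X> U)" if "j \<in> J" for j using that by auto
      have "(\<Oplus>\<^bsub>sec \<X> U\<^esub>l\<in>J. const_sec \<X> \<kappa> U (\<gamma> j (ract V g (w l))) \<otimes>\<^bsub>sec \<X> U\<^esub> (\<lambda>j\<in>J. a \<otimes>\<^bsub>sec \<X> U\<^esub> x j) l)
        = a \<otimes>\<^bsub>sec \<X> U\<^esub> (\<Oplus>\<^bsub>sec \<X> U\<^esub>l\<in>J. const_sec \<X> \<kappa> U (\<gamma> j (ract V g (w l))) \<otimes>\<^bsub>sec \<X> U\<^esub> x l)" if j: "j \<in> J" for j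
      proof -
        have "(\<Oplus>\<^bsub>sec \<X> U\<^esub>l\<in>J. const_sec \<X> \<kappa> U (\<gamma> j (ract V g (w l))) \<otimes>\<^bsub>sec \<X> U\<^esub> (\<lambda>j\<in>J. a \<otimes>\<^bsub>sec \<X> U\<^esub> x j) l)
          = (\<Oplus>\<^bsub>sec \<X> U\<^esub>l\<in>J. a \<otimes>\<^bsub>sec \<X> U\<^esub> (const_sec \<X> \<kappa> U (\<gamma> j (ract V g (w l))) \<otimes>\<^bsub>sec \<X> U\<^esub> x l))"
          by (rule B.finsum_cong') (use m' x a j in \<open>auto simp: B.m_lcomm\<close>)
        also have "\<dots> = a \<otimes>\<^bsub>sec \<X> U\<^esub> (\<Oplus>\<^bsub>sec \<X> U\<^esub>l\<in>J. const_sec \<X> \<kappa> U (\<gamma> j (ract V g (w l))) \<otimes>\<^bsub>sec \<X> U\<^esub> x l)"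
          by (rule B.finsum_rdistr[symmetric]) (use m' x a j d(1) in auto)
        finally show ?thesis .
      qed
      then show "gact ?F g U (a \<odot>\<^bsub>msec ?F U\<^esub> x) = a \<odot>\<^bsub>msec ?F U\<^esub> gact ?F g U x"
        by (simp cong: restrict_cong)
    qed
  next
    fix U W x assume "opn U \<and> opn W \<and> W \<subseteq> U" and "x \<in> carrier (msec ?F U)"
    then have o: "opn U" "opn W" "W \<subseteq> U" and x: "\<And>j. j \<in> J \<Longrightarrow> x j \<in> carrier (sec \<X> U)" by auto
    interpret B: cring "sec \<X> U" by (rule cring_sec[OF o(1)])
    interpret B': cring "sec \<X> W" by (rule cring_sec[OF o(2)])
    note r = res_simps[OF o]
    have m: "\<gamma> j (ract V g (w l)) \<in> carrier k" if "j \<in> J" "l \<in> J" for j l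
      using that d(4,6) V'(3)[OF g] by simp
    have "res \<X> U W (\<Oplus>\<^bsub>sec \<X> U\<^esub>l\<in>J. const_sec \<X> \<kappa> U (\<gamma> j (ract V g (w l))) \<otimes>\<^bsub>sec \<X> U\<^esub> x l)
      = (\<Oplus>\<^bsub>sec \<X> W\<^esub>l\<in>J. const_sec \<X> \<kappa> W (\<gamma> j (ract V g (w l))) \<otimes>\<^bsub>sec \<X> W\<^esub> (\<lambda>j\<in>J. res \<X> U W (x j)) l)" if j: "j \<in> J" for j
    proof -
      have "res \<X> U W (\<Oplus>\<^bsub>sec \<X> U\<^esub>l\<in>J. const_sec \<X> \<kappa> U (\<gamma> j (ract V g (w l))) \<otimes>\<^bsub>sec \<X> U\<^esub> x l)
        = (\<Oplus>\<^bsub>sec \<X> W\<^esub>l\<in>J. res \<X> U W (const_sec \<X> \<kappa> U (\<gamma> j (ract V g (w l))) \<otimes>\<^bsub>sec \<X> U\<^esub> x l))"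
        by (rule hom_finsum_additive(2)[OF B.is_abelian_group B'.is_abelian_group])
          (use r x m j const_sec_simps(1)[OF o(1)] in auto)
      also have "\<dots> = (\<Oplus>\<^bsub>sec \<X> W\<^esub>l\<in>J. const_sec \<X> \<kappa> W (\<gamma> j (ract V g (w l))) \<otimes>\<^bsub>sec \<X> W\<^esub> (\<lambda>j\<in>J. res \<X> U W (x j)) l)"
        by (rule B'.finsum_cong')
          (use r x m j const_sec_simps(1)[OF o(1)] const_sec_simps(1)[OF o(2)] const_sec_res[OF o] in auto)
      finally show ?thesis .
    qed
    then show "gact ?F g W (mres ?F U W x) = mres ?F U W (gact ?F g U x)"
      by (simp cong: restrict_cong)
  qed
  have "rep_sheaf k \<X> \<kappa> V = sheafify \<X> P" by (simp add: rep_sheaf_def P_def)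
  then show "\<exists>\<zeta>. gsheaf_iso \<X> G (rep_sheaf k \<X> \<kappa> V) ?F \<zeta>"
    using sheafify_iso_of_iso[OF iso omodule_free_gmod act] by simp
qed

end

section \<open>Idempotents acting on \<open>E\<close> and their image sheaves\<close>

section \<open>The group algebra acting on a sheaf of modules\<close>

context irr_system
begin

text \<open>Tested on the \<open>V j\<close>, where the element acts as one or as zero and so
  commutes with everything.\<close>

lemma isotypical_central:
  assumes i: "i \<le> r" and a: "a \<in> carrier (group_algebra k G)"
  shows "isotypical i \<otimes>\<^bsub>group_algebra k G\<^esub> a = a \<otimes>\<^bsub>group_algebra k G\<^esub> isotypical i"
proof (rule group_algebra_faithful)
  note e = isotypical_closed[OF i]
  have zero: "alg_act G (V j) a \<zero>\<^bsub>V j\<^esub> = \<zero>\<^bsub>V j\<^esub>" if "j \<le> r" for j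
  proof -
    interpret Vj: module k "V j" by (rule representationD[OF representation_V[OF that(1)]])
    have a: "\<And>g. g \<in> carrier G \<Longrightarrow> a g \<in> carrier k" using a by (auto simp: group_algebra_def)
    show ?thesis
      by (rule additive_zero[OF Vj.M.abelian_group_axioms Vj.M.abelian_group_axioms])
        (use module_homsD[OF alg_act_hom[OF representation_V[OF that(1)] a]] in auto)
  qed
  have cl: "alg_act G (V j) a v \<in> carrier (V j)" if "j \<le> r" "v \<in> carrier (V j)" for j v
    by (rule alg_act_closed[OF representation_V[OF that(1)] _ that(2)]) (use a in \<open>auto simp: group_algebra_def\<close>)
  show "alg_act G (V j) (isotypical i \<otimes>\<^bsub>group_algebra k G\<^esub> a) v = alg_act G (V j) (a \<otimes>\<^bsub>group_algebra k G\<^esub> isotypical i) v"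
    if "j \<le> r" "v \<in> carrier (V j)" for j v
    using alg_act_group_algebra_mult[OF representation_V[OF that(1)] e a that(2)]
      alg_act_group_algebra_mult[OF representation_V[OF that(1)] a e that(2)]
      isotypical_act_V[OF i that] isotypical_act_V[OF i that(1) cl[OF that]] zero[OF that(1)] by simp
qed (use group_algebra_mult_closed isotypical_closed[OF i] a in auto)

lemma isotypical_ract:
  assumes M: "representation k G M" and i: "i \<le> r" and g: "g \<in> carrier G" and x: "x \<in> carrier M"
  shows "alg_act G M (isotypical i) (ract M g x) = ract M g (alg_act G M (isotypical i) x)"
proof -
  note M' = representationD[OF M]
  interpret M: module k M by (rule M')
  \<comment> \<open>The group element \<open>g\<close> as an element of the group algebra, to which
    centrality applies.\<close>
  define \<delta> where "\<delta> = (\<lambda>h\<in>carrier G. if h = g then \<one>\<^bsub>k\<^esub> else \<zero>\<^bsub>k\<^esub>)"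
  have \<delta>: "\<delta> \<in> carrier (group_algebra k G)" by (auto simp: \<delta>_def group_algebra_def)
  have act: "alg_act G M \<delta> y = ract M g y" if y: "y \<in> carrier M" for y
  proof -
    have "alg_act G M \<delta> y = (\<Oplus>\<^bsub>M\<^esub>h\<in>carrier G. if h = g then ract M g y else \<zero>\<^bsub>M\<^esub>)"
      unfolding alg_act_def by (rule M.M.finsum_cong') (use M'(3)[OF _ y] g in \<open>auto simp: \<delta>_def\<close>)
    also have "\<dots> = ract M g y" by (rule M.M.finsum_delta) (use fin g M'(3)[OF g y] in auto)
    finally show ?thesis .
  qed
  have c: "alg_act G M (isotypical i) x \<in> carrier M"
    by (rule alg_act_closed[OF M isotypical_closed'[OF i] x])
  show ?thesis
    using alg_act_group_algebra_mult[OF M isotypical_closed[OF i] \<delta> x] alg_act_group_algebra_mult[OF M \<delta> isotypical_closed[OF i] x]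
      isotypical_central[OF i \<delta>] act[OF x] act[OF c] by simp
qed

lemma isotypical_munit:
  assumes M: "representation k G M" and i: "i \<le> r" and j: "j \<le> r" "c \<in> J j" "v \<in> carrier (V j)" and x: "x \<in> carrier M"
  shows "alg_act G M (isotypical i) (alg_act G M (munit j c v) x) = (if j = i then alg_act G M (munit j c v) x else \<zero>\<^bsub>M\<^esub>)"
  using alg_act_munit_left[OF M j x isotypical_closed'[OF i]] isotypical_act_V[OF i j(1,3)] munit_zero[OF M j(1,2) x] by auto

text \<open>The inner idempotent is expanded into diagonal units, each of which is fixed or killed
  by the outer one.\<close>

lemma isotypical_isotypical:
  assumes M: "representation k G M" and i: "i \<le> r" and j: "j \<le> r" and x: "x \<in> carrier M"
  shows "alg_act G M (isotypical i) (alg_act G M (isotypical j) x) = (if j = i then alg_act G M (isotypical j) x else \<zero>\<^bsub>M\<^esub>)"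
proof -
  interpret M: module k M by (rule representationD[OF M])
  note e = alg_act_isotypical[OF M j x] and d = dual_basisD[OF db[OF j]]
  have h: "alg_act G M (isotypical i) \<in> module_homs k M M"
    by (rule alg_act_hom[OF M isotypical_closed'[OF i]])
  have u: "alg_act G M (munit j b (w j b)) x \<in> carrier M" if "b \<in> J j" for b
    by (rule munit_basis_closed[OF M j that x])
  have "alg_act G M (isotypical i) (alg_act G M (isotypical j) x)
      = (\<Oplus>\<^bsub>M\<^esub>b\<in>J j. alg_act G M (isotypical i) (alg_act G M (munit j b (w j b)) x))"
    unfolding e by (rule add_homs_finsum[OF M.M.abelian_group_axioms M.M.abelian_group_axioms module_homs_add_homs[OF h]])
      (use u in auto)
  also have "\<dots> = (\<Oplus>\<^bsub>M\<^esub>b\<in>J j. if j = i then alg_act G M (munit j b (w j b)) x else \<zero>\<^bsub>M\<^esub>)"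
    by (rule M.M.finsum_cong') (use isotypical_munit[OF M i j _ _ x] d(4) u in auto)
  also have "\<dots> = (if j = i then alg_act G M (isotypical j) x else \<zero>\<^bsub>M\<^esub>)"
    unfolding e by simp
  finally show ?thesis .
qed

text \<open>The resolution of the identity by matrix units, grouped by blocks.\<close>

lemma isotypical_sum:
  assumes M: "representation k G M" and x: "x \<in> carrier M"
  shows "(\<Oplus>\<^bsub>M\<^esub>j\<in>{..r}. alg_act G M (isotypical j) x) = x"
proof -
  interpret M: module k M by (rule representationD[OF M])
  have "(\<Oplus>\<^bsub>M\<^esub>j\<in>{..r}. alg_act G M (isotypical j) x)
    = (\<Oplus>\<^bsub>M\<^esub>j\<in>{..r}. \<Oplus>\<^bsub>M\<^esub>c\<in>J j. alg_act G M (munit j c (w j c)) x)"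
    by (rule M.M.finsum_cong')
      (use alg_act_isotypical[OF M _ x] munit_basis_closed[OF M _ _ x] in \<open>auto intro!: M.M.finsum_closed\<close>)
  then show ?thesis using munit_sum[OF M x] by simp
qed

end

locale gmod_system = irr_system k G r V J w \<gamma> + ringed_over \<X> k \<kappa>
  for k :: "'k ring" and G :: "'g monoid" and r and V :: "nat \<Rightarrow> ('k, 'v, 'g) rep"
    and J :: "nat \<Rightarrow> 'i set" and w and \<gamma> and \<X> :: "('p, 'a) rspace" and \<kappa> +
  fixes E :: "('p, 'a, 'b, 'g) gmod"
  assumes gmodule: "gmodule \<X> G E"
begin

sublocale E: act_omod \<X> E G
  by unfold_locales (use gmodule in \<open>auto simp: gmodule_def\<close>)

text \<open>Sections over \<open>U\<close> as a representation over \<open>k\<close>, by restriction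
  of scalars along the constants. The identities for the group algebra become available for
  \<open>E\<close> in this way.\<close>

definition sec_rep :: "'p set \<Rightarrow> ('k, 'b, 'g) rep" where
  "sec_rep U = \<lparr>carrier = carrier (msec E U), monoid.mult = undefined, monoid.one = undefined,
     ring.zero = \<zero>\<^bsub>msec E U\<^esub>, ring.add = ring.add (msec E U),
     module.smult = (\<lambda>c x. const_sec \<X> \<kappa> U c \<odot>\<^bsub>msec E U\<^esub> x), ract = (\<lambda>g. gact E g U)\<rparr>"

lemma sec_rep_simps [simp]:
  "carrier (sec_rep U) = carrier (msec E U)" "\<zero>\<^bsub>sec_rep U\<^esub> = \<zero>\<^bsub>msec E U\<^esub>"
  "x \<oplus>\<^bsub>sec_rep U\<^esub> y = x \<oplus>\<^bsub>msec E U\<^esub> y" "c \<odot>\<^bsub>sec_rep U\<^esub> x = const_sec \<X> \<kappa> U c \<odot>\<^bsub>msec E U\<^esub> x"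
  "ract (sec_rep U) g = gact E g U"
  by (simp_all add: sec_rep_def)

lemma finsum_sec_rep: "finsum (sec_rep U) f A = finsum (msec E U) f A"
  by (rule finsum_record_cong) (simp_all add: sec_rep_def)

lemma representation_sec_rep:
  assumes U: "opn U"
  shows "representation k G (sec_rep U)"
proof -
  interpret M: module "sec \<X> U" "msec E U" by (rule E.module_msec[OF U])
  have "abelian_group (sec_rep U)"
    by (rule abelian_groupI) (auto simp: M.M.a_ac M.M.l_zero intro: M.M.l_neg M.M.add.l_inv_ex)
  then have "module k (sec_rep U)"
    by (intro moduleI cring_k)
      (simp_all add: const_sec_simps[OF U] M.smult_l_distr M.smult_r_distr M.smult_assoc1)
  moreover have "gact E \<one>\<^bsub>G\<^esub> U x = x"
    "\<lbrakk>g \<in> carrier G; h \<in> carrier G\<rbrakk> \<Longrightarrow> gact E (g \<otimes>\<^bsub>G\<^esub> h) U x = gact E g U (gact E h U x)" if "x \<in> carrier (msec E U)" for x g h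
    using gmodule U that by (simp_all add: gmodule_def)
  ultimately show ?thesis
    unfolding representation_def
    by (auto intro!: module_homsI simp: E.gact_simps[OF _ U] const_sec_simps[OF U])
qed

abbreviation A :: "'p set \<Rightarrow> ('g \<Rightarrow> 'k) \<Rightarrow> 'b \<Rightarrow> 'b" where
  "A U a \<equiv> galg_act G \<X> \<kappa> E a U"

lemma alg_act_sec_rep: "alg_act G (sec_rep U) a = A U a"
  by (simp add: alg_act_def[abs_def] galg_act_def[abs_def] finsum_sec_rep)

lemma A_closed: "\<lbrakk>opn U; \<And>g. g \<in> carrier G \<Longrightarrow> a g \<in> carrier k; x \<in> carrier (msec E U)\<rbrakk> \<Longrightarrow> A U a x \<in> carrier (msec E U)"
  using alg_act_closed[OF representation_sec_rep, of U a x] by (simp add: alg_act_sec_rep)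

lemma A_add:
  "\<lbrakk>opn U; \<And>g. g \<in> carrier G \<Longrightarrow> a g \<in> carrier k; x \<in> carrier (msec E U); y \<in> carrier (msec E U)\<rbrakk>
    \<Longrightarrow> A U a (x \<oplus>\<^bsub>msec E U\<^esub> y) = A U a x \<oplus>\<^bsub>msec E U\<^esub> A U a y"
  using module_homsD(2)[OF alg_act_hom[OF representation_sec_rep, of U a]] by (simp add: alg_act_sec_rep)

text \<open>Each group element acts linearly over the structure sheaf, and the constant coefficients
  commute with \<open>f\<close>.\<close>

lemma A_smult:
  assumes U: "opn U" and a: "\<And>g. g \<in> carrier G \<Longrightarrow> a g \<in> carrier k" and f: "f \<in> carrier (sec \<X> U)" and x: "x \<in> carrier (msec E U)"
  shows "A U a (f \<odot>\<^bsub>msec E U\<^esub> x) = f \<odot>\<^bsub>msec E U\<^esub> A U a x"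
proof -
  interpret M: module "sec \<X> U" "msec E U" by (rule E.module_msec[OF U])
  note c = const_sec_simps(1)[OF U] and g = E.gact_simps[OF _ U]
  have "A U a (f \<odot>\<^bsub>msec E U\<^esub> x) = (\<Oplus>\<^bsub>msec E U\<^esub>h\<in>carrier G. f \<odot>\<^bsub>msec E U\<^esub> (const_sec \<X> \<kappa> U (a h) \<odot>\<^bsub>msec E U\<^esub> gact E h U x))"
    unfolding galg_act_def
    by (rule M.M.finsum_cong') (use a f x c g in \<open>auto simp: M.smult_assoc1[symmetric] M.R.m_comm\<close>)
  also have "\<dots> = f \<odot>\<^bsub>msec E U\<^esub> A U a x"
    unfolding galg_act_def by (rule M.finsum_smult_ldistr[symmetric]) (use a f x c g fin in auto)
  finally show ?thesis .
qed

lemma A_add_hom: "\<lbrakk>opn U; \<And>g. g \<in> carrier G \<Longrightarrow> a g \<in> carrier k\<rbrakk> \<Longrightarrow> A U a \<in> add_homs (msec E U) (msec E U)"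
  by (rule add_homsI) (simp_all add: A_closed A_add)

lemma A_zero: "\<lbrakk>opn U; \<And>g. g \<in> carrier G \<Longrightarrow> a g \<in> carrier k\<rbrakk> \<Longrightarrow> A U a \<zero>\<^bsub>msec E U\<^esub> = \<zero>\<^bsub>msec E U\<^esub>"
  by (rule add_homs_zero[OF E.abelian_msec E.abelian_msec A_add_hom])

text \<open>Constants restrict to constants, and the action commutes with restriction.\<close>

lemma A_res:
  assumes o: "opn U" "opn W" "W \<subseteq> U" and a: "\<And>g. g \<in> carrier G \<Longrightarrow> a g \<in> carrier k" and x: "x \<in> carrier (msec E U)"
  shows "mres E U W (A U a x) = A W a (mres E U W x)"
proof -
  interpret M: module "sec \<X> U" "msec E U" by (rule E.module_msec[OF o(1)])
  interpret M': module "sec \<X> W" "msec E W" by (rule E.module_msec[OF o(2)])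
  note c = const_sec_simps(1)[OF o(1)] const_sec_simps(1)[OF o(2)] and g = E.gact_simps[OF _ o(1)] E.gact_simps[OF _ o(2)]
    and m = E.mres_simps[OF o]
  have "mres E U W (A U a x) = (\<Oplus>\<^bsub>msec E W\<^esub>h\<in>carrier G. mres E U W (const_sec \<X> \<kappa> U (a h) \<odot>\<^bsub>msec E U\<^esub> gact E h U x))"
    unfolding galg_act_def
    by (rule hom_finsum_additive(2)[OF M.M.abelian_group_axioms M'.M.abelian_group_axioms])
      (use m a c g x in auto)
  also have "\<dots> = A W a (mres E U W x)"
    unfolding galg_act_def
    by (rule M'.M.finsum_cong') (use m a c g x o const_sec_res[OF o] in auto)
  finally show ?thesis .
qed

text \<open>The image of an idempotent is the set of sections it fixes. Being fixed can be tested
  locally, so a section glued in \<open>E\<close> from fixed ones is fixed.\<close>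

lemma omodule_fixed_part:
  assumes a: "\<And>g. g \<in> carrier G \<Longrightarrow> a g \<in> carrier k"
    and idem: "\<And>U x. \<lbrakk>opn U; x \<in> carrier (msec E U)\<rbrakk> \<Longrightarrow> A U a (A U a x) = A U a x"
  shows "omodule \<X> (idempotent_part G \<X> \<kappa> E a)"
    and "opn U \<Longrightarrow> carrier (msec (idempotent_part G \<X> \<kappa> E a) U) = {x \<in> carrier (msec E U). A U a x = x}"
proof -
  let ?P = "idempotent_part G \<X> \<kappa> E a"
  have car: "carrier (msec ?P U) = {x \<in> carrier (msec E U). A U a x = x}" if U: "opn U" for U
  proof -
    have "A U a ` carrier (msec E U) = {x \<in> carrier (msec E U). A U a x = x}"
    proof (intro equalityI subsetI)
      fix x assume "x \<in> {x \<in> carrier (msec E U). A U a x = x}"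
      then show "x \<in> A U a ` carrier (msec E U)" by (intro image_eqI[of _ _ x]) auto
    qed (use idem[OF U] A_closed[OF U, of a, OF a] in auto)
    then show ?thesis by (simp add: idempotent_part_def)
  qed
  then show "opn U \<Longrightarrow> carrier (msec ?P U) = {x \<in> carrier (msec E U). A U a x = x}" .
  have ops: "x \<oplus>\<^bsub>msec ?P U\<^esub> y = x \<oplus>\<^bsub>msec E U\<^esub> y" "f \<odot>\<^bsub>msec ?P U\<^esub> x = f \<odot>\<^bsub>msec E U\<^esub> x" "mres ?P U W x = mres E U W x" for U W x y f
    by (simp_all add: idempotent_part_def)
  show "omodule \<X> ?P"
  proof (rule omoduleI)
    fix U assume U: "opn U"
    interpret M: module "sec \<X> U" "msec E U" by (rule E.module_msec[OF U])
    have "submodule {x \<in> carrier (msec E U). A U a x = x} (sec \<X> U) (msec E U)"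
      by (rule submoduleI'[OF E.module_msec[OF U]])
        (use A_zero[OF U, of a, OF a] A_add[OF U, of a, OF a] A_smult[OF U, of a, OF a] in auto)
    from submodule.submodule_is_module[OF this E.module_msec[OF U]]
    show "module (sec \<X> U) (msec ?P U)"
      using car[OF U] by (simp add: idempotent_part_def)
  next
    show "set_sheaf (topo \<X>) (\<lambda>U. carrier (msec ?P U)) (mres ?P)"
    proof (rule set_sheafI)
      fix U W s assume o: "opn U" "opn W" "W \<subseteq> U" and s: "s \<in> carrier (msec ?P U)"
      show "mres ?P U W s \<in> carrier (msec ?P W)"
        using s E.mres_simps(1)[OF o] A_res[OF o, of a s, OF a] by (auto simp: car[OF o(1)] car[OF o(2)] ops)
    next
      show "mres ?P U U s = s" if "opn U" "s \<in> carrier (msec ?P U)" for U s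
        using that E.S.res_id by (simp add: car ops)
      show "mres ?P W W' (mres ?P U W s) = mres ?P U W' s"
        if "opn U" "opn W" "opn W'" "W' \<subseteq> W" "W \<subseteq> U" "s \<in> carrier (msec ?P U)" for U W W' s
        using that E.S.res_res[OF that(1-5)] by (simp add: car ops)
    next
      fix \<U> s t assume o: "\<And>W. W \<in> \<U> \<Longrightarrow> opn W" and s: "s \<in> carrier (msec ?P (\<Union>\<U>))" and t: "t \<in> carrier (msec ?P (\<Union>\<U>))"
        and eq: "\<And>W. W \<in> \<U> \<Longrightarrow> mres ?P (\<Union>\<U>) W s = mres ?P (\<Union>\<U>) W t"
      have UU: "opn (\<Union>\<U>)" using o by blast
      show "s = t"
        by (rule E.S.locality[OF o]) (use s t eq in \<open>auto simp: car[OF UU] ops\<close>)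
    next
      fix \<U> \<sigma> assume o: "\<And>W. W \<in> \<U> \<Longrightarrow> opn W" and s: "\<And>W. W \<in> \<U> \<Longrightarrow> \<sigma> W \<in> carrier (msec ?P W)"
        and eq: "\<And>W W'. \<lbrakk>W \<in> \<U>; W' \<in> \<U>\<rbrakk> \<Longrightarrow> mres ?P W (W \<inter> W') (\<sigma> W) = mres ?P W' (W \<inter> W') (\<sigma> W')"
      have UU: "opn (\<Union>\<U>)" using o by blast
      have s': "\<sigma> W \<in> carrier (msec E W) \<and> A W a (\<sigma> W) = \<sigma> W" if "W \<in> \<U>" for W
        using s[OF that] car[OF o[OF that]] by simp
      have "\<exists>t\<in>carrier (msec E (\<Union>\<U>)). \<forall>W\<in>\<U>. mres E (\<Union>\<U>) W t = \<sigma> W"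
        by (rule E.S.gluing[OF o]) (use s' eq in \<open>auto simp: ops\<close>)
      then obtain t where t: "t \<in> carrier (msec E (\<Union>\<U>))" "\<And>W. W \<in> \<U> \<Longrightarrow> mres E (\<Union>\<U>) W t = \<sigma> W" by blast
      have "A (\<Union>\<U>) a t = t"
      proof (rule E.S.locality[OF o])
        fix W assume W: "W \<in> \<U>"
        then have "W \<subseteq> \<Union>\<U>" by blast
        then show "mres E (\<Union>\<U>) W (A (\<Union>\<U>) a t) = mres E (\<Union>\<U>) W t"
          using A_res[OF UU o[OF W] _ _ t(1), of a, OF _ a] t(2)[OF W] s'[OF W] by simp
      qed (use t(1) A_closed[OF UU _ t(1), of a, OF a] in auto)
      then have "t \<in> carrier (msec ?P (\<Union>\<U>))" using t(1) by (simp add: car[OF UU])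
      then show "\<exists>t\<in>carrier (msec ?P (\<Union>\<U>)). \<forall>W\<in>\<U>. mres ?P (\<Union>\<U>) W t = \<sigma> W"
        using t(2) by (auto simp: ops)
    qed
  next
    show "mres ?P U W (x \<oplus>\<^bsub>msec ?P U\<^esub> y) = mres ?P U W x \<oplus>\<^bsub>msec ?P W\<^esub> mres ?P U W y"
      if "opn U" "opn W" "W \<subseteq> U" "x \<in> carrier (msec ?P U)" "y \<in> carrier (msec ?P U)" for U W x y
      using that E.mres_simps(2)[OF that(1-3)] by (simp add: car ops)
    show "mres ?P U W (f \<odot>\<^bsub>msec ?P U\<^esub> x) = res \<X> U W f \<odot>\<^bsub>msec ?P W\<^esub> mres ?P U W x"
      if "opn U" "opn W" "W \<subseteq> U" "f \<in> carrier (sec \<X> U)" "x \<in> carrier (msec ?P U)" for U W f x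
      using that E.mres_simps(3)[OF that(1-3)] by (simp add: car ops)
  qed
qed

lemma A_isotypical_idem:
  assumes "i \<le> r" "opn U" "x \<in> carrier (msec E U)"
  shows "A U (isotypical i) (A U (isotypical i) x) = A U (isotypical i) x"
  using isotypical_isotypical[OF representation_sec_rep[OF assms(2)] assms(1) assms(1), of x] assms(3)
  by (simp add: alg_act_sec_rep)

text \<open>Stability under the group is due to centrality of the idempotent; the image of a single
  diagonal unit does not have it in general.\<close>

lemma isotypical_part_act:
  assumes i: "i \<le> r" and g: "g \<in> carrier G"
  shows "omod_hom \<X> (idempotent_part G \<X> \<kappa> E (isotypical i)) (idempotent_part G \<X> \<kappa> E (isotypical i))
     (gact (idempotent_part G \<X> \<kappa> E (isotypical i)) g)"
proof -
  let ?P = "idempotent_part G \<X> \<kappa> E (isotypical i)"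
  have car: "carrier (msec ?P U) = {x \<in> carrier (msec E U). A U (isotypical i) x = x}" if "opn U" for U
    by (rule omodule_fixed_part(2)[OF isotypical_closed'[OF i] A_isotypical_idem[OF i] that])
  have ops: "x \<oplus>\<^bsub>msec ?P U\<^esub> y = x \<oplus>\<^bsub>msec E U\<^esub> y" "f \<odot>\<^bsub>msec ?P U\<^esub> x = f \<odot>\<^bsub>msec E U\<^esub> x" "mres ?P U W x = mres E U W x"
    "gact ?P h U x = gact E h U x" for U W x y f h
    by (simp_all add: idempotent_part_def)
  have "A U (isotypical i) (gact E g U x) = gact E g U x"
    if "opn U" "x \<in> carrier (msec E U)" "A U (isotypical i) x = x" for U x
    using isotypical_ract[OF representation_sec_rep[OF that(1)] i g, of x] that by (simp add: alg_act_sec_rep)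
  then show ?thesis
    unfolding omod_hom_def
    by (intro conjI allI impI module_homsI ballI) (auto simp: car ops E.gact_simps[OF g])
qed

end

section \<open>Multiplicity sheaves and their pairing with O(V i)\<close>

section \<open>The isotypical pieces\<close>

lemma trivial_action_simps [simp]:
  "msec (trivial_action F) = msec F" "mres (trivial_action F) = mres F" "gact (trivial_action F) g U s = s"
  by (simp_all add: trivial_action_def omod.defs gmod.defs)

lemma omodule_cong: "\<lbrakk>msec M = msec N; mres M = mres N\<rbrakk> \<Longrightarrow> omodule \<X> M \<longleftrightarrow> omodule \<X> N"
  by (simp add: omodule_def)

context irr_system
begin

definition base :: "nat \<Rightarrow> 'i" where
  "base i = (SOME b. b \<in> J i)"

text \<open>An empty basis would make the irreducible \<open>V i\<close> zero.\<close>

lemma base: assumes i: "i \<le> r" shows "base i \<in> J i"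
proof -
  interpret Vi: module k "V i" by (rule representationD[OF representation_V[OF i]])
  have "J i \<noteq> {}"
  proof
    assume "J i = {}"
    then have "x = \<zero>\<^bsub>V i\<^esub>" if "x \<in> carrier (V i)" for x
      using dual_basis_expand[OF db[OF i] that] by simp
    then show False using irreducible_repD(2)[OF irreducible_V[OF i]] Vi.M.zero_closed by blast
  qed
  then show ?thesis unfolding base_def by (simp add: some_in_eq)
qed

abbreviation munit0 :: "nat \<Rightarrow> 'g \<Rightarrow> 'k" where
  "munit0 i \<equiv> munit i (base i) (w i (base i))"

end

context gmod_system
begin

text \<open>Inside one block the factor in the general product rule is a value of the dual basis on
  the basis, a Kronecker delta.\<close>

lemma A_munit_munit:
  assumes i: "i \<le> r" and b: "b \<in> J i" "c \<in> J i" "d \<in> J i" and v: "v \<in> carrier (V i)" and U: "opn U" and x: "x \<in> carrier (msec E U)"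
  shows "A U (munit i b v) (A U (munit i c (w i d)) x) = (if b = d then A U (munit i c v) x else \<zero>\<^bsub>msec E U\<^esub>)"
proof -
  note R = representation_sec_rep[OF U]
  interpret M: module k "sec_rep U" by (rule representationD[OF R])
  have "A U (munit i c v) x \<in> carrier (msec E U)"
    by (rule A_closed[OF U munit_closed'[OF i b(2) v] x])
  then show ?thesis
    using munit_munit[OF R i b(1) v i b(2) dual_basisD(4)[OF db[OF i] b(3)], of x] x dual_basisD(5)[OF db[OF i] b(1,3)]
      M.smult_l_null[of "A U (munit i c v) x"] M.smult_one[of "A U (munit i c v) x"]
    by (auto simp: alg_act_sec_rep simp del: M.smult_l_null M.smult_one)
qed

text \<open>The image of a primitive idempotent. The multiplicity sheaves have to have sections of type
  \<open>'v \<Rightarrow> 'b\<close>, so the sections of \<open>E\<close> are turned into constant functions.\<close>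

definition mult_sheaf :: "nat \<Rightarrow> ('p, 'a, 'v \<Rightarrow> 'b) omod" where
  "mult_sheaf i =
     \<lparr>msec = (\<lambda>U.
        \<lparr>carrier = (\<lambda>x _. x) ` {x \<in> carrier (msec E U). A U (munit0 i) x = x},
         monoid.mult = undefined, monoid.one = undefined,
         ring.zero = (\<lambda>_. \<zero>\<^bsub>msec E U\<^esub>),
         ring.add = (\<lambda>f g _. f undefined \<oplus>\<^bsub>msec E U\<^esub> g undefined),
         module.smult = (\<lambda>a f _. a \<odot>\<^bsub>msec E U\<^esub> f undefined)\<rparr>),
      mres = (\<lambda>U U' f _. mres E U U' (f undefined))\<rparr>"

lemma mult_sheaf_simps [simp]:
  "carrier (msec (mult_sheaf i) U) = (\<lambda>x _. x) ` {x \<in> carrier (msec E U). A U (munit0 i) x = x}"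
  "\<zero>\<^bsub>msec (mult_sheaf i) U\<^esub> = (\<lambda>_. \<zero>\<^bsub>msec E U\<^esub>)"
  "f \<oplus>\<^bsub>msec (mult_sheaf i) U\<^esub> g = (\<lambda>_. f undefined \<oplus>\<^bsub>msec E U\<^esub> g undefined)"
  "a \<odot>\<^bsub>msec (mult_sheaf i) U\<^esub> f = (\<lambda>_. a \<odot>\<^bsub>msec E U\<^esub> f undefined)"
  "mres (mult_sheaf i) U U' f = (\<lambda>_. mres E U U' (f undefined))"
  by (simp_all add: mult_sheaf_def)

lemma munit_w_closed: "\<lbrakk>i \<le> r; b \<in> J i; c \<in> J i; g \<in> carrier G\<rbrakk> \<Longrightarrow> munit i b (w i c) g \<in> carrier k"
  using munit_closed' dual_basisD(4)[OF db] by blast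

lemma A_munit_closed:
  "\<lbrakk>i \<le> r; b \<in> J i; c \<in> J i; opn U; x \<in> carrier (msec E U)\<rbrakk> \<Longrightarrow> A U (munit i b (w i c)) x \<in> carrier (msec E U)"
  by (rule A_closed) (use munit_w_closed in auto)

text \<open>Evaluation at \<open>undefined\<close> identifies constant functions with their values,
  hence the sheaf with the image of \<open>munit0 i\<close> in \<open>E\<close>. The action is
  replaced by the trivial one on both sides, as the group does not preserve this image in
  general.\<close>

lemma omodule_mult_sheaf:
  assumes i: "i \<le> r"
  shows "omodule \<X> (mult_sheaf i)"
proof -
  let ?P = "(idempotent_part G \<X> \<kappa> E (munit0 i))\<lparr>gact := \<lambda>g U s. s\<rparr>"
  let ?I = "idempotent_part G \<X> \<kappa> E (munit0 i)"
  have cl: "munit0 i g \<in> carrier k" if "g \<in> carrier G" for g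
    by (rule munit_w_closed[OF i base[OF i] base[OF i] that])
  have idem: "A U (munit0 i) (A U (munit0 i) x) = A U (munit0 i) x" if "opn U" "x \<in> carrier (msec E U)" for U x
    using A_munit_munit[OF i base[OF i] base[OF i] base[OF i] dual_basisD(4)[OF db[OF i] base[OF i]] that] by simp
  have "omodule \<X> (idempotent_part G \<X> \<kappa> E (munit0 i))"
    by (rule omodule_fixed_part(1)) (use cl idem in auto)
  then have om: "omodule \<X> ?P" by (subst omodule_cong[of _ "idempotent_part G \<X> \<kappa> E (munit0 i)"]) auto
  interpret P: omod \<X> ?P by unfold_locales (rule om)
  have car: "carrier (msec ?I U) = {x \<in> carrier (msec E U). A U (munit0 i) x = x}" if "opn U" for U
    using omodule_fixed_part(2)[of "munit0 i", OF _ _ that] cl idem by simp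
  have ops: "\<zero>\<^bsub>msec ?I U\<^esub> = \<zero>\<^bsub>msec E U\<^esub>" "x \<oplus>\<^bsub>msec ?I U\<^esub> y = x \<oplus>\<^bsub>msec E U\<^esub> y"
    "f \<odot>\<^bsub>msec ?I U\<^esub> x = f \<odot>\<^bsub>msec E U\<^esub> x" "mres ?I U W x = mres E U W x" for U W x y f
    by (simp_all add: idempotent_part_def)
  have "gsheaf_iso \<X> G (trivial_action (mult_sheaf i)) ?P (\<lambda>U f. f undefined)"
  proof (rule gsheaf_isoI)
    fix U assume U: "opn U"
    show "bij_betw (\<lambda>f. f undefined) (carrier (msec (trivial_action (mult_sheaf i)) U)) (carrier (msec ?P U))"
      by (rule bij_betw_byWitness[of _ "\<lambda>x _. x"]) (auto simp: car[OF U])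
    show "\<zero>\<^bsub>msec (trivial_action (mult_sheaf i)) U\<^esub> \<in> carrier (msec (trivial_action (mult_sheaf i)) U)"
      using P.msec_closed(3)[OF U] by (auto simp: car[OF U] ops)
    fix x assume x: "x \<in> carrier (msec (trivial_action (mult_sheaf i)) U)"
    show "x \<oplus>\<^bsub>msec (trivial_action (mult_sheaf i)) U\<^esub> y \<in> carrier (msec (trivial_action (mult_sheaf i)) U)"
      if "y \<in> carrier (msec (trivial_action (mult_sheaf i)) U)" for y
      using that x P.msec_closed(1)[OF U] by (auto simp: car[OF U] ops)
    show "a \<odot>\<^bsub>msec (trivial_action (mult_sheaf i)) U\<^esub> x \<in> carrier (msec (trivial_action (mult_sheaf i)) U)"
      if "a \<in> carrier (sec \<X> U)" for a
      using that x P.msec_closed(2)[OF U] by (auto simp: car[OF U] ops)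
    show "mres (trivial_action (mult_sheaf i)) U W x \<in> carrier (msec (trivial_action (mult_sheaf i)) W)"
      if W: "opn W" "W \<subseteq> U" for W
      using x P.mres_simps(1)[OF U W] by (auto simp: car[OF U] car[OF W(1)] ops)
  qed (simp_all add: ops)
  from omodule_pullback[OF this om] show ?thesis
    by (subst (asm) omodule_cong[of _ "mult_sheaf i"]) auto
qed

abbreviation part :: "nat \<Rightarrow> ('p, 'a, 'b, 'g) gmod" where
  "part i \<equiv> idempotent_part G \<X> \<kappa> E (isotypical i)"

lemma part_carrier:
  assumes "i \<le> r" "opn U"
  shows "carrier (msec (part i) U) = {x \<in> carrier (msec E U). A U (isotypical i) x = x}"
  by (rule omodule_fixed_part(2)) (use isotypical_closed'[OF assms(1)] A_isotypical_idem[OF assms(1)] assms(2) in auto)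

lemma part_simps [simp]:
  "\<zero>\<^bsub>msec (part i) U\<^esub> = \<zero>\<^bsub>msec E U\<^esub>" "x \<oplus>\<^bsub>msec (part i) U\<^esub> y = x \<oplus>\<^bsub>msec E U\<^esub> y"
  "f \<odot>\<^bsub>msec (part i) U\<^esub> x = f \<odot>\<^bsub>msec E U\<^esub> x" "mres (part i) U U' x = mres E U U' x" "gact (part i) g U x = gact E g U x"
  by (simp_all add: idempotent_part_def)

lemma mult_sheaf_secD:
  assumes "f \<in> carrier (msec (mult_sheaf i) U)"
  shows "f undefined \<in> carrier (msec E U)" "A U (munit0 i) (f undefined) = f undefined"
  using assms by auto

lemma mult_sheaf_secI:
  "\<lbrakk>x \<in> carrier (msec E U); A U (munit0 i) x = x\<rbrakk> \<Longrightarrow> (\<lambda>_. x) \<in> carrier (msec (mult_sheaf i) U)"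
  by auto

end

text \<open>O(V i) is handled through an isomorphism \<zeta> with the free sheaf, so that its
  sections have coordinates in the structure sheaf.\<close>

locale isotypical_piece = gmod_system k G r V J w \<gamma> \<X> \<kappa> E
  for k :: "'k ring" and G :: "'g monoid" and r and V :: "nat \<Rightarrow> ('k, 'v, 'g) rep"
    and J :: "nat \<Rightarrow> 'i set" and w and \<gamma> and \<X> :: "('p, 'a) rspace" and \<kappa> and E :: "('p, 'a, 'b, 'g) gmod" +
  fixes i :: nat and \<zeta> :: "'p set \<Rightarrow> ('p \<Rightarrow> ('p set \<times> ('a \<times> 'v \<Rightarrow>\<^sub>0 int) set) set) \<Rightarrow> 'i \<Rightarrow> 'a"
  assumes i: "i \<le> r"
    and \<zeta>: "gsheaf_iso \<X> G (rep_sheaf k \<X> \<kappa> (V i)) (free_gmod (V i) (J i) (w i) (\<gamma> i)) \<zeta>"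
begin

abbreviation R :: "('p, 'a, 'p \<Rightarrow> ('p set \<times> ('a \<times> 'v \<Rightarrow>\<^sub>0 int) set) set, 'g) gmod" where
  "R \<equiv> rep_sheaf k \<X> \<kappa> (V i)"

abbreviation F :: "('p, 'a, 'v \<Rightarrow> 'b) omod" where
  "F \<equiv> mult_sheaf i"

abbreviation N :: "('p, 'a, 'b, 'g) gmod" where
  "N \<equiv> part i"

abbreviation b0 :: 'i where
  "b0 \<equiv> base i"

lemmas d = dual_basisD[OF db[OF i]]
lemmas b0 = base[OF i]
lemmas \<zeta>D = gsheaf_isoD[OF \<zeta>, unfolded free_gmod_simps dsum_module_simps ring_module_simps]

sublocale R: act_omod \<X> R G
  by unfold_locales
    (rule omodule_pullback[OF \<zeta> omodule_free_gmod],
     rule omod_hom_pullback[OF \<zeta> omodule_free_gmod rep_sheaf_iso(2)[OF representation_V[OF i] db[OF i]]])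

sublocale F: omod \<X> F
  by unfold_locales (rule omodule_mult_sheaf[OF i])

sublocale N: act_omod \<X> N G
  by unfold_locales
    (rule omodule_fixed_part(1), use isotypical_closed'[OF i] A_isotypical_idem[OF i] in auto,
     rule isotypical_part_act[OF i])

lemma finsum_N:
  assumes U: "opn U" and f: "f \<in> B \<rightarrow> carrier (msec N U)"
  shows "finsum (msec N U) f B = finsum (msec E U) f B"
  using hom_finsum_additive(2)[OF N.abelian_msec[OF U] E.abelian_msec[OF U], of "\<lambda>x. x" f B] f part_carrier[OF i U] by auto

lemma \<zeta>_closed: "\<lbrakk>opn U; x \<in> carrier (msec R U); b \<in> J i\<rbrakk> \<Longrightarrow> \<zeta> U x b \<in> carrier (sec \<X> U)"
  using \<zeta>D(12) by (auto simp: PiE_iff)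

text \<open>The matrix unit with row \<open>c\<close> and column \<open>b\<close>, in the usual
  order of indices: it moves the copy of index \<open>b\<close> to the copy of index
  \<open>c\<close>.\<close>

abbreviation e :: "'i \<Rightarrow> 'i \<Rightarrow> 'p set \<Rightarrow> 'b \<Rightarrow> 'b" where
  "e c b U \<equiv> A U (munit i b (w i c))"

lemma e_closed: "\<lbrakk>opn U; b \<in> J i; c \<in> J i; x \<in> carrier (msec E U)\<rbrakk> \<Longrightarrow> e c b U x \<in> carrier (msec E U)"
  by (rule A_munit_closed[OF i])

lemma e_e:
  "\<lbrakk>opn U; b \<in> J i; c \<in> J i; c' \<in> J i; b' \<in> J i; x \<in> carrier (msec E U)\<rbrakk>
    \<Longrightarrow> e c b U (e c' b' U x) = (if b = c' then e c b' U x else \<zero>\<^bsub>msec E U\<^esub>)"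
  by (rule A_munit_munit[OF i _ _ _ d(4)])

lemma e_add_hom: "\<lbrakk>opn U; b \<in> J i; c \<in> J i\<rbrakk> \<Longrightarrow> e c b U \<in> add_homs (msec E U) (msec E U)"
  by (rule A_add_hom) (use munit_w_closed[OF i] in auto)

lemma e_smult: "\<lbrakk>opn U; b \<in> J i; c \<in> J i; f \<in> carrier (sec \<X> U); x \<in> carrier (msec E U)\<rbrakk>
    \<Longrightarrow> e c b U (f \<odot>\<^bsub>msec E U\<^esub> x) = f \<odot>\<^bsub>msec E U\<^esub> e c b U x"
  by (rule A_smult) (use munit_w_closed[OF i] in auto)

lemma e_res: "\<lbrakk>opn U; opn W; W \<subseteq> U; b \<in> J i; c \<in> J i; x \<in> carrier (msec E U)\<rbrakk>
    \<Longrightarrow> mres E U W (e c b U x) = e c b W (mres E U W x)"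
  by (rule A_res) (use munit_w_closed[OF i] in auto)

text \<open>The central idempotent of a block fixes every matrix unit of that block.\<close>

lemma e_in_N:
  assumes U: "opn U" and b: "b \<in> J i" "c \<in> J i" and x: "x \<in> carrier (msec E U)"
  shows "e c b U x \<in> carrier (msec N U)"
  using isotypical_munit[OF representation_sec_rep[OF U] i i b(1) d(4)[OF b(2)], of x] x e_closed[OF U b x]
  by (simp add: part_carrier[OF i U] alg_act_sec_rep)

text \<open>On sections the diagonal units of the block add up to the central idempotent, which
  fixes the isotypical part.\<close>

lemma e_sum:
  assumes U: "opn U" and x: "x \<in> carrier (msec N U)"
  shows "(\<Oplus>\<^bsub>msec E U\<^esub>b\<in>J i. e b b U x) = x"
  using alg_act_isotypical[OF representation_sec_rep[OF U] i, of x] x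
  by (simp add: part_carrier[OF i U] alg_act_sec_rep finsum_sec_rep)

text \<open>A section of the multiplicity sheaf corresponds to an equivariant map on
  \<open>V i\<close> taking it as value at the basis vector of index \<open>b0\<close>; then
  \<open>e b b0\<close> yields the value at the basis vector of index \<open>b\<close>. So \<mu>
  evaluates this map at \<open>s\<close>, extended linearly over the structure sheaf.\<close>

definition \<mu> :: "'p set \<Rightarrow> ('p \<Rightarrow> ('p set \<times> ('a \<times> 'v \<Rightarrow>\<^sub>0 int) set) set) \<Rightarrow> ('v \<Rightarrow> 'b) \<Rightarrow> 'b" where
  "\<mu> U s f = (\<Oplus>\<^bsub>msec E U\<^esub>b\<in>J i. \<zeta> U s b \<odot>\<^bsub>msec E U\<^esub> e b b0 U (f undefined))"

lemma \<mu>_closed: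
  assumes U: "opn U" and s: "s \<in> carrier (msec R U)" and f: "f \<in> carrier (msec F U)"
  shows "\<mu> U s f \<in> carrier (msec N U)"
proof -
  interpret N': module "sec \<X> U" "msec N U" by (rule N.module_msec[OF U])
  have t: "\<zeta> U s b \<odot>\<^bsub>msec N U\<^esub> e b b0 U (f undefined) \<in> carrier (msec N U)" if "b \<in> J i" for b
    by (rule N'.smult_closed[OF \<zeta>_closed[OF U s that] e_in_N[OF U b0 that mult_sheaf_secD(1)[OF f]]])
  then have "(\<Oplus>\<^bsub>msec N U\<^esub>b\<in>J i. \<zeta> U s b \<odot>\<^bsub>msec N U\<^esub> e b b0 U (f undefined)) \<in> carrier (msec N U)"
    by (intro N'.M.finsum_closed) auto
  moreover have "(\<Oplus>\<^bsub>msec N U\<^esub>b\<in>J i. \<zeta> U s b \<odot>\<^bsub>msec N U\<^esub> e b b0 U (f undefined)) = \<mu> U s f"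
    unfolding \<mu>_def using t by (subst finsum_N[OF U]) auto
  ultimately show ?thesis by simp
qed

lemma \<mu>_add_left:
  assumes U: "opn U" and s: "s \<in> carrier (msec R U)" "s' \<in> carrier (msec R U)" and f: "f \<in> carrier (msec F U)"
  shows "\<mu> U (s \<oplus>\<^bsub>msec R U\<^esub> s') f = \<mu> U s f \<oplus>\<^bsub>msec N U\<^esub> \<mu> U s' f"
proof -
  interpret M: module "sec \<X> U" "msec E U" by (rule E.module_msec[OF U])
  have fE: "e b b0 U (f undefined) \<in> carrier (msec E U)" if "b \<in> J i" for b by (rule e_closed[OF U b0 that mult_sheaf_secD(1)[OF f]])
  note z = \<zeta>_closed[OF U s(1)] \<zeta>_closed[OF U s(2)]
  have "\<mu> U (s \<oplus>\<^bsub>msec R U\<^esub> s') f = (\<Oplus>\<^bsub>msec E U\<^esub>b\<in>J i. (\<zeta> U s b \<oplus>\<^bsub>sec \<X> U\<^esub> \<zeta> U s' b) \<odot>\<^bsub>msec E U\<^esub> e b b0 U (f undefined))"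
    unfolding \<mu>_def by (rule M.M.finsum_cong') (use z fE \<zeta>D(5)[OF U s] in auto)
  also have "\<dots> = \<mu> U s f \<oplus>\<^bsub>msec N U\<^esub> \<mu> U s' f"
    unfolding \<mu>_def part_simps by (rule M.lincomb_add) (use z fE in auto)
  finally show ?thesis .
qed

lemma \<mu>_add_right:
  assumes U: "opn U" and s: "s \<in> carrier (msec R U)" and f: "f \<in> carrier (msec F U)" "f' \<in> carrier (msec F U)"
  shows "\<mu> U s (f \<oplus>\<^bsub>msec F U\<^esub> f') = \<mu> U s f \<oplus>\<^bsub>msec N U\<^esub> \<mu> U s f'"
proof -
  interpret M: module "sec \<X> U" "msec E U" by (rule E.module_msec[OF U])
  have fE: "e b b0 U (f undefined) \<in> carrier (msec E U)" "e b b0 U (f' undefined) \<in> carrier (msec E U)" if "b \<in> J i" for b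
    by (rule e_closed[OF U b0 that mult_sheaf_secD(1)[OF f(1)]], rule e_closed[OF U b0 that mult_sheaf_secD(1)[OF f(2)]])
  note z = \<zeta>_closed[OF U s]
  have "\<mu> U s (f \<oplus>\<^bsub>msec F U\<^esub> f') = (\<Oplus>\<^bsub>msec E U\<^esub>b\<in>J i. \<zeta> U s b \<odot>\<^bsub>msec E U\<^esub> e b b0 U (f undefined)
      \<oplus>\<^bsub>msec E U\<^esub> \<zeta> U s b \<odot>\<^bsub>msec E U\<^esub> e b b0 U (f' undefined))"
    unfolding \<mu>_def
    by (rule M.M.finsum_cong')
      (use z fE add_homsD(2)[OF e_add_hom[OF U b0] mult_sheaf_secD(1)[OF f(1)] mult_sheaf_secD(1)[OF f(2)]] M.smult_r_distr in auto)
  also have "\<dots> = \<mu> U s f \<oplus>\<^bsub>msec N U\<^esub> \<mu> U s f'"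
    unfolding \<mu>_def part_simps by (rule M.M.finsum_addf) (use z fE in auto)
  finally show ?thesis .
qed

lemma \<mu>_smult_left:
  assumes U: "opn U" and a: "a \<in> carrier (sec \<X> U)" and s: "s \<in> carrier (msec R U)" and f: "f \<in> carrier (msec F U)"
  shows "\<mu> U (a \<odot>\<^bsub>msec R U\<^esub> s) f = a \<odot>\<^bsub>msec N U\<^esub> \<mu> U s f"
proof -
  interpret M: module "sec \<X> U" "msec E U" by (rule E.module_msec[OF U])
  have fE: "e b b0 U (f undefined) \<in> carrier (msec E U)" if "b \<in> J i" for b by (rule e_closed[OF U b0 that mult_sheaf_secD(1)[OF f]])
  note z = \<zeta>_closed[OF U s]
  have "\<mu> U (a \<odot>\<^bsub>msec R U\<^esub> s) f = (\<Oplus>\<^bsub>msec E U\<^esub>b\<in>J i. (a \<otimes>\<^bsub>sec \<X> U\<^esub> \<zeta> U s b) \<odot>\<^bsub>msec E U\<^esub> e b b0 U (f undefined))"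
    unfolding \<mu>_def by (rule M.M.finsum_cong') (use z a fE \<zeta>D(7)[OF U a s] in auto)
  also have "\<dots> = a \<odot>\<^bsub>msec N U\<^esub> \<mu> U s f"
    unfolding \<mu>_def part_simps by (rule M.lincomb_smult) (use z a fE d(1) in auto)
  finally show ?thesis .
qed

text \<open>Scalars leave the matrix units, which act linearly over the structure sheaf. Together
  with \<open>\<mu>_smult_left\<close> this is the balancing condition for the tensor
  product.\<close>

lemma \<mu>_smult_right:
  assumes U: "opn U" and a: "a \<in> carrier (sec \<X> U)" and s: "s \<in> carrier (msec R U)" and f: "f \<in> carrier (msec F U)"
  shows "\<mu> U s (a \<odot>\<^bsub>msec F U\<^esub> f) = a \<odot>\<^bsub>msec N U\<^esub> \<mu> U s f"
proof -
  interpret M: module "sec \<X> U" "msec E U" by (rule E.module_msec[OF U])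
  have fE: "e b b0 U (f undefined) \<in> carrier (msec E U)" if "b \<in> J i" for b by (rule e_closed[OF U b0 that mult_sheaf_secD(1)[OF f]])
  note z = \<zeta>_closed[OF U s]
  have "\<mu> U s (a \<odot>\<^bsub>msec F U\<^esub> f) = (\<Oplus>\<^bsub>msec E U\<^esub>b\<in>J i. (a \<otimes>\<^bsub>sec \<X> U\<^esub> \<zeta> U s b) \<odot>\<^bsub>msec E U\<^esub> e b b0 U (f undefined))"
    unfolding \<mu>_def
  proof (rule M.M.finsum_cong')
    fix b assume b: "b \<in> J i"
    show "\<zeta> U s b \<odot>\<^bsub>msec E U\<^esub> e b b0 U ((a \<odot>\<^bsub>msec F U\<^esub> f) undefined) = (a \<otimes>\<^bsub>sec \<X> U\<^esub> \<zeta> U s b) \<odot>\<^bsub>msec E U\<^esub> e b b0 U (f undefined)"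
      using z[OF b] a fE[OF b] e_smult[OF U b0 b a mult_sheaf_secD(1)[OF f]]
      by (simp add: M.smult_assoc1[symmetric] M.R.m_comm)
  qed (use z a fE in auto)
  also have "\<dots> = a \<odot>\<^bsub>msec N U\<^esub> \<mu> U s f"
    unfolding \<mu>_def part_simps by (rule M.lincomb_smult) (use z a fE d(1) in auto)
  finally show ?thesis .
qed

text \<open>Both the coordinates \<zeta> and the matrix units commute with restriction.\<close>

lemma \<mu>_res:
  assumes o: "opn U" "opn W" "W \<subseteq> U" and s: "s \<in> carrier (msec R U)" and f: "f \<in> carrier (msec F U)"
  shows "\<mu> W (mres R U W s) (mres F U W f) = mres E U W (\<mu> U s f)"
proof -
  have fE: "e b b0 U (f undefined) \<in> carrier (msec E U)" if "b \<in> J i" for b by (rule e_closed[OF o(1) b0 that mult_sheaf_secD(1)[OF f]])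
  note z = \<zeta>_closed[OF o(1) s]
  have "mres E U W (\<mu> U s f) = (\<Oplus>\<^bsub>msec E W\<^esub>b\<in>J i. mres E U W (\<zeta> U s b \<odot>\<^bsub>msec E U\<^esub> e b b0 U (f undefined)))"
    unfolding \<mu>_def
    by (rule hom_finsum_additive(2)[OF E.abelian_msec[OF o(1)] E.abelian_msec[OF o(2)]])
      (use E.mres_simps[OF o] E.msec_closed(2)[OF o(1)] z fE in auto)
  also have "\<dots> = \<mu> W (mres R U W s) (mres F U W f)"
    unfolding \<mu>_def
  proof (rule abelian_monoid.finsum_cong'[OF abelian_group.axioms(1)[OF E.abelian_msec[OF o(2)]]])
    fix b assume b: "b \<in> J i"
    have "\<zeta> W (mres R U W s) b = res \<X> U W (\<zeta> U s b)"
      using \<zeta>D(11)[OF o s] b by simp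
    then show "mres E U W (\<zeta> U s b \<odot>\<^bsub>msec E U\<^esub> e b b0 U (f undefined)) =
        \<zeta> W (mres R U W s) b \<odot>\<^bsub>msec E W\<^esub> e b b0 W (mres F U W f undefined)"
      using E.mres_simps(3)[OF o z[OF b] fE[OF b]] e_res[OF o b0 b mult_sheaf_secD(1)[OF f]] by simp
  next
    have rW: "mres R U W s \<in> carrier (msec R W)" by (rule R.mres_simps(1)[OF o s])
    show "(\<lambda>b. \<zeta> W (mres R U W s) b \<odot>\<^bsub>msec E W\<^esub> e b b0 W (mres F U W f undefined)) \<in> J i \<rightarrow> carrier (msec E W)"
      using \<zeta>_closed[OF o(2) rW] e_closed[OF o(2) b0] E.mres_simps(1)[OF o mult_sheaf_secD(1)[OF f]] E.msec_closed(2)[OF o(2)] by auto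
  qed simp
  finally show ?thesis by simp
qed

lemma \<mu>_gact:
  assumes U: "opn U" and g: "g \<in> carrier G" and s: "s \<in> carrier (msec R U)" and f: "f \<in> carrier (msec F U)"
  shows "\<mu> U (gact R g U s) f = gact E g U (\<mu> U s f)"
proof -
  interpret M: module "sec \<X> U" "msec E U" by (rule E.module_msec[OF U])
  note Vi = representationD[OF representation_V[OF i]]
  interpret Vi: module k "V i" by (rule Vi)
  note x = mult_sheaf_secD(1)[OF f]
  have fE: "e b b0 U (f undefined) \<in> carrier (msec E U)" if "b \<in> J i" for b by (rule e_closed[OF U b0 that x])
  note z = \<zeta>_closed[OF U s]
  define m where "m b l = const_sec \<X> \<kappa> U (\<gamma> i b (ract (V i) g (w i l)))" for b l
  have gw: "ract (V i) g (w i l) \<in> carrier (V i)" if "l \<in> J i" for l using Vi(3)[OF g d(4)[OF that]] .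
  have m: "m b l \<in> carrier (sec \<X> U)" if "b \<in> J i" "l \<in> J i" for b l
    unfolding m_def by (rule const_sec_simps(1)[OF U d(6)[OF that(1) gw[OF that(2)]]])
  \<comment> \<open>Sending \<open>v\<close> to the action of \<open>munit i b0 v\<close> is
    equivariant, so \<open>g\<close> transforms the vectors \<open>e l b0\<close> by the same matrix
    as the basis vectors of \<open>V i\<close>.\<close>
  have ge: "gact E g U (e l b0 U (f undefined)) = (\<Oplus>\<^bsub>msec E U\<^esub>b\<in>J i. m b l \<odot>\<^bsub>msec E U\<^esub> e b b0 U (f undefined))" if l: "l \<in> J i" for l
  proof -
    have eq: "(\<lambda>v. alg_act G (sec_rep U) (munit i b0 v) (f undefined)) \<in> equivariant_homs k G (V i) (sec_rep U)"
      by (rule munit_equivariant[OF representation_sec_rep[OF U] i b0]) (use x in simp)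
    then have h: "(\<lambda>v. A U (munit i b0 v) (f undefined)) \<in> module_homs k (V i) (sec_rep U)"
      and gh: "gact E g U (e l b0 U (f undefined)) = A U (munit i b0 (ract (V i) g (w i l))) (f undefined)"
      using g d(4)[OF l] by (auto simp: equivariant_homs_def alg_act_sec_rep)
    have "A U (munit i b0 (ract (V i) g (w i l))) (f undefined)
      = A U (munit i b0 (\<Oplus>\<^bsub>V i\<^esub>b\<in>J i. \<gamma> i b (ract (V i) g (w i l)) \<odot>\<^bsub>V i\<^esub> w i b)) (f undefined)"
      using dual_basis_expand[OF db[OF i] gw[OF l]] by simp
    also have "\<dots> = (\<Oplus>\<^bsub>sec_rep U\<^esub>b\<in>J i. \<gamma> i b (ract (V i) g (w i l)) \<odot>\<^bsub>sec_rep U\<^esub> e b b0 U (f undefined))"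
      by (rule module_hom_lincomb[OF Vi(1) representationD(1)[OF representation_sec_rep[OF U]] h]) (use d gw[OF l] in auto)
    finally show ?thesis using gh by (simp add: finsum_sec_rep m_def)
  qed
  have "gact E g U (\<mu> U s f) = (\<Oplus>\<^bsub>msec E U\<^esub>l\<in>J i. gact E g U (\<zeta> U s l \<odot>\<^bsub>msec E U\<^esub> e l b0 U (f undefined)))"
    unfolding \<mu>_def
    by (rule hom_finsum_additive(2)[OF M.M.abelian_group_axioms M.M.abelian_group_axioms])
      (use E.gact_simps[OF g U] z fE in auto)
  also have "\<dots> = (\<Oplus>\<^bsub>msec E U\<^esub>l\<in>J i. \<Oplus>\<^bsub>msec E U\<^esub>b\<in>J i. (m b l \<otimes>\<^bsub>sec \<X> U\<^esub> \<zeta> U s l) \<odot>\<^bsub>msec E U\<^esub> e b b0 U (f undefined))"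
  proof (rule M.M.finsum_cong')
    fix l assume l: "l \<in> J i"
    have "gact E g U (\<zeta> U s l \<odot>\<^bsub>msec E U\<^esub> e l b0 U (f undefined))
      = \<zeta> U s l \<odot>\<^bsub>msec E U\<^esub> (\<Oplus>\<^bsub>msec E U\<^esub>b\<in>J i. m b l \<odot>\<^bsub>msec E U\<^esub> e b b0 U (f undefined))"
      using E.gact_simps(3)[OF g U z[OF l] fE[OF l]] ge[OF l] by simp
    also have "\<dots> = (\<Oplus>\<^bsub>msec E U\<^esub>b\<in>J i. (\<zeta> U s l \<otimes>\<^bsub>sec \<X> U\<^esub> m b l) \<odot>\<^bsub>msec E U\<^esub> e b b0 U (f undefined))"
      by (rule M.lincomb_smult[symmetric]) (use d(1) z m l fE in auto)
    also have "\<dots> = (\<Oplus>\<^bsub>msec E U\<^esub>b\<in>J i. (m b l \<otimes>\<^bsub>sec \<X> U\<^esub> \<zeta> U s l) \<odot>\<^bsub>msec E U\<^esub> e b b0 U (f undefined))"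
      by (rule M.M.finsum_cong') (use z m l fE M.R.m_comm in auto)
    finally show "gact E g U (\<zeta> U s l \<odot>\<^bsub>msec E U\<^esub> e l b0 U (f undefined))
      = (\<Oplus>\<^bsub>msec E U\<^esub>b\<in>J i. (m b l \<otimes>\<^bsub>sec \<X> U\<^esub> \<zeta> U s l) \<odot>\<^bsub>msec E U\<^esub> e b b0 U (f undefined))" .
  qed (use z m fE in \<open>auto intro!: M.M.finsum_closed\<close>)
  \<comment> \<open>After the sums are exchanged, the coefficient of index \<open>b\<close> is the
    corresponding coordinate of the translated section of O(V i).\<close>
  also have "\<dots> = (\<Oplus>\<^bsub>msec E U\<^esub>b\<in>J i. \<Oplus>\<^bsub>msec E U\<^esub>l\<in>J i. (m b l \<otimes>\<^bsub>sec \<X> U\<^esub> \<zeta> U s l) \<odot>\<^bsub>msec E U\<^esub> e b b0 U (f undefined))"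
    by (rule M.M.finsum_swap) (use d(1) z m fE in auto)
  also have "\<dots> = (\<Oplus>\<^bsub>msec E U\<^esub>b\<in>J i. (\<Oplus>\<^bsub>sec \<X> U\<^esub>l\<in>J i. m b l \<otimes>\<^bsub>sec \<X> U\<^esub> \<zeta> U s l) \<odot>\<^bsub>msec E U\<^esub> e b b0 U (f undefined))"
    by (rule M.M.finsum_cong') (use z m fE in \<open>auto intro!: M.finsum_smult_rdistr[symmetric] M.R.finsum_closed\<close>)
  also have "\<dots> = \<mu> U (gact R g U s) f"
    unfolding \<mu>_def
    by (rule M.M.finsum_cong') (use z m fE \<zeta>D(9)[OF U g s] in \<open>auto simp: m_def intro!: M.R.finsum_closed\<close>)
  finally show ?thesis by simp
qed

end

section \<open>The pairing as an isomorphism on the tensor product\<close>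

context isotypical_piece
begin

text \<open>The pairing \<open>\<mu>\<close> induces an isomorphism from \<open>R \<otimes> F\<close> to the isotypical part; its inverse maps
  \<open>x\<close> to the sum of the \<open>\<beta> b \<otimes> e b0 b x\<close>, where \<open>e b0 b\<close> moves the \<open>b\<close>-th copy of the multiplicity
  sheaf inside \<open>E\<close> to the one with index \<open>b0\<close>.\<close>

definition \<beta> :: "'p set \<Rightarrow> 'i \<Rightarrow> 'p \<Rightarrow> ('p set \<times> ('a \<times> 'v \<Rightarrow>\<^sub>0 int) set) set" where
  "\<beta> U b = (SOME s. s \<in> carrier (msec R U) \<and> (\<lambda>j\<in>J i. if j = b then \<one>\<^bsub>sec \<X> U\<^esub> else \<zero>\<^bsub>sec \<X> U\<^esub>) = \<zeta> U s)"

lemma \<beta>: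
  assumes U: "opn U" and b: "b \<in> J i"
  shows "\<beta> U b \<in> carrier (msec R U)" "\<zeta> U (\<beta> U b) = (\<lambda>j\<in>J i. if j = b then \<one>\<^bsub>sec \<X> U\<^esub> else \<zero>\<^bsub>sec \<X> U\<^esub>)"
proof -
  interpret O: cring "sec \<X> U" by (rule cring_sec[OF U])
  have "\<exists>s. s \<in> carrier (msec R U) \<and> (\<lambda>j\<in>J i. if j = b then \<one>\<^bsub>sec \<X> U\<^esub> else \<zero>\<^bsub>sec \<X> U\<^esub>) = \<zeta> U s"
  proof -
    have "(\<lambda>j\<in>J i. if j = b then \<one>\<^bsub>sec \<X> U\<^esub> else \<zero>\<^bsub>sec \<X> U\<^esub>) \<in> (\<Pi>\<^sub>E j\<in>J i. carrier (sec \<X> U))" by auto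
    from \<zeta>D(14)[OF U this] show ?thesis by blast
  qed
  from someI_ex[OF this] show "\<beta> U b \<in> carrier (msec R U)"
    "\<zeta> U (\<beta> U b) = (\<lambda>j\<in>J i. if j = b then \<one>\<^bsub>sec \<X> U\<^esub> else \<zero>\<^bsub>sec \<X> U\<^esub>)"
    by (simp_all add: \<beta>_def)
qed

lemma \<beta>_expand:
  assumes U: "opn U" and s: "s \<in> carrier (msec R U)"
  shows "(\<Oplus>\<^bsub>msec R U\<^esub>b\<in>J i. \<zeta> U s b \<odot>\<^bsub>msec R U\<^esub> \<beta> U b) = s"
proof -
  interpret O: cring "sec \<X> U" by (rule cring_sec[OF U])
  interpret R: module "sec \<X> U" "msec R U" by (rule R.module_msec[OF U])
  note z = \<zeta>_closed[OF U s]
  have t: "\<zeta> U s b \<odot>\<^bsub>msec R U\<^esub> \<beta> U b \<in> carrier (msec R U)" if "b \<in> J i" for b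
    using z[OF that] \<beta>(1)[OF U that] by simp
  have sum: "(\<Oplus>\<^bsub>msec R U\<^esub>b\<in>J i. \<zeta> U s b \<odot>\<^bsub>msec R U\<^esub> \<beta> U b) \<in> carrier (msec R U)"
    using t by (intro R.M.finsum_closed) auto
  show ?thesis
  proof (rule \<zeta>D(13)[OF U sum s])
    have "\<zeta> U (\<Oplus>\<^bsub>msec R U\<^esub>b\<in>J i. \<zeta> U s b \<odot>\<^bsub>msec R U\<^esub> \<beta> U b) j = \<zeta> U s j" if j: "j \<in> J i" for j
    proof -
      have "\<zeta> U (\<Oplus>\<^bsub>msec R U\<^esub>b\<in>J i. \<zeta> U s b \<odot>\<^bsub>msec R U\<^esub> \<beta> U b) j
          = (\<Oplus>\<^bsub>sec \<X> U\<^esub>b\<in>J i. \<zeta> U (\<zeta> U s b \<odot>\<^bsub>msec R U\<^esub> \<beta> U b) j)"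
        by (rule hom_finsum_additive(2)[OF R.M.abelian_group_axioms O.abelian_group_axioms, of "\<lambda>y. \<zeta> U y j"])
          (use \<zeta>_closed[OF U _ j] \<zeta>D(5)[OF U] t j in auto)
      also have "\<dots> = (\<Oplus>\<^bsub>sec \<X> U\<^esub>b\<in>J i. if b = j then \<zeta> U s j else \<zero>\<^bsub>sec \<X> U\<^esub>)"
        by (rule O.finsum_cong') (use j z \<zeta>D(7)[OF U z \<beta>(1)[OF U]] \<beta>(2)[OF U] in auto)
      also have "\<dots> = \<zeta> U s j" by (rule O.finsum_delta) (use d(1) j z in auto)
      finally show ?thesis .
    qed
    then show "\<zeta> U (\<Oplus>\<^bsub>msec R U\<^esub>b\<in>J i. \<zeta> U s b \<odot>\<^bsub>msec R U\<^esub> \<beta> U b) = \<zeta> U s"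
      by (rule PiE_ext[OF \<zeta>D(12)[OF U sum] \<zeta>D(12)[OF U s]])
  qed
qed

text \<open>In coordinates \<beta> is a unit vector, so a single term of the sum defining \<mu>
  remains.\<close>

lemma \<mu>_\<beta>:
  assumes U: "opn U" and b: "b \<in> J i" and x: "x \<in> carrier (msec E U)"
  shows "\<mu> U (\<beta> U b) (\<lambda>_. x) = e b b0 U x"
proof -
  interpret M: module "sec \<X> U" "msec E U" by (rule E.module_msec[OF U])
  have "\<mu> U (\<beta> U b) (\<lambda>_. x) = (\<Oplus>\<^bsub>msec E U\<^esub>l\<in>J i. if l = b then e b b0 U x else \<zero>\<^bsub>msec E U\<^esub>)"
    unfolding \<mu>_def \<beta>(2)[OF U b] by (rule M.M.finsum_cong') (use e_closed[OF U b0 _ x] in auto)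
  also have "\<dots> = e b b0 U x" by (rule M.M.finsum_delta) (use d(1) b e_closed[OF U b0 b x] in auto)
  finally show ?thesis .
qed

text \<open>Of the products of \<open>e b0 b\<close> with \<open>e l b0\<close> only that with
  \<open>l = b\<close> survives. It is \<open>e b0 b0\<close>, which fixes sections of the
  multiplicity sheaf.\<close>

lemma e_\<mu>:
  assumes U: "opn U" and s: "s \<in> carrier (msec R U)" and f: "f \<in> carrier (msec F U)" and b: "b \<in> J i"
  shows "e b0 b U (\<mu> U s f) = \<zeta> U s b \<odot>\<^bsub>msec E U\<^esub> f undefined"
proof -
  interpret M: module "sec \<X> U" "msec E U" by (rule E.module_msec[OF U])
  note x = mult_sheaf_secD(1)[OF f] and z = \<zeta>_closed[OF U s]
  have t: "e l b0 U (f undefined) \<in> carrier (msec E U)" if "l \<in> J i" for l by (rule e_closed[OF U b0 that x])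
  have "e b0 b U (\<mu> U s f) = (\<Oplus>\<^bsub>msec E U\<^esub>l\<in>J i. e b0 b U (\<zeta> U s l \<odot>\<^bsub>msec E U\<^esub> e l b0 U (f undefined)))"
    unfolding \<mu>_def by (rule add_homs_finsum[OF M.M.abelian_group_axioms M.M.abelian_group_axioms e_add_hom[OF U b b0]])
      (use z t in auto)
  also have "\<dots> = (\<Oplus>\<^bsub>msec E U\<^esub>l\<in>J i. if l = b then \<zeta> U s b \<odot>\<^bsub>msec E U\<^esub> f undefined else \<zero>\<^bsub>msec E U\<^esub>)"
    by (rule M.M.finsum_cong')
      (use z t x e_smult[OF U b b0 z t] e_e[OF U b b0 _ b0 x] mult_sheaf_secD(2)[OF f] in auto)
  also have "\<dots> = \<zeta> U s b \<odot>\<^bsub>msec E U\<^esub> f undefined" by (rule M.M.finsum_delta) (use d(1) b z x in auto)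
  finally show ?thesis .
qed

text \<open>The unit \<open>e b0 b0\<close> fixes everything in row \<open>b0\<close>.\<close>

lemma e_in_F: "\<lbrakk>opn U; b \<in> J i; x \<in> carrier (msec E U)\<rbrakk> \<Longrightarrow> (\<lambda>_. e b0 b U x) \<in> carrier (msec F U)"
  by (rule mult_sheaf_secI) (simp_all add: e_closed b0 e_e)

lemma tensor_factors_piece: "opn U \<Longrightarrow> tensor_factors (sec \<X> U) (module.smult (msec R U)) (msec R U) (msec F U)"
  by (intro tensor_factors.intro tensor_factors_axioms.intro R.abelian_msec F.abelian_msec R.msec_closed(2) F.msec_closed(2))

abbreviation T :: "'p set \<Rightarrow> ('a, (('p \<Rightarrow> ('p set \<times> ('a \<times> 'v \<Rightarrow>\<^sub>0 int) set) set) \<times> ('v \<Rightarrow> 'b) \<Rightarrow>\<^sub>0 int) set) module" where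
  "T U \<equiv> tensor (sec \<X> U) (module.smult (msec R U)) (msec R U) (msec F U)"

abbreviation pr where
  "pr U \<equiv> tensor_factors.pure (sec \<X> U) (module.smult (msec R U)) (msec R U) (msec F U)"

text \<open>The proposed inverse followed by the pairing is the sum of the \<open>e b b\<close>,
  which is the identity on the isotypical part. For the other composite the coordinates of
  \<open>s\<close> reappear as scalars and rebuild \<open>s\<close>.\<close>

lemma exists_evaluation:
  assumes U: "opn U"
  shows "\<exists>L\<in>add_homs (T U) (msec N U). (\<forall>s\<in>carrier (msec R U). \<forall>f\<in>carrier (msec F U). L (pr U s f) = \<mu> U s f) \<and>
    bij_betw L (carrier (T U)) (carrier (msec N U))"
proof -
  interpret TF: tensor_factors "sec \<X> U" "module.smult (msec R U)" "msec R U" "msec F U"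
    by (rule tensor_factors_piece[OF U])
  interpret N: module "sec \<X> U" "msec N U" by (rule N.module_msec[OF U])
  interpret R: module "sec \<X> U" "msec R U" by (rule R.module_msec[OF U])
  have NE: "z \<in> carrier (msec E U)" if "z \<in> carrier (msec N U)" for z using that part_carrier[OF i U] by simp
  show ?thesis
  proof (rule TF.tensor_iso[where p = "\<lambda>b _. \<beta> U b" and q = "\<lambda>b z _. e b0 b U z" and B = "J i"])
    show "abelian_group (msec N U)" by (rule N.M.abelian_group_axioms)
    show "\<mu> U (a \<odot>\<^bsub>msec R U\<^esub> s) f = \<mu> U s (a \<odot>\<^bsub>msec F U\<^esub> f)"
      if "a \<in> carrier (sec \<X> U)" "s \<in> carrier (msec R U)" "f \<in> carrier (msec F U)" for a s f
      using \<mu>_smult_left[OF U that] \<mu>_smult_right[OF U that] by simp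
    show "(\<Oplus>\<^bsub>msec N U\<^esub>b\<in>J i. \<mu> U (\<beta> U b) (\<lambda>_. e b0 b U z)) = z" if z: "z \<in> carrier (msec N U)" for z
    proof -
      note zE = NE[OF z]
      have t: "\<mu> U (\<beta> U b) (\<lambda>_. e b0 b U z) = e b b U z" if b: "b \<in> J i" for b
        using \<mu>_\<beta>[OF U b e_closed[OF U b b0 zE]] e_e[OF U b0 b b0 b zE] by simp
      have "(\<Oplus>\<^bsub>msec N U\<^esub>b\<in>J i. \<mu> U (\<beta> U b) (\<lambda>_. e b0 b U z)) = (\<Oplus>\<^bsub>msec N U\<^esub>b\<in>J i. e b b U z)"
        by (rule N.M.finsum_cong') (use t e_in_N[OF U _ _ zE] in auto)
      also have "\<dots> = (\<Oplus>\<^bsub>msec E U\<^esub>b\<in>J i. e b b U z)"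
        by (rule finsum_N[OF U]) (use e_in_N[OF U _ _ zE] in auto)
      also have "\<dots> = z" by (rule e_sum[OF U z])
      finally show ?thesis .
    qed
    show "(\<Oplus>\<^bsub>T U\<^esub>b\<in>J i. pr U (\<beta> U b) (\<lambda>_. e b0 b U (\<mu> U s f))) = pr U s f"
      if s: "s \<in> carrier (msec R U)" and f: "f \<in> carrier (msec F U)" for s f
    proof -
      note z = \<zeta>_closed[OF U s]
      have t: "\<zeta> U s b \<odot>\<^bsub>msec R U\<^esub> \<beta> U b \<in> carrier (msec R U)" if "b \<in> J i" for b
        using z[OF that] \<beta>(1)[OF U that] by simp
      have "(\<Oplus>\<^bsub>T U\<^esub>b\<in>J i. pr U (\<beta> U b) (\<lambda>_. e b0 b U (\<mu> U s f))) = (\<Oplus>\<^bsub>T U\<^esub>b\<in>J i. pr U (\<zeta> U s b \<odot>\<^bsub>msec R U\<^esub> \<beta> U b) f)"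
      proof (rule TF.T.finsum_cong')
        \<comment> \<open>The coordinate of \<open>s\<close> is moved across the tensor sign to the
          factor \<beta>.\<close>
        fix b assume b: "b \<in> J i"
        have "(\<lambda>_. e b0 b U (\<mu> U s f)) = \<zeta> U s b \<odot>\<^bsub>msec F U\<^esub> f"
          using e_\<mu>[OF U s f b] by simp
        then show "pr U (\<beta> U b) (\<lambda>_. e b0 b U (\<mu> U s f)) = pr U (\<zeta> U s b \<odot>\<^bsub>msec R U\<^esub> \<beta> U b) f"
          using TF.pure_balanced[OF z[OF b] \<beta>(1)[OF U b] f] by simp
      qed (use t f TF.pure_closed in auto)
      also have "\<dots> = pr U (\<Oplus>\<^bsub>msec R U\<^esub>b\<in>J i. \<zeta> U s b \<odot>\<^bsub>msec R U\<^esub> \<beta> U b) f"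
        by (rule add_homs_finsum[OF R.abelian_msec[OF U] TF.T.abelian_group_axioms TF.pure_left_add_hom[OF f], symmetric])
          (use t in auto)
      finally show ?thesis unfolding \<beta>_expand[OF U s] .
    qed
    show "(\<lambda>z. pr U (\<beta> U b) (\<lambda>_. e b0 b U z)) \<in> add_homs (msec N U) (T U)" if b: "b \<in> J i" for b
    proof (rule add_homs_comp[of "\<lambda>z _. e b0 b U z", OF _ TF.pure_right_add_hom[OF \<beta>(1)[OF U b]]])
      show "(\<lambda>z _. e b0 b U z) \<in> add_homs (msec N U) (msec F U)"
        by (rule add_homsI) (use e_in_F[OF U b] NE add_homsD(2)[OF e_add_hom[OF U b b0]] in auto)
    qed
  qed (use \<mu>_closed[OF U] \<mu>_add_left[OF U] \<mu>_add_right[OF U] \<beta>(1)[OF U] e_in_F[OF U] NE in auto)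
qed

definition ev where
  "ev U = (SOME L. L \<in> add_homs (T U) (msec N U) \<and>
     (\<forall>s\<in>carrier (msec R U). \<forall>f\<in>carrier (msec F U). L (pr U s f) = \<mu> U s f) \<and> bij_betw L (carrier (T U)) (carrier (msec N U)))"

lemma ev:
  assumes U: "opn U"
  shows "ev U \<in> add_homs (T U) (msec N U)" "\<lbrakk>s \<in> carrier (msec R U); f \<in> carrier (msec F U)\<rbrakk> \<Longrightarrow> ev U (pr U s f) = \<mu> U s f"
    "bij_betw (ev U) (carrier (T U)) (carrier (msec N U))"
proof -
  have "\<exists>L. L \<in> add_homs (T U) (msec N U) \<and>
     (\<forall>s\<in>carrier (msec R U). \<forall>f\<in>carrier (msec F U). L (pr U s f) = \<mu> U s f) \<and> bij_betw L (carrier (T U)) (carrier (msec N U))"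
    using exists_evaluation[OF U] by blast
  from someI_ex[OF this, folded ev_def]
  show "ev U \<in> add_homs (T U) (msec N U)" "\<lbrakk>s \<in> carrier (msec R U); f \<in> carrier (msec F U)\<rbrakk> \<Longrightarrow> ev U (pr U s f) = \<mu> U s f"
    "bij_betw (ev U) (carrier (T U)) (carrier (msec N U))"
    by (simp_all del: mult_sheaf_simps)
qed

text \<open>Two additive maps are compared on pure tensors. The statement covers restriction, scalar
  multiplication and the group action at once; \<open>bal\<close> asks that \<open>f\<close> and
  \<open>g\<close> turn a scalar into the same scalar \<open>a'\<close>, which makes their tensor
  product respect balancing.\<close>

lemma ev_tensor_map:
  assumes o: "opn U" "opn W" and f: "f \<in> add_homs (msec R U) (msec R W)" and g: "g \<in> add_homs (msec F U) (msec F W)"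
    and bal: "\<And>a x y. \<lbrakk>a \<in> carrier (sec \<X> U); x \<in> carrier (msec R U); y \<in> carrier (msec F U)\<rbrakk> \<Longrightarrow>
       \<exists>a'\<in>carrier (sec \<X> W). f (a \<odot>\<^bsub>msec R U\<^esub> x) = a' \<odot>\<^bsub>msec R W\<^esub> f x \<and> g (a \<odot>\<^bsub>msec F U\<^esub> y) = a' \<odot>\<^bsub>msec F W\<^esub> g y"
    and \<psi>: "\<psi> \<in> add_homs (msec N U) (msec N W)"
    and comm: "\<And>x y. \<lbrakk>x \<in> carrier (msec R U); y \<in> carrier (msec F U)\<rbrakk> \<Longrightarrow> \<mu> W (f x) (g y) = \<psi> (\<mu> U x y)"
    and C: "C \<in> carrier (T U)"
  shows "tensor_map (sec \<X> W) (module.smult (msec R W)) (msec R W) (msec F W) f g C \<in> carrier (T W)"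
    and "ev W (tensor_map (sec \<X> W) (module.smult (msec R W)) (msec R W) (msec F W) f g C) = \<psi> (ev U C)"
proof -
  interpret TU: tensor_factors "sec \<X> U" "module.smult (msec R U)" "msec R U" "msec F U"
    by (rule tensor_factors_piece[OF o(1)])
  interpret TW: tensor_factors "sec \<X> W" "module.smult (msec R W)" "msec R W" "msec F W"
    by (rule tensor_factors_piece[OF o(2)])
  have bal': "pr W (f (a \<odot>\<^bsub>msec R U\<^esub> x)) (g y) = pr W (f x) (g (a \<odot>\<^bsub>msec F U\<^esub> y))"
    if a: "a \<in> carrier (sec \<X> U)" "x \<in> carrier (msec R U)" "y \<in> carrier (msec F U)" for a x y
  proof -
    obtain a' where a': "a' \<in> carrier (sec \<X> W)" "f (a \<odot>\<^bsub>msec R U\<^esub> x) = a' \<odot>\<^bsub>msec R W\<^esub> f x" "g (a \<odot>\<^bsub>msec F U\<^esub> y) = a' \<odot>\<^bsub>msec F W\<^esub> g y"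
      using bal[OF a] by (elim bexE conjE) 
    show ?thesis unfolding a'(2,3)
      by (rule TW.pure_balanced[OF a'(1) add_homsD(1)[OF f a(2)] add_homsD(1)[OF g a(3)]])
  qed
  note tm = TW.tensor_map_hom[OF TU.tensor_factors_axioms, OF f g, OF bal']
  let ?t = "tensor_map (sec \<X> W) (module.smult (msec R W)) (msec R W) (msec F W) f g"
  have h: "?t \<in> add_homs (T U) (T W)" by (rule tm(1))
  show "?t C \<in> carrier (T W)" by (rule add_homsD(1)[OF h C])
  show "ev W (?t C) = \<psi> (ev U C)"
  proof (rule TU.tensor_hom_eq[OF add_homs_comp[OF h ev(1)[OF o(2)]] add_homs_comp[OF ev(1)[OF o(1)] \<psi>] _ C])
    fix x y assume xy: "x \<in> carrier (msec R U)" "y \<in> carrier (msec F U)"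
    have "?t (pr U x y) = pr W (f x) (g y)" by (rule tm(2)[OF _ _ _ xy])
    then show "ev W (?t (pr U x y)) = \<psi> (ev U (pr U x y))"
      using ev(2)[OF o(2) add_homsD(1)[OF f xy(1)] add_homsD(1)[OF g xy(2)]] ev(2)[OF o(1) xy] comm[OF xy] by simp
  qed
qed

text \<open>The presheaf of tensor products is already isomorphic to a sheaf, the isotypical part,
  so sheafification can be removed.\<close>

lemma exists_piece_iso: "\<exists>\<Theta>. gsheaf_iso \<X> G (tensor_gmod \<X> R (trivial_action F)) N \<Theta>"
proof -
  let ?F = "trivial_action F :: ('p, 'a, 'v \<Rightarrow> 'b, 'g) gmod"
  have ga: "gact (trivial_action F) g U = (\<lambda>s. s)" for g :: 'g and U by auto
  let ?P = "\<lparr>msec = (\<lambda>U. tensor (sec \<X> U) (module.smult (msec R U)) (msec R U) (msec ?F U)),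
      mres = (\<lambda>U V. tensor_map (sec \<X> V) (module.smult (msec R V)) (msec R V) (msec ?F V) (mres R U V) (mres ?F U V)),
      gact = (\<lambda>g U. tensor_map (sec \<X> U) (module.smult (msec R U)) (msec R U) (msec ?F U) (gact R g U) (gact ?F g U))\<rparr>
    :: ('p, 'a, (('p \<Rightarrow> ('p set \<times> ('a \<times> 'v \<Rightarrow>\<^sub>0 int) set) set) \<times> ('v \<Rightarrow> 'b) \<Rightarrow>\<^sub>0 int) set, 'g) gmod"
  have "gsheaf_iso \<X> G ?P N ev"
    unfolding trivial_action_simps(1,2) ga
  proof (rule gsheaf_isoI, unfold omod.simps gmod.simps)
    fix U assume U: "opn U"
    interpret TF: tensor_factors "sec \<X> U" "module.smult (msec R U)" "msec R U" "msec F U"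
      by (rule tensor_factors_piece[OF U])
    note h = add_homsD[OF ev(1)[OF U]]
    show "bij_betw (ev U) (carrier (T U)) (carrier (msec N U))" by (rule ev(3)[OF U])
    show "\<zero>\<^bsub>T U\<^esub> \<in> carrier (T U)" by (rule TF.T.zero_closed)
    show "ev U \<zero>\<^bsub>T U\<^esub> = \<zero>\<^bsub>msec N U\<^esub>"
      by (rule add_homs_zero[OF TF.T.abelian_group_axioms N.abelian_msec[OF U] ev(1)[OF U]])
    fix x assume x: "x \<in> carrier (T U)"
    show "x \<oplus>\<^bsub>T U\<^esub> y \<in> carrier (T U)" "ev U (x \<oplus>\<^bsub>T U\<^esub> y) = ev U x \<oplus>\<^bsub>msec N U\<^esub> ev U y"
      if y: "y \<in> carrier (T U)" for y
      using h(2)[OF x y] x y by simp_all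
    show "a \<odot>\<^bsub>T U\<^esub> x \<in> carrier (T U)" "ev U (a \<odot>\<^bsub>T U\<^esub> x) = a \<odot>\<^bsub>msec N U\<^esub> ev U x"
      if a: "a \<in> carrier (sec \<X> U)" for a
    proof -
      interpret R: module "sec \<X> U" "msec R U" by (rule R.module_msec[OF U])
      interpret N: module "sec \<X> U" "msec N U" by (rule N.module_msec[OF U])
      have "(\<lambda>x. a \<odot>\<^bsub>msec R U\<^esub> x) \<in> add_homs (msec R U) (msec R U)" "(\<lambda>x. a \<odot>\<^bsub>msec N U\<^esub> x) \<in> add_homs (msec N U) (msec N U)"
        using a by (auto intro!: add_homsI simp: R.smult_r_distr N.smult_r_distr simp del: part_simps)
      note tm = ev_tensor_map[OF U U this(1) _ _ this(2) _ x, of id]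
      have c1: "id \<in> add_homs (msec F U) (msec F U)" by (simp add: add_homs_def)
      \<comment> \<open>Here the common scalar is \<open>c\<close> itself, because scalars
        commute.\<close>
      have c2: "\<exists>a'\<in>carrier (sec \<X> U). a \<odot>\<^bsub>msec R U\<^esub> (c \<odot>\<^bsub>msec R U\<^esub> y) = a' \<odot>\<^bsub>msec R U\<^esub> (a \<odot>\<^bsub>msec R U\<^esub> y) \<and>
          id (c \<odot>\<^bsub>msec F U\<^esub> f) = a' \<odot>\<^bsub>msec F U\<^esub> id f" if "c \<in> carrier (sec \<X> U)" "y \<in> carrier (msec R U)" for c y f
        by (rule bexI[of _ c]) (use that a in \<open>simp_all add: R.smult_assoc1[symmetric] R.R.m_comm\<close>)
      have c3: "\<mu> U (a \<odot>\<^bsub>msec R U\<^esub> s) (id f) = a \<odot>\<^bsub>msec N U\<^esub> \<mu> U s f"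
        if "s \<in> carrier (msec R U)" "f \<in> carrier (msec F U)" for s f
        unfolding id_apply by (rule \<mu>_smult_left[OF U a that])
      show "a \<odot>\<^bsub>T U\<^esub> x \<in> carrier (T U)" "ev U (a \<odot>\<^bsub>T U\<^esub> x) = a \<odot>\<^bsub>msec N U\<^esub> ev U x"
        unfolding TF.tensor_simps(4) by (rule tm, rule c1, (rule c2 c3; assumption)+)+
    qed
    show "tensor_map (sec \<X> U) (module.smult (msec R U)) (msec R U) (msec F U) (gact R g U) (\<lambda>s. s) x \<in> carrier (T U)"
      "ev U (tensor_map (sec \<X> U) (module.smult (msec R U)) (msec R U) (msec F U) (gact R g U) (\<lambda>s. s) x) = gact N g U (ev U x)"
      if g: "g \<in> carrier G" for g
    proof -
      have "gact R g U \<in> add_homs (msec R U) (msec R U)" "gact N g U \<in> add_homs (msec N U) (msec N U)"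
        using R.gact_simps[OF g U] N.gact_simps[OF g U] by (auto intro!: add_homsI simp del: part_simps)
      note tm = ev_tensor_map[OF U U this(1) _ _ this(2) _ x, of "\<lambda>s. s"]
      have c1: "(\<lambda>s. s) \<in> add_homs (msec F U) (msec F U)" by (simp add: add_homs_def)
      have c2: "\<exists>a'\<in>carrier (sec \<X> U). gact R g U (c \<odot>\<^bsub>msec R U\<^esub> y) = a' \<odot>\<^bsub>msec R U\<^esub> gact R g U y \<and>
          c \<odot>\<^bsub>msec F U\<^esub> f = a' \<odot>\<^bsub>msec F U\<^esub> f" if "c \<in> carrier (sec \<X> U)" "y \<in> carrier (msec R U)" for c y f
        by (rule bexI[of _ c]) (use that R.gact_simps(3)[OF g U] in auto)
      have c3: "\<mu> U (gact R g U s) f = gact N g U (\<mu> U s f)"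
        if "s \<in> carrier (msec R U)" "f \<in> carrier (msec F U)" for s f
        using \<mu>_gact[OF U g that] by simp
      show "tensor_map (sec \<X> U) (module.smult (msec R U)) (msec R U) (msec F U) (gact R g U) (\<lambda>s. s) x \<in> carrier (T U)"
        "ev U (tensor_map (sec \<X> U) (module.smult (msec R U)) (msec R U) (msec F U) (gact R g U) (\<lambda>s. s) x) = gact N g U (ev U x)"
        by (rule tm, rule c1, (rule c2 c3; assumption)+)+
    qed
    show "tensor_map (sec \<X> W) (module.smult (msec R W)) (msec R W) (msec F W) (mres R U W) (mres F U W) x \<in> carrier (T W)"
      "ev W (tensor_map (sec \<X> W) (module.smult (msec R W)) (msec R W) (msec F W) (mres R U W) (mres F U W) x) = mres N U W (ev U x)"
      if W: "opn W" "W \<subseteq> U" for W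
    proof -
      note r = R.mres_simps[OF U W] and rF = F.mres_simps[OF U W] and rN = N.mres_simps[OF U W]
      have ad: "mres R U W \<in> add_homs (msec R U) (msec R W)" "mres F U W \<in> add_homs (msec F U) (msec F W)"
        "mres N U W \<in> add_homs (msec N U) (msec N W)"
        using r rF rN by (auto intro!: add_homsI simp del: part_simps mult_sheaf_simps)
      \<comment> \<open>For restriction the common scalar is the restricted one.\<close>
      have bal: "\<exists>a'\<in>carrier (sec \<X> W). mres R U W (a \<odot>\<^bsub>msec R U\<^esub> x) = a' \<odot>\<^bsub>msec R W\<^esub> mres R U W x \<and>
          mres F U W (a \<odot>\<^bsub>msec F U\<^esub> y) = a' \<odot>\<^bsub>msec F W\<^esub> mres F U W y"
        if "a \<in> carrier (sec \<X> U)" "x \<in> carrier (msec R U)" "y \<in> carrier (msec F U)" for a x y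
        by (rule bexI[of _ "res \<X> U W a"]) (use r(3)[OF that(1,2)] rF(3)[OF that(1,3)] res_simps(1)[OF U W that(1)] in blast)+
      have cm: "\<mu> W (mres R U W s) (mres F U W f) = mres N U W (\<mu> U s f)"
        if "s \<in> carrier (msec R U)" "f \<in> carrier (msec F U)" for s f
        using \<mu>_res[OF U W that] by (simp del: mult_sheaf_simps)
      show "tensor_map (sec \<X> W) (module.smult (msec R W)) (msec R W) (msec F W) (mres R U W) (mres F U W) x \<in> carrier (T W)"
        "ev W (tensor_map (sec \<X> W) (module.smult (msec R W)) (msec R W) (msec F W) (mres R U W) (mres F U W) x) = mres N U W (ev U x)"
        by (rule ev_tensor_map[OF U W(1) ad(1,2) _ ad(3) _ x], (rule bal cm; assumption)+)+
    qed
  qed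
  from sheafify_iso_of_iso[OF this N.omodule N.gact_hom] show ?thesis
    by (simp add: tensor_gmod_def)
qed

end

section \<open>Bases, dimensions, and coordinates on the multiplicity representation\<close>

section \<open>Dimensions\<close>

text \<open>The basis vectors are the preimages of the unit vectors.\<close>

lemma dual_basis_of_coords:
  assumes M: "module R M" and J: "finite J" and \<phi>: "\<phi> \<in> module_homs R M (free_module R J)"
    and bij: "bij_betw \<phi> (carrier M) (carrier (free_module R J))"
  shows "\<exists>w. dual_basis R M J w (\<lambda>j x. \<phi> x j)"
proof -
  interpret M: module R M by (rule M)
  note p = module_homsD[OF \<phi>]
  have pc: "\<phi> x j \<in> carrier R" if "x \<in> carrier M" "j \<in> J" for x j using p(1)[OF that(1)] that(2) by auto
  have "\<exists>x\<in>carrier M. \<phi> x = (\<lambda>l\<in>J. if l = j then \<one>\<^bsub>R\<^esub> else \<zero>\<^bsub>R\<^esub>)" for j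
  proof -
    have "(\<lambda>l\<in>J. if l = j then \<one>\<^bsub>R\<^esub> else \<zero>\<^bsub>R\<^esub>) \<in> carrier (free_module R J)" by auto
    then obtain x where "(\<lambda>l\<in>J. if l = j then \<one>\<^bsub>R\<^esub> else \<zero>\<^bsub>R\<^esub>) = \<phi> x" "x \<in> carrier M"
      unfolding bij_betw_imp_surj_on[OF bij, symmetric] by (rule imageE)
    then show ?thesis by (intro bexI[of _ x]) (rule sym)
  qed
  then obtain w where w: "\<And>j. w j \<in> carrier M" "\<And>j. \<phi> (w j) = (\<lambda>l\<in>J. if l = j then \<one>\<^bsub>R\<^esub> else \<zero>\<^bsub>R\<^esub>)" by metis
  have expand: "x = (\<Oplus>\<^bsub>M\<^esub>j\<in>J. \<phi> x j \<odot>\<^bsub>M\<^esub> w j)" if x: "x \<in> carrier M" for x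
  proof (rule inj_onD[OF bij_betw_imp_inj_on[OF bij] _ x])
    have t: "(\<lambda>j. \<phi> x j \<odot>\<^bsub>M\<^esub> w j) \<in> J \<rightarrow> carrier M" using pc[OF x] w(1) by auto
    then show S: "(\<Oplus>\<^bsub>M\<^esub>j\<in>J. \<phi> x j \<odot>\<^bsub>M\<^esub> w j) \<in> carrier M" by (rule M.M.finsum_closed)
    have "\<phi> x i = \<phi> (\<Oplus>\<^bsub>M\<^esub>j\<in>J. \<phi> x j \<odot>\<^bsub>M\<^esub> w j) i" if i: "i \<in> J" for i
    proof -
      have "\<phi> (\<Oplus>\<^bsub>M\<^esub>j\<in>J. \<phi> x j \<odot>\<^bsub>M\<^esub> w j) i = (\<Oplus>\<^bsub>R\<^esub>j\<in>J. \<phi> (\<phi> x j \<odot>\<^bsub>M\<^esub> w j) i)"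
        by (rule hom_finsum_additive(2)[OF M.M.abelian_group_axioms M.R.abelian_group_axioms, of "\<lambda>y. \<phi> y i"])
          (use t pc i p(2) in auto)
      also have "\<dots> = (\<Oplus>\<^bsub>R\<^esub>j\<in>J. if j = i then \<phi> x i else \<zero>\<^bsub>R\<^esub>)"
        by (rule M.R.finsum_cong') (use p(3)[OF pc[OF x] w(1)] w(2) pc[OF x] i in auto)
      also have "\<dots> = \<phi> x i" by (rule M.R.finsum_delta) (use J i pc[OF x] in auto)
      finally show ?thesis by simp
    qed
    then show "\<phi> x = \<phi> (\<Oplus>\<^bsub>M\<^esub>j\<in>J. \<phi> x j \<odot>\<^bsub>M\<^esub> w j)"
      by (rule PiE_ext[of _ J "\<lambda>_. carrier R", rotated 2]) (use p(1)[OF x] p(1)[OF S] in auto)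
  qed
  have h: "(\<lambda>x. \<phi> x j) \<in> module_homs R M (ring_module R)" if j: "j \<in> J" for j
    by (rule module_homsI) (use pc p(2,3) j in auto)
  show ?thesis
    unfolding dual_basis_def using J w expand h by (intro exI[of _ w]) auto
qed

text \<open>\<open>has_dim\<close> speaks of a set of vectors. As one differs from zero, the vectors
  of the family are distinct, and their set has \<open>card J\<close> elements.\<close>

lemma dual_basis_has_dim:
  assumes db: "dual_basis R M J w \<gamma>" and M: "module R M" and one: "\<one>\<^bsub>R\<^esub> \<noteq> \<zero>\<^bsub>R\<^esub>"
  shows "has_dim R M (card J)"
proof -
  interpret M: module R M by (rule M)
  note d = dual_basisD[OF db]
  have inj: "inj_on w J"
  proof (rule inj_onI)
    fix a b assume ab: "a \<in> J" "b \<in> J" "w a = w b"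
    then show "a = b" using d(5)[OF ab(1,1)] d(5)[OF ab(1,2)] one by (auto split: if_splits)
  qed
  have sum: "(\<Oplus>\<^bsub>M\<^esub>v\<in>w ` J. c v \<odot>\<^bsub>M\<^esub> v) = (\<Oplus>\<^bsub>M\<^esub>j\<in>J. c (w j) \<odot>\<^bsub>M\<^esub> w j)" if "c \<in> w ` J \<rightarrow> carrier R" for c
    using inj that d(4) by (subst M.M.finsum_reindex) auto
  show ?thesis
    unfolding has_dim_def
  proof (intro exI[of _ "w ` J"] conjI ballI)
    show "w ` J \<subseteq> carrier M" "finite (w ` J)" "card (w ` J) = card J"
      using d(1,4) card_image[OF inj] by auto
    fix x assume x: "x \<in> carrier M"
    show "\<exists>!c. c \<in> w ` J \<rightarrow>\<^sub>E carrier R \<and> x = (\<Oplus>\<^bsub>M\<^esub>b\<in>w ` J. c b \<odot>\<^bsub>M\<^esub> b)"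
    proof (rule ex1I[of _ "\<lambda>v\<in>w ` J. \<gamma> (the_inv_into J w v) x"])
      have c: "(\<lambda>v\<in>w ` J. \<gamma> (the_inv_into J w v) x) \<in> w ` J \<rightarrow>\<^sub>E carrier R"
        using the_inv_into_f_f[OF inj] d(6)[OF _ x] by auto
      have "(\<Oplus>\<^bsub>M\<^esub>b\<in>w ` J. (\<lambda>v\<in>w ` J. \<gamma> (the_inv_into J w v) x) b \<odot>\<^bsub>M\<^esub> b)
          = (\<Oplus>\<^bsub>M\<^esub>j\<in>J. (\<lambda>v\<in>w ` J. \<gamma> (the_inv_into J w v) x) (w j) \<odot>\<^bsub>M\<^esub> w j)"
        by (rule sum) (use c in auto)
      also have "\<dots> = (\<Oplus>\<^bsub>M\<^esub>j\<in>J. \<gamma> j x \<odot>\<^bsub>M\<^esub> w j)"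
        by (rule M.M.finsum_cong') (use the_inv_into_f_f[OF inj] d(4) d(6)[OF _ x] in auto)
      also have "\<dots> = x" by (rule dual_basis_expand[OF db x, symmetric])
      finally have "x = (\<Oplus>\<^bsub>M\<^esub>b\<in>w ` J. (\<lambda>v\<in>w ` J. \<gamma> (the_inv_into J w v) x) b \<odot>\<^bsub>M\<^esub> b)" ..
      with c show "(\<lambda>v\<in>w ` J. \<gamma> (the_inv_into J w v) x) \<in> w ` J \<rightarrow>\<^sub>E carrier R \<and>
          x = (\<Oplus>\<^bsub>M\<^esub>b\<in>w ` J. (\<lambda>v\<in>w ` J. \<gamma> (the_inv_into J w v) x) b \<odot>\<^bsub>M\<^esub> b)" by (rule conjI)
      fix c assume c': "c \<in> w ` J \<rightarrow>\<^sub>E carrier R \<and> x = (\<Oplus>\<^bsub>M\<^esub>b\<in>w ` J. c b \<odot>\<^bsub>M\<^esub> b)"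
      then have cJ: "\<And>j. j \<in> J \<Longrightarrow> c (w j) \<in> carrier R" by auto
      have "\<gamma> i x = c (w i)" if i: "i \<in> J" for i
      proof -
        have "c \<in> w ` J \<rightarrow> carrier R" using cJ by auto
        then have "\<gamma> i x = \<gamma> i (\<Oplus>\<^bsub>M\<^esub>j\<in>J. c (w j) \<odot>\<^bsub>M\<^esub> w j)"
          using conjunct2[OF c'] sum[of c] by simp
        also have "\<dots> = (\<Oplus>\<^bsub>R\<^esub>j\<in>J. \<gamma> i (c (w j) \<odot>\<^bsub>M\<^esub> w j))"
          by (rule dual_basis_coord_finsum[OF db M i]) (use cJ d(4) in auto)
        also have "\<dots> = (\<Oplus>\<^bsub>R\<^esub>j\<in>J. if j = i then c (w i) else \<zero>\<^bsub>R\<^esub>)"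
          by (rule M.R.finsum_cong') (use cJ d(4,5,8) i in auto)
        also have "\<dots> = c (w i)" by (rule M.R.finsum_delta) (use d(1) i cJ in auto)
        finally show ?thesis .
      qed
      then show "c = (\<lambda>v\<in>w ` J. \<gamma> (the_inv_into J w v) x)"
        using conjunct1[OF c'] the_inv_into_f_f[OF inj] by (intro PiE_ext[OF _ c]) auto
    qed
  qed
qed

lemma dsum_rep_simps [simp]:
  "carrier (dsum_rep I V) = (\<Pi>\<^sub>E i\<in>I. carrier (V i))"
  "\<zero>\<^bsub>dsum_rep I V\<^esub> = (\<lambda>i\<in>I. \<zero>\<^bsub>V i\<^esub>)"
  "x \<oplus>\<^bsub>dsum_rep I V\<^esub> y = (\<lambda>i\<in>I. x i \<oplus>\<^bsub>V i\<^esub> y i)"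
  "a \<odot>\<^bsub>dsum_rep I V\<^esub> x = (\<lambda>i\<in>I. a \<odot>\<^bsub>V i\<^esub> x i)"
  "ract (dsum_rep I V) g x = (\<lambda>i\<in>I. ract (V i) g (x i))"
  by (simp_all add: dsum_rep_def dsum_module_def module.defs rep.defs)

lemma module_dsum_rep:
  assumes "cring R" and M: "\<And>i. i \<in> I \<Longrightarrow> module R (V i)"
  shows "module R (dsum_rep I V)"
  by (rule module_pullback[OF module_dsum_module[OF assms], where f = "\<lambda>x. x"])
    (use M in \<open>auto simp: dsum_module_def dsum_rep_def module.defs rep.defs
      intro!: abelian_groupE(1)[OF module.axioms(2)[OF M]] abelian_groupE(2)[OF module.axioms(2)[OF M]] module.smult_closed[OF M]\<close>)

context irr_system
begin

text \<open>An index \<open>((i, j), b)\<close> stands for the basis vector of index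
  \<open>b\<close> in the \<open>j\<close>-th copy of \<open>V i\<close>.\<close>

definition mult_index :: "(nat \<Rightarrow> nat) \<Rightarrow> ((nat \<times> nat) \<times> 'i) set" where
  "mult_index n = (SIGMA p:(SIGMA i:{..r}. {..<n i}). J (fst p))"

definition mult_coord :: "(nat \<times> nat) \<times> 'i \<Rightarrow> (nat \<times> nat \<Rightarrow> 'v) \<Rightarrow> 'k" where
  "mult_coord l x = \<gamma> (fst (fst l)) (snd l) (x (fst l))"

lemma finite_mult_index: "finite (mult_index n)"
  unfolding mult_index_def using dual_basisD(1)[OF db] by (intro finite_SigmaI) auto

lemma module_multiplicity_rep: "module k (multiplicity_rep r V n)"
  unfolding multiplicity_rep_def
  by (rule module_dsum_rep[OF k.is_cring]) (use representationD(1)[OF representation_V] in auto)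

lemma multiplicity_rep_component:
  assumes "x \<in> carrier (multiplicity_rep r V n)" "i \<le> r" "j < n i"
  shows "x (i, j) \<in> carrier (V i)"
  using assms PiE_mem[of x "SIGMA i:{..r}. {..<n i}" "\<lambda>p. carrier (case p of (i, j) \<Rightarrow> V i)" "(i, j)"]
  by (simp add: multiplicity_rep_def)

lemma mult_coord_hom:
  assumes l: "l \<in> mult_index n"
  shows "mult_coord l \<in> module_homs k (multiplicity_rep r V n) (ring_module k)"
proof -
  obtain i j b where lij: "l = ((i, j), b)" by (metis surj_pair)
  have ij: "i \<le> r" "j < n i" "b \<in> J i" using l lij by (auto simp: mult_index_def)
  note d = dual_basisD[OF db[OF ij(1)] ]
  have c: "x (i, j) \<in> carrier (V i)" if "x \<in> carrier (multiplicity_rep r V n)" for x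
    by (rule multiplicity_rep_component[OF that ij(1,2)])
  have ops: "(x \<oplus>\<^bsub>multiplicity_rep r V n\<^esub> y) (i, j) = x (i, j) \<oplus>\<^bsub>V i\<^esub> y (i, j)"
    "(a \<odot>\<^bsub>multiplicity_rep r V n\<^esub> x) (i, j) = a \<odot>\<^bsub>V i\<^esub> x (i, j)" for x y a
    using ij by (simp_all add: multiplicity_rep_def)
  show ?thesis
    by (rule module_homsI) (use c d(6-8)[OF ij(3)] in \<open>simp_all add: mult_coord_def lij ops\<close>)
qed

lemma multiplicity_rep_dual_basis: "\<exists>w'. dual_basis k (multiplicity_rep r V n) (mult_index n) w' mult_coord"
proof -
  let ?W = "multiplicity_rep r V n" and ?I = "SIGMA i:{..r}. {..<n i}"
  let ?\<phi> = "\<lambda>x. \<lambda>l\<in>mult_index n. mult_coord l x"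
  note d = dual_basisD[OF db]
  have idx: "i \<le> r" "j < n i" "b \<in> J i" if "((i, j), b) \<in> mult_index n" for i j b
    using that by (auto simp: mult_index_def)
  have "?\<phi> \<in> module_homs k ?W (free_module k (mult_index n))"
  proof (rule module_homsI)
    note m = module_homsD[OF mult_coord_hom, unfolded ring_module_simps]
    fix x assume x: "x \<in> carrier ?W"
    show "?\<phi> x \<in> carrier (free_module k (mult_index n))"
      unfolding dsum_module_simps ring_module_simps using m(1)[OF _ x] by (rule restrict_PiE_iff[THEN iffD2, OF ballI])
    show "?\<phi> (x \<oplus>\<^bsub>?W\<^esub> y) = ?\<phi> x \<oplus>\<^bsub>free_module k (mult_index n)\<^esub> ?\<phi> y" if y: "y \<in> carrier ?W" for y
      unfolding dsum_module_simps ring_module_simps by (rule restrict_ext) (simp only: m(2)[OF _ x y] restrict_apply')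
    show "?\<phi> (a \<odot>\<^bsub>?W\<^esub> x) = a \<odot>\<^bsub>free_module k (mult_index n)\<^esub> ?\<phi> x" if a: "a \<in> carrier k" for a
      unfolding dsum_module_simps ring_module_simps by (rule restrict_ext) (simp only: m(3)[OF _ a x] restrict_apply')
  qed
  moreover have "bij_betw ?\<phi> (carrier ?W) (carrier (free_module k (mult_index n)))"
    unfolding bij_betw_def
  proof (intro conjI equalityI subsetI)
    show "inj_on ?\<phi> (carrier ?W)"
    proof (rule inj_onI)
      fix x y assume x: "x \<in> carrier ?W" and y: "y \<in> carrier ?W" and eq: "?\<phi> x = ?\<phi> y"
      show "x = y"
      proof (rule PiE_ext[of x ?I "\<lambda>(i, j). carrier (V i)"])
        show "x \<in> (\<Pi>\<^sub>E (i, j)\<in>?I. carrier (V i))" "y \<in> (\<Pi>\<^sub>E (i, j)\<in>?I. carrier (V i))"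
          using x y by (auto simp: multiplicity_rep_def PiE_iff split_beta)
        fix p assume "p \<in> ?I"
        then obtain i j where p: "p = (i, j)" "i \<le> r" "j < n i" by auto
        have "\<gamma> i b (x p) = \<gamma> i b (y p)" if "b \<in> J i" for b
          using fun_cong[OF eq, of "((i, j), b)"] p that by (simp add: mult_index_def mult_coord_def)
        then show "x p = y p"
          using dual_basis_eqI[OF db[OF p(2)] representationD(1)[OF representation_V[OF p(2)]]]
            multiplicity_rep_component[OF x p(2,3)] multiplicity_rep_component[OF y p(2,3)] p(1) by blast
      qed
    qed
    show "z \<in> carrier (free_module k (mult_index n))" if "z \<in> ?\<phi> ` carrier ?W" for z
      using that module_homsD(1)[OF calculation] by blast
    fix z assume z: "z \<in> carrier (free_module k (mult_index n))"
    \<comment> \<open>In each copy, the vector with the prescribed coordinates.\<close>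
    define x where "x = (\<lambda>p\<in>?I. \<Oplus>\<^bsub>V (fst p)\<^esub>b\<in>J (fst p). z (p, b) \<odot>\<^bsub>V (fst p)\<^esub> w (fst p) b)"
    have zc: "z ((i, j), b) \<in> carrier k" if "i \<le> r" "j < n i" "b \<in> J i" for i j b
      using z that by (auto simp: mult_index_def PiE_iff)
    have t: "(\<lambda>b. z ((i, j), b) \<odot>\<^bsub>V i\<^esub> w i b) \<in> J i \<rightarrow> carrier (V i)" if "i \<le> r" "j < n i" for i j
      using zc[OF that] d(4)[OF that(1)] module.smult_closed[OF representationD(1)[OF representation_V[OF that(1)]]] by auto
    have "x \<in> carrier ?W"
      using abelian_monoid.finsum_closed[OF abelian_group.axioms(1)[OF module.axioms(2)[OF representationD(1)[OF representation_V]]] t]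
      by (auto simp: x_def multiplicity_rep_def)
    moreover have "z = ?\<phi> x"
    proof (rule PiE_ext[of z "mult_index n" "\<lambda>_. carrier k"])
      show "?\<phi> x \<in> mult_index n \<rightarrow>\<^sub>E carrier k"
        using module_homsD(1)[OF mult_coord_hom calculation] by auto
      fix l assume l: "l \<in> mult_index n"
      obtain i j b where lij: "l = ((i, j), b)" by (metis surj_pair)
      note ij = idx[OF l[unfolded lij]]
      have "?\<phi> x l = \<gamma> i b (\<Oplus>\<^bsub>V i\<^esub>c\<in>J i. z ((i, j), c) \<odot>\<^bsub>V i\<^esub> w i c)"
        using l lij ij by (simp add: mult_coord_def x_def)
      also have "\<dots> = (\<Oplus>\<^bsub>k\<^esub>c\<in>J i. \<gamma> i b (z ((i, j), c) \<odot>\<^bsub>V i\<^esub> w i c))"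
        by (rule dual_basis_coord_finsum[OF db[OF ij(1)] representationD(1)[OF representation_V[OF ij(1)]] ij(3) t[OF ij(1,2)]])
      also have "\<dots> = (\<Oplus>\<^bsub>k\<^esub>c\<in>J i. if c = b then z l else \<zero>\<^bsub>k\<^esub>)"
        by (rule k.finsum_cong') (use d(4,5,8)[OF ij(1)] ij zc lij in auto)
      also have "\<dots> = z l" by (rule k.finsum_delta) (use d(1)[OF ij(1)] ij zc lij in auto)
      finally show "z l = ?\<phi> x l" ..
    qed (use z in simp)
    ultimately show "z \<in> ?\<phi> ` carrier ?W" by blast
  qed
  ultimately obtain w' where w': "dual_basis k ?W (mult_index n) w' (\<lambda>l x. ?\<phi> x l)"
    using dual_basis_of_coords[OF module_multiplicity_rep finite_mult_index] by blast
  interpret W: module k ?W by (rule module_multiplicity_rep)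
  note e = dual_basisD[OF w']
  \<comment> \<open>The functionals obtained contain a restriction to the index set, which is
    removed here.\<close>
  have "(\<Oplus>\<^bsub>?W\<^esub>l\<in>mult_index n. ?\<phi> x l \<odot>\<^bsub>?W\<^esub> w' l) = (\<Oplus>\<^bsub>?W\<^esub>l\<in>mult_index n. mult_coord l x \<odot>\<^bsub>?W\<^esub> w' l)"
    if x: "x \<in> carrier ?W" for x
  proof (rule W.M.finsum_cong')
    show "(\<lambda>l. mult_coord l x \<odot>\<^bsub>?W\<^esub> w' l) \<in> mult_index n \<rightarrow> carrier ?W"
      using W.smult_closed[OF module_homsD(1)[OF mult_coord_hom x, unfolded ring_module_simps] e(4)] by (rule funcsetI)
  qed simp_all
  then have "x = (\<Oplus>\<^bsub>?W\<^esub>l\<in>mult_index n. mult_coord l x \<odot>\<^bsub>?W\<^esub> w' l)" if "x \<in> carrier ?W" for x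
    using dual_basis_expand[OF w' that] that by simp
  then have "dual_basis k ?W (mult_index n) w' mult_coord"
    unfolding dual_basis_def using e(1,2) mult_coord_hom e(5) by simp
  then show ?thesis by blast
qed

lemma ract_multiplicity_rep:
  assumes g: "g \<in> carrier G"
  shows "ract (multiplicity_rep r V n) g \<in> module_homs k (multiplicity_rep r V n) (multiplicity_rep r V n)"
proof (rule module_homsI)
  note a = representationD[OF representation_V]
  fix x y c assume x: "x \<in> carrier (multiplicity_rep r V n)"
  note xc = multiplicity_rep_component[OF x]
  show "ract (multiplicity_rep r V n) g x \<in> carrier (multiplicity_rep r V n)"
    using xc a(3)[OF _ g] by (auto simp: multiplicity_rep_def)
  show "ract (multiplicity_rep r V n) g (x \<oplus>\<^bsub>multiplicity_rep r V n\<^esub> y)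
    = ract (multiplicity_rep r V n) g x \<oplus>\<^bsub>multiplicity_rep r V n\<^esub> ract (multiplicity_rep r V n) g y"
    if "y \<in> carrier (multiplicity_rep r V n)"
    using xc multiplicity_rep_component[OF that] a(4)[OF _ g] by (auto simp: multiplicity_rep_def intro!: restrict_ext)
  show "ract (multiplicity_rep r V n) g (c \<odot>\<^bsub>multiplicity_rep r V n\<^esub> x) = c \<odot>\<^bsub>multiplicity_rep r V n\<^esub> ract (multiplicity_rep r V n) g x"
    if "c \<in> carrier k"
    using xc a(5)[OF _ g] that by (auto simp: multiplicity_rep_def intro!: restrict_ext)
qed

text \<open>The element acts in each copy separately: on copies of \<open>V i\<close> as the
  projection to the basis vector of index \<open>base i\<close>, on all other copies as zero. It is
  stated in coordinates over \<open>k\<close>, the form that passes to the function field.\<close>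

lemma mult_coord_munit0:
  assumes i: "i \<le> r" and l: "l \<in> mult_index n" and x: "x \<in> carrier (multiplicity_rep r V n)"
  shows "(\<Oplus>\<^bsub>k\<^esub>g\<in>carrier G. munit0 i g \<otimes>\<^bsub>k\<^esub> mult_coord l (ract (multiplicity_rep r V n) g x))
    = (if fst (fst l) = i \<and> snd l = base i then mult_coord l x else \<zero>\<^bsub>k\<^esub>)"
proof -
  obtain i' j b where lij: "l = ((i', j), b)" by (metis surj_pair)
  have ij: "i' \<le> r" "j < n i'" "b \<in> J i'" using l lij by (auto simp: mult_index_def)
  note a = representationD[OF representation_V[OF ij(1)]] and d = dual_basisD[OF db[OF ij(1)]]
  note y = multiplicity_rep_component[OF x ij(1,2)]
  interpret V': module k "V i'" by (rule a(1))
  have m: "munit0 i g \<in> carrier k" if "g \<in> carrier G" for g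
    by (rule munit_closed'[OF i base[OF i] dual_basisD(4)[OF db[OF i] base[OF i]] that])
  note wb = dual_basisD(4)[OF db[OF i] base[OF i]]
  have "\<gamma> i' b (alg_act G (V i') (munit0 i) (x (i', j)))
      = (\<Oplus>\<^bsub>k\<^esub>g\<in>carrier G. \<gamma> i' b (munit0 i g \<odot>\<^bsub>V i'\<^esub> ract (V i') g (x (i', j))))"
    unfolding alg_act_def by (rule dual_basis_coord_finsum[OF db[OF ij(1)] a(1) ij(3)]) (use m a(3)[OF _ y] in auto)
  also have "\<dots> = (\<Oplus>\<^bsub>k\<^esub>g\<in>carrier G. munit0 i g \<otimes>\<^bsub>k\<^esub> mult_coord l (ract (multiplicity_rep r V n) g x))"
    by (rule k.finsum_cong') (use m a(3)[OF _ y] d(6,8)[OF ij(3)] ij lij in \<open>auto simp: mult_coord_def multiplicity_rep_def\<close>)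
  finally have eq: "(\<Oplus>\<^bsub>k\<^esub>g\<in>carrier G. munit0 i g \<otimes>\<^bsub>k\<^esub> mult_coord l (ract (multiplicity_rep r V n) g x))
      = \<gamma> i' b (alg_act G (V i') (munit0 i) (x (i', j)))" ..
  show ?thesis
  proof (cases "i' = i")
    case True
    then show ?thesis
      unfolding eq using munit_act_same[OF i base[OF i] wb, of "x (i', j)"] y d ij base[OF i] lij
      by (auto simp: mult_coord_def)
  next
    case False
    have "\<gamma> i' b \<zero>\<^bsub>V i'\<^esub> = \<zero>\<^bsub>k\<^esub>"
      by (rule additive_zero[OF V'.M.abelian_group_axioms k.abelian_group_axioms]) (use d(6,7)[OF ij(3)] in auto)
    then show ?thesis
      unfolding eq using munit_act_other[OF i ij(1) _ base[OF i] wb y] False lij by auto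
  qed
qed

end

section \<open>Coordinates on the generic stalk and the rank of the multiplicity sheaves\<close>

section \<open>The stalk at the generic point\<close>

text \<open>A maximal ideal is proper, which excludes the zero ring.\<close>

lemma local_ring_one_not_zero:
  assumes "local_ring R"
  shows "cring R" "\<one>\<^bsub>R\<^esub> \<noteq> \<zero>\<^bsub>R\<^esub>"
proof -
  show R: "cring R" using assms by (simp add: local_ring_def)
  interpret cring R by (rule R)
  obtain I where "maximalideal I R" using assms by (auto simp: local_ring_def)
  then interpret I: maximalideal I R .
  show "\<one>\<^bsub>R\<^esub> \<noteq> \<zero>\<^bsub>R\<^esub>"
  proof
    assume "\<one>\<^bsub>R\<^esub> = \<zero>\<^bsub>R\<^esub>"
    then have "I = carrier R" using I.one_imp_carrier I.zero_closed by simp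
    then show False using I.I_notcarr by simp
  qed
qed

context ringed
begin

text \<open>The structure sheaf as a module over itself, so that the computations with germs of
  modules also yield those in the stalk ring.\<close>

definition self_omod :: "('p, 'a, 'a) omod" where
  "self_omod = \<lparr>msec = (\<lambda>U. ring_module (sec \<X> U)), mres = res \<X>\<rparr>"

lemma omod_self_omod: "omod \<X> self_omod"
proof unfold_locales
  show "omodule \<X> self_omod"
    by (rule omoduleI) (simp_all add: self_omod_def O.set_sheaf_axioms module_ring_module cring_sec res_simps)
qed

lemma stalk_ring_simps:
  assumes U: "opn U" "x \<in> U" "a \<in> carrier (sec \<X> U)" "b \<in> carrier (sec \<X> U)"
  shows "rgerm \<X> x U a \<oplus>\<^bsub>stalk_ring \<X> x\<^esub> rgerm \<X> x U b = rgerm \<X> x U (a \<oplus>\<^bsub>sec \<X> U\<^esub> b)"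
    "rgerm \<X> x U a \<otimes>\<^bsub>stalk_ring \<X> x\<^esub> rgerm \<X> x U b = rgerm \<X> x U (a \<otimes>\<^bsub>sec \<X> U\<^esub> b)"
proof -
  interpret M: omod \<X> self_omod by (rule omod_self_omod)
  have "a \<in> carrier (msec self_omod U)" "b \<in> carrier (msec self_omod U)" using U by (simp_all add: self_omod_def)
  then show "rgerm \<X> x U a \<oplus>\<^bsub>stalk_ring \<X> x\<^esub> rgerm \<X> x U b = rgerm \<X> x U (a \<oplus>\<^bsub>sec \<X> U\<^esub> b)"
    "rgerm \<X> x U a \<otimes>\<^bsub>stalk_ring \<X> x\<^esub> rgerm \<X> x U b = rgerm \<X> x U (a \<otimes>\<^bsub>sec \<X> U\<^esub> b)"
    using M.stalk_add[of U x a b] M.stalk_smult[of U x a b] U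
    by (simp_all add: stalk_def stalk_ring_def self_omod_def)
qed

lemma rgerm_closed: "\<lbrakk>opn U; x \<in> U; s \<in> carrier (sec \<X> U)\<rbrakk> \<Longrightarrow> rgerm \<X> x U s \<in> carrier (stalk_ring \<X> x)"
  by (auto simp: stalk_ring_def)

lemma stalk_ring_carrierE:
  assumes "C \<in> carrier (stalk_ring \<X> x)"
  obtains U s where "opn U" "x \<in> U" "s \<in> carrier (sec \<X> U)" "C = rgerm \<X> x U s"
  using assms by (auto simp: stalk_ring_def)

end

locale gmod_type = gmod_system k G r V J w \<gamma> \<X> \<kappa> E
  for k :: "'k ring" and G :: "'g monoid" and r and V :: "nat \<Rightarrow> ('k, 'v, 'g) rep"
    and J :: "nat \<Rightarrow> 'i set" and w and \<gamma> and \<X> :: "('p, 'a) rspace" and \<kappa> and E :: "('p, 'a, 'b, 'g) gmod" +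
  fixes \<epsilon> :: 'p and n :: "nat \<Rightarrow> nat" and i :: nat
  assumes \<epsilon>: "\<epsilon> \<in> points \<X>" and local: "local_ring (stalk_ring \<X> \<epsilon>)"
    and type: "has_type k G \<X> \<kappa> \<epsilon> E (multiplicity_rep r V n)" and i: "i \<le> r"
begin

abbreviation K :: "('p set \<times> 'a) set ring" where
  "K \<equiv> stalk_ring \<X> \<epsilon>"

definition h :: "'k \<Rightarrow> ('p set \<times> 'a) set" where
  "h c = rgerm \<X> \<epsilon> (points \<X>) (\<kappa> c)"

abbreviation W :: "('k, nat \<times> nat \<Rightarrow> 'v, 'g) rep" where
  "W \<equiv> multiplicity_rep r V n"

abbreviation I :: "((nat \<times> nat) \<times> 'i) set" where
  "I \<equiv> mult_index n"

sublocale K: cring K by (rule local_ring_one_not_zero[OF local])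

lemma h_hom: "h \<in> ring_hom k K"
  using stalk_ring_simps[OF opn_points \<epsilon>] rgerm_closed[OF opn_points \<epsilon>] \<kappa>
  by (auto simp: h_def ring_hom_def stalk_ring_def Pi_iff)

definition w' :: "(nat \<times> nat) \<times> 'i \<Rightarrow> nat \<times> nat \<Rightarrow> 'v" where
  "w' = (SOME w'. dual_basis k W I w' mult_coord)"

lemma db': "dual_basis k W I w' mult_coord"
  unfolding w'_def by (rule someI_ex[OF multiplicity_rep_dual_basis])

lemmas d' = dual_basisD[OF db']

sublocale BC: free_base_change k K h W I w' mult_coord
  by (intro free_base_change.intro free_base_change_axioms.intro k.is_cring K.is_cring module_multiplicity_rep h_hom db')

lemma gstalk_simps:
  "carrier (gstalk \<X> E \<epsilon>) = carrier (stalk \<X> E \<epsilon>)"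
  "x \<oplus>\<^bsub>gstalk \<X> E \<epsilon>\<^esub> y = x \<oplus>\<^bsub>stalk \<X> E \<epsilon>\<^esub> y" "a \<odot>\<^bsub>gstalk \<X> E \<epsilon>\<^esub> x = a \<odot>\<^bsub>stalk \<X> E \<epsilon>\<^esub> x"
  by (simp_all add: gstalk_def module.defs rep.defs)

lemma base_change_simps:
  "carrier (base_change k K h W) = carrier BC.BC.T"
  "x \<oplus>\<^bsub>base_change k K h W\<^esub> y = x \<oplus>\<^bsub>BC.BC.T\<^esub> y" "a \<odot>\<^bsub>base_change k K h W\<^esub> x = a \<odot>\<^bsub>BC.BC.T\<^esub> x"
  "ract (base_change k K h W) g = tensor_map k (alg_scale K h) (ring_module K) W id (ract W g)"
  by (simp_all add: base_change_def module.defs rep.defs)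

text \<open>Meant for the isomorphism provided by \<open>has_type\<close> followed by the
  coordinates of the base change. In them a group element acts on the generic stalk by its matrix on
  \<open>W\<close>, whose entries are constants.\<close>

definition is_stalk_coords :: "(('p set \<times> 'b) set \<Rightarrow> (nat \<times> nat) \<times> 'i \<Rightarrow> ('p set \<times> 'a) set) \<Rightarrow> bool" where
  "is_stalk_coords c \<longleftrightarrow> bij_betw c (carrier (stalk \<X> E \<epsilon>)) (I \<rightarrow>\<^sub>E carrier K) \<and>
     (\<forall>x\<in>carrier (stalk \<X> E \<epsilon>). \<forall>y\<in>carrier (stalk \<X> E \<epsilon>). \<forall>l\<in>I. c (x \<oplus>\<^bsub>stalk \<X> E \<epsilon>\<^esub> y) l = c x l \<oplus>\<^bsub>K\<^esub> c y l) \<and>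
     (\<forall>a\<in>carrier K. \<forall>x\<in>carrier (stalk \<X> E \<epsilon>). \<forall>l\<in>I. c (a \<odot>\<^bsub>stalk \<X> E \<epsilon>\<^esub> x) l = a \<otimes>\<^bsub>K\<^esub> c x l) \<and>
     (\<forall>g\<in>carrier G. \<forall>x\<in>carrier (stalk \<X> E \<epsilon>). \<forall>l\<in>I. c (ract (gstalk \<X> E \<epsilon>) g x) l =
        (\<Oplus>\<^bsub>K\<^esub>m\<in>I. h (mult_coord l (ract W g (w' m))) \<otimes>\<^bsub>K\<^esub> c x m))"

lemma exists_stalk_coords: "\<exists>c. is_stalk_coords c"
proof -
  have "rep_isomorphic K G (gstalk \<X> E \<epsilon>) (base_change k K h W)"
    using type by (simp add: has_type_def h_def[abs_def])
  then obtain f where f: "f \<in> module_homs K (gstalk \<X> E \<epsilon>) (base_change k K h W)"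
    and bij: "bij_betw f (carrier (gstalk \<X> E \<epsilon>)) (carrier (base_change k K h W))"
    and ract: "\<forall>g\<in>carrier G. \<forall>v\<in>carrier (gstalk \<X> E \<epsilon>). f (ract (gstalk \<X> E \<epsilon>) g v) = ract (base_change k K h W) g (f v)"
    unfolding rep_isomorphic_def by blast
  note f' = module_homsD[OF f, unfolded gstalk_simps base_change_simps]
    and bij' = bij[unfolded gstalk_simps base_change_simps] and ract' = ract[unfolded gstalk_simps base_change_simps, rule_format]
  have "is_stalk_coords (\<lambda>x. BC.coords (f x))"
    unfolding is_stalk_coords_def
  proof (intro conjI ballI)
    show "bij_betw (\<lambda>x. BC.coords (f x)) (carrier (stalk \<X> E \<epsilon>)) (I \<rightarrow>\<^sub>E carrier K)"
      using bij_betw_trans[OF bij' BC.coords_bij] by (simp add: comp_def)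
    fix x l assume x: "x \<in> carrier (stalk \<X> E \<epsilon>)" and l: "l \<in> I"
    show "BC.coords (f (x \<oplus>\<^bsub>stalk \<X> E \<epsilon>\<^esub> y)) l = BC.coords (f x) l \<oplus>\<^bsub>K\<^esub> BC.coords (f y) l" if y: "y \<in> carrier (stalk \<X> E \<epsilon>)" for y
      using l by (simp add: f'(2)[OF x y] add_homsD(2)[OF BC.coords_add_hom f'(1)[OF x] f'(1)[OF y]])
    show "BC.coords (f (a \<odot>\<^bsub>stalk \<X> E \<epsilon>\<^esub> x)) l = a \<otimes>\<^bsub>K\<^esub> BC.coords (f x) l" if a: "a \<in> carrier K" for a
      using l by (simp add: f'(3)[OF a x] BC.coords_smult(2)[OF a f'(1)[OF x]])
    show "BC.coords (f (ract (gstalk \<X> E \<epsilon>) g x)) l = (\<Oplus>\<^bsub>K\<^esub>m\<in>I. h (mult_coord l (ract W g (w' m))) \<otimes>\<^bsub>K\<^esub> BC.coords (f x) m)"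
      if g: "g \<in> carrier G" for g
      using l by (simp add: ract'[OF g x] BC.coords_ract(2)[OF ract_multiplicity_rep[OF g] f'(1)[OF x]])
  qed
  then show ?thesis by blast
qed

definition c where "c = (SOME c. is_stalk_coords c)"

lemma c_props: "is_stalk_coords c"
  unfolding c_def by (rule someI_ex[OF exists_stalk_coords])

lemma c_bij: "bij_betw c (carrier (stalk \<X> E \<epsilon>)) (I \<rightarrow>\<^sub>E carrier K)"
  and c_add: "\<lbrakk>x \<in> carrier (stalk \<X> E \<epsilon>); y \<in> carrier (stalk \<X> E \<epsilon>); l \<in> I\<rbrakk> \<Longrightarrow> c (x \<oplus>\<^bsub>stalk \<X> E \<epsilon>\<^esub> y) l = c x l \<oplus>\<^bsub>K\<^esub> c y l"
  and c_smult: "\<lbrakk>a \<in> carrier K; x \<in> carrier (stalk \<X> E \<epsilon>); l \<in> I\<rbrakk> \<Longrightarrow> c (a \<odot>\<^bsub>stalk \<X> E \<epsilon>\<^esub> x) l = a \<otimes>\<^bsub>K\<^esub> c x l"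
  and c_ract: "\<lbrakk>g \<in> carrier G; x \<in> carrier (stalk \<X> E \<epsilon>); l \<in> I\<rbrakk> \<Longrightarrow> c (ract (gstalk \<X> E \<epsilon>) g x) l =
        (\<Oplus>\<^bsub>K\<^esub>m\<in>I. h (mult_coord l (ract W g (w' m))) \<otimes>\<^bsub>K\<^esub> c x m)"
  using c_props unfolding is_stalk_coords_def by simp_all

lemma c_mem: "x \<in> carrier (stalk \<X> E \<epsilon>) \<Longrightarrow> c x \<in> I \<rightarrow>\<^sub>E carrier K"
  using bij_betwE[OF c_bij] by blast

lemma c_closed: "\<lbrakk>x \<in> carrier (stalk \<X> E \<epsilon>); l \<in> I\<rbrakk> \<Longrightarrow> c x l \<in> carrier K"
  using c_mem by blast

text \<open>A constant section has the same germ on a neighbourhood as globally.\<close>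

lemma h_germ: "\<lbrakk>opn U; \<epsilon> \<in> U; a \<in> carrier k\<rbrakk> \<Longrightarrow> rgerm \<X> \<epsilon> U (const_sec \<X> \<kappa> U a) = h a"
  unfolding h_def const_sec_def by (rule O.germ_res[OF opn_points _ _ opn_subset ring_hom_closed[OF \<kappa>]])

text \<open>In coordinates the element acts by its matrix on \<open>W\<close>, carried to the
  function field by \<open>h\<close>. By \<open>mult_coord_munit0\<close> this matrix is diagonal
  with entries one and zero, so the element is a projection.\<close>

lemma c_munit0:
  assumes U: "opn U" "\<epsilon> \<in> U" and s: "s \<in> carrier (msec E U)" and l: "l \<in> I"
  shows "c (mgerm \<X> E \<epsilon> U (A U (munit0 i) s)) l =
    (if fst (fst l) = i \<and> snd l = base i then c (mgerm \<X> E \<epsilon> U s) l else \<zero>\<^bsub>K\<^esub>)"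
proof -
  interpret M: module "sec \<X> U" "msec E U" by (rule E.module_msec[OF U(1)])
  let ?a = "munit0 i" and ?m = "\<lambda>g m. mult_coord l (ract W g (w' m))"
  have a: "?a g \<in> carrier k" if "g \<in> carrier G" for g by (rule munit_w_closed[OF i base[OF i] base[OF i] that])
  have m: "?m g m \<in> carrier k" if "g \<in> carrier G" "m \<in> I" for g m
    by (rule d'(6)[OF l module_homsD(1)[OF ract_multiplicity_rep[OF that(1)] d'(4)[OF that(2)]]])
  note gm = E.mgerm_closed[OF U] and C = c_closed[OF E.mgerm_closed[OF U]]
  have t: "const_sec \<X> \<kappa> U (?a g) \<odot>\<^bsub>msec E U\<^esub> gact E g U s \<in> carrier (msec E U)" if "g \<in> carrier G" for g
    using const_sec_simps(1)[OF U(1) a[OF that]] E.gact_simps(1)[OF that U(1) s] by simp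
  have tm: "c (mgerm \<X> E \<epsilon> U (const_sec \<X> \<kappa> U (?a g) \<odot>\<^bsub>msec E U\<^esub> gact E g U s)) l
      = (\<Oplus>\<^bsub>K\<^esub>m\<in>I. h (?a g \<otimes>\<^bsub>k\<^esub> ?m g m) \<otimes>\<^bsub>K\<^esub> c (mgerm \<X> E \<epsilon> U s) m)" if g: "g \<in> carrier G" for g
  proof -
    note cs = const_sec_simps(1)[OF U(1) a[OF g]] and gs = E.gact_simps(1)[OF g U(1) s]
    have "c (mgerm \<X> E \<epsilon> U (const_sec \<X> \<kappa> U (?a g) \<odot>\<^bsub>msec E U\<^esub> gact E g U s)) l = h (?a g) \<otimes>\<^bsub>K\<^esub> c (mgerm \<X> E \<epsilon> U (gact E g U s)) l"
      using c_smult[OF BC.h_simps(1)[OF a[OF g]] gm[OF gs] l] E.stalk_smult[OF U cs gs] h_germ[OF U a[OF g]] by simp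
    also have "\<dots> = h (?a g) \<otimes>\<^bsub>K\<^esub> (\<Oplus>\<^bsub>K\<^esub>m\<in>I. h (?m g m) \<otimes>\<^bsub>K\<^esub> c (mgerm \<X> E \<epsilon> U s) m)"
      using c_ract[OF g gm[OF s] l] E.ract_gstalk[OF g U s] by simp
    also have "\<dots> = (\<Oplus>\<^bsub>K\<^esub>m\<in>I. h (?a g) \<otimes>\<^bsub>K\<^esub> (h (?m g m) \<otimes>\<^bsub>K\<^esub> c (mgerm \<X> E \<epsilon> U s) m))"
      by (rule K.finsum_rdistr) (use d'(1) BC.h_simps(1) a[OF g] m[OF g] C[OF s] in auto)
    also have "\<dots> = (\<Oplus>\<^bsub>K\<^esub>m\<in>I. h (?a g \<otimes>\<^bsub>k\<^esub> ?m g m) \<otimes>\<^bsub>K\<^esub> c (mgerm \<X> E \<epsilon> U s) m)"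
      by (rule K.finsum_cong') (use BC.h_simps(1,3) a[OF g] m[OF g] C[OF s] in \<open>auto simp: K.m_assoc\<close>)
    finally show ?thesis .
  qed
  have "c (mgerm \<X> E \<epsilon> U (A U ?a s)) l = (\<Oplus>\<^bsub>K\<^esub>g\<in>carrier G. c (mgerm \<X> E \<epsilon> U (const_sec \<X> \<kappa> U (?a g) \<odot>\<^bsub>msec E U\<^esub> gact E g U s)) l)"
    unfolding galg_act_def
    by (rule hom_finsum_additive(2)[OF M.M.abelian_group_axioms K.is_abelian_group, of "\<lambda>x. c (mgerm \<X> E \<epsilon> U x) l"])
      (use C[OF _ l] c_add[OF gm gm l] E.stalk_add[OF U] t in auto)
  also have "\<dots> = (\<Oplus>\<^bsub>K\<^esub>g\<in>carrier G. \<Oplus>\<^bsub>K\<^esub>m\<in>I. h (?a g \<otimes>\<^bsub>k\<^esub> ?m g m) \<otimes>\<^bsub>K\<^esub> c (mgerm \<X> E \<epsilon> U s) m)"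
    by (rule K.finsum_cong') (use tm a m C[OF s] BC.h_simps(1) in \<open>auto intro!: K.finsum_closed\<close>)
  also have "\<dots> = (\<Oplus>\<^bsub>K\<^esub>m\<in>I. \<Oplus>\<^bsub>K\<^esub>g\<in>carrier G. h (?a g \<otimes>\<^bsub>k\<^esub> ?m g m) \<otimes>\<^bsub>K\<^esub> c (mgerm \<X> E \<epsilon> U s) m)"
    by (rule K.finsum_swap) (use fin d'(1) a m C[OF s] BC.h_simps(1) in auto)
  also have "\<dots> = (\<Oplus>\<^bsub>K\<^esub>m\<in>I. if m = l then (if fst (fst l) = i \<and> snd l = base i then c (mgerm \<X> E \<epsilon> U s) l else \<zero>\<^bsub>K\<^esub>) else \<zero>\<^bsub>K\<^esub>)"
  proof (rule K.finsum_cong')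
    \<comment> \<open>The sum over the group is the image under \<open>h\<close> of the matrix entry
      with row \<open>l\<close> and column \<open>m\<close>.\<close>
    fix m assume mI: "m \<in> I"
    have "(\<Oplus>\<^bsub>K\<^esub>g\<in>carrier G. h (?a g \<otimes>\<^bsub>k\<^esub> ?m g m) \<otimes>\<^bsub>K\<^esub> c (mgerm \<X> E \<epsilon> U s) m)
      = (\<Oplus>\<^bsub>K\<^esub>g\<in>carrier G. h (?a g \<otimes>\<^bsub>k\<^esub> ?m g m)) \<otimes>\<^bsub>K\<^esub> c (mgerm \<X> E \<epsilon> U s) m"
      by (rule K.finsum_ldistr[symmetric]) (use fin a m mI C[OF s] BC.h_simps(1) in auto)
    also have "(\<Oplus>\<^bsub>K\<^esub>g\<in>carrier G. h (?a g \<otimes>\<^bsub>k\<^esub> ?m g m)) = h (\<Oplus>\<^bsub>k\<^esub>g\<in>carrier G. ?a g \<otimes>\<^bsub>k\<^esub> ?m g m)"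
      by (rule hom_finsum_additive(2)[OF k.is_abelian_group K.is_abelian_group, symmetric]) (use BC.h_simps a m mI in auto)
    also have "\<dots> = h (if fst (fst l) = i \<and> snd l = base i then mult_coord l (w' m) else \<zero>\<^bsub>k\<^esub>)"
      unfolding mult_coord_munit0[OF i l d'(4)[OF mI]] ..
    finally show "(\<Oplus>\<^bsub>K\<^esub>g\<in>carrier G. h (?a g \<otimes>\<^bsub>k\<^esub> ?m g m) \<otimes>\<^bsub>K\<^esub> c (mgerm \<X> E \<epsilon> U s) m)
      = (if m = l then (if fst (fst l) = i \<and> snd l = base i then c (mgerm \<X> E \<epsilon> U s) l else \<zero>\<^bsub>K\<^esub>) else \<zero>\<^bsub>K\<^esub>)"
      using d'(5)[OF l mI] BC.h_simps(4,5) C[OF s mI] by auto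
  qed (use C[OF s] l in auto)
  also have "\<dots> = (if fst (fst l) = i \<and> snd l = base i then c (mgerm \<X> E \<epsilon> U s) l else \<zero>\<^bsub>K\<^esub>)"
    by (rule K.finsum_delta) (use d'(1) l C[OF s] in auto)
  finally show ?thesis .
qed

abbreviation F :: "('p, 'a, 'v \<Rightarrow> 'b) omod" where
  "F \<equiv> mult_sheaf i"

sublocale F: omod \<X> F
  by unfold_locales (rule omodule_mult_sheaf[OF i])

text \<open>The map on stalks induced by the inclusion of the multiplicity sheaf into
  \<open>E\<close>.\<close>

definition \<iota> :: "('p set \<times> ('v \<Rightarrow> 'b)) set \<Rightarrow> ('p set \<times> 'b) set" where
  "\<iota> z = (\<Union>(U, f)\<in>z. mgerm \<X> E \<epsilon> U (f undefined))"

text \<open>Restriction acts on constant functions through their values.\<close>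

lemma F_germ_eq_iff:
  assumes U: "opn U" "\<epsilon> \<in> U" "f \<in> carrier (msec F U)" and U': "opn U'" "\<epsilon> \<in> U'" "f' \<in> carrier (msec F U')"
  shows "mgerm \<X> F \<epsilon> U f = mgerm \<X> F \<epsilon> U' f' \<longleftrightarrow> mgerm \<X> E \<epsilon> U (f undefined) = mgerm \<X> E \<epsilon> U' (f' undefined)"
  unfolding F.S.germ_eq_iff[OF U U'] E.S.germ_eq_iff[OF U(1,2) mult_sheaf_secD(1)[OF U(3)] U'(1,2) mult_sheaf_secD(1)[OF U'(3)]]
  by (simp add: fun_eq_iff)

lemma \<iota>_germ:
  assumes "opn U" "\<epsilon> \<in> U" "f \<in> carrier (msec F U)"
  shows "\<iota> (mgerm \<X> F \<epsilon> U f) = mgerm \<X> E \<epsilon> U (f undefined)"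
  unfolding \<iota>_def by (rule F.S.germ_UN1[OF assms]) (use F_germ_eq_iff assms in blast)

lemma \<iota>_closed: "z \<in> carrier (stalk \<X> F \<epsilon>) \<Longrightarrow> \<iota> z \<in> carrier (stalk \<X> E \<epsilon>)"
  by (erule F.stalk_carrierE) (simp add: \<iota>_germ E.mgerm_closed mult_sheaf_secD(1) del: mult_sheaf_simps)

lemma \<iota>_add:
  assumes z: "z \<in> carrier (stalk \<X> F \<epsilon>)" "z' \<in> carrier (stalk \<X> F \<epsilon>)"
  shows "z \<oplus>\<^bsub>stalk \<X> F \<epsilon>\<^esub> z' \<in> carrier (stalk \<X> F \<epsilon>)" "\<iota> (z \<oplus>\<^bsub>stalk \<X> F \<epsilon>\<^esub> z') = \<iota> z \<oplus>\<^bsub>stalk \<X> E \<epsilon>\<^esub> \<iota> z'"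
proof -
  obtain U f where U: "opn U" "\<epsilon> \<in> U" "f \<in> carrier (msec F U)" and zf: "z = mgerm \<X> F \<epsilon> U f"
    by (rule F.stalk_carrierE[OF z(1)])
  obtain U' f' where U': "opn U'" "\<epsilon> \<in> U'" "f' \<in> carrier (msec F U')" and zf': "z' = mgerm \<X> F \<epsilon> U' f'"
    by (rule F.stalk_carrierE[OF z(2)])
  let ?D = "U \<inter> U'"
  have D: "opn ?D" "\<epsilon> \<in> ?D" using opn_Int U U' by auto
  let ?s = "mres F U ?D f \<oplus>\<^bsub>msec F ?D\<^esub> mres F U' ?D f'"
  have s: "?s \<in> carrier (msec F ?D)"
    by (rule F.msec_closed(1)[OF D(1) F.mres_simps(1)[OF U(1) D(1) Int_lower1 U(3)] F.mres_simps(1)[OF U'(1) D(1) Int_lower2 U'(3)]])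
  have eq: "z \<oplus>\<^bsub>stalk \<X> F \<epsilon>\<^esub> z' = mgerm \<X> F \<epsilon> ?D ?s" unfolding zf zf' by (rule F.stalk_add_Int[OF U U'])
  then show "z \<oplus>\<^bsub>stalk \<X> F \<epsilon>\<^esub> z' \<in> carrier (stalk \<X> F \<epsilon>)" using F.mgerm_closed[OF D s] by simp
  show "\<iota> (z \<oplus>\<^bsub>stalk \<X> F \<epsilon>\<^esub> z') = \<iota> z \<oplus>\<^bsub>stalk \<X> E \<epsilon>\<^esub> \<iota> z'"
    unfolding eq \<iota>_germ[OF D s] unfolding zf zf' \<iota>_germ[OF U] \<iota>_germ[OF U']
      E.stalk_add_Int[OF U(1,2) mult_sheaf_secD(1)[OF U(3)] U'(1,2) mult_sheaf_secD(1)[OF U'(3)]]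
    by simp
qed

lemma \<iota>_smult:
  assumes a: "a \<in> carrier K" and z: "z \<in> carrier (stalk \<X> F \<epsilon>)"
  shows "a \<odot>\<^bsub>stalk \<X> F \<epsilon>\<^esub> z \<in> carrier (stalk \<X> F \<epsilon>)" "\<iota> (a \<odot>\<^bsub>stalk \<X> F \<epsilon>\<^esub> z) = a \<odot>\<^bsub>stalk \<X> E \<epsilon>\<^esub> \<iota> z"
proof -
  obtain U t where U: "opn U" "\<epsilon> \<in> U" "t \<in> carrier (sec \<X> U)" and at: "a = rgerm \<X> \<epsilon> U t"
    by (rule stalk_ring_carrierE[OF a])
  obtain U' f' where U': "opn U'" "\<epsilon> \<in> U'" "f' \<in> carrier (msec F U')" and zf': "z = mgerm \<X> F \<epsilon> U' f'"
    by (rule F.stalk_carrierE[OF z])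
  let ?D = "U \<inter> U'"
  have D: "opn ?D" "\<epsilon> \<in> ?D" using opn_Int U U' by auto
  let ?s = "res \<X> U ?D t \<odot>\<^bsub>msec F ?D\<^esub> mres F U' ?D f'"
  have s: "?s \<in> carrier (msec F ?D)"
    by (rule F.msec_closed(2)[OF D(1) res_simps(1)[OF U(1) D(1) Int_lower1 U(3)] F.mres_simps(1)[OF U'(1) D(1) Int_lower2 U'(3)]])
  have eq: "a \<odot>\<^bsub>stalk \<X> F \<epsilon>\<^esub> z = mgerm \<X> F \<epsilon> ?D ?s" unfolding at zf' by (rule F.stalk_smult_Int[OF U U'])
  then show "a \<odot>\<^bsub>stalk \<X> F \<epsilon>\<^esub> z \<in> carrier (stalk \<X> F \<epsilon>)" using F.mgerm_closed[OF D s] by simp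
  show "\<iota> (a \<odot>\<^bsub>stalk \<X> F \<epsilon>\<^esub> z) = a \<odot>\<^bsub>stalk \<X> E \<epsilon>\<^esub> \<iota> z"
    unfolding eq \<iota>_germ[OF D s] unfolding at zf' \<iota>_germ[OF U'] E.stalk_smult_Int[OF U U'(1,2) mult_sheaf_secD(1)[OF U'(3)]]
    by simp
qed

lemma \<iota>_inj: "\<lbrakk>z \<in> carrier (stalk \<X> F \<epsilon>); z' \<in> carrier (stalk \<X> F \<epsilon>); \<iota> z = \<iota> z'\<rbrakk> \<Longrightarrow> z = z'"
  by (erule F.stalk_carrierE, erule F.stalk_carrierE) (simp add: \<iota>_germ F_germ_eq_iff del: mult_sheaf_simps)

text \<open>Sections of the multiplicity sheaf are fixed by the projection, so the coordinates that
  it kills vanish.\<close>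

lemma c_\<iota>_zero:
  assumes z: "z \<in> carrier (stalk \<X> F \<epsilon>)" and l: "l \<in> I" "\<not> (fst (fst l) = i \<and> snd l = base i)"
  shows "c (\<iota> z) l = \<zero>\<^bsub>K\<^esub>"
proof -
  obtain U f where U: "opn U" "\<epsilon> \<in> U" "f \<in> carrier (msec F U)" and zf: "z = mgerm \<X> F \<epsilon> U f"
    by (rule F.stalk_carrierE[OF z(1)])
  show ?thesis
    using c_munit0[OF U(1,2) mult_sheaf_secD(1)[OF U(3)] l(1)] l(2) mult_sheaf_secD(2)[OF U(3)] unfolding zf \<iota>_germ[OF U] by simp
qed

lemma idx: "j < n i \<Longrightarrow> ((i, j), base i) \<in> I"
  using i base[OF i] by (simp add: mult_index_def)

text \<open>The coordinates that survive the projection.\<close>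

definition c0 :: "('p set \<times> ('v \<Rightarrow> 'b)) set \<Rightarrow> nat \<Rightarrow> ('p set \<times> 'a) set" where
  "c0 z = (\<lambda>j\<in>{..<n i}. c (\<iota> z) ((i, j), base i))"

lemma c0_hom:
  assumes z: "z \<in> carrier (stalk \<X> F \<epsilon>)"
  shows "c0 z \<in> {..<n i} \<rightarrow>\<^sub>E carrier K"
    "z' \<in> carrier (stalk \<X> F \<epsilon>) \<Longrightarrow> c0 (z \<oplus>\<^bsub>stalk \<X> F \<epsilon>\<^esub> z') = c0 z \<oplus>\<^bsub>free_module K {..<n i}\<^esub> c0 z'"
    "a \<in> carrier K \<Longrightarrow> c0 (a \<odot>\<^bsub>stalk \<X> F \<epsilon>\<^esub> z) = a \<odot>\<^bsub>free_module K {..<n i}\<^esub> c0 z"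
  using \<iota>_closed[OF z] c_closed[OF \<iota>_closed[OF z] idx] z
  by (auto simp: c0_def \<iota>_add \<iota>_smult c_add c_smult \<iota>_closed idx intro!: restrict_ext)

text \<open>A germ of the multiplicity sheaf is determined by the surviving coordinates, since the
  others vanish. Conversely, a vector is extended by zero and realised by a germ of
  \<open>E\<close>, which is then projected.\<close>

lemma c0_bij: "bij_betw c0 (carrier (stalk \<X> F \<epsilon>)) ({..<n i} \<rightarrow>\<^sub>E carrier K)"
  unfolding bij_betw_def
proof (intro conjI equalityI subsetI)
  show "inj_on c0 (carrier (stalk \<X> F \<epsilon>))"
  proof (rule inj_onI)
    fix z z' assume z: "z \<in> carrier (stalk \<X> F \<epsilon>)" "z' \<in> carrier (stalk \<X> F \<epsilon>)" and eq: "c0 z = c0 z'"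
    have "c (\<iota> z) l = c (\<iota> z') l" if l: "l \<in> I" for l
    proof (cases "fst (fst l) = i \<and> snd l = base i")
      case True
      then obtain j where j: "l = ((i, j), base i)" "j < n i" using l by (auto simp: mult_index_def)
      then show ?thesis using fun_cong[OF eq, of j] by (simp add: c0_def)
    next
      case False
      then show ?thesis using c_\<iota>_zero[OF z(1) l] c_\<iota>_zero[OF z(2) l] by simp
    qed
    then have "c (\<iota> z) = c (\<iota> z')"
      by (rule PiE_ext[OF c_mem[OF \<iota>_closed[OF z(1)]] c_mem[OF \<iota>_closed[OF z(2)]]])
    then show "z = z'"
      by (intro \<iota>_inj[OF z] inj_onD[OF bij_betw_imp_inj_on[OF c_bij]] \<iota>_closed z)
  qed
  show "y \<in> {..<n i} \<rightarrow>\<^sub>E carrier K" if "y \<in> c0 ` carrier (stalk \<X> F \<epsilon>)" for y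
    using that c0_hom(1) by blast
  fix y assume y: "y \<in> {..<n i} \<rightarrow>\<^sub>E carrier K"
  define Y where "Y = (\<lambda>l\<in>I. if fst (fst l) = i \<and> snd l = base i then y (snd (fst l)) else \<zero>\<^bsub>K\<^esub>)"
  have Y: "Y \<in> I \<rightarrow>\<^sub>E carrier K" using y by (auto simp: Y_def mult_index_def PiE_iff)
  then have "Y \<in> c ` carrier (stalk \<X> E \<epsilon>)" unfolding bij_betw_imp_surj_on[OF c_bij] .
  then obtain C where C: "Y = c C" "C \<in> carrier (stalk \<X> E \<epsilon>)" by (rule imageE)
  obtain U s where U: "opn U" "\<epsilon> \<in> U" and s: "s \<in> carrier (msec E U)" and Cs: "C = mgerm \<X> E \<epsilon> U s"
    by (rule E.stalk_carrierE[OF C(2)])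
  \<comment> \<open>Projecting the representative places it in the multiplicity sheaf and keeps the
    prescribed coordinates.\<close>
  let ?x = "A U (munit0 i) s"
  note b = base[OF i]
  have x: "?x \<in> carrier (msec E U)" by (rule A_munit_closed[OF i b b U(1) s])
  have idem: "A U (munit0 i) ?x = ?x"
    using A_munit_munit[OF i b b b dual_basisD(4)[OF db[OF i] b] U(1) s] by simp
  have f: "(\<lambda>_. ?x) \<in> carrier (msec F U)" using x idem by simp
  let ?z = "mgerm \<X> F \<epsilon> U (\<lambda>_. ?x)"
  have z: "?z \<in> carrier (stalk \<X> F \<epsilon>)" by (rule F.mgerm_closed[OF U f])
  have "y = c0 ?z"
  proof (rule PiE_ext[OF y c0_hom(1)[OF z]])
    fix j assume "j \<in> {..<n i}"
    then have j: "j < n i" by simp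
    have "c (\<iota> ?z) ((i, j), base i) = Y ((i, j), base i)"
      unfolding \<iota>_germ[OF U f] using c_munit0[OF U s idx[OF j]] C(1) Cs by simp
    then show "y j = c0 ?z j" using j idx[OF j] by (simp add: c0_def Y_def)
  qed
  then show "y \<in> c0 ` carrier (stalk \<X> F \<epsilon>)" using z by (rule image_eqI)
qed

text \<open>The module structure of the stalk is pulled back along \<open>c0\<close>, whose
  components then form the functionals of a basis with \<open>n i\<close> elements.\<close>

lemma mult_sheaf_rank: "has_rank \<X> \<epsilon> (mult_sheaf i) (n i)"
proof -
  let ?S = "stalk \<X> F \<epsilon>" and ?N = "free_module K {..<n i}"
  have N: "module K ?N" by (rule module_dsum_module[OF K.is_cring module_ring_module[OF K.is_cring]])
  have bij: "bij_betw c0 (carrier ?S) (carrier ?N)" using c0_bij by simp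
  have z: "\<zero>\<^bsub>?S\<^esub> \<in> carrier ?S"
    using F.stalk_zero[OF opn_points \<epsilon>] F.mgerm_closed[OF opn_points \<epsilon> F.msec_closed(3)[OF opn_points]] by simp
  \<comment> \<open>The stalk is not yet known to be a group; the value of \<open>c0\<close> at zero
    is found from zero plus zero being zero.\<close>
  have z0: "c0 \<zero>\<^bsub>?S\<^esub> = \<zero>\<^bsub>?N\<^esub>"
  proof -
    interpret N: module K ?N by (rule N)
    have "\<zero>\<^bsub>?S\<^esub> \<oplus>\<^bsub>?S\<^esub> \<zero>\<^bsub>?S\<^esub> = \<zero>\<^bsub>?S\<^esub>"
      using F.stalk_add[OF opn_points \<epsilon> F.msec_closed(3)[OF opn_points] F.msec_closed(3)[OF opn_points]]
        abelian_groupE(5)[OF F.abelian_msec[OF opn_points] F.msec_closed(3)[OF opn_points]]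
      by (simp add: F.stalk_zero[OF opn_points \<epsilon>] del: mult_sheaf_simps)
    then have "c0 \<zero>\<^bsub>?S\<^esub> \<oplus>\<^bsub>?N\<^esub> c0 \<zero>\<^bsub>?S\<^esub> = c0 \<zero>\<^bsub>?S\<^esub>" using c0_hom(2)[OF z z] by simp
    moreover have "c0 \<zero>\<^bsub>?S\<^esub> \<in> carrier ?N" using c0_hom(1)[OF z] by simp
    ultimately show ?thesis by (metis N.M.add.l_cancel_one N.M.zero_closed)
  qed
  have S: "module K ?S"
    by (rule module_pullback[OF N bij_betw_imp_inj_on[OF bij] bij_betw_imp_surj_on[OF bij] z z0])
      (rule \<iota>_add(1) c0_hom(2) \<iota>_smult(1) c0_hom(3); assumption)+
  have "c0 \<in> module_homs K ?S ?N"
    unfolding module_homs_def dsum_module_simps(1) ring_module_simps using c0_hom by blast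
  from dual_basis_of_coords[OF S _ this bij] obtain v where v: "dual_basis K ?S {..<n i} v (\<lambda>j x. c0 x j)" by blast
  show ?thesis
    using dual_basis_has_dim[OF v S local_ring_one_not_zero(2)[OF local]] by (simp add: has_rank_def)
qed

end

section \<open>Assembling the direct sum decomposition\<close>

section \<open>The isotypical decomposition\<close>

lemma gsheaf_iso_cong:
  assumes iso: "gsheaf_iso \<X> G M N \<theta>"
    and eq: "\<And>U x. \<lbrakk>openin (topo \<X>) U; x \<in> carrier (msec M U)\<rbrakk> \<Longrightarrow> \<theta>' U x = \<theta> U x"
  shows "gsheaf_iso \<X> G M N \<theta>'"
proof -
  note d = gsheaf_isoD[OF iso]
  show ?thesis
  proof (rule gsheaf_isoI)
    fix U assume U: "openin (topo \<X>) U"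
    show "bij_betw (\<theta>' U) (carrier (msec M U)) (carrier (msec N U))"
      using d(1)[OF U] bij_betw_cong[of "carrier (msec M U)" "\<theta>' U" "\<theta> U"] eq[OF U] by blast
  qed (simp_all add: eq d(2-12))
qed

context gmod_system
begin

text \<open>The idempotents of distinct blocks annihilate each other, so only the summand of index
  \<open>i\<close> survives.\<close>

lemma A_isotypical_sum:
  assumes U: "opn U" and i: "i \<le> r" and y: "\<And>j. j \<le> r \<Longrightarrow> y j \<in> carrier (msec (part j) U)"
  shows "A U (isotypical i) (\<Oplus>\<^bsub>msec E U\<^esub>j\<in>{..r}. y j) = y i"
proof -
  interpret M: module "sec \<X> U" "msec E U" by (rule E.module_msec[OF U])
  have yE: "y j \<in> carrier (msec E U)" "A U (isotypical j) (y j) = y j" if "j \<le> r" for j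
    using y[OF that] part_carrier[OF that U] by auto
  have h: "A U (isotypical i) \<in> add_homs (msec E U) (msec E U)"
    by (rule A_add_hom[OF U]) (use isotypical_closed'[OF i] in auto)
  have "A U (isotypical i) (\<Oplus>\<^bsub>msec E U\<^esub>j\<in>{..r}. y j) = (\<Oplus>\<^bsub>msec E U\<^esub>j\<in>{..r}. A U (isotypical i) (y j))"
    by (rule add_homs_finsum[OF M.M.abelian_group_axioms M.M.abelian_group_axioms h]) (use yE in auto)
  also have "\<dots> = (\<Oplus>\<^bsub>msec E U\<^esub>j\<in>{..r}. if j = i then y i else \<zero>\<^bsub>msec E U\<^esub>)"
  proof (rule M.M.finsum_cong')
    fix j assume "j \<in> {..r}"
    then have j: "j \<le> r" by simp
    show "A U (isotypical i) (y j) = (if j = i then y i else \<zero>\<^bsub>msec E U\<^esub>)"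
      using isotypical_isotypical[OF representation_sec_rep[OF U] i j, of "y j"] yE[OF j]
      by (cases "j = i") (auto simp: alg_act_sec_rep)
  qed (use yE i in auto)
  also have "\<dots> = y i" by (rule M.M.finsum_delta) (use i yE in auto)
  finally show ?thesis .
qed

text \<open>Applying \<open>isotypical i\<close> to the total map recovers the component of index
  \<open>i\<close>, which gives injectivity; surjectivity holds because the idempotents add up to
  the identity. On one summand the total map is the given isomorphism, as the other ones send zero
  to zero.\<close>

lemma decomposition:
  fixes T :: "nat \<Rightarrow> ('p, 'a, 'c, 'g) gmod"
  assumes T: "\<And>i. i \<le> r \<Longrightarrow> gsheaf_iso \<X> G (T i) (part i) (\<Theta> i)"
  defines "\<phi> \<equiv> \<lambda>U s. \<Oplus>\<^bsub>msec E U\<^esub>i\<in>{..r}. \<Theta> i U (s i)"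
  shows "gmod_iso \<X> G (dsum_gmod {..r} T) E \<phi>"
    and "i \<le> r \<Longrightarrow> gmod_iso \<X> G (T i) (part i) (\<lambda>U s. \<phi> U (dsum_in {..r} T i U s))"
proof -
  have \<Theta>N: "\<Theta> i U s \<in> carrier (msec (part i) U)" if "i \<le> r" "opn U" "s \<in> carrier (msec (T i) U)" for i U s
    using gsheaf_isoD(12)[OF T] that by blast
  have \<Theta>E: "\<Theta> i U s \<in> carrier (msec E U)" if "i \<le> r" "opn U" "s \<in> carrier (msec (T i) U)" for i U s
    using \<Theta>N[OF that] part_carrier[OF that(1,2)] by simp
  let ?D = "dsum_gmod {..r} T"
  have D: "carrier (msec ?D U) = (\<Pi>\<^sub>E i\<in>{..r}. carrier (msec (T i) U))"
    "x \<oplus>\<^bsub>msec ?D U\<^esub> y = (\<lambda>i\<in>{..r}. x i \<oplus>\<^bsub>msec (T i) U\<^esub> y i)"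
    "a \<odot>\<^bsub>msec ?D U\<^esub> x = (\<lambda>i\<in>{..r}. a \<odot>\<^bsub>msec (T i) U\<^esub> x i)"
    "mres ?D U U' x = (\<lambda>i\<in>{..r}. mres (T i) U U' (x i))"
    "gact ?D g U x = (\<lambda>i\<in>{..r}. gact (T i) g U (x i))" for U U' x y a g
    by (simp_all add: dsum_gmod_def)
  have mem: "s i \<in> carrier (msec (T i) U)" if "s \<in> carrier (msec ?D U)" "i \<le> r" for s i U
    using that by (auto simp: D)
  have f: "(\<lambda>i. \<Theta> i U (s i)) \<in> {..r} \<rightarrow> carrier (msec E U)" if "opn U" "s \<in> carrier (msec ?D U)" for U s
    using \<Theta>E[OF _ that(1) mem[OF that(2)]] by auto
  have A\<phi>: "A U (isotypical i) (\<phi> U s) = \<Theta> i U (s i)" if "opn U" "s \<in> carrier (msec ?D U)" "i \<le> r" for U s i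
    unfolding \<phi>_def by (rule A_isotypical_sum[OF that(1,3)]) (rule \<Theta>N[OF _ that(1) mem[OF that(2)]])
  show "gmod_iso \<X> G ?D E \<phi>"
    unfolding gmod_iso_def omod_hom_def
  proof (intro conjI allI impI ballI)
    fix U assume U: "opn U"
    interpret M: module "sec \<X> U" "msec E U" by (rule E.module_msec[OF U])
    have closed: "\<phi> U s \<in> carrier (msec E U)" if "s \<in> carrier (msec ?D U)" for s
      unfolding \<phi>_def by (rule M.M.finsum_closed[OF f[OF U that]])
    show "\<phi> U \<in> module_homs (sec \<X> U) (msec ?D U) (msec E U)"
    proof (rule module_homsI)
      fix s assume s: "s \<in> carrier (msec ?D U)"
      show "\<phi> U s \<in> carrier (msec E U)" by (rule closed[OF s])
      show "\<phi> U (s \<oplus>\<^bsub>msec ?D U\<^esub> t) = \<phi> U s \<oplus>\<^bsub>msec E U\<^esub> \<phi> U t" if t: "t \<in> carrier (msec ?D U)" for t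
      proof -
        have "\<phi> U (s \<oplus>\<^bsub>msec ?D U\<^esub> t) = (\<Oplus>\<^bsub>msec E U\<^esub>i\<in>{..r}. \<Theta> i U (s i) \<oplus>\<^bsub>msec E U\<^esub> \<Theta> i U (t i))"
          unfolding \<phi>_def
          by (rule M.M.finsum_cong') (use f[OF U s] f[OF U t] gsheaf_isoD(5)[OF T, OF _ U mem[OF s] mem[OF t]] in \<open>auto simp: D\<close>)
        also have "\<dots> = \<phi> U s \<oplus>\<^bsub>msec E U\<^esub> \<phi> U t"
          unfolding \<phi>_def by (rule M.M.finsum_addf[OF f[OF U s] f[OF U t]])
        finally show ?thesis .
      qed
      show "\<phi> U (a \<odot>\<^bsub>msec ?D U\<^esub> s) = a \<odot>\<^bsub>msec E U\<^esub> \<phi> U s" if a: "a \<in> carrier (sec \<X> U)" for a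
      proof -
        have "\<phi> U (a \<odot>\<^bsub>msec ?D U\<^esub> s) = (\<Oplus>\<^bsub>msec E U\<^esub>i\<in>{..r}. a \<odot>\<^bsub>msec E U\<^esub> \<Theta> i U (s i))"
          unfolding \<phi>_def
          by (rule M.M.finsum_cong') (use f[OF U s] a gsheaf_isoD(7)[OF T, OF _ U a mem[OF s]] in \<open>auto simp: D\<close>)
        also have "\<dots> = a \<odot>\<^bsub>msec E U\<^esub> \<phi> U s"
          unfolding \<phi>_def by (rule M.finsum_smult_ldistr[symmetric]) (use f[OF U s] a in auto)
        finally show ?thesis .
      qed
    qed
    show "bij_betw (\<phi> U) (carrier (msec ?D U)) (carrier (msec E U))"
      unfolding bij_betw_def
    proof (intro conjI equalityI subsetI)
      show "inj_on (\<phi> U) (carrier (msec ?D U))"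
      proof (rule inj_onI)
        fix s t assume s: "s \<in> carrier (msec ?D U)" and t: "t \<in> carrier (msec ?D U)" and eq: "\<phi> U s = \<phi> U t"
        show "s = t"
        proof (rule PiE_ext[OF s[unfolded D] t[unfolded D]])
          fix i assume "i \<in> {..r}"
          then have i: "i \<le> r" by simp
          show "s i = t i"
            using gsheaf_isoD(13)[OF T[OF i] U mem[OF s i] mem[OF t i]] A\<phi>[OF U s i] A\<phi>[OF U t i] eq by simp
        qed
      qed
      show "y \<in> carrier (msec E U)" if "y \<in> \<phi> U ` carrier (msec ?D U)" for y
        using that closed by blast
      fix y assume y: "y \<in> carrier (msec E U)"
      have "\<exists>x\<in>carrier (msec (T i) U). A U (isotypical i) y = \<Theta> i U x" if i: "i \<le> r" for i
      proof (rule gsheaf_isoD(14)[OF T[OF i] U])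
        have "A U (isotypical i) y \<in> carrier (msec E U)"
          by (rule A_closed[OF U _ y]) (use isotypical_closed'[OF i] in auto)
        then show "A U (isotypical i) y \<in> carrier (msec (part i) U)"
          using A_isotypical_idem[OF i U y] by (simp add: part_carrier[OF i U])
      qed
      then obtain x where x: "\<And>i. i \<le> r \<Longrightarrow> x i \<in> carrier (msec (T i) U) \<and> A U (isotypical i) y = \<Theta> i U (x i)"
        by metis
      have xD: "restrict x {..r} \<in> carrier (msec ?D U)" using x by (auto simp: D)
      have "\<phi> U (restrict x {..r}) = (\<Oplus>\<^bsub>msec E U\<^esub>i\<in>{..r}. A U (isotypical i) y)"
        unfolding \<phi>_def by (rule M.M.finsum_cong') (use x \<Theta>E[OF _ U] in auto)
      also have "\<dots> = y"
        using isotypical_sum[OF representation_sec_rep[OF U], of y] y by (simp add: alg_act_sec_rep finsum_sec_rep)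
      finally show "y \<in> \<phi> U ` carrier (msec ?D U)" using xD by (intro image_eqI[OF sym])
    qed
    fix g s assume g: "g \<in> carrier G" and s: "s \<in> carrier (msec ?D U)"
    have "\<phi> U (gact ?D g U s) = (\<Oplus>\<^bsub>msec E U\<^esub>i\<in>{..r}. gact E g U (\<Theta> i U (s i)))"
      unfolding \<phi>_def
      by (rule M.M.finsum_cong') (use f[OF U s] E.gact_simps(1)[OF g U] gsheaf_isoD(9)[OF T, OF _ U g mem[OF s]] in \<open>auto simp: D\<close>)
    also have "\<dots> = gact E g U (\<phi> U s)"
      unfolding \<phi>_def
      by (rule hom_finsum_additive(2)[OF M.M.abelian_group_axioms M.M.abelian_group_axioms, symmetric])
        (use E.gact_simps[OF g U] f[OF U s] in auto)
    finally show "\<phi> U (gact ?D g U s) = gact E g U (\<phi> U s)" .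
  next
    fix U W s assume o: "opn U \<and> opn W \<and> W \<subseteq> U" and s: "s \<in> carrier (msec ?D U)"
    then have o: "opn U" "opn W" "W \<subseteq> U" by auto
    interpret M: module "sec \<X> W" "msec E W" by (rule E.module_msec[OF o(2)])
    have "\<phi> W (mres ?D U W s) = (\<Oplus>\<^bsub>msec E W\<^esub>i\<in>{..r}. mres E U W (\<Theta> i U (s i)))"
      unfolding \<phi>_def
      by (rule M.M.finsum_cong') (use f[OF o(1) s] E.mres_simps(1)[OF o] gsheaf_isoD(11)[OF T, OF _ o mem[OF s]] in \<open>auto simp: D\<close>)
    also have "\<dots> = mres E U W (\<phi> U s)"
      unfolding \<phi>_def
      by (rule hom_finsum_additive(2)[OF E.abelian_msec[OF o(1)] M.M.abelian_group_axioms, symmetric])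
        (use E.mres_simps[OF o] f[OF o(1) s] in auto)
    finally show "\<phi> W (mres ?D U W s) = mres E U W (\<phi> U s)" .
  qed
  assume i: "i \<le> r"
  have "\<phi> U (dsum_in {..r} T i U s) = \<Theta> i U s" if U: "opn U" and s: "s \<in> carrier (msec (T i) U)" for U s
  proof -
    interpret M: module "sec \<X> U" "msec E U" by (rule E.module_msec[OF U])
    have "\<phi> U (dsum_in {..r} T i U s) = (\<Oplus>\<^bsub>msec E U\<^esub>j\<in>{..r}. if j = i then \<Theta> i U s else \<zero>\<^bsub>msec E U\<^esub>)"
      unfolding \<phi>_def
      by (rule M.M.finsum_cong') (use \<Theta>E[OF i U s] gsheaf_isoD(3)[OF T, OF _ U] in \<open>auto simp: dsum_in_def\<close>)
    also have "\<dots> = \<Theta> i U s" by (rule M.M.finsum_delta) (use i \<Theta>E[OF i U s] in auto)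
    finally show ?thesis .
  qed
  from gsheaf_iso_imp_gmod_iso[OF gsheaf_iso_cong[OF T[OF i] this]]
  show "gmod_iso \<X> G (T i) (part i) (\<lambda>U s. \<phi> U (dsum_in {..r} T i U s))" .
qed

end

theorem theorem3:
  fixes k :: "'k ring"
    and G :: "'g monoid"
    and \<X> :: "('p, 'a) rspace"
    and \<kappa> :: "'k \<Rightarrow> 'a"
    and \<epsilon> :: 'p
    and r :: nat
    and V :: "nat \<Rightarrow> ('k, 'v, 'g) rep"
    and n :: "nat \<Rightarrow> nat"
    and E :: "('p, 'a, 'b, 'g) gmod"
  assumes "algebraically_closed k"
    and "group G" and "finite (carrier G)"
    and "\<not> ring_char k dvd order G"
    and "scheme_over k \<X> \<kappa>" and "integral_scheme \<X>"
    and "generic_point \<X> \<epsilon>"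
    and "irreducibles k G r V"
    and "gmodule \<X> G E"
    and "coherent \<X> E"
    and "torsion_free \<X> E"
    and "has_type k G \<X> \<kappa> \<epsilon> E (multiplicity_rep r V n)"
  shows "\<exists>(F :: nat \<Rightarrow> ('p, 'a, 'v \<Rightarrow> 'b) omod) \<phi>.
    (\<forall>i\<le>r. omodule \<X> (F i) \<and> has_rank \<X> \<epsilon> (F i) (n i)) \<and>
    gmod_iso \<X> G
      (dsum_gmod {..r} (\<lambda>i. tensor_gmod \<X> (rep_sheaf k \<X> \<kappa> (V i)) (trivial_action (F i)))) E \<phi> \<and>
    (\<forall>i\<le>r. gmod_iso \<X> G
      (tensor_gmod \<X> (rep_sheaf k \<X> \<kappa> (V i)) (trivial_action (F i)))
      (idempotent_part G \<X> \<kappa> E (isotypical_idempotent k G r V i))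
      (\<lambda>U s. \<phi> U
        (dsum_in {..r} (\<lambda>j. tensor_gmod \<X> (rep_sheaf k \<X> \<kappa> (V j)) (trivial_action (F j))) i U s)))"
proof -
  interpret kG: fin_group_field k G
    by (intro fin_group_field.intro fin_group_field_axioms.intro assms(1-4))
  \<comment> \<open>Orbits provide the bases, so the matrix units are indexed by group
    elements.\<close>
  have "\<exists>(J :: 'g set) w \<gamma>. dual_basis k (V i) J w \<gamma>" if "i \<le> r" for i
    using kG.irreducible_dual_basis[of "V i"] assms(8) that by (simp add: irreducibles_def)
  then obtain J w \<gamma> where db: "\<And>i. i \<le> r \<Longrightarrow> dual_basis k (V i) (J i :: 'g set) (w i) (\<gamma> i)"
    by metis
  have scheme: "locally_ringed_space \<X>" "\<kappa> \<in> ring_hom k (sec \<X> (points \<X>))"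
    using assms(5) by (simp_all add: scheme_over_def scheme_def)
  have ringed: "ringed_space \<X>" using scheme(1) by (simp add: locally_ringed_space_def)
  have \<epsilon>: "\<epsilon> \<in> points \<X>" using assms(7) by (simp add: generic_point_def)
  have sys: "gmod_system k G r V J w \<gamma> \<X> \<kappa> E"
    by (intro gmod_system.intro gmod_system_axioms.intro irr_system.intro irr_system_axioms.intro kG.fin_group_field_axioms
        ringed_over.intro ringed_over_axioms.intro ringed.intro kG.k.is_cring ringed scheme(2) assms(8,9) db)
  interpret gmod_system k G r V J w \<gamma> \<X> \<kappa> E by (rule sys)
  let ?T = "\<lambda>i. tensor_gmod \<X> (rep_sheaf k \<X> \<kappa> (V i)) (trivial_action (mult_sheaf i))"
  have rank: "has_rank \<X> \<epsilon> (mult_sheaf i) (n i)" if i: "i \<le> r" for i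
  proof -
    interpret gmod_type k G r V J w \<gamma> \<X> \<kappa> E \<epsilon> n i
      by unfold_locales (use \<epsilon> scheme(1) assms(12) i in \<open>simp_all add: locally_ringed_space_def\<close>)
    show ?thesis by (rule mult_sheaf_rank)
  qed
  have "\<exists>\<Theta>. gsheaf_iso \<X> G (?T i) (part i) \<Theta>" if i: "i \<le> r" for i
  proof -
    obtain \<zeta> where \<zeta>: "gsheaf_iso \<X> G (rep_sheaf k \<X> \<kappa> (V i)) (free_gmod (V i) (J i) (w i) (\<gamma> i)) \<zeta>"
      using rep_sheaf_iso(1)[OF representation_V[OF i] db[OF i]] by blast
    have "isotypical_piece k G r V J w \<gamma> \<X> \<kappa> E i \<zeta>"
      by (intro isotypical_piece.intro isotypical_piece_axioms.intro sys i \<zeta>)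
    then show ?thesis by (rule isotypical_piece.exists_piece_iso)
  qed
  then obtain \<Theta> where \<Theta>: "\<And>i. i \<le> r \<Longrightarrow> gsheaf_iso \<X> G (?T i) (part i) (\<Theta> i)"
    by metis
  show ?thesis
  proof (rule exI[of _ mult_sheaf], rule exI[of _ "\<lambda>U s. \<Oplus>\<^bsub>msec E U\<^esub>i\<in>{..r}. \<Theta> i U (s i)"], intro conjI allI impI)
    fix i assume i: "i \<le> r"
    show "gmod_iso \<X> G (?T i) (idempotent_part G \<X> \<kappa> E (isotypical_idempotent k G r V i))
      (\<lambda>U s. \<Oplus>\<^bsub>msec E U\<^esub>j\<in>{..r}. \<Theta> j U (dsum_in {..r} ?T i U s j))"
      unfolding isotypical_idempotent_eq[OF i] by (rule decomposition(2)[OF \<Theta> i])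
  qed (rule omodule_mult_sheaf rank decomposition(1)[OF \<Theta>]; assumption)+
qed

end
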